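(* Let $p$ be an odd prime, $N$ a prime with $N\equiv1\pmod p$, $L=\mathbb{Q}(\zeta_p,N^{1/p})$, and let $1\le i<p-1$ and $j\not\equiv1\pmod{p-1}$. Then there is a one-to-one correspondence between the set of unramified $A^{i,j}$-extensions of $L$ and \[\mathbb{P}^1H^1_\Lambda(G_\mathbb{Q},A^{i,j})\setminus\mathbb{P}^1H^1_\Lambda(G_\mathbb{Q},A^{i-1,j+1}),\] where $H^1_\Lambda(G_\mathbb{Q},A^{i-1,j+1})$ is regarded in $H^1_\Lambda(G_\mathbb{Q},A^{i,j})$ via the map induced by the inclusion $A^{i-1,j+1}\subseteq A^{i,j}$.
   Context: Let $\mathcal{G}=\operatorname{Gal}(L/\mathbb{Q})$, $\chi$ the mod $p$ cyclotomic character, $b:G_\mathbb{Q}\to\mathbb{F}_p$ with $\sigma(N^{1/p})/N^{1/p}=\zeta_p^{b(\sigma)}$, $V\cong\mathbb{F}_p^2$ with action $\sigma\mapsto\begin{pmatrix}\chi(\sigma)&b(\sigma)\\0&1\end{pmatrix}$, $\mathbb{F}_p(j)$ the twist by $\chi^j$, and $A^{i,j}=\operatorname{Sym}^i(V)\otimes\mathbb{F}_p(j)$ (a $\mathcal{G}$-module; $A^{i,j}$ contains a unique submodule isomorphic to $A^{i-1,j+1}$). An $A^{i,j}$-extension of $L$ is a Galois extension $M/L$, with $M$ Galois over $\mathbb{Q}$, such that $\operatorname{Gal}(M/L)\cong A^{i,j}$ as $\mathcal{G}$-modules (with $\mathcal{G}$ acting by conjugation). $\mathbb{P}^1(W)$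 denotes the set of nonzero vectors of $W$ modulo $\mathbb{F}_p^\times$-scaling. The Selmer group $H^1_\Lambda(G_\mathbb{Q},A)$ consists of classes unramified at all $\ell\ne N,p$, arbitrary at $N$, and whose restriction to $G_{L_p}$, $L_p=\mathbb{Q}_p(\zeta_p,N^{1/p})$, is unramified. *)

theory Defs
  imports
    "HOL-Algebra.Bij"
    "HOL-Algebra.Ideal_Product"
    "HOL-Algebra.Generated_Fields"
    "HOL-Algebra.Algebraic_Closure_Type"
    "HOL-Analysis.Analysis"
    "HOL-Number_Theory.Cong"
    "Berlekamp_Zassenhaus.Finite_Field"
begin

section \<open>Fields of algebraic numbers and their Galois groups\<close>

text \<open>
  All fields are subfields of the complex numbers; the field of algebraic numbers in \<^typ>\<open>complex\<close>
  serves as the algebraic closure of the rationals.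
\<close>

definition subring_of_complex :: "complex set \<Rightarrow> complex ring" where
  "subring_of_complex E = ring_of_type_algebra\<lparr>carrier := E\<rparr>"

definition Qbar :: "complex set" where
  "Qbar = {x. algebraic x}"

definition Zbar :: "complex set" where
  "Zbar = {x. algebraic_int x}"

definition adjoin :: "complex set \<Rightarrow> complex set" where
  "adjoin S = generate_field ring_of_type_algebra S"

definition ring_of_integers :: "complex set \<Rightarrow> complex ring" where
  "ring_of_integers K = subring_of_complex (K \<inter> Zbar)"

text \<open>
  Automorphisms of \<open>E\<close> are total functions that are \<^const>\<open>undefined\<close> outside \<open>E\<close>, so that equal
  automorphisms are equal functions; the group law is that of \<^const>\<open>BijGroup\<close>.
\<close>

definition Gal :: "complex set \<Rightarrow> complex set \<Rightarrow> (complex \<Rightarrow> complex) set" where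
  "Gal E K = {\<sigma> \<in> ring_iso (subring_of_complex E) (subring_of_complex E).
     \<sigma> \<in> extensional E \<and> (\<forall>x\<in>K. \<sigma> x = x)}"

definition gal_group :: "complex set \<Rightarrow> complex set \<Rightarrow> (complex \<Rightarrow> complex) monoid" where
  "gal_group E K = (BijGroup E)\<lparr>carrier := Gal E K\<rparr>"

definition galois_extension :: "complex set \<Rightarrow> complex set \<Rightarrow> bool" where
  "galois_extension K M \<longleftrightarrow>
     subfield K ring_of_type_algebra \<and> subfield M ring_of_type_algebra \<and>
     K \<subseteq> M \<and> M \<subseteq> Qbar \<and>
     {x \<in> M. \<forall>\<sigma>\<in>Gal M K. \<sigma> x = x} = K"

abbreviation G_Q :: "(complex \<Rightarrow> complex) set" where
  "G_Q \<equiv> Gal Qbar \<rat>"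

text \<open>
  The Krull topology, with basis the cosets of the subgroups \<open>Gal(Qbar/K)\<close> for number fields \<open>K\<close>.
\<close>

definition krull_topology :: "(complex \<Rightarrow> complex) topology" where
  "krull_topology = topology_generated_by
     {{\<tau> \<in> G_Q. \<forall>x\<in>adjoin S. \<tau> x = \<sigma> x} | \<sigma> S. \<sigma> \<in> G_Q \<and> finite S \<and> S \<subseteq> Qbar}"


section \<open>Places, inertia and ramification\<close>

text \<open>
  A place of \<^const>\<open>Qbar\<close> over the prime number \<open>l\<close>, i.e. an embedding of \<^const>\<open>Qbar\<close> into an
  algebraic closure of the \<open>l\<close>-adic numbers up to local conjugacy, is given by the prime ideal \<open>P\<close> of
  the algebraic integers that lies over \<open>l\<close>.
\<close>

definition places_over :: "nat \<Rightarrow> complex set set" where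
  "places_over l = {P. primeideal P (ring_of_integers Qbar) \<and> of_nat l \<in> P}"

text \<open>
  For a subfield \<open>K\<close> of \<^const>\<open>Qbar\<close>, \<open>decomposition_group K P\<close> is the absolute Galois group of the
  completion of \<open>K\<close> at the place below \<open>P\<close> (embedded in the absolute Galois group of \<open>K\<close>), and
  \<open>inertia_group K P\<close> is its inertia subgroup.  In particular, when \<open>P\<close> lies over \<open>p\<close> and \<open>K\<close> is the
  Kummer field \<open>L\<close> below, the completion is obtained from the \<open>p\<close>-adic numbers by adjoining a
  primitive \<open>p\<close>-th root of unity and a \<open>p\<close>-th root of \<open>N\<close>.
\<close>

definition decomposition_group :: "complex set \<Rightarrow> complex set \<Rightarrow> (complex \<Rightarrow> complex) set" where
  "decomposition_group K P = {\<sigma> \<in> Gal Qbar K. \<sigma> ` P = P}"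

definition inertia_group :: "complex set \<Rightarrow> complex set \<Rightarrow> (complex \<Rightarrow> complex) set" where
  "inertia_group K P = {\<sigma> \<in> decomposition_group K P. \<forall>x\<in>Zbar. \<sigma> x - x \<in> P}"

text \<open>
  Every nonzero prime ideal \<open>P\<close> of the integers of \<open>M\<close> occurs with exponent one in the ideal
  generated by the prime \<open>P \<inter> L\<close> of \<open>L\<close>; residue fields are finite, hence residue extensions are
  separable.  The extension is only used for a totally complex field \<open>L\<close>, where there is no condition
  at the infinite places.
\<close>

definition unramified_extension :: "complex set \<Rightarrow> complex set \<Rightarrow> bool" where
  "unramified_extension L M \<longleftrightarrow>
     (\<forall>P. primeideal P (ring_of_integers M) \<and> P \<noteq> {0} \<longrightarrow>
        \<not> P \<inter> L \<subseteq> ideal_prod (ring_of_integers M) P P)"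


section \<open>Continuous first cohomology of the absolute Galois group of the rationals\<close>

text \<open>
  A module is a set \<open>A\<close> closed under the addition of the ambient type, with an action \<open>act\<close>, and
  carries the discrete topology.  Cochains vanish outside \<^const>\<open>G_Q\<close> so that they are determined by
  their values there.
\<close>

definition Z1 :: "'m::ab_group_add set \<Rightarrow> ((complex \<Rightarrow> complex) \<Rightarrow> 'm \<Rightarrow> 'm)
    \<Rightarrow> ((complex \<Rightarrow> complex) \<Rightarrow> 'm) set" where
  "Z1 A act = {c. c \<in> G_Q \<rightarrow> A \<and> (\<forall>\<sigma>. \<sigma> \<notin> G_Q \<longrightarrow> c \<sigma> = 0) \<and>
     continuous_map krull_topology (discrete_topology A) c \<and>
     (\<forall>\<sigma>\<in>G_Q. \<forall>\<tau>\<in>G_Q. c (\<sigma> \<otimes>\<^bsub>gal_group Qbar \<rat>\<^esub> \<tau>) = c \<sigma> + act \<sigma> (c \<tau>))}"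

definition cohomologous :: "'m::ab_group_add set \<Rightarrow> ((complex \<Rightarrow> complex) \<Rightarrow> 'm \<Rightarrow> 'm)
    \<Rightarrow> ((complex \<Rightarrow> complex) \<Rightarrow> 'm) rel" where
  "cohomologous A act = {(c, d). c \<in> Z1 A act \<and> d \<in> Z1 A act \<and>
     (\<exists>a\<in>A. \<forall>\<sigma>\<in>G_Q. c \<sigma> - d \<sigma> = act \<sigma> a - a)}"

definition H1 :: "'m::ab_group_add set \<Rightarrow> ((complex \<Rightarrow> complex) \<Rightarrow> 'm \<Rightarrow> 'm)
    \<Rightarrow> ((complex \<Rightarrow> complex) \<Rightarrow> 'm) set set" where
  "H1 A act = Z1 A act // cohomologous A act"

text \<open>The class \<open>\<xi>\<close> restricts to zero in the first cohomology of the subgroup \<open>I\<close>.\<close>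

definition trivial_on :: "'m::ab_group_add set \<Rightarrow> ((complex \<Rightarrow> complex) \<Rightarrow> 'm \<Rightarrow> 'm)
    \<Rightarrow> ((complex \<Rightarrow> complex) \<Rightarrow> 'm) set \<Rightarrow> (complex \<Rightarrow> complex) set \<Rightarrow> bool" where
  "trivial_on A act \<xi> I \<longleftrightarrow> (\<forall>c\<in>\<xi>. \<exists>a\<in>A. \<forall>\<sigma>\<in>I. c \<sigma> = act \<sigma> a - a)"

text \<open>The map induced by an equivariant homomorphism \<open>f\<close> into the module \<open>(B, act)\<close>.\<close>

definition H1_map :: "('m::ab_group_add \<Rightarrow> 'n::ab_group_add) \<Rightarrow> 'n set
    \<Rightarrow> ((complex \<Rightarrow> complex) \<Rightarrow> 'n \<Rightarrow> 'n)
    \<Rightarrow> ((complex \<Rightarrow> complex) \<Rightarrow> 'm) set \<Rightarrow> ((complex \<Rightarrow> complex) \<Rightarrow> 'n) set" where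
  "H1_map f B act \<xi> = cohomologous B act `` ((\<lambda>c. f \<circ> c) ` \<xi>)"


section \<open>The Kummer field and the modules \<open>A\<^sup>i\<^sup>,\<^sup>j\<close>\<close>

text \<open>
  The field with \<open>p\<close> elements is \<^typ>\<open>'p mod_ring\<close> with \<open>p = CARD('p)\<close>.
\<close>

definition zeta :: "nat \<Rightarrow> complex" where
  "zeta p = cis (2 * pi / real p)"

definition kummer_root :: "nat \<Rightarrow> nat \<Rightarrow> complex" where
  "kummer_root p N = complex_of_real (root p (real N))"

definition kummer_field :: "nat \<Rightarrow> nat \<Rightarrow> complex set" where
  "kummer_field p N = adjoin {zeta p, kummer_root p N}"

text \<open>
  The following functions make sense for automorphisms of any field containing the Kummer field, so
  they define the action both of \<^const>\<open>G_Q\<close> and of the Galois group of the Kummer field.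
\<close>

definition cyc_char :: "(complex \<Rightarrow> complex) \<Rightarrow> 'p::prime_card mod_ring" where
  "cyc_char \<sigma> = (THE a. \<sigma> (zeta CARD('p)) = zeta CARD('p) ^ nat (to_int_mod_ring a))"

definition kummer_cocycle :: "nat \<Rightarrow> (complex \<Rightarrow> complex) \<Rightarrow> 'p::prime_card mod_ring" where
  "kummer_cocycle N \<sigma> = (THE a.
     \<sigma> (kummer_root CARD('p) N) / kummer_root CARD('p) N =
       zeta CARD('p) ^ nat (to_int_mod_ring a))"

text \<open>
  The symmetric algebra of \<open>V\<close> is the polynomial ring over the field with \<open>p\<close> elements in the
  standard basis vectors \<open>e1\<close> (inner variable) and \<open>e2\<close> (outer variable) of \<open>V\<close>; \<open>Sym i\<close> is its part
  of degree \<open>i\<close>.  An automorphism \<open>\<sigma>\<close> acts on it by the algebra homomorphism extending its action on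
  \<open>V\<close>, that is, by substituting \<open>\<chi>(\<sigma>) e1\<close> for \<open>e1\<close> and \<open>b(\<sigma>) e1 + e2\<close> for \<open>e2\<close>.
\<close>

definition Sym :: "nat \<Rightarrow> 'p::prime_card mod_ring poly poly set" where
  "Sym i = {f. \<forall>k m. Polynomial.coeff (Polynomial.coeff f k) m \<noteq> 0 \<longrightarrow> k + m = i}"

definition Sym_act :: "nat \<Rightarrow> (complex \<Rightarrow> complex)
    \<Rightarrow> 'p::prime_card mod_ring poly poly \<Rightarrow> 'p mod_ring poly poly" where
  "Sym_act N \<sigma> f =
     pcompose (map_poly (\<lambda>q. pcompose q [:0, cyc_char \<sigma>:]) f) [:[:0, kummer_cocycle N \<sigma>:], 1:]"

text \<open>
  The module \<open>A\<^sup>i\<^sup>,\<^sup>j\<close> is \<open>Sym i\<close> with the action \<open>A_act N j\<close>.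
\<close>

definition A_act :: "nat \<Rightarrow> int \<Rightarrow> (complex \<Rightarrow> complex)
    \<Rightarrow> 'p::prime_card mod_ring poly poly \<Rightarrow> 'p mod_ring poly poly" where
  "A_act N j \<sigma> f = Polynomial.smult [:cyc_char \<sigma> powi j:] (Sym_act N \<sigma> f)"

definition Sym_group :: "nat \<Rightarrow> 'p::prime_card mod_ring poly poly monoid" where
  "Sym_group i = \<lparr>carrier = Sym i, monoid.mult = (+), one = 0\<rparr>"

text \<open>
  The inclusion of \<open>A\<^sup>i\<^sup>-\<^sup>1\<^sup>,\<^sup>j\<^sup>+\<^sup>1\<close> in \<open>A\<^sup>i\<^sup>,\<^sup>j\<close>: multiplication by \<open>e1\<close>, on which \<open>\<sigma>\<close> acts as \<open>\<chi>(\<sigma>)\<close>.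
\<close>

definition mult_e1 :: "'p::prime_card mod_ring poly poly \<Rightarrow> 'p mod_ring poly poly" where
  "mult_e1 f = [:[:0, 1:]:] * f"


section \<open>Unramified extensions with prescribed Galois module\<close>

text \<open>
  In the last condition the Galois group of the Kummer field \<open>L\<close> acts on \<open>Gal(M/L)\<close> by conjugation
  with lifts to \<open>Gal(M/Q)\<close>.
\<close>

definition A_extension :: "'p::prime_card itself \<Rightarrow> nat \<Rightarrow> nat \<Rightarrow> int \<Rightarrow> complex set \<Rightarrow> bool" where
  "A_extension _ N i j M \<longleftrightarrow>
     (let L = kummer_field CARD('p) N; G = gal_group M \<rat> in
        galois_extension L M \<and> galois_extension \<rat> M \<and>
        (\<exists>\<phi> \<in> iso (gal_group M L) (Sym_group i :: 'p mod_ring poly poly monoid).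
           \<forall>\<sigma>\<in>Gal M \<rat>. \<forall>\<tau>\<in>Gal M L.
             \<phi> (\<sigma> \<otimes>\<^bsub>G\<^esub> \<tau> \<otimes>\<^bsub>G\<^esub> inv\<^bsub>G\<^esub> \<sigma>) = A_act N j (restrict \<sigma> L) (\<phi> \<tau>)))"

definition unramified_A_extensions ::
    "'p::prime_card itself \<Rightarrow> nat \<Rightarrow> nat \<Rightarrow> int \<Rightarrow> complex set set" where
  "unramified_A_extensions T N i j =
     {M. A_extension T N i j M \<and> unramified_extension (kummer_field CARD('p) N) M}"


section \<open>The Selmer group and its projectivization\<close>

text \<open>
  Conditions are imposed at all places of \<^const>\<open>Qbar\<close> over a given prime; these places are conjugate
  under \<^const>\<open>G_Q\<close>, so this is the same as imposing them at one place.
\<close>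

definition H1_Lambda :: "nat \<Rightarrow> nat \<Rightarrow> int
    \<Rightarrow> ((complex \<Rightarrow> complex) \<Rightarrow> 'p::prime_card mod_ring poly poly) set set" where
  "H1_Lambda N i j = {\<xi> \<in> H1 (Sym i) (A_act N j).
     (\<forall>l. prime l \<and> l \<noteq> N \<and> l \<noteq> CARD('p) \<longrightarrow>
        (\<forall>P\<in>places_over l. trivial_on (Sym i) (A_act N j) \<xi> (inertia_group \<rat> P))) \<and>
     (\<forall>P\<in>places_over CARD('p).
        trivial_on (Sym i) (A_act N j) \<xi> (inertia_group (kummer_field CARD('p) N) P))}"

text \<open>
  The image in the cohomology of \<open>A\<^sup>i\<^sup>,\<^sup>j\<close>, for \<open>i \<ge> 1\<close>, of the Selmer group of \<open>A\<^sup>i\<^sup>-\<^sup>1\<^sup>,\<^sup>j\<^sup>+\<^sup>1\<close>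
  (the induced map is not injective in general).
\<close>

definition H1_Lambda_sub :: "nat \<Rightarrow> nat \<Rightarrow> int
    \<Rightarrow> ((complex \<Rightarrow> complex) \<Rightarrow> 'p::prime_card mod_ring poly poly) set set" where
  "H1_Lambda_sub N i j = H1_map mult_e1 (Sym i) (A_act N j) ` H1_Lambda N (i - 1) (j + 1)"

definition line :: "((complex \<Rightarrow> complex) \<Rightarrow> 'p::prime_card mod_ring poly poly) set
    \<Rightarrow> ((complex \<Rightarrow> complex) \<Rightarrow> 'p mod_ring poly poly) set set" where
  "line \<xi> = {(\<lambda>c \<sigma>. Polynomial.smult [:a:] (c \<sigma>)) ` \<xi> | a. a \<noteq> 0}"

definition P1 :: "((complex \<Rightarrow> complex) \<Rightarrow> 'p::prime_card mod_ring poly poly) set set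
    \<Rightarrow> ((complex \<Rightarrow> complex) \<Rightarrow> 'p mod_ring poly poly) set set set" where
  "P1 W = line ` {\<xi> \<in> W. (\<lambda>\<sigma>. 0) \<notin> \<xi>}"

end

theory Submission
  imports Defs "Jordan_Normal_Form.Char_Poly"
begin

text \<open>
  Write \<open>G\<^sub>L\<close> for the absolute Galois group of the Kummer field \<open>L\<close>.  A cocycle \<open>c\<close> restricts to an
  equivariant homomorphism on \<open>G\<^sub>L\<close>, whose kernel cuts out a Galois extension \<open>M\<close> of \<open>L\<close>.  Every proper
  submodule of \<open>A\<^sup>i\<^sup>,\<^sup>j\<close> lies in \<open>A\<^sup>i\<^sup>-\<^sup>1\<^sup>,\<^sup>j\<^sup>+\<^sup>1\<close>, so outside the image of the smaller Selmer group the
  restriction is onto \<open>A\<^sup>i\<^sup>,\<^sup>j\<close>.  Since \<open>H\<^sup>1(Gal(L/Q), A\<^sup>i\<^sup>,\<^sup>j) = 0\<close> for \<open>j \<noteq> 1\<close> and the equivariant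
  endomorphisms of \<open>A\<^sup>i\<^sup>,\<^sup>j\<close> are the scalars, \<open>M\<close> determines the class up to a scalar.

  Away from \<open>N\<close> the local conditions say that \<open>c\<close> kills inertia in \<open>G\<^sub>L\<close>.  At \<open>N\<close> inertia is tame, and
  contains an element \<open>t\<close> with \<open>b(t) = 1\<close>.  If \<open>c\<close> is a cocycle then \<open>c(t\<^sup>p)\<close> is a norm, which vanishes
  because \<open>i < p - 1\<close>; hence \<open>t\<close> has order \<open>p\<close> in \<open>Gal(M/Q)\<close>, and as tame inertia of exponent \<open>p\<close> is
  cyclic, it meets \<open>Gal(M/L)\<close> trivially.  Conversely, if \<open>M\<close> is an unramified extension, then \<open>t\<^sup>p\<close> is
  trivial on \<open>M\<close>, so that \<open>Gal(M/L)\<close> has a complement in the kernel of \<open>\<chi>\<close>; the resulting cocycle on this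
  kernel is extended to \<open>G\<^sub>Q\<close> by corestriction, whose index \<open>p - 1\<close> is invertible modulo \<open>p\<close>.
\<close>

section \<open>Subrings and subfields of the complex numbers\<close>

text \<open>The bijection is not constructed directly. The cocycles in the set \<open>B\<close> of
  the last proof, unramified outside \<open>N\<close> and onto on \<open>G_L\<close>, surject onto
  both sides, through \<open>class_field\<close> and through \<open>line\<close>, and these two maps
  have the same fibres.

  The bound \<open>i < p - 1\<close> enters twice. A polynomial of degree \<open>i\<close> is still
  a difference \<open>a (X + b) - a X\<close> with \<open>a\<close> of degree below
  \<open>p\<close>, which makes norms over a group of order \<open>p\<close> vanish; and the
  diagonal elements of \<open>Gal L \<rat>\<close> act on the monomials of degree at most
  \<open>i\<close> with distinct weights, which leaves only scalar endomorphisms. The condition on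
  \<open>j\<close> says that the top quotient of the module, where Galois acts through
  \<open>chi powi j\<close>, differs from the conjugation action on the subgroup of order
  \<open>p\<close>.

  Localizations and completions are replaced by statements that hold after multiplication by an
  integer outside the prime, and a place is a prime ideal of all algebraic integers. The price is
  that inertia elements of a finite layer must be lifted to \<open>G_Q\<close>, one number field at
  a time along an exhausting sequence.\<close>

definition csubring :: "complex set \<Rightarrow> bool" where
  "csubring R \<longleftrightarrow> 1 \<in> R \<and> (\<forall>x\<in>R. \<forall>y\<in>R. x - y \<in> R \<and> x * y \<in> R)"

text \<open>Since \<open>inverse 0 = 0\<close>, zero needs no exception. The link to the algebraic
  structure \<open>subfield\<close> is \<open>subfield_iff_csubfield\<close>.\<close>

definition csubfield :: "complex set \<Rightarrow> bool" where
  "csubfield K \<longleftrightarrow> csubring K \<and> (\<forall>x\<in>K. inverse x \<in> K)"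

lemma csubring_basic:
  assumes "csubring R"
  shows "1 \<in> R" "x \<in> R \<Longrightarrow> y \<in> R \<Longrightarrow> x - y \<in> R" "x \<in> R \<Longrightarrow> y \<in> R \<Longrightarrow> x * y \<in> R"
    "0 \<in> R" "x \<in> R \<Longrightarrow> - x \<in> R" "x \<in> R \<Longrightarrow> y \<in> R \<Longrightarrow> x + y \<in> R"
proof -
  show 1: "1 \<in> R" and m: "\<And>x y. x \<in> R \<Longrightarrow> y \<in> R \<Longrightarrow> x - y \<in> R"
    and "x \<in> R \<Longrightarrow> y \<in> R \<Longrightarrow> x * y \<in> R" using assms by (auto simp: csubring_def)
  show 0: "0 \<in> R" using m[OF 1 1] by simp
  show n: "\<And>x. x \<in> R \<Longrightarrow> - x \<in> R" using m[OF 0] by simp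
  show "x \<in> R \<Longrightarrow> y \<in> R \<Longrightarrow> x + y \<in> R" using m[of x "- y"] n[of y] by simp
qed

lemma csubring_power: "csubring R \<Longrightarrow> x \<in> R \<Longrightarrow> x ^ n \<in> R"
  by (induction n) (auto intro: csubring_basic)

lemma csubring_sum: "csubring R \<Longrightarrow> (\<And>k. k \<in> I \<Longrightarrow> f k \<in> R) \<Longrightarrow> sum f I \<in> R"
  by (induction I rule: infinite_finite_induct) (auto intro: csubring_basic)

lemma csubring_prod: "csubring R \<Longrightarrow> (\<And>k. k \<in> I \<Longrightarrow> f k \<in> R) \<Longrightarrow> prod f I \<in> R"
  by (induction I rule: infinite_finite_induct) (auto intro: csubring_basic)

lemma csubring_of_nat: "csubring R \<Longrightarrow> of_nat n \<in> R" by (induction n) (auto intro: csubring_basic)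

lemma csubring_of_int: "csubring R \<Longrightarrow> of_int n \<in> R"
  by (cases n rule: int_cases2) (auto intro: csubring_basic csubring_of_nat)

lemmas csubring_rules = csubring_basic csubring_power csubring_sum csubring_prod csubring_of_nat
  csubring_of_int

lemma csubfield_csubring: "csubfield K \<Longrightarrow> csubring K" by (simp add: csubfield_def)

lemma csubfield_inverse: "csubfield K \<Longrightarrow> x \<in> K \<Longrightarrow> inverse x \<in> K"
  by (simp add: csubfield_def)

lemma csubfield_divide: "csubfield K \<Longrightarrow> x \<in> K \<Longrightarrow> y \<in> K \<Longrightarrow> x / y \<in> K"
  by (simp add: divide_inverse csubfield_csubring csubfield_inverse csubring_rules)

lemma csubfield_Rats: "csubfield \<rat>" by (auto simp: csubfield_def csubring_def)

lemma Rats_subset_csubfield: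
  assumes "csubfield K" shows "\<rat> \<subseteq> K"
proof
  fix x :: complex assume "x \<in> \<rat>"
  then obtain a b where "x = of_int a / of_int b" by (rule Rats_cases') auto
  thus "x \<in> K" using assms by (simp add: csubfield_divide csubfield_csubring csubring_of_int)
qed

lemma csubfield_coeff_rules:
  assumes "csubring R"
  shows "(\<And>k. coeff p k \<in> R) \<Longrightarrow> x \<in> R \<Longrightarrow> poly p x \<in> R"
  by (auto simp: poly_altdef intro!: csubring_rules assms)

subsection \<open>Algebraic integers\<close>

text \<open>The determinant trick: \<open>x\<close> is an eigenvalue of an integer matrix, whose
  characteristic polynomial is monic with integer coefficients.\<close>

lemma algebraic_int_eigenvalue:
  fixes v :: "nat \<Rightarrow> complex" and a :: "nat \<Rightarrow> nat \<Rightarrow> int"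
  assumes k: "k < n" "v k \<noteq> 0"
    and eq: "\<And>r. r < n \<Longrightarrow> x * v r = (\<Sum>l<n. of_int (a r l) * v l)"
  shows "algebraic_int x"
proof -
  define A where "A = Matrix.mat n n (\<lambda>(r, l). a r l)"
  define Ac :: "complex Matrix.mat" where "Ac = map_mat of_int A"
  have A: "A \<in> carrier_mat n n" and Ac: "Ac \<in> carrier_mat n n" by (auto simp: A_def Ac_def)
  have "Ac *\<^sub>v Matrix.vec n v = x \<cdot>\<^sub>v Matrix.vec n v"
  proof (rule eq_vecI)
    fix r assume r: "r < dim_vec (x \<cdot>\<^sub>v Matrix.vec n v)"
    hence r': "r < n" by simp
    have "vec_index (Ac *\<^sub>v Matrix.vec n v) r = (\<Sum>l<n. of_int (a r l) * v l)"
      using r' by (auto simp: Ac_def A_def scalar_prod_def atLeast0LessThan intro!: sum.cong)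
    thus "vec_index (Ac *\<^sub>v Matrix.vec n v) r = vec_index (x \<cdot>\<^sub>v Matrix.vec n v) r"
      using eq[OF r'] r' by simp
  qed (simp add: Ac_def A_def)
  moreover have "Matrix.vec n v \<noteq> 0\<^sub>v n" using k by (metis index_vec index_zero_vec(1))
  ultimately have "eigenvector Ac (Matrix.vec n v) x" using Ac by (auto simp: eigenvector_def)
  hence "poly (char_poly Ac) x = 0" using eigenvalue_root_char_poly[OF Ac] by (auto simp: eigenvalue_def)
  moreover have "char_poly Ac = of_int_poly (char_poly A)" unfolding Ac_def by (rule of_int_hom.char_poly_hom[OF A])
  ultimately show ?thesis using degree_monic_char_poly[OF A] unfolding algebraic_int_altdef_ipoly by auto
qed

definition zspan :: "complex set \<Rightarrow> complex set" where
  "zspan B = {y. \<exists>f::complex \<Rightarrow> int. y = (\<Sum>b\<in>B. of_int (f b) * b)}"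

text \<open>The multiplier ring of the lattice spanned by \<open>B\<close>.\<close>

definition mring :: "complex set \<Rightarrow> complex set" where
  "mring B = {y. \<forall>b\<in>B. y * b \<in> zspan B}"

lemma zspan_rules:
  shows "0 \<in> zspan B" "x \<in> zspan B \<Longrightarrow> y \<in> zspan B \<Longrightarrow> x + y \<in> zspan B"
    "x \<in> zspan B \<Longrightarrow> of_int n * x \<in> zspan B"
    "finite B \<Longrightarrow> b \<in> B \<Longrightarrow> b \<in> zspan B"
proof -
  show "0 \<in> zspan B" unfolding zspan_def by (rule CollectI, rule exI[of _ "\<lambda>_. 0"]) simp
  show "x \<in> zspan B \<Longrightarrow> y \<in> zspan B \<Longrightarrow> x + y \<in> zspan B"
  proof -
    assume "x \<in> zspan B" "y \<in> zspan B"
    then obtain f g where "x = (\<Sum>b\<in>B. of_int (f b) * b)" "y = (\<Sum>b\<in>B. of_int (g b) * b)"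
      by (auto simp: zspan_def)
    thus ?thesis unfolding zspan_def
      by (intro CollectI exI[of _ "\<lambda>b. f b + g b"]) (simp add: sum.distrib algebra_simps)
  qed
  show "x \<in> zspan B \<Longrightarrow> of_int n * x \<in> zspan B"
  proof -
    assume "x \<in> zspan B"
    then obtain f where "x = (\<Sum>b\<in>B. of_int (f b) * b)" by (auto simp: zspan_def)
    thus ?thesis unfolding zspan_def
      by (intro CollectI exI[of _ "\<lambda>b. n * f b"]) (simp add: sum_distrib_left algebra_simps)
  qed
  show "finite B \<Longrightarrow> b \<in> B \<Longrightarrow> b \<in> zspan B"
  proof -
    assume b: "finite B" "b \<in> B"
    have "(\<Sum>c\<in>B. of_int (if c = b then 1 else 0) * c) = (\<Sum>c\<in>B. if c = b then c else 0)"
      by (intro sum.cong) auto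
    thus ?thesis using b unfolding zspan_def by (intro CollectI exI[of _ "\<lambda>c. if c = b then 1 else 0"]) simp
  qed
qed

lemma zspan_sum: "(\<And>k. k \<in> I \<Longrightarrow> f k \<in> zspan B) \<Longrightarrow> sum f I \<in> zspan B"
  by (induction I rule: infinite_finite_induct) (auto intro: zspan_rules)

lemma zspan_minus: "x \<in> zspan B \<Longrightarrow> - x \<in> zspan B" using zspan_rules(3)[of x B "-1"] by simp

lemma zspan_times:
  assumes "z \<in> zspan B" "\<And>b. b \<in> B \<Longrightarrow> w * b \<in> zspan B'"
  shows "w * z \<in> zspan B'"
proof -
  obtain f where z: "z = (\<Sum>b\<in>B. of_int (f b) * b)" using assms(1) by (auto simp: zspan_def)
  have "w * z = (\<Sum>b\<in>B. of_int (f b) * (w * b))" by (simp add: z sum_distrib_left algebra_simps)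
  thus ?thesis using assms(2) by (auto intro!: zspan_sum zspan_rules(3))
qed

lemma csubring_mring:
  assumes "finite B" shows "csubring (mring B)" unfolding csubring_def
proof (intro conjI ballI)
  show "1 \<in> mring B" using assms by (simp add: mring_def zspan_rules(4))
  fix x y assume xy: "x \<in> mring B" "y \<in> mring B"
  show "x - y \<in> mring B" unfolding mring_def
  proof (intro CollectI ballI)
    fix b assume "b \<in> B"
    hence "x * b \<in> zspan B" "y * b \<in> zspan B" using xy by (auto simp: mring_def)
    hence "x * b + - (y * b) \<in> zspan B" using zspan_rules(2) zspan_minus by metis
    thus "(x - y) * b \<in> zspan B" by (simp add: algebra_simps)
  qed
  show "x * y \<in> mring B" unfolding mring_def
  proof (intro CollectI ballI)
    fix b assume "b \<in> B"
    hence "x * (y * b) \<in> zspan B" using xy zspan_times[of "y * b" B x B] by (auto simp: mring_def)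
    thus "x * y * b \<in> zspan B" by (simp add: mult.assoc)
  qed
qed

text \<open>Multiplication by \<open>x\<close> is an integer matrix on the generators; having
  \<open>1\<close> among them makes the vector of generators nonzero.\<close>

lemma mring_algebraic_int:
  assumes "finite B" "1 \<in> B" "x \<in> mring B"
  shows "algebraic_int x"
proof -
  define n where "n = card B"
  obtain h where h: "bij_betw h {..<n} B" using ex_bij_betw_nat_finite[OF assms(1)] by (auto simp: n_def atLeast0LessThan)
  have "\<exists>f::complex \<Rightarrow> int. x * h r = (\<Sum>b\<in>B. of_int (f b) * b)" if "r < n" for r
    using assms(3) bij_betwE[OF h] that by (auto simp: mring_def zspan_def)
  then obtain f :: "nat \<Rightarrow> complex \<Rightarrow> int"
    where f: "\<And>r. r < n \<Longrightarrow> x * h r = (\<Sum>b\<in>B. of_int (f r b) * b)" by metis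
  have eq: "x * h r = (\<Sum>l<n. of_int (f r (h l)) * h l)" if "r < n" for r
    using f[OF that] sum.reindex_bij_betw[OF h, of "\<lambda>b. of_int (f r b) * b"] by simp
  obtain k where k: "k < n" "h k = 1" using h assms(2) by (metis bij_betw_iff_bijections lessThan_iff)
  show ?thesis by (rule algebraic_int_eigenvalue[of k n h x "\<lambda>r l. f r (h l)"]) (use k eq in auto)
qed

text \<open>The larger lattice is spanned by the products \<open>b * x ^ e\<close> with
  \<open>e\<close> below the degree, and the monic equation reduces the top power. The coefficients
  need only multiply the old lattice into itself, which later yields transitivity of
  integrality.\<close>

lemma mring_adjoin_root:
  assumes B: "finite B" "1 \<in> B" and p: "monic p" "\<And>k. coeff p k \<in> mring B" "poly p x = 0"
  obtains B' where "finite B'" "1 \<in> B'" "mring B \<subseteq> mring B'" "x \<in> mring B'"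
proof -
  define d where "d = degree p"
  have d: "d > 0"
  proof (rule ccontr)
    assume "\<not> d > 0"
    hence "degree p = 0" by (simp add: d_def)
    then obtain c where "p = [:c:]" by (rule degree_eq_zeroE)
    thus False using p by simp
  qed
  define B' where "B' = (\<lambda>(b, e). b * x ^ e) ` (B \<times> {..<d})"
  have fin: "finite B'" using B by (simp add: B'_def)
  have mem: "b * x ^ e \<in> B'" if "b \<in> B" "e < d" for b e using that by (force simp: B'_def)
  have sp: "x ^ e * z \<in> zspan B'" if "z \<in> zspan B" "e < d" for z e
    using mem fin that(2) by (intro zspan_times[OF that(1)]) (auto simp: mult.commute intro: zspan_rules)
  show ?thesis
  proof (rule that[of B'])
    show "1 \<in> B'" using mem[OF B(2) d] by simp
    show "mring B \<subseteq> mring B'"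
    proof
      fix y assume y: "y \<in> mring B"
      have "y * (b * x ^ e) \<in> zspan B'" if "b \<in> B" "e < d" for b e
        using sp[of "y * b" e] y that by (simp add: mring_def algebra_simps)
      thus "y \<in> mring B'" by (auto simp: mring_def B'_def)
    qed
    have "x * (b * x ^ e) \<in> zspan B'" if be: "b \<in> B" "e < d" for b e
    proof (cases "Suc e < d")
      case True
      thus ?thesis using mem[OF be(1) True] fin by (simp add: algebra_simps zspan_rules)
    next
      case False
      hence e: "d = Suc e" using be by simp
      have "0 = (\<Sum>k\<le>d. coeff p k * x ^ k)" using p(3) by (simp add: poly_altdef d_def)
      also have "\<dots> = x ^ d + (\<Sum>k<d. coeff p k * x ^ k)"
        using p(1) by (simp add: d_def lessThan_Suc_atMost[symmetric])
      finally have xd: "x ^ d = - (\<Sum>k<d. coeff p k * x ^ k)" by (simp add: eq_neg_iff_add_eq_0)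
      have "x * (b * x ^ e) = x ^ d * b" by (simp add: e algebra_simps)
      also have "\<dots> = - (\<Sum>k<d. x ^ k * (coeff p k * b))"
        by (simp add: xd sum_distrib_left sum_distrib_right mult_ac)
      also have "\<dots> \<in> zspan B'" using p(2) be by (intro zspan_minus zspan_sum sp) (auto simp: mring_def)
      finally show ?thesis .
    qed
    thus "x \<in> mring B'" by (auto simp: mring_def B'_def)
  qed (rule fin)
qed

lemma mring_adjoin_finite:
  assumes "finite T" "\<And>x. x \<in> T \<Longrightarrow> algebraic_int x"
  shows "\<exists>B. finite B \<and> 1 \<in> B \<and> T \<subseteq> mring B" using assms
proof (induction T rule: finite_induct)
  case empty
  show ?case by (rule exI[of _ "{1}"]) simp
next
  case (insert x T)
  then obtain B where B: "finite B" "1 \<in> B" "T \<subseteq> mring B" by auto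
  obtain p where p: "poly (of_int_poly p) x = 0" "monic p"
    using insert.prems[of x] unfolding algebraic_int_altdef_ipoly by auto
  obtain B' where "finite B'" "1 \<in> B'" "mring B \<subseteq> mring B'" "x \<in> mring B'"
    by (rule mring_adjoin_root[OF B(1,2), of "of_int_poly p" x])
      (use p B in \<open>auto intro: csubring_of_int csubring_mring\<close>)
  thus ?case using B by (intro exI[of _ B']) auto
qed

lemma csubring_Zbar: "csubring Zbar" unfolding csubring_def
proof (intro conjI ballI)
  show "1 \<in> Zbar" by (simp add: Zbar_def int_imp_algebraic_int)
  fix x y assume "x \<in> Zbar" "y \<in> Zbar"
  then obtain B where B: "finite B" "1 \<in> B" "{x, y} \<subseteq> mring B"
    using mring_adjoin_finite[of "{x, y}"] by (auto simp: Zbar_def)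
  thus "x - y \<in> Zbar" "x * y \<in> Zbar" using csubring_basic(2,3)[OF csubring_mring[OF B(1)], of x y]
    by (auto simp: Zbar_def intro!: mring_algebraic_int[OF B(1,2)])
qed

lemmas Zbar_rules = csubring_rules[OF csubring_Zbar]

text \<open>The finitely many coefficients lie in one multiplier ring, and the root can be adjoined
  to it.\<close>

lemma Zbar_integrally_closed:
  assumes "monic p" "\<And>k. coeff p k \<in> Zbar" "poly p x = 0"
  shows "x \<in> Zbar"
proof -
  obtain B where B: "finite B" "1 \<in> B" "coeff p ` {..degree p} \<subseteq> mring B"
    using mring_adjoin_finite[of "coeff p ` {..degree p}"] assms(2) by (auto simp: Zbar_def)
  have "coeff p k \<in> mring B" for k using B(3) csubring_basic(4)[OF csubring_mring[OF B(1)]]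
    by (cases "k \<le> degree p") (auto simp: coeff_eq_0)
  then obtain B' where "finite B'" "1 \<in> B'" "x \<in> mring B'"
    using mring_adjoin_root[OF B(1,2) assms(1) _ assms(3)] by metis
  thus ?thesis using mring_algebraic_int by (auto simp: Zbar_def)
qed

lemma Rats_Zbar:
  assumes "x \<in> \<rat>" "x \<in> Zbar" shows "x \<in> \<int>"
  using assms rational_algebraic_int_is_int by (auto simp: Zbar_def)

lemma Qbar_iff_int_poly: "x \<in> Qbar \<longleftrightarrow> (\<exists>p::int poly. p \<noteq> 0 \<and> poly (of_int_poly p) x = 0)"
proof
  assume "x \<in> Qbar"
  thus "\<exists>p::int poly. p \<noteq> 0 \<and> poly (of_int_poly p) x = 0" unfolding Qbar_def by (auto elim!: algebraicE')
next
  assume "\<exists>p::int poly. p \<noteq> 0 \<and> poly (of_int_poly p) x = 0"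
  then obtain p :: "int poly" where "p \<noteq> 0" "poly (of_int_poly p) x = 0" by auto
  thus "x \<in> Qbar" unfolding Qbar_def by (intro CollectI algebraicI[of "of_int_poly p"]) auto
qed

text \<open>Multiplying by the leading coefficient makes an algebraic number integral. A natural
  number is wanted as denominator because every embedding fixes it.\<close>

lemma Qbar_iff: "x \<in> Qbar \<longleftrightarrow> (\<exists>n::nat. n > 0 \<and> of_nat n * x \<in> Zbar)"
proof
  assume "x \<in> Qbar"
  then obtain p :: "int poly" where p: "poly (of_int_poly p) x = 0" "p \<noteq> 0" unfolding Qbar_iff_int_poly by auto
  define d a where "d = degree p" and "a = lead_coeff p"
  have a: "a \<noteq> 0" using p by (simp add: a_def)
  have d: "d > 0"
  proof (rule ccontr)
    assume "\<not> d > 0"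
    hence "degree p = 0" by (simp add: d_def)
    then obtain c where "p = [:c:]" by (rule degree_eq_zeroE)
    thus False using p by simp
  qed
  \<comment> \<open>\<open>q\<close> is \<open>a ^ (d - 1) * p (X / a)\<close>: monic, with integer
    coefficients, and with root \<open>a * x\<close>.\<close>
  define q :: "complex poly" where
    "q = monom 1 d + (\<Sum>k<d. monom (of_int (coeff p k * a ^ (d - 1 - k))) k)"
  have co: "coeff q k = (if k = d then 1 else if k < d then of_int (coeff p k * a ^ (d - 1 - k)) else 0)" for k
    by (auto simp: q_def coeff_sum)
  have dq: "degree q = d"
  proof (rule antisym)
    show "degree q \<le> d" by (rule degree_le) (simp add: co)
    show "d \<le> degree q" by (rule le_degree) (simp add: co)
  qed
  have px: "poly (of_int_poly p) x = (\<Sum>k\<le>d. of_int (coeff p k) * x ^ k)" by (simp add: poly_altdef d_def)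
  have "poly q (of_int a * x) = of_int a ^ (d-1) * poly (of_int_poly p) x"
  proof -
    have "poly q (of_int a * x) = (\<Sum>k\<le>d. coeff q k * (of_int a * x) ^ k)" by (simp add: poly_altdef dq)
    also have "\<dots> = (\<Sum>k\<le>d. of_int a ^ (d-1) * (of_int (coeff p k) * x ^ k))"
    proof (rule sum.cong[OF refl])
      fix k assume "k \<in> {..d}"
      show "coeff q k * (of_int a * x) ^ k = of_int a ^ (d-1) * (of_int (coeff p k) * x ^ k)"
      proof (cases "k = d")
        case True
        obtain e where e: "d = Suc e" using d by (cases d) auto
        have "coeff q k = 1" "coeff p k = a" using True by (auto simp: co a_def d_def)
        thus ?thesis using True by (simp only: e) (simp add: power_mult_distrib)
      next
        case False
        hence k: "k < d" using \<open>k \<in> {..d}\<close> by simp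
        hence "(of_int a :: complex) ^ (d - 1) = of_int a ^ (d - 1 - k) * of_int a ^ k"
          by (metis One_nat_def Suc_pred d le_add_diff_inverse2 less_Suc_eq_le power_add)
        moreover have "coeff q k = of_int (coeff p k) * of_int a ^ (d - 1 - k)" using k by (simp add: co)
        ultimately show ?thesis by (simp only: power_mult_distrib mult_ac)
      qed
    qed
    also have "\<dots> = of_int a ^ (d-1) * poly (of_int_poly p) x" by (simp only: px sum_distrib_left)
    finally show ?thesis .
  qed
  moreover have "coeff q k \<in> Zbar" for k by (simp add: co Zbar_rules del: of_int_mult of_int_power)
  ultimately have "of_int a * x \<in> Zbar" using p dq Zbar_integrally_closed[of q "of_int a * x"] by (simp add: co)
  \<comment> \<open>The sign turns the integer denominator \<open>a\<close> into a natural
    number.\<close>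
  hence "of_int (sgn a) * (of_int a * x) \<in> Zbar" by (rule Zbar_rules(3)[OF Zbar_rules(11)])
  moreover have "of_int (sgn a) * (of_int a * x) = of_nat (nat \<bar>a\<bar>) * x" by (simp add: abs_if sgn_if)
  ultimately show "\<exists>n::nat. n > 0 \<and> of_nat n * x \<in> Zbar"
    using a by (intro exI[of _ "nat \<bar>a\<bar>"]) auto
next
  assume "\<exists>n::nat. n > 0 \<and> of_nat n * x \<in> Zbar"
  then obtain n :: nat and p :: "int poly" where n: "n > 0"
    and p: "poly (of_int_poly p) (of_nat n * x) = 0" "monic p" by (auto simp: Zbar_def algebraic_int_altdef_ipoly)
  have "of_int_poly [:0, int n:] = ([:0, of_nat n:] :: complex poly)"
    by (rule poly_eqI) (simp add: coeff_map_poly coeff_pCons split: nat.split)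
  hence "poly (of_int_poly (pcompose p [:0, int n:])) x = 0"
    using p by (simp add: of_int_hom.map_poly_pcompose poly_pcompose mult.commute)
  moreover have "pcompose p [:0, int n:] \<noteq> 0" using n p by (auto simp: pcompose_eq_0_iff)
  ultimately show "x \<in> Qbar" unfolding Qbar_iff_int_poly by auto
qed

lemma Zbar_subset_Qbar: "Zbar \<subseteq> Qbar" by (auto simp: Zbar_def Qbar_def)

lemma Qbar_field: "csubfield Qbar" unfolding csubfield_def csubring_def
proof (intro conjI ballI)
  show "1 \<in> Qbar" using Zbar_subset_Qbar csubring_basic(1)[OF csubring_Zbar] by auto
  fix x assume x: "x \<in> Qbar"
  then obtain m :: nat where m: "m > 0" "of_nat m * x \<in> Zbar" by (auto simp: Qbar_iff)
  show "inverse x \<in> Qbar" using x by (auto simp: Qbar_def)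
  fix y assume "y \<in> Qbar"
  then obtain n :: nat where n: "n > 0" "of_nat n * y \<in> Zbar" by (auto simp: Qbar_iff)
  have "of_nat n * (of_nat m * x) - of_nat m * (of_nat n * y) \<in> Zbar" by (intro Zbar_rules m n)
  thus "x - y \<in> Qbar" unfolding Qbar_iff using m n by (intro exI[of _ "m * n"]) (simp add: algebra_simps)
  have "(of_nat m * x) * (of_nat n * y) \<in> Zbar" by (intro Zbar_rules m n)
  thus "x * y \<in> Qbar" unfolding Qbar_iff using m n by (intro exI[of _ "m * n"]) (simp add: algebra_simps)
qed

section \<open>Embeddings of fields of algebraic numbers\<close>

text \<open>Dividing an integral relation for \<open>y\<close> by a power of \<open>y\<close> gives
  it a nonzero constant term, and solving for that term writes the inverse as a rational multiple of
  a polynomial in \<open>y\<close>. The induction on the relation performs the division.\<close>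

lemma csubfield_of_csubring:
  assumes "csubring R" "\<rat> \<subseteq> R" "R \<subseteq> Qbar"
  shows "csubfield R" unfolding csubfield_def
proof (intro conjI ballI assms(1))
  fix y assume y: "y \<in> R"
  show "inverse y \<in> R"
  proof (cases "y = 0")
    case True
    thus ?thesis using csubring_basic[OF assms(1)] by simp
  next
    case False
    obtain p :: "int poly" where "p \<noteq> 0" "poly (of_int_poly p) y = 0"
      using subsetD[OF assms(3) y] unfolding Qbar_iff_int_poly by blast
    thus ?thesis
    proof (induction p)
      case 0
      thus ?case by simp
    next
      case (pCons c q)
      have eq: "of_int c + y * poly (of_int_poly q) y = 0" using pCons.prems by (simp add: map_poly_pCons)
      show ?case
      proof (cases "c = 0")
        case True
        thus ?thesis using pCons eq False by auto
      next
        case c: False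
        have "inverse y = - poly (of_int_poly q) y * (1 / of_int c)"
          using eq c False by (simp add: field_simps eq_neg_iff_add_eq_0)
        moreover have "poly (of_int_poly q) y \<in> R"
          using y by (intro csubfield_coeff_rules assms(1)) (simp_all add: csubring_of_int assms(1))
        moreover have "1 / of_int c \<in> R" using assms(2) by auto
        ultimately show ?thesis by (metis csubring_basic(3,5)[OF assms(1)])
      qed
    qed
  qed
qed

text \<open>Partial ring homomorphisms are represented by their graphs, which are ordered by inclusion in the appeal to Zorn's lemma.\<close>

definition hom_graph :: "(complex \<times> complex) set \<Rightarrow> bool" where
  "hom_graph g \<longleftrightarrow> (\<forall>(a, b)\<in>g. \<forall>(c, d)\<in>g. (a - c, b - d) \<in> g \<and> (a * c, b * d) \<in> g) \<and>
     single_valued g \<and> Domain g \<subseteq> Qbar \<and> \<rat> \<subseteq> Domain g \<and> (1, 1) \<in> g"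

lemma hom_graph_rules:
  assumes "hom_graph g"
  shows "(a, b) \<in> g \<Longrightarrow> (c, d) \<in> g \<Longrightarrow> (a - c, b - d) \<in> g"
    "(a, b) \<in> g \<Longrightarrow> (c, d) \<in> g \<Longrightarrow> (a * c, b * d) \<in> g"
    "(1, 1) \<in> g" "(0, 0) \<in> g" "(a, b) \<in> g \<Longrightarrow> (c, d) \<in> g \<Longrightarrow> (a + c, b + d) \<in> g"
    "(a, b) \<in> g \<Longrightarrow> (a, c) \<in> g \<Longrightarrow> b = c"
proof -
  show m: "\<And>a b c d. (a, b) \<in> g \<Longrightarrow> (c, d) \<in> g \<Longrightarrow> (a - c, b - d) \<in> g"
    and "(a, b) \<in> g \<Longrightarrow> (c, d) \<in> g \<Longrightarrow> (a * c, b * d) \<in> g" and 1: "(1, 1) \<in> g"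
    and "(a, b) \<in> g \<Longrightarrow> (a, c) \<in> g \<Longrightarrow> b = c"
    using assms unfolding hom_graph_def by (auto simp: single_valued_def)
  show 0: "(0, 0) \<in> g" using m[OF 1 1] by simp
  show "(a, b) \<in> g \<Longrightarrow> (c, d) \<in> g \<Longrightarrow> (a + c, b + d) \<in> g"
    using m[of a b "- c" "- d"] m[OF 0, of c d] by simp
qed

lemma hom_graph_sum:
  assumes "hom_graph g" "\<And>k. k \<in> I \<Longrightarrow> (u k, v k) \<in> g"
  shows "(sum u I, sum v I) \<in> g"
  using assms(2) by (induction I rule: infinite_finite_induct) (auto intro: hom_graph_rules assms(1))

lemma csubfield_Domain: "hom_graph g \<Longrightarrow> csubfield (Domain g)"
proof -
  assume g: "hom_graph g"
  have "csubring (Domain g)" unfolding csubring_def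
  proof (intro conjI ballI)
    show "1 \<in> Domain g" using hom_graph_rules(3)[OF g] by (rule DomainI)
    fix a c assume "a \<in> Domain g" "c \<in> Domain g"
    then obtain b d where "(a, b) \<in> g" "(c, d) \<in> g" by blast
    thus "a - c \<in> Domain g" "a * c \<in> Domain g" using hom_graph_rules(1,2)[OF g] by (blast intro: DomainI)+
  qed
  thus ?thesis using g by (intro csubfield_of_csubring) (auto simp: hom_graph_def)
qed

text \<open>The extension sends \<open>poly f \<alpha>\<close> to \<open>poly f' \<beta>\<close>,
  where \<open>f'\<close> is the image of \<open>f\<close>. The minimal degree of \<open>f0\<close>
  makes this well defined.\<close>

lemma hom_graph_adjoin:
  fixes f0 f0' :: "complex poly"
  assumes g: "hom_graph g" and al: "\<alpha> \<in> Qbar"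
    and f0: "\<And>k. (coeff f0 k, coeff f0' k) \<in> g" "f0 \<noteq> 0" "poly f0 \<alpha> = 0" "poly f0' \<beta> = 0"
    and min: "\<And>h. h \<noteq> 0 \<Longrightarrow> (\<And>k. coeff h k \<in> Domain g) \<Longrightarrow> poly h \<alpha> = 0 \<Longrightarrow> degree f0 \<le> degree h"
  shows "\<exists>g'. hom_graph g' \<and> g \<subseteq> g' \<and> (\<alpha>, \<beta>) \<in> g'"
proof -
  note gr = hom_graph_rules[OF g]
  \<comment> \<open>\<open>PP f f'\<close> says that \<open>f'\<close> arises from \<open>f\<close>
    by applying the partial homomorphism to each coefficient.\<close>
  define PP where "PP f f' \<longleftrightarrow> (\<forall>k. (coeff f k, coeff f' k) \<in> g)" for f f' :: "complex poly"
  define g' where "g' = {(poly f \<alpha>, poly f' \<beta>) | f f'. PP f f'}"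
  have inj0: "b = 0" if "(0, b) \<in> g" for b using gr(6)[OF that gr(4)] .
  have mult: "PP (f * h) (f' * h')" if "PP f f'" "PP h h'" for f f' h h'
    using that unfolding PP_def coeff_mult by (auto intro!: hom_graph_sum[OF g] gr(2))
  have diff: "PP (f - h) (f' - h')" if "PP f f'" "PP h h'" for f f' h h'
    using that unfolding PP_def coeff_diff by (auto intro!: gr(1))
  have mono: "PP (monom a n) (monom b n)" if "(a, b) \<in> g" for a b n using that gr(4) by (auto simp: PP_def)
  have PP0: "PP f0 f0'" using f0 by (simp add: PP_def)
  have dom: "PP f f' \<Longrightarrow> coeff f k \<in> Domain g" for f f' k by (auto simp: PP_def)
  \<comment> \<open>Division with remainder by \<open>f0\<close>, one leading term at a time; the
    quotient terms have images because the domain is a field.\<close>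
  have vanish: "poly f' \<beta> = 0" if "PP f f'" "poly f \<alpha> = 0" for f f' using that
  proof (induction "degree f" arbitrary: f f' rule: less_induct)
    case less
    show ?case
    proof (cases "f = 0")
      case True
      hence "f' = 0" using less.prems(1) inj0 by (intro poly_eqI) (auto simp: PP_def)
      thus ?thesis by simp
    next
      case False
      have le: "degree f0 \<le> degree f" using min[OF False dom[OF less.prems(1)] less.prems(2)] .
      define l where "l = lead_coeff f / lead_coeff f0"
      have "l \<in> Domain g" unfolding l_def
        by (intro csubfield_divide csubfield_Domain g dom[OF less.prems(1)] dom[OF PP0])
      then obtain l' where l': "(l, l') \<in> g" by auto
      define mm mm' where "mm = monom l (degree f - degree f0)"
        and "mm' = monom l' (degree f - degree f0)"
      define h h' where "h = f - mm * f0" and "h' = f' - mm' * f0'"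
      have PPh: "PP h h'" unfolding h_def h'_def mm_def mm'_def by (intro diff mult mono less.prems PP0 l')
      have h0: "poly h \<alpha> = 0" using less.prems(2) f0 by (simp add: h_def)
      have h'0: "poly h' \<beta> = poly f' \<beta>" using f0 by (simp add: h'_def)
      show ?thesis
      proof (cases "h = 0")
        case True
        hence "h' = 0" using PPh inj0 by (intro poly_eqI) (auto simp: PP_def)
        thus ?thesis using h'0 by simp
      next
        case h: False
        have l0: "l \<noteq> 0" using False f0(2) by (simp add: l_def)
        hence mm0: "mm \<noteq> 0" "degree mm = degree f - degree f0"
          using l0 degree_monom_eq[OF l0] by (simp_all add: mm_def)
        have dg: "degree (mm * f0) = degree f" using mm0 f0(2) le by (simp add: degree_mult_eq)
        have lc: "lead_coeff (mm * f0) = lead_coeff f"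
        proof -
          have "lead_coeff mm = l" using degree_monom_eq[OF l0] by (simp add: mm_def)
          thus ?thesis using f0(2) by (simp add: lead_coeff_mult l_def)
        qed
        have "degree h < degree f"
        proof (rule ccontr)
          assume "\<not> degree h < degree f"
          moreover have "degree h \<le> degree f" unfolding h_def using dg by (intro degree_diff_le) auto
          ultimately have "degree h = degree f" by simp
          hence "lead_coeff h = 0" using lc dg by (simp add: h_def)
          thus False using h by simp
        qed
        hence "poly h' \<beta> = 0" using less.hyps[OF _ PPh h0] by simp
        thus ?thesis using h'0 by simp
      qed
    qed
  qed
  have g'E: "\<exists>f f'. PP f f' \<and> a = poly f \<alpha> \<and> b = poly f' \<beta>" if "(a, b) \<in> g'" for a b
    using that unfolding g'_def by blast
  have g'I: "PP f f' \<Longrightarrow> (poly f \<alpha>, poly f' \<beta>) \<in> g'" for f f' unfolding g'_def by blast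
  have sub: "g \<subseteq> g'"
  proof clarify
    fix a b assume "(a, b) \<in> g"
    hence "PP [:a:] [:b:]" using gr(4) by (auto simp: PP_def coeff_pCons split: nat.split)
    thus "(a, b) \<in> g'" using g'I[of "[:a:]" "[:b:]"] by simp
  qed
  have "hom_graph g'" unfolding hom_graph_def
  proof (intro conjI)
    show "\<forall>(a, b)\<in>g'. \<forall>(c, d)\<in>g'. (a - c, b - d) \<in> g' \<and> (a * c, b * d) \<in> g'"
    proof (intro ballI, clarsimp)
      fix a b c d assume ab: "(a, b) \<in> g'" and cd: "(c, d) \<in> g'"
      obtain f f' where f: "PP f f'" "a = poly f \<alpha>" "b = poly f' \<beta>" using g'E[OF ab] by blast
      obtain h h' where h: "PP h h'" "c = poly h \<alpha>" "d = poly h' \<beta>" using g'E[OF cd] by blast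
      show "(a - c, b - d) \<in> g' \<and> (a * c, b * d) \<in> g'"
        using g'I[OF diff[OF f(1) h(1)]] g'I[OF mult[OF f(1) h(1)]] f h by simp
    qed
    show "single_valued g'"
    proof (rule single_valuedI)
      fix a b c assume ab: "(a, b) \<in> g'" and ac: "(a, c) \<in> g'"
      obtain f f' where f: "PP f f'" "a = poly f \<alpha>" "b = poly f' \<beta>" using g'E[OF ab] by blast
      obtain h h' where h: "PP h h'" "a = poly h \<alpha>" "c = poly h' \<beta>" using g'E[OF ac] by blast
      have "poly (f - h) \<alpha> = 0" using f h by simp
      hence "poly (f' - h') \<beta> = 0" using vanish[OF diff[OF f(1) h(1)]] by blast
      thus "b = c" using f h by simp
    qed
    show "Domain g' \<subseteq> Qbar"
    proof clarify
      fix a b assume "(a, b) \<in> g'"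
      then obtain f f' where f: "PP f f'" "a = poly f \<alpha>" using g'E by blast
      have "coeff f k \<in> Qbar" for k using dom[OF f(1)] g by (auto simp: hom_graph_def)
      thus "a \<in> Qbar" unfolding f(2) by (intro csubfield_coeff_rules csubfield_csubring Qbar_field al)
    qed
    show "\<rat> \<subseteq> Domain g'" using Domain_mono[OF sub] g unfolding hom_graph_def by blast
    show "(1, 1) \<in> g'" using sub gr(3) by auto
  qed
  moreover have "(\<alpha>, \<beta>) \<in> g'"
  proof -
    have "PP [:0, 1:] [:0, 1:]" using gr(3,4) by (auto simp: PP_def coeff_pCons split: nat.split)
    thus ?thesis using g'I[of "[:0, 1:]" "[:0, 1:]"] by simp
  qed
  ultimately show ?thesis using sub by blast
qed

text \<open>Beyond the degree of \<open>m\<close> the chosen images are images of 0, and the leading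
  one is the image of 1, so \<open>m'\<close> keeps the degree and acquires a complex root whenever
  \<open>m\<close> is not constant.\<close>

lemma hom_graph_minpoly:
  assumes g: "hom_graph g" and al: "\<alpha> \<in> Qbar"
  obtains m m' where "monic m" "monic m'" "degree m' = degree m" "poly m \<alpha> = 0"
    "\<And>k. (coeff m k, coeff m' k) \<in> g"
    "\<And>h. h \<noteq> 0 \<Longrightarrow> (\<And>k. coeff h k \<in> Domain g) \<Longrightarrow> poly h \<alpha> = 0 \<Longrightarrow> degree m \<le> degree h"
proof -
  define Q where "Q h \<longleftrightarrow> h \<noteq> 0 \<and> (\<forall>k. coeff h k \<in> Domain g) \<and> poly h \<alpha> = 0" for h :: "complex poly"
  obtain p :: "int poly" where p: "p \<noteq> 0" "poly (of_int_poly p) \<alpha> = 0"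
    using al by (auto simp: Qbar_iff_int_poly)
  have "Q (of_int_poly p)" using p csubring_of_int[OF csubfield_csubring[OF csubfield_Domain[OF g]]] by (auto simp: Q_def)
  then obtain m0 where m0: "Q m0" "\<And>h. Q h \<Longrightarrow> degree m0 \<le> degree h"
    using arg_min_nat_lemma[of Q "of_int_poly p" degree] by blast
  define m where "m = smult (inverse (lead_coeff m0)) m0"
  have m: "Q m" "monic m" "degree m = degree m0" using m0(1) csubfield_Domain[OF g] unfolding m_def
    by (auto simp: Q_def csubfield_def intro!: csubring_rules)
  have "\<exists>b. (coeff m k, b) \<in> g" for k using m(1) by (auto simp: Q_def)
  then obtain c where c: "\<And>k. (coeff m k, c k) \<in> g" by metis
  have c0: "c k = 0" if "k > degree m" for k
    using c[of k] that hom_graph_rules(6)[OF g _ hom_graph_rules(4)[OF g]] by (simp add: coeff_eq_0)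
  have c1: "c (degree m) = 1" using c[of "degree m"] m(2) hom_graph_rules(6)[OF g _ hom_graph_rules(3)[OF g]] by simp
  define m' where "m' = (\<Sum>k\<le>degree m. monom (c k) k)"
  have co: "coeff m' k = c k" for k using c0[of k] by (auto simp: m'_def coeff_sum)
  have dm': "degree m' = degree m"
  proof (rule antisym)
    show "degree m' \<le> degree m" by (rule degree_le) (simp add: co c0)
    show "degree m \<le> degree m'" by (rule le_degree) (simp add: co c1)
  qed
  show ?thesis by (rule that[of m m']) (use m m0(2) c co c1 dm' in \<open>auto simp: Q_def\<close>)
qed

text \<open>Nothing is required of \<open>s\<close> outside \<open>K\<close>, unlike for elements of
  \<open>Gal\<close>, so that a single function can be viewed as a homomorphism on each subfield in
  turn.\<close>

definition chom :: "complex set \<Rightarrow> (complex \<Rightarrow> complex) \<Rightarrow> bool" where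
  "chom K s \<longleftrightarrow> s 1 = 1 \<and> (\<forall>x\<in>K. \<forall>y\<in>K. s (x + y) = s x + s y \<and> s (x * y) = s x * s y)"

lemma chom_rules:
  assumes "chom K s" "csubring K"
  shows "s 1 = 1" "x \<in> K \<Longrightarrow> y \<in> K \<Longrightarrow> s (x + y) = s x + s y"
    "x \<in> K \<Longrightarrow> y \<in> K \<Longrightarrow> s (x * y) = s x * s y"
    "s 0 = 0" "x \<in> K \<Longrightarrow> s (- x) = - s x" "x \<in> K \<Longrightarrow> y \<in> K \<Longrightarrow> s (x - y) = s x - s y"
proof -
  note K = csubring_basic[OF assms(2)]
  show "s 1 = 1" and a: "\<And>x y. x \<in> K \<Longrightarrow> y \<in> K \<Longrightarrow> s (x + y) = s x + s y"
    and "x \<in> K \<Longrightarrow> y \<in> K \<Longrightarrow> s (x * y) = s x * s y"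
    using assms(1) by (auto simp: chom_def)
  show 0: "s 0 = 0" using a[of 0 0] K by simp
  show m: "\<And>x. x \<in> K \<Longrightarrow> s (- x) = - s x" using a K 0 by (metis add.right_inverse add_eq_0_iff)
  show "x \<in> K \<Longrightarrow> y \<in> K \<Longrightarrow> s (x - y) = s x - s y"
    using a[of x "- y"] m[of y] K(5)[of y] by simp
qed

lemma chom_power: "chom K s \<Longrightarrow> csubring K \<Longrightarrow> x \<in> K \<Longrightarrow> s (x ^ n) = s x ^ n"
  by (induction n) (auto simp: chom_rules csubring_rules)

lemma chom_sum: "chom K s \<Longrightarrow> csubring K \<Longrightarrow> (\<And>k. k \<in> I \<Longrightarrow> f k \<in> K) \<Longrightarrow> s (sum f I) = (\<Sum>k\<in>I. s (f k))"
  by (induction I rule: infinite_finite_induct) (auto simp: chom_rules csubring_sum)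

lemma chom_prod: "chom K s \<Longrightarrow> csubring K \<Longrightarrow> (\<And>k. k \<in> I \<Longrightarrow> f k \<in> K) \<Longrightarrow> s (prod f I) = (\<Prod>k\<in>I. s (f k))"
  by (induction I rule: infinite_finite_induct) (auto simp: chom_rules csubring_prod)

lemma chom_of_nat: "chom K s \<Longrightarrow> csubring K \<Longrightarrow> s (of_nat n) = of_nat n"
  by (induction n) (auto simp: chom_rules csubring_of_nat csubring_basic)

lemma chom_of_int: "chom K s \<Longrightarrow> csubring K \<Longrightarrow> s (of_int n) = of_int n"
  by (cases n rule: int_cases2) (auto simp: chom_rules csubring_of_nat chom_of_nat)

lemma chom_inverse:
  assumes "chom K s" "csubfield K" "x \<in> K"
  shows "s (inverse x) = inverse (s x)"
proof (cases "x = 0")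
  case False
  have "s x * s (inverse x) = s (x * inverse x)" using assms by (simp add: chom_rules csubfield_csubring csubfield_inverse)
  hence "s x * s (inverse x) = 1" using False chom_rules(1)[OF assms(1)] assms(2) by (simp add: csubfield_csubring)
  thus ?thesis by (metis inverse_unique)
qed (use assms in \<open>simp add: chom_rules(4) csubfield_csubring\<close>)

lemma chom_Rats: "chom K s \<Longrightarrow> csubfield K \<Longrightarrow> x \<in> \<rat> \<Longrightarrow> s x = x"
  by (elim Rats_cases')
    (auto simp: divide_inverse chom_rules(3) chom_inverse chom_of_int csubfield_csubring
      csubring_of_int csubfield_inverse)

lemma chom_inj:
  assumes "chom K s" "csubfield K" shows "inj_on s K"
proof (rule inj_onI)
  fix x y assume xy: "x \<in> K" "y \<in> K" "s x = s y"
  show "x = y"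
  proof (rule ccontr)
    assume "x \<noteq> y"
    define z where "z = x - y"
    have z: "z \<in> K" "z \<noteq> 0" "s z = 0"
      using xy \<open>x \<noteq> y\<close> assms by (auto simp: z_def csubfield_csubring csubring_rules chom_rules(6))
    have "s (z * inverse z) = s z * s (inverse z)"
      using z assms by (intro chom_rules(3)[of K]) (auto simp: csubfield_csubring csubfield_inverse)
    moreover have "s 1 = 1" using assms by (auto simp: chom_def)
    ultimately show False using z by simp
  qed
qed

lemma chom_int_poly:
  assumes "chom K s" "csubring K" "x \<in> K"
  shows "s (poly (of_int_poly p) x) = poly (of_int_poly p) (s x)" using assms
  by (simp add: poly_altdef chom_sum csubring_rules chom_rules(3) chom_of_int chom_power)

lemma chom_Qbar:
  assumes "chom K s" "csubring K" "x \<in> K" "x \<in> Qbar" shows "s x \<in> Qbar"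
  using assms chom_int_poly[OF assms(1-3)] unfolding Qbar_iff_int_poly by (metis chom_rules(4))

lemma chom_Zbar:
  assumes "chom K s" "csubring K" "x \<in> K" "x \<in> Zbar" shows "s x \<in> Zbar"
  using assms chom_int_poly[OF assms(1-3)] unfolding Zbar_def algebraic_int_altdef_ipoly mem_Collect_eq
  by (metis chom_rules(4))

lemma Qbar_conjugates_finite:
  assumes "x \<in> Qbar"
  shows "finite {s x | s K. chom K s \<and> csubring K \<and> x \<in> K}"
proof -
  obtain p :: "int poly" where p: "p \<noteq> 0" "poly (of_int_poly p) x = 0" using assms by (auto simp: Qbar_iff_int_poly)
  have "{s x | s K. chom K s \<and> csubring K \<and> x \<in> K} \<subseteq> {y. poly (of_int_poly p) y = 0}"
    using p chom_int_poly chom_rules(4) by fastforce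
  moreover have "finite {y::complex. poly (of_int_poly p) y = 0}" using p by (intro poly_roots_finite) auto
  ultimately show ?thesis by (rule finite_subset)
qed

lemma hom_graph_of_chom:
  assumes s: "chom K s" and K: "csubfield K" "K \<subseteq> Qbar"
  shows "hom_graph ((\<lambda>x. (x, s x)) ` K)"
proof -
  define g where "g = (\<lambda>x. (x, s x)) ` K"
  note R = csubfield_csubring[OF K(1)]
  have gI: "(x, s x) \<in> g" if "x \<in> K" for x using that by (simp add: g_def)
  have gE: "a \<in> K \<and> b = s a" if "(a, b) \<in> g" for a b using that by (auto simp: g_def)
  have "(a - c, b - d) \<in> g \<and> (a * c, b * d) \<in> g" if ab: "(a, b) \<in> g" and cd: "(c, d) \<in> g" for a b c d
  proof -
    have a: "a \<in> K" "b = s a" and c: "c \<in> K" "d = s c" using gE[OF ab] gE[OF cd] by blast+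
    have "s (a - c) = s a - s c" "s (a * c) = s a * s c" by (rule chom_rules[OF s R], fact, fact)+
    thus ?thesis using gI[OF csubring_basic(2)[OF R a(1) c(1)]] gI[OF csubring_basic(3)[OF R a(1) c(1)]] a c by simp
  qed
  moreover have "single_valued g" using gE by (auto simp: single_valued_def)
  moreover have "(1, 1) \<in> g" using gI[OF csubring_basic(1)[OF R]] s by (simp add: chom_def)
  moreover have "Domain g = K" by (auto simp: g_def)
  ultimately show ?thesis using Rats_subset_csubfield[OF K(1)] K(2) unfolding hom_graph_def g_def by blast
qed

text \<open>A maximal graph is defined on all of \<open>Qbar\<close>: otherwise the image of a
  minimal polynomial has a complex root to which the missing element can be sent.\<close>

lemma hom_graph_total_extension:
  assumes g: "hom_graph g"
  obtains s where "chom Qbar s" "\<And>x y. (x, y) \<in> g \<Longrightarrow> s x = y"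
proof -
  define A where "A = {h. hom_graph h \<and> g \<subseteq> h}"
  have "\<exists>m\<in>A. \<forall>h\<in>A. m \<subseteq> h \<longrightarrow> h = m"
  proof (rule subset_Zorn_nonempty)
    show "A \<noteq> {}" unfolding A_def using g by blast
    fix C assume C: "C \<noteq> {}" "subset.chain A C"
    have hC: "hom_graph h" "g \<subseteq> h" if "h \<in> C" for h using C(2) that unfolding A_def subset_chain_def by blast+
    \<comment> \<open>Each closure condition involves at most two pairs, so it can be checked inside
      one member of the chain.\<close>
    have two: "\<exists>h\<in>C. u \<in> h \<and> v \<in> h" if uv: "u \<in> \<Union>C" "v \<in> \<Union>C" for u v
    proof -
      obtain h1 h2 where h: "h1 \<in> C" "u \<in> h1" "h2 \<in> C" "v \<in> h2" using uv by blast
      hence "h1 \<subseteq> h2 \<or> h2 \<subseteq> h1" using C(2) unfolding subset_chain_def by blast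
      thus ?thesis using h by blast
    qed
    have "hom_graph (\<Union>C)" unfolding hom_graph_def
    proof (intro conjI)
      show "\<forall>(a, b)\<in>\<Union>C. \<forall>(c, d)\<in>\<Union>C. (a - c, b - d) \<in> \<Union>C \<and> (a * c, b * d) \<in> \<Union>C"
      proof (intro ballI, clarify)
        fix a b c d H1 H2 assume "(a, b) \<in> H1" "H1 \<in> C" "(c, d) \<in> H2" "H2 \<in> C"
        then obtain h where "h \<in> C" "(a, b) \<in> h" "(c, d) \<in> h" using two[of "(a,b)" "(c,d)"] by blast
        thus "(a - c, b - d) \<in> \<Union>C \<and> (a * c, b * d) \<in> \<Union>C"
          using hom_graph_rules(1,2)[OF hC(1)] by blast
      qed
      show "single_valued (\<Union>C)"
      proof (rule single_valuedI)
        fix a b c assume "(a, b) \<in> \<Union>C" "(a, c) \<in> \<Union>C"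
        then obtain h where "h \<in> C" "(a, b) \<in> h" "(a, c) \<in> h" using two by blast
        thus "b = c" using hom_graph_rules(6)[OF hC(1)] by blast
      qed
      show "Domain (\<Union>C) \<subseteq> Qbar" using hC(1) unfolding hom_graph_def by blast
      obtain h where h: "h \<in> C" using C(1) by blast
      show "(1, 1) \<in> \<Union>C" using hom_graph_rules(3)[OF hC(1)[OF h]] h by blast
      have "\<rat> \<subseteq> Domain h" using hC(1)[OF h] by (simp add: hom_graph_def)
      thus "\<rat> \<subseteq> Domain (\<Union>C)" using h by blast
    qed
    thus "\<Union>C \<in> A" unfolding A_def using C(1) hC(2) by blast
  qed
  then obtain m where mA: "m \<in> A" and mmax: "\<forall>h\<in>A. m \<subseteq> h \<longrightarrow> h = m" by blast
  have m: "hom_graph m" "g \<subseteq> m" using mA by (simp_all add: A_def)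
  have mm: "h = m" if h: "hom_graph h" "m \<subseteq> h" for h
  proof -
    have "h \<in> A" using h m by (simp add: A_def)
    thus ?thesis using mmax h by simp
  qed
  have dom: "x \<in> Domain m" if x: "x \<in> Qbar" for x
  proof -
    obtain p p' where p: "monic p" "monic p'" "degree p' = degree p" "poly p x = 0"
      "\<And>k. (coeff p k, coeff p' k) \<in> m"
      "\<And>h. h \<noteq> 0 \<Longrightarrow> (\<And>k. coeff h k \<in> Domain m) \<Longrightarrow> poly h x = 0 \<Longrightarrow> degree p \<le> degree h"
      using hom_graph_minpoly[OF m(1) x] by metis
    have "degree p \<noteq> 0"
    proof
      assume "degree p = 0"
      then obtain c where "p = [:c:]" by (rule degree_eq_zeroE)
      thus False using p(1,4) by simp
    qed
    hence "\<not> constant (poly p')" using p(3) by (simp add: constant_degree)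
    then obtain y where y: "poly p' y = 0" using fundamental_theorem_of_algebra by blast
    have "p \<noteq> 0" using p(1) by auto
    then obtain h where h: "hom_graph h" "m \<subseteq> h" "(x, y) \<in> h"
      using hom_graph_adjoin[OF m(1) x p(5) _ p(4) y p(6)] by blast
    have "h = m" using mm[OF h(1,2)] .
    thus ?thesis using h(3) by blast
  qed
  define s where "s x = (THE y. (x, y) \<in> m)" for x
  have s: "s x = y" if "(x, y) \<in> m" for x y
    unfolding s_def by (rule the_equality) (use that hom_graph_rules(6)[OF m(1)] in auto)
  have s': "(x, s x) \<in> m" if xQ: "x \<in> Qbar" for x
  proof -
    obtain y where "(x, y) \<in> m" using dom[OF xQ] by blast
    thus ?thesis using s[of x y] by simp
  qed
  show ?thesis
  proof (rule that)
    show "chom Qbar s" unfolding chom_def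
    proof (intro conjI ballI)
      show "s 1 = 1" by (rule s[OF hom_graph_rules(3)[OF m(1)]])
      fix x y assume "x \<in> Qbar" "y \<in> Qbar"
      note xy = s'[OF this(1)] s'[OF this(2)]
      show "s (x + y) = s x + s y" by (rule s[OF hom_graph_rules(5)[OF m(1) xy]])
      show "s (x * y) = s x * s y" by (rule s[OF hom_graph_rules(2)[OF m(1) xy]])
    qed
    show "s x = y" if "(x, y) \<in> g" for x y using s[of x y] that m(2) by blast
  qed
qed

text \<open>An injective self-map of the finite set of roots of an integer polynomial is
  onto.\<close>

lemma chom_Qbar_onto:
  assumes "chom Qbar s" shows "s ` Qbar = Qbar"
proof
  note Q = csubfield_csubring[OF Qbar_field]
  show "s ` Qbar \<subseteq> Qbar" using chom_Qbar[OF assms Q] by auto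
  show "Qbar \<subseteq> s ` Qbar"
  proof
    fix x assume x: "x \<in> Qbar"
    obtain p :: "int poly" where p: "p \<noteq> 0" "poly (of_int_poly p) x = 0" using x by (auto simp: Qbar_iff_int_poly)
    define Z where "Z = {y::complex. poly (of_int_poly p) y = 0}"
    have fin: "finite Z" unfolding Z_def using p by (intro poly_roots_finite) auto
    have ZQ: "Z \<subseteq> Qbar" using p by (auto simp: Z_def Qbar_iff_int_poly)
    have "s ` Z \<subseteq> Z"
    proof clarify
      fix y assume y: "y \<in> Z"
      have "poly (of_int_poly p) (s y) = s (poly (of_int_poly p) y)" using chom_int_poly[OF assms Q subsetD[OF ZQ y]] by simp
      thus "s y \<in> Z" using y chom_rules(4)[OF assms Q] by (simp add: Z_def)
    qed
    moreover have "inj_on s Z" using chom_inj[OF assms Qbar_field] ZQ inj_on_subset by blast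
    ultimately have "s ` Z = Z" using endo_inj_surj[OF fin] by blast
    thus "x \<in> s ` Qbar" using p ZQ by (auto simp: Z_def)
  qed
qed

section \<open>Galois groups\<close>

lemma chom_cong: "(\<And>x. x \<in> K \<Longrightarrow> s x = t x) \<Longrightarrow> csubring K \<Longrightarrow> chom K s \<longleftrightarrow> chom K t"
  by (auto simp: chom_def csubring_basic)

lemma chom_subset: "chom M s \<Longrightarrow> K \<subseteq> M \<Longrightarrow> chom K s"
  by (auto simp: chom_def subset_iff)

lemma chom_compose: "chom M s \<Longrightarrow> chom K t \<Longrightarrow> t ` K \<subseteq> M \<Longrightarrow> chom K (\<lambda>x. s (t x))"
  unfolding chom_def by (metis image_subset_iff)

lemma subfield_iff_csubfield: "subfield K (ring_of_type_algebra :: complex ring) \<longleftrightarrow> csubfield K"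
proof -
  define R where "R = (ring_of_type_algebra :: complex ring)"
  interpret R: field R unfolding R_def by (rule field_from_type_algebra)
  have ops: "carrier R = UNIV" "x \<otimes>\<^bsub>R\<^esub> y = x * y" "x \<oplus>\<^bsub>R\<^esub> y = x + y" "\<one>\<^bsub>R\<^esub> = 1" "\<zero>\<^bsub>R\<^esub> = 0" for x y
    by (simp_all add: R_def ring_of_type_algebra_def)
  have minus: "\<ominus>\<^bsub>R\<^esub> x = - x" for x by (rule R.minus_equality) (simp_all add: ops)
  have inv: "inv\<^bsub>R\<^esub> x = inverse x" if "x \<noteq> 0" for x using that by (intro R.inv_char) (simp_all add: ops)
  show ?thesis unfolding R_def[symmetric]
  proof
    assume K: "subfield K R"
    note r = subringE[OF subfieldE(1)[OF K], unfolded ops minus]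
    have "inverse x \<in> K" if "x \<in> K" for x
    proof (cases "x = 0")
      case False
      hence "inv\<^bsub>R\<^esub> x \<in> K - {\<zero>\<^bsub>R\<^esub>}" using that by (intro R.subfield_m_inv K) (simp add: ops)
      thus ?thesis using inv[OF False] by simp
    qed (use r in simp)
    moreover have "x - y \<in> K" if "x \<in> K" "y \<in> K" for x y using r(7)[OF that(1) r(5)[OF that(2)]] by simp
    ultimately show "csubfield K" using r by (auto simp: csubfield_def csubring_def)
  next
    assume K: "csubfield K"
    note r = csubring_basic[OF csubfield_csubring[OF K]]
    have "subring K R" by (rule R.subringI) (auto simp: ops minus r)
    thus "subfield K R" by (rule R.subfieldI') (simp add: ops inv csubfield_inverse[OF K])
  qed
qed

text \<open>Injectivity, contained in \<open>ring_iso\<close>, is automatic for homomorphisms of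
  fields.\<close>

lemma Gal_iff:
  assumes "csubfield E"
  shows "s \<in> Gal E K \<longleftrightarrow> s \<in> extensional E \<and> chom E s \<and> s ` E = E \<and> (\<forall>x\<in>K. s x = x)"
proof -
  have ops: "carrier (subring_of_complex E) = E" "x \<otimes>\<^bsub>subring_of_complex E\<^esub> y = x * y"
     "x \<oplus>\<^bsub>subring_of_complex E\<^esub> y = x + y" "\<one>\<^bsub>subring_of_complex E\<^esub> = 1" for x y
    by (simp_all add: subring_of_complex_def ring_of_type_algebra_def)
  have "s \<in> ring_iso (subring_of_complex E) (subring_of_complex E) \<longleftrightarrow> chom E s \<and> s ` E = E"
    using chom_inj[OF _ assms] by (auto simp: ring_iso_def Ring.ring_hom_def ops chom_def bij_betw_def)
  thus ?thesis by (auto simp: Gal_def)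
qed

lemma Gal_rules:
  assumes "csubfield E" "s \<in> Gal E K"
  shows "s \<in> extensional E" "chom E s" "s ` E = E" "x \<in> E \<Longrightarrow> s x \<in> E" "x \<in> K \<Longrightarrow> s x = x" "inj_on s E"
    "s \<in> Bij E" using assms(2) chom_inj[OF _ assms(1)] unfolding Gal_iff[OF assms(1)] Bij_def bij_betw_def by auto

lemma Gal_compose:
  assumes E: "csubfield E" and K: "K \<subseteq> E" and s: "s \<in> Gal E K" and t: "t \<in> Gal E K"
  shows "compose E s t \<in> Gal E K"
proof -
  have "chom E (\<lambda>x. s (t x))"
    using Gal_rules(3)[OF E t] by (intro chom_compose[OF Gal_rules(2)[OF E s] Gal_rules(2)[OF E t]]) simp
  hence "chom E (compose E s t)"
    using chom_cong[of E "compose E s t" "\<lambda>x. s (t x)"] csubfield_csubring[OF E] by (simp add: compose_eq)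
  moreover have "compose E s t ` E = E"
  proof -
    have "compose E s t ` E = s ` (t ` E)" by (auto simp: compose_eq)
    thus ?thesis using Gal_rules(3)[OF E s] Gal_rules(3)[OF E t] by simp
  qed
  moreover have "\<forall>x\<in>K. compose E s t x = x"
    using K Gal_rules(5)[OF E s] Gal_rules(5)[OF E t] by (auto simp: compose_eq)
  ultimately show ?thesis by (simp add: Gal_iff[OF E])
qed

lemma Gal_id:
  assumes E: "csubfield E" and K: "K \<subseteq> E" shows "restrict (\<lambda>x. x) E \<in> Gal E K"
proof -
  have "chom E (restrict (\<lambda>x. x) E)" using csubring_basic[OF csubfield_csubring[OF E]] by (auto simp: chom_def)
  thus ?thesis using K by (auto simp: Gal_iff[OF E])
qed

lemma Gal_inverse:
  assumes E: "csubfield E" and K: "K \<subseteq> E" and s: "s \<in> Gal E K"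
  obtains t where "t \<in> Gal E K" "\<And>x. x \<in> E \<Longrightarrow> s (t x) = x" "\<And>x. x \<in> E \<Longrightarrow> t (s x) = x"
proof
  define t where "t = restrict (inv_into E s) E"
  note r = Gal_rules[OF E s] and c = csubring_basic[OF csubfield_csubring[OF E]]
  have tE: "t x \<in> E" and st: "s (t x) = x" if "x \<in> E" for x
    using that r(3) by (auto simp: t_def inv_into_into f_inv_into_f)
  show ts: "t (s x) = x" if "x \<in> E" for x using that r(4)[OF that] r(6) by (simp add: t_def)
  show "\<And>x. x \<in> E \<Longrightarrow> s (t x) = x" by (rule st)
  have "chom E t" unfolding chom_def
  proof (intro conjI ballI)
    show "t 1 = 1" using ts[OF c(1)] r(2) by (simp add: chom_def)
    fix x y assume xy: "x \<in> E" "y \<in> E"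
    have "s (t x + t y) = x + y" "s (t x * t y) = x * y"
      using r(2) xy tE st csubfield_csubring[OF E] by (simp_all add: chom_rules)
    thus "t (x + y) = t x + t y" "t (x * y) = t x * t y" using ts tE xy c by metis+
  qed
  moreover have "t ` E = E" using tE ts r(4) by (auto simp: image_iff) (metis r(4) ts)
  moreover have "t x = x" if "x \<in> K" for x using ts[of x] r(5)[OF that] that K by auto
  ultimately show "t \<in> Gal E K" by (simp add: Gal_iff[OF E] t_def)
qed

lemma Gal_eqI:
  assumes "csubfield E" "s \<in> Gal E K" "t \<in> Gal E K'" "\<And>x. x \<in> E \<Longrightarrow> s x = t x"
  shows "s = t" using assms(4) Gal_rules(1)[OF assms(1,2)] Gal_rules(1)[OF assms(1,3)] by (metis extensionalityI)

lemma Gal_antimono: "K \<subseteq> K' \<Longrightarrow> Gal E K' \<subseteq> Gal E K" by (auto simp: Gal_def)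

lemma Gal_Rats: "csubfield E \<Longrightarrow> s \<in> Gal E K \<Longrightarrow> s \<in> Gal E \<rat>"
  unfolding Gal_iff[of E] using chom_Rats[of E s] by blast

lemma gal_group_mult:
  assumes "csubfield E" "s \<in> Gal E K" "t \<in> Gal E K'"
  shows "s \<otimes>\<^bsub>gal_group E J\<^esub> t = compose E s t"
  using Gal_rules(7)[OF assms(1,2)] Gal_rules(7)[OF assms(1,3)] by (simp add: gal_group_def BijGroup_def)

lemma gal_group_group:
  assumes E: "csubfield E" and K: "K \<subseteq> E" shows "Group.group (gal_group E K)"
proof (rule groupI)
  have ops: "carrier (gal_group E K) = Gal E K" "\<one>\<^bsub>gal_group E K\<^esub> = restrict (\<lambda>x. x) E"
    by (simp_all add: gal_group_def BijGroup_def)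
  show "\<one>\<^bsub>gal_group E K\<^esub> \<in> carrier (gal_group E K)" unfolding ops by (rule Gal_id[OF E K])
  fix s assume "s \<in> carrier (gal_group E K)"
  hence s: "s \<in> Gal E K" by (simp add: ops)
  show "\<one>\<^bsub>gal_group E K\<^esub> \<otimes>\<^bsub>gal_group E K\<^esub> s = s"
    using gal_group_mult[OF E Gal_id[OF E K] s] Gal_rules[OF E s]
    unfolding ops by (auto simp: compose_def fun_eq_iff extensional_def)
  obtain t where t: "t \<in> Gal E K" "\<And>x. x \<in> E \<Longrightarrow> t (s x) = x" using Gal_inverse[OF E K s] by metis
  show "\<exists>t\<in>carrier (gal_group E K). t \<otimes>\<^bsub>gal_group E K\<^esub> s = \<one>\<^bsub>gal_group E K\<^esub>"
    unfolding ops using t gal_group_mult[OF E t(1) s] by (intro bexI[of _ t]) (auto simp: compose_def fun_eq_iff)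
  fix t assume "t \<in> carrier (gal_group E K)"
  hence t: "t \<in> Gal E K" by (simp add: ops)
  show "s \<otimes>\<^bsub>gal_group E K\<^esub> t \<in> carrier (gal_group E K)"
    unfolding ops gal_group_mult[OF E s t] by (rule Gal_compose[OF E K s t])
  fix u assume "u \<in> carrier (gal_group E K)"
  hence u: "u \<in> Gal E K" by (simp add: ops)
  show "s \<otimes>\<^bsub>gal_group E K\<^esub> t \<otimes>\<^bsub>gal_group E K\<^esub> u = s \<otimes>\<^bsub>gal_group E K\<^esub> (t \<otimes>\<^bsub>gal_group E K\<^esub> u)"
    unfolding gal_group_mult[OF E s t] gal_group_mult[OF E t u] gal_group_mult[OF E Gal_compose[OF E K s t] u]
       gal_group_mult[OF E s Gal_compose[OF E K t u]] using Gal_rules(4)[OF E u] by (auto simp: compose_def fun_eq_iff)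
qed

lemma gal_group_inv:
  assumes E: "csubfield E" and K: "K \<subseteq> E" and s: "s \<in> Gal E K" and t: "t \<in> Gal E K"
    and ts: "\<And>x. x \<in> E \<Longrightarrow> t (s x) = x"
  shows "inv\<^bsub>gal_group E K\<^esub> s = t"
proof -
  interpret Group.group "gal_group E K" by (rule gal_group_group[OF E K])
  have "t \<otimes>\<^bsub>gal_group E K\<^esub> s = \<one>\<^bsub>gal_group E K\<^esub>"
    unfolding gal_group_mult[OF E t s] using ts by (auto simp: gal_group_def BijGroup_def compose_def)
  moreover have "s \<in> carrier (gal_group E K)" "t \<in> carrier (gal_group E K)"
    using s t by (simp_all add: gal_group_def)
  ultimately show ?thesis by (metis inv_equality)
qed

subsection \<open>The absolute Galois group\<close>

lemma chom_Qbar_Gal: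
  assumes "chom Qbar s" "\<And>x. x \<in> K \<Longrightarrow> s x = x" "K \<subseteq> Qbar"
  shows "restrict s Qbar \<in> Gal Qbar K"
proof -
  have "chom Qbar (restrict s Qbar)"
    using chom_cong[of Qbar "restrict s Qbar" s] csubfield_csubring[OF Qbar_field] assms(1) by simp
  moreover have "restrict s Qbar ` Qbar = Qbar" using chom_Qbar_onto[OF assms(1)] by simp
  ultimately show ?thesis using assms(2,3) by (auto simp: Gal_iff[OF Qbar_field])
qed

lemma extend_embedding:
  assumes "chom K s" "csubfield K" "K \<subseteq> Qbar"
  obtains t where "t \<in> G_Q" "\<And>x. x \<in> K \<Longrightarrow> t x = s x"
proof -
  obtain t where t: "chom Qbar t" "\<And>x y. (x, y) \<in> (\<lambda>x. (x, s x)) ` K \<Longrightarrow> t x = y"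
    using hom_graph_total_extension[OF hom_graph_of_chom[OF assms]] by metis
  have "restrict t Qbar \<in> G_Q" using chom_Qbar_Gal[OF t(1), of \<rat>] chom_Rats[OF t(1) Qbar_field]
      Rats_subset_csubfield[OF Qbar_field] by auto
  thus ?thesis using t(2) assms(3) by (intro that[of "restrict t Qbar"]) auto
qed

text \<open>Separability in characteristic zero. If \<open>x\<close> were the only root of its
  minimal polynomial, this would be \<open>(X - x) ^ d\<close>, and its second coefficient
  \<open>- d * x\<close> would put \<open>x\<close> into \<open>K\<close>. So there is another root,
  and an embedding taking \<open>x\<close> to it.\<close>

lemma Gal_Qbar_moves:
  assumes K: "csubfield K" "K \<subseteq> Qbar" and x: "x \<in> Qbar" "x \<notin> K"
  obtains s where "s \<in> Gal Qbar K" "s x \<noteq> x"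
proof -
  define g where "g = (\<lambda>x. (x, x)) ` K"
  have "chom K (\<lambda>x. x)" by (simp add: chom_def)
  hence g: "hom_graph g" using hom_graph_of_chom[OF _ K] by (simp add: g_def)
  have D: "Domain g = K" by (auto simp: g_def)
  obtain m m' where m: "monic m" "monic m'" "degree m' = degree m" "poly m x = 0"
      "\<And>k. (coeff m k, coeff m' k) \<in> g"
      "\<And>h. h \<noteq> 0 \<Longrightarrow> (\<And>k. coeff h k \<in> Domain g) \<Longrightarrow> poly h x = 0 \<Longrightarrow> degree m \<le> degree h"
    using hom_graph_minpoly[OF g x(1)] by metis
  have mm: "m' = m" using m(5) by (intro poly_eqI) (auto simp: g_def)
  have mK: "coeff m k \<in> K" for k using m(5)[of k] by (auto simp: g_def)
  have m0: "m \<noteq> 0" using m(1) by auto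
  have "\<exists>y. poly m y = 0 \<and> y \<noteq> x"
  proof (rule ccontr)
    assume *: "\<not> (\<exists>y. poly m y = 0 \<and> y \<noteq> x)"
    obtain q where q: "m = [:- x, 1:] ^ order x m * q" "\<not> [:- x, 1:] dvd q" using order_decomp[OF m0] by blast
    have "degree q = 0"
    proof (rule ccontr)
      assume "degree q \<noteq> 0"
      then obtain y where y: "poly q y = 0" using fundamental_theorem_of_algebra[of q] by (auto simp: constant_degree)
      hence "poly m y = 0" by (subst q(1)) simp
      hence "y = x" using * by auto
      thus False using y q(2) by (simp add: poly_eq_0_iff_dvd)
    qed
    then obtain c where c: "q = [:c:]" by (rule degree_eq_zeroE)
    define d where "d = order x m"
    have lc: "lead_coeff ([:- x, 1:] ^ d) = 1" by (simp add: lead_coeff_power)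
    have "lead_coeff ([:- x, 1:] ^ order x m * q) = c" unfolding lead_coeff_mult using lc by (simp add: c d_def)
    hence "lead_coeff m = c" using q(1) by metis
    hence "m = [:- x, 1:] ^ d" using q(1) m(1) c by (simp add: d_def one_pCons)
    moreover have "d > 0" using m(4) m0 by (simp add: d_def order_gt_0_iff)
    ultimately obtain e where e: "m = [:- x, 1:] ^ Suc e" by (cases d) auto
    have dg: "degree m = Suc e" by (simp add: e degree_power_eq del: power_Suc)
    have "coeff ([:- x, 1:] ^ Suc n) n = - of_nat (Suc n) * x \<and> coeff ([:- x, 1:] ^ Suc n) (Suc n) = 1" for n
    proof (induction n)
      case (Suc n)
      define f where "f = [:- x, 1:] ^ Suc n"
      have "coeff f (Suc (Suc n)) = 0" by (rule coeff_eq_0) (simp add: f_def degree_power_eq del: power_Suc)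
      moreover have eq: "[:- x, 1:] ^ Suc (Suc n) = smult (- x) f + pCons 0 f" by (simp add: f_def)
      ultimately show ?case using Suc.IH[folded f_def] unfolding eq
        by (simp add: algebra_simps del: power_Suc) (metis add.commute add_diff_cancel_left' diff_minus_eq_add minus_diff_eq uminus_add_conv_diff)
    qed simp
    hence "coeff m e = - of_nat (Suc e) * x" by (simp add: e del: power_Suc of_nat_Suc)
    hence "x = - coeff m e / of_nat (Suc e)" by (simp add: field_simps del: of_nat_Suc)
    also have "\<dots> \<in> K" using mK K(1) by (intro csubfield_divide csubring_rules csubfield_csubring) auto
    finally show False using x(2) by simp
  qed
  then obtain y where y: "poly m y = 0" "y \<noteq> x" by blast
  have "poly m' y = 0" using y mm by simp
  then obtain g' where g': "hom_graph g'" "g \<subseteq> g'" "(x, y) \<in> g'"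
    using hom_graph_adjoin[OF g x(1) m(5) m0 m(4) _ m(6)] by blast
  obtain t where t: "chom Qbar t" "\<And>x y. (x, y) \<in> g' \<Longrightarrow> t x = y"
    using hom_graph_total_extension[OF g'(1)] by metis
  have "restrict t Qbar \<in> Gal Qbar K" using g'(2) by (intro chom_Qbar_Gal t K(2)) (auto simp: g_def)
  moreover have "restrict t Qbar x \<noteq> x" using t(2)[OF g'(3)] y x(1) by simp
  ultimately show ?thesis by (rule that)
qed

subsection \<open>Independence of characters modulo a prime ideal\<close>

text \<open>One notion serves three kinds of rings: \<open>Zbar\<close>, the integers of a number
  field, and \<open>UNIV\<close> with the ideal \<open>{0}\<close>, where it turns congruences into
  equations.\<close>

definition prime_in :: "complex set \<Rightarrow> complex set \<Rightarrow> bool" where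
  "prime_in R P \<longleftrightarrow> P \<subseteq> R \<and> 0 \<in> P \<and> (\<forall>x\<in>P. \<forall>y\<in>P. x + y \<in> P) \<and> (\<forall>r\<in>R. \<forall>x\<in>P. r * x \<in> P) \<and>
     1 \<notin> P \<and> (\<forall>x\<in>R. \<forall>y\<in>R. x * y \<in> P \<longrightarrow> x \<in> P \<or> y \<in> P)"

lemma prime_in_rules:
  assumes "prime_in R P" "csubring R"
  shows "x \<in> P \<Longrightarrow> x \<in> R" "0 \<in> P" "x \<in> P \<Longrightarrow> y \<in> P \<Longrightarrow> x + y \<in> P"
    "r \<in> R \<Longrightarrow> x \<in> P \<Longrightarrow> r * x \<in> P" "r \<in> R \<Longrightarrow> x \<in> P \<Longrightarrow> x * r \<in> P"
    "x \<in> P \<Longrightarrow> - x \<in> P" "x \<in> P \<Longrightarrow> y \<in> P \<Longrightarrow> x - y \<in> P" "1 \<notin> P"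
    "x * y \<in> P \<Longrightarrow> x \<in> R \<Longrightarrow> y \<in> R \<Longrightarrow> x \<in> P \<or> y \<in> P"
proof -
  show "x \<in> P \<Longrightarrow> x \<in> R" "0 \<in> P" and a: "\<And>x y. x \<in> P \<Longrightarrow> y \<in> P \<Longrightarrow> x + y \<in> P"
    and m: "\<And>r x. r \<in> R \<Longrightarrow> x \<in> P \<Longrightarrow> r * x \<in> P" and "1 \<notin> P"
    "x * y \<in> P \<Longrightarrow> x \<in> R \<Longrightarrow> y \<in> R \<Longrightarrow> x \<in> P \<or> y \<in> P"
    using assms(1) by (auto simp: prime_in_def)
  show "r \<in> R \<Longrightarrow> x \<in> P \<Longrightarrow> x * r \<in> P" using m by (simp add: mult.commute)
  show n: "\<And>x. x \<in> P \<Longrightarrow> - x \<in> P" using m[of "-1"] csubring_basic(1,5)[OF assms(2)] by simp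
  show "x \<in> P \<Longrightarrow> y \<in> P \<Longrightarrow> x - y \<in> P" using a[of x "- y"] n[of y] by simp
qed

lemma prime_in_sum:
  "prime_in R P \<Longrightarrow> csubring R \<Longrightarrow> (\<And>k. k \<in> I \<Longrightarrow> f k \<in> P) \<Longrightarrow> sum f I \<in> P"
  by (induction I rule: infinite_finite_induct) (auto intro: prime_in_rules)

lemma prime_in_prod:
  assumes "prime_in R P" "csubring R" "finite I" "\<And>k. k \<in> I \<Longrightarrow> f k \<in> R" "prod f I \<in> P"
  shows "\<exists>k\<in>I. f k \<in> P" using assms(3-5)
proof (induction I rule: finite_induct)
  case empty
  thus ?case using prime_in_rules(8)[OF assms(1,2)] by simp
next
  case (insert k I)
  have "f k * prod f I \<in> P" using insert by simp
  moreover have "prod f I \<in> R" using insert by (intro csubring_prod assms(2)) auto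
  ultimately have "f k \<in> P \<or> prod f I \<in> P" using insert by (intro prime_in_rules(9)[OF assms(1,2)]) auto
  thus ?case using insert by blast
qed

lemma prime_in_power:
  assumes "prime_in R P" "csubring R" "x \<in> R" "x ^ n \<in> P"
  shows "x \<in> P" using assms(4)
proof (induction n)
  case 0
  thus ?case using prime_in_rules(8)[OF assms(1,2)] by simp
next
  case (Suc n)
  hence "x \<in> P \<or> x ^ n \<in> P" using assms by (intro prime_in_rules(9)[OF assms(1,2)]) (auto intro: csubring_power)
  thus ?case using Suc by blast
qed

text \<open>Dedekind's argument modulo \<open>P\<close>: the relation at \<open>x * y\<close> minus
  \<open>f a y\<close> times the relation at \<open>x\<close> no longer involves the character
  \<open>a\<close>. By induction \<open>c b * (f b y - f a y)\<close> lies in \<open>P\<close>, and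
  \<open>y\<close> can be chosen with the second factor outside.\<close>

lemma independent_characters:
  fixes f :: "'a \<Rightarrow> complex \<Rightarrow> complex"
  assumes P: "prime_in R P" and R: "csubring R" and D: "1 \<in> D" "\<And>x y. x \<in> D \<Longrightarrow> y \<in> D \<Longrightarrow> x * y \<in> D"
    and S: "finite S" "\<And>s x. s \<in> S \<Longrightarrow> x \<in> D \<Longrightarrow> f s x \<in> R" "\<And>s. s \<in> S \<Longrightarrow> f s 1 = 1"
    "\<And>s x y. s \<in> S \<Longrightarrow> x \<in> D \<Longrightarrow> y \<in> D \<Longrightarrow> f s (x * y) = f s x * f s y"
    and dist: "\<And>s t. s \<in> S \<Longrightarrow> t \<in> S \<Longrightarrow> s \<noteq> t \<Longrightarrow> \<exists>x\<in>D. f s x - f t x \<notin> P"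
    and c: "\<And>s. s \<in> S \<Longrightarrow> c s \<in> R" "\<And>x. x \<in> D \<Longrightarrow> (\<Sum>s\<in>S. c s * f s x) \<in> P"
  shows "s \<in> S \<Longrightarrow> c s \<in> P" using S dist c
proof (induction S arbitrary: c s rule: finite_induct)
  case empty
  thus ?case by simp
next
  case (insert a S)
  note pr = prime_in_rules[OF P R] and rr = csubring_basic[OF R]
  have fR: "f s x \<in> R" if "s \<in> insert a S" "x \<in> D" for s x using insert.prems(2) that by blast
  have cR: "c s \<in> R" if "s \<in> insert a S" for s using insert.prems(6) that by blast
  have IH: "c b * (f b y - f a y) \<in> P" if b: "b \<in> S" and y: "y \<in> D" for b y
  proof (rule insert.IH[where c = "\<lambda>s. c s * (f s y - f a y)" and s = b])
    show "c s * (f s y - f a y) \<in> R" if "s \<in> S" for s using that fR cR y rr by simp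
    fix x assume x: "x \<in> D"
    have "(\<Sum>s\<in>S. c s * (f s y - f a y) * f s x) = (\<Sum>s\<in>insert a S. c s * (f s y - f a y) * f s x)"
      using insert.hyps by simp
    also have "\<dots> = (\<Sum>s\<in>insert a S. c s * f s (x * y)) - f a y * (\<Sum>s\<in>insert a S. c s * f s x)"
      unfolding sum_distrib_left sum_subtractf[symmetric]
      using insert.prems(4) x y by (intro sum.cong refl) (simp add: algebra_simps)
    also have "\<dots> \<in> P" using insert.prems(7) D(2)[OF x y] x fR y by (intro pr(7) pr(4)) auto
    finally show "(\<Sum>s\<in>S. c s * (f s y - f a y) * f s x) \<in> P" .
  qed (use insert.prems b in auto)
  have cS: "c b \<in> P" if b: "b \<in> S" for b
  proof -
    have "b \<noteq> a" using b insert.hyps by auto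
    then obtain y where y: "y \<in> D" "f b y - f a y \<notin> P" using insert.prems(5)[of b a] b by blast
    have "c b \<in> P \<or> f b y - f a y \<in> P" using IH[OF b y(1)] cR fR b y rr(2) by (intro pr(9)) auto
    thus ?thesis using y by blast
  qed
  have "(\<Sum>s\<in>insert a S. c s * f s 1) \<in> P" using insert.prems(7) D(1) by blast
  moreover have "(\<Sum>s\<in>insert a S. c s * f s 1) = c a + sum c S" using insert.hyps insert.prems(3) by simp
  moreover have "sum c S \<in> P" using cS by (intro prime_in_sum[OF P R])
  ultimately have "c a + sum c S - sum c S \<in> P" using pr(7) by metis
  thus ?case using cS insert.prems(1) by auto
qed

lemma prime_in_zero: "prime_in UNIV {0}" by (auto simp: prime_in_def)

lemma csubring_UNIV: "csubring UNIV" by (simp add: csubring_def)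

lemma Gal_bij_compose:
  assumes E: "csubfield E" and K: "K \<subseteq> E" and s: "s \<in> Gal E K"
  shows "bij_betw (compose E s) (Gal E K) (Gal E K)"
proof -
  obtain t where t: "t \<in> Gal E K" "\<And>x. x \<in> E \<Longrightarrow> s (t x) = x" "\<And>x. x \<in> E \<Longrightarrow> t (s x) = x"
    using Gal_inverse[OF E K s] by metis
  have "compose E t (compose E s u) = u" if u: "u \<in> Gal E K" for u using Gal_rules(4)[OF E u] t(3)
    by (intro Gal_eqI[OF E Gal_compose[OF E K t(1) Gal_compose[OF E K s u]] u]) (simp add: compose_eq)
  moreover have "compose E s (compose E t u) = u" if u: "u \<in> Gal E K" for u using Gal_rules(4)[OF E u] t(2)
    by (intro Gal_eqI[OF E Gal_compose[OF E K s Gal_compose[OF E K t(1) u]] u]) (simp add: compose_eq)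
  ultimately show ?thesis using Gal_compose[OF E K s] Gal_compose[OF E K t(1)]
    by (intro bij_betw_byWitness[where f' = "compose E t"]) auto
qed

lemma sum_Gal_compose:
  assumes E: "csubfield E" and K: "K \<subseteq> E" and s: "s \<in> Gal E K" and x: "x \<in> E"
  shows "(\<Sum>g\<in>Gal E K. f (s (g x))) = (\<Sum>g\<in>Gal E K. f (g x))"
proof -
  have "(\<Sum>g\<in>Gal E K. f (g x)) = (\<Sum>g\<in>Gal E K. f (compose E s g x))"
    using sum.reindex_bij_betw[OF Gal_bij_compose[OF E K s], of "\<lambda>g. f (g x)"] by simp
  thus ?thesis using x by (simp add: compose_eq)
qed

text \<open>Comparing the trace with its image under \<open>t\<close> shows that \<open>t\<close> inverts some automorphism.\<close>

lemma Galois_subgroup_complete: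
  assumes M: "csubfield M" and A: "A \<subseteq> Gal M \<rat>" "finite A" "restrict (\<lambda>x. x) M \<in> A"
    and bij: "\<And>s. s \<in> A \<Longrightarrow> bij_betw (compose M s) A A"
    and t: "chom M t" "\<And>x. x \<in> M \<Longrightarrow> (\<And>s. s \<in> A \<Longrightarrow> s x = x) \<Longrightarrow> t x = x"
  shows "restrict t M \<in> A"
proof -
  note R = csubfield_csubring[OF M]
  define B where "B = (\<lambda>g. restrict (\<lambda>x. t (g x)) M) ` A"
  \<comment> \<open>The coefficients of the sum over \<open>A\<close> minus the sum over
    \<open>t A\<close>. This combination vanishes on \<open>M\<close>, hence so does each
    coefficient; the identity lies in \<open>A\<close>, so it must lie in \<open>t A\<close> as
    well.\<close>
  define c :: "(complex \<Rightarrow> complex) \<Rightarrow> complex" where "c f = of_bool (f \<in> A) - of_bool (f \<in> B)" for f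
  have G: "chom M g" "g x \<in> M" if "g \<in> A" "x \<in> M" for g x using Gal_rules[OF M, of g \<rat>] that A(1) by auto
  have inj: "inj_on (\<lambda>g. restrict (\<lambda>x. t (g x)) M) A"
  proof (rule inj_onI)
    fix g h assume gh: "g \<in> A" "h \<in> A"
      and eq: "restrict (\<lambda>x. t (g x)) M = restrict (\<lambda>x. t (h x)) M"
    have "g x = h x" if x: "x \<in> M" for x
      using fun_cong[OF eq, of x] x G(2)[OF gh(1) x] G(2)[OF gh(2) x] inj_onD[OF chom_inj[OF t(1) M]] by simp
    thus "g = h" using A(1) gh by (intro Gal_eqI[OF M]) auto
  qed
  have chA: "chom M f" if fAB: "f \<in> A \<union> B" for f
  proof (cases "f \<in> A")
    case True thus ?thesis using G(1)[OF True csubring_basic(1)[OF R]] by blast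
  next
    case False
    then obtain g where g: "g \<in> A" "f = restrict (\<lambda>x. t (g x)) M" using fAB by (auto simp: B_def)
    have "g \<in> Gal M \<rat>" using g(1) A(1) by blast
    hence "chom M (\<lambda>x. t (g x))" using Gal_rules[OF M] by (intro chom_compose[OF t(1)]) auto
    thus ?thesis using chom_cong[of M f "\<lambda>x. t (g x)"] R g(2) by simp
  qed
  have ext: "f \<in> extensional M" if "f \<in> A \<union> B" for f using that Gal_rules(1)[OF M] A(1) by (auto simp: B_def)
  have finB: "finite B" using A(2) by (auto simp: B_def)
  have "c (restrict (\<lambda>x. x) M) \<in> {0}"
  proof (rule independent_characters[OF prime_in_zero csubring_UNIV, of M "A \<union> B" "\<lambda>s x. s x" c])
    show "\<exists>x\<in>M. f x - g x \<notin> {0}" if "f \<in> A \<union> B" "g \<in> A \<union> B" "f \<noteq> g" for f g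
    proof (rule ccontr)
      assume "\<not> (\<exists>x\<in>M. f x - g x \<notin> {0})"
      hence "f = g" by (intro extensionalityI[OF ext[OF that(1)] ext[OF that(2)]]) simp
      thus False using that by simp
    qed
    fix x assume x: "x \<in> M"
    define T where "T = (\<Sum>g\<in>A. g x)"
    have TM: "T \<in> M" unfolding T_def using G x by (intro csubring_sum R) auto
    have "s T = T" if s: "s \<in> A" for s
    proof -
      have "s T = (\<Sum>g\<in>A. s (g x))"
        unfolding T_def using chom_sum[OF G(1)[OF s x] R, of A "\<lambda>g. g x"] G x by simp
      also have "\<dots> = (\<Sum>g\<in>A. compose M s g x)" using x by (simp add: compose_eq)
      also have "\<dots> = T" unfolding T_def by (rule sum.reindex_bij_betw[OF bij[OF s], of "\<lambda>g. g x"])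
      finally show ?thesis .
    qed
    hence tT: "t T = T" using t(2) TM by blast
    have "(\<Sum>f\<in>A \<union> B. c f * f x) = (\<Sum>f\<in>A \<union> B. of_bool (f \<in> A) * f x) - (\<Sum>f\<in>A \<union> B. of_bool (f \<in> B) * f x)"
      by (simp add: c_def sum_subtractf left_diff_distrib)
    also have "(\<Sum>f\<in>A \<union> B. of_bool (f \<in> A) * f x) = (\<Sum>f\<in>A. f x)"
      using A(2) finB by (intro sum.mono_neutral_cong_right) auto
    also have "(\<Sum>f\<in>A \<union> B. of_bool (f \<in> B) * f x) = (\<Sum>f\<in>B. f x)"
      using A(2) finB by (intro sum.mono_neutral_cong_right) auto
    also have "(\<Sum>f\<in>B. f x) = (\<Sum>g\<in>A. t (g x))" unfolding B_def by (subst sum.reindex[OF inj]) (simp add: x)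
    also have "\<dots> = t T" unfolding T_def using chom_sum[OF t(1) R, of A "\<lambda>g. g x"] G x by simp
    finally show "(\<Sum>f\<in>A \<union> B. c f * f x) \<in> {0}" using tT by (simp add: T_def)
  next
    fix f assume "f \<in> A \<union> B"
    hence f: "chom M f" by (rule chA)
    thus "f 1 = 1" by (simp add: chom_def)
    show "f (x * y) = f x * f y" if "x \<in> M" "y \<in> M" for x y using chom_rules(3)[OF f R] that by simp
  qed (use A finB R in \<open>auto intro: csubring_basic\<close>)
  hence "restrict (\<lambda>x. x) M \<in> B" using A(3) by (simp add: c_def split: if_splits)
  then obtain g where g: "g \<in> A" "restrict (\<lambda>x. x) M = restrict (\<lambda>x. t (g x)) M" by (auto simp: B_def)
  have tg: "t (g x) = x" if "x \<in> M" for x using fun_cong[OF g(2), of x] that by simp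
  obtain h where h: "h \<in> A" "compose M g h = restrict (\<lambda>x. x) M"
    using bij_betw_imp_surj_on[OF bij[OF g(1)]] A(3) by (metis imageE)
  have gh: "g (h x) = x" if "x \<in> M" for x using fun_cong[OF h(2), of x] that by (simp add: compose_eq)
  have hG: "h \<in> Gal M \<rat>" using h(1) A(1) by blast
  have "t x = h x" if x: "x \<in> M" for x using tg[OF G(2)[OF h(1) x]] gh[OF x] by simp
  hence "restrict t M = h" using Gal_rules(1)[OF M hG] by (intro extensionalityI[of _ M]) auto
  thus ?thesis using h(1) by simp
qed

lemma Gal_complete:
  assumes M: "csubfield M" and K: "K \<subseteq> M" and fin: "finite (Gal M K)"
    and fixed: "\<And>x. x \<in> M \<Longrightarrow> (\<And>s. s \<in> Gal M K \<Longrightarrow> s x = x) \<Longrightarrow> x \<in> K"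
    and t: "chom M t" "\<And>x. x \<in> K \<Longrightarrow> t x = x"
  shows "restrict t M \<in> Gal M K"
proof (rule Galois_subgroup_complete[OF M _ fin Gal_id[OF M K] Gal_bij_compose[OF M K] t(1)])
  show "Gal M K \<subseteq> Gal M \<rat>" using Gal_Rats[OF M] by blast
qed (use fixed t(2) in blast)+

section \<open>Normal fields and restriction of automorphisms\<close>

definition normal_field :: "complex set \<Rightarrow> bool" where
  "normal_field M \<longleftrightarrow> csubfield M \<and> M \<subseteq> Qbar \<and> (\<forall>s\<in>G_Q. s ` M \<subseteq> M)"

text \<open>\<open>galois_extension\<close> speaks only of fixed points. Each \<open>s\<close> in
  \<open>G_Q\<close> is an embedding of \<open>M\<close> over the rationals, so by
  \<open>Gal_complete\<close> its restriction is already one of the automorphisms of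
  \<open>M\<close>.\<close>

lemma galois_extension_normal:
  assumes "galois_extension \<rat> M" "finite (Gal M \<rat>)"
  shows "normal_field M" unfolding normal_field_def
proof (intro conjI ballI)
  show M: "csubfield M" and MQ: "M \<subseteq> Qbar" using assms(1) by (auto simp: galois_extension_def subfield_iff_csubfield)
  fix s assume s: "s \<in> G_Q"
  have fx: "{x \<in> M. \<forall>\<sigma>\<in>Gal M \<rat>. \<sigma> x = x} = \<rat>" using assms(1) by (simp add: galois_extension_def)
  have ch: "chom M s" using Gal_rules(2)[OF Qbar_field s] chom_subset MQ by blast
  have "restrict s M \<in> Gal M \<rat>" by (rule Gal_complete[OF M Rats_subset_csubfield[OF M] assms(2) _ ch])
      (use fx chom_Rats[OF ch M] in blast)+
  thus "s ` M \<subseteq> M" using Gal_rules(4)[OF M] by fastforce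
qed

lemma normal_restrict:
  assumes M: "normal_field M" and K: "K \<subseteq> M" and s: "s \<in> Gal Qbar K"
  shows "restrict s M \<in> Gal M K"
proof -
  have Mf: "csubfield M" and MQ: "M \<subseteq> Qbar" and stab: "\<And>s. s \<in> G_Q \<Longrightarrow> s ` M \<subseteq> M"
    using M by (auto simp: normal_field_def)
  note Q = Qbar_field
  have KQ: "K \<subseteq> Qbar" using K MQ by blast
  obtain t where t: "t \<in> Gal Qbar K" "\<And>x. x \<in> Qbar \<Longrightarrow> s (t x) = x"
    using Gal_inverse[OF Q KQ s] by metis
  have sG: "s \<in> G_Q" "t \<in> G_Q" using Gal_Rats[OF Q] s t(1) by blast+
  have "s ` M = M"
  proof
    show "s ` M \<subseteq> M" by (rule stab[OF sG(1)])
    show "M \<subseteq> s ` M"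
    proof
      fix x assume x: "x \<in> M"
      hence "t x \<in> M" "s (t x) = x" using stab[OF sG(2)] t(2) MQ by auto
      thus "x \<in> s ` M" by (metis imageI)
    qed
  qed
  moreover have "chom M (restrict s M)"
    using chom_cong[of M "restrict s M" s] chom_subset[OF Gal_rules(2)[OF Q s] MQ] csubfield_csubring[OF Mf] by simp
  ultimately show ?thesis using Gal_rules(5)[OF Q s] K by (auto simp: Gal_iff[OF Mf])
qed

lemma Gal_lift:
  assumes M: "csubfield M" "M \<subseteq> Qbar" and K: "K \<subseteq> M" and g: "g \<in> Gal M K"
  obtains s where "s \<in> Gal Qbar K" "\<And>x. x \<in> M \<Longrightarrow> s x = g x"
proof -
  obtain s where s: "s \<in> G_Q" "\<And>x. x \<in> M \<Longrightarrow> s x = g x"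
    using extend_embedding[OF Gal_rules(2)[OF M(1) g] M] by metis
  have "s \<in> Gal Qbar K"
    using s Gal_rules[OF Qbar_field s(1)] Gal_rules(5)[OF M(1) g] K by (auto simp: Gal_iff[OF Qbar_field])
  thus ?thesis using s(2) that by blast
qed

lemma normal_fixed:
  assumes M: "normal_field M" and K: "csubfield K" "K \<subseteq> M" and x: "x \<in> M" "\<And>g. g \<in> Gal M K \<Longrightarrow> g x = x"
  shows "x \<in> K"
proof (rule ccontr)
  assume "x \<notin> K"
  have MQ: "M \<subseteq> Qbar" using M by (simp add: normal_field_def)
  obtain s where s: "s \<in> Gal Qbar K" "s x \<noteq> x"
    by (rule Gal_Qbar_moves[of K x]) (use K x MQ \<open>x \<notin> K\<close> in auto)
  show False using x(2)[OF normal_restrict[OF M K(2) s(1)]] s(2) x(1) by simp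
qed

lemma normal_galois_extension:
  assumes M: "normal_field M" and K: "csubfield K" "K \<subseteq> M"
  shows "galois_extension K M" unfolding galois_extension_def subfield_iff_csubfield
  using assms normal_fixed[OF M K] Gal_rules(5)[of M _ K] by (auto simp: normal_field_def)

section \<open>Arithmetic of Galois number fields\<close>

lemma primeideal_iff:
  assumes "csubring (K \<inter> Zbar)"
  shows "primeideal P (ring_of_integers K) \<longleftrightarrow> prime_in (K \<inter> Zbar) P"
proof -
  define R where "R = ring_of_integers K"
  have ops: "carrier R = K \<inter> Zbar" "x \<otimes>\<^bsub>R\<^esub> y = x * y" "x \<oplus>\<^bsub>R\<^esub> y = x + y" "\<one>\<^bsub>R\<^esub> = 1" "\<zero>\<^bsub>R\<^esub> = 0" for x y
    by (simp_all add: R_def ring_of_integers_def subring_of_complex_def ring_of_type_algebra_def)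
  note r = csubring_basic[OF assms]
  have "cring R"
  proof (rule cringI)
    show "abelian_group R"
    proof (rule abelian_groupI)
      fix x assume "x \<in> carrier R"
      thus "\<exists>y\<in>carrier R. y \<oplus>\<^bsub>R\<^esub> x = \<zero>\<^bsub>R\<^esub>"
        unfolding ops using r(5) by (intro bexI[of _ "- x"]) auto
    qed (use r in \<open>auto simp: ops\<close>)
    show "Group.comm_monoid R" by (rule comm_monoidI) (use r in \<open>auto simp: ops\<close>)
  qed (simp add: ops algebra_simps)
  then interpret R: cring R .
  have minus: "\<ominus>\<^bsub>R\<^esub> x = - x" if "x \<in> K \<inter> Zbar" for x
    using that r(5)[OF that] by (intro R.minus_equality) (auto simp: ops)
  show ?thesis unfolding R_def[symmetric]
  proof
    assume "primeideal P R"
    then interpret P: primeideal P R .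
    have "0 \<in> P" using P.zero_closed by (simp add: ops)
    moreover have "x + y \<in> P" if "x \<in> P" "y \<in> P" for x y using P.a_closed[OF that] by (simp add: ops)
    moreover have "P \<subseteq> K \<inter> Zbar" using P.Icarr by (auto simp: ops)
    moreover have "a * x \<in> P" if "a \<in> K \<inter> Zbar" "x \<in> P" for a x
      using P.I_l_closed[OF that(2), of a] that by (simp add: ops)
    moreover have "1 \<notin> P" using P.one_imp_carrier P.I_notcarr by (auto simp: ops)
    moreover have "x \<in> P \<or> y \<in> P" if "x \<in> K \<inter> Zbar" "y \<in> K \<inter> Zbar" "x * y \<in> P" for x y
      using P.I_prime[of x y] that by (simp add: ops)
    ultimately show "prime_in (K \<inter> Zbar) P" unfolding prime_in_def by simp
  next
    assume P: "prime_in (K \<inter> Zbar) P"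
    note pr = prime_in_rules[OF P assms]
    have "ideal P R"
    proof (rule idealI)
      show "ring R" by (rule R.ring_axioms)
      show "subgroup P (add_monoid R)"
      proof (rule group.subgroupI)
        show "Group.group (add_monoid R)" by (rule R.a_group)
        show "P \<subseteq> carrier (add_monoid R)" using pr(1) by (auto simp: ops)
        show "P \<noteq> {}" using pr(2) by auto
        show "inv\<^bsub>add_monoid R\<^esub> a \<in> P" if "a \<in> P" for a
          using minus[OF pr(1)[OF that]] pr(6)[OF that] by (simp add: a_inv_def)
        show "a \<otimes>\<^bsub>add_monoid R\<^esub> b \<in> P" if "a \<in> P" "b \<in> P" for a b
          using pr(3)[OF that] by (simp add: ops)
      qed
    qed (use pr in \<open>auto simp: ops\<close>)
    thus "primeideal P R"
    proof (rule primeidealI[OF _ R.cring_axioms])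
      show "carrier R \<noteq> P" using pr(8) r(1) by (auto simp: ops)
      show "a \<in> P \<or> b \<in> P" if "a \<in> carrier R" "b \<in> carrier R" "a \<otimes>\<^bsub>R\<^esub> b \<in> P" for a b
        using pr(9)[of a b] that by (simp add: ops)
    qed
  qed
qed

lemma coeff_mult_mem:
  "csubring R \<Longrightarrow> (\<And>k. coeff p k \<in> R) \<Longrightarrow> (\<And>k. coeff q k \<in> R) \<Longrightarrow> coeff (p * q) k \<in> R"
  unfolding coeff_mult by (intro csubring_sum csubring_basic(3)) auto

lemma coeff_prod_linear_mem:
  assumes "csubring R" "\<And>h. h \<in> I \<Longrightarrow> f h \<in> R"
  shows "coeff (\<Prod>h\<in>I. [:- f h, 1:]) k \<in> R" using assms(2)
proof (induction I arbitrary: k rule: infinite_finite_induct)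
  case (insert h I)
  have "coeff [:- f h, 1:] k \<in> R" for k
    using insert.prems[of h] csubring_basic[OF assms(1)] by (auto simp: coeff_pCons split: nat.split)
  thus ?case unfolding prod.insert[OF insert.hyps] using insert by (intro coeff_mult_mem assms(1)) auto
qed (use csubring_basic[OF assms(1)] in \<open>auto simp: coeff_1\<close>)

section \<open>Traces, norms and finite residue rings\<close>

locale galois_number_field =
  fixes M :: "complex set"
  assumes normal: "normal_field M" and finite_Gal: "finite (Gal M \<rat>)"
begin

abbreviation "\<O> \<equiv> M \<inter> Zbar"

lemma M: "csubfield M" and M_Qbar: "M \<subseteq> Qbar" using normal by (auto simp: normal_field_def)

lemma M_ring: "csubring M" using M by (rule csubfield_csubring)

lemma O_ring: "csubring \<O>"
  using csubring_basic(1-3)[OF M_ring] csubring_basic(1-3)[OF csubring_Zbar] by (auto simp: csubring_def)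

lemmas O_rules = csubring_rules[OF O_ring]

lemma Rats_M: "\<rat> \<subseteq> M" by (rule Rats_subset_csubfield[OF M])

lemmas G_rules = Gal_rules[OF M]

lemma G_O: "g \<in> Gal M K \<Longrightarrow> x \<in> \<O> \<Longrightarrow> g x \<in> \<O>"
  using G_rules(4)[of g K x] chom_Zbar[OF G_rules(2) M_ring] by auto

lemma O_closed: "monic p \<Longrightarrow> (\<And>k. coeff p k \<in> \<O>) \<Longrightarrow> x \<in> M \<Longrightarrow> poly p x = 0 \<Longrightarrow> x \<in> \<O>"
  using Zbar_integrally_closed[of p x] by blast

lemma M_multiple_O: assumes "x \<in> M" obtains n :: nat where "n > 0" "of_nat n * x \<in> \<O>"
  using assms M_Qbar csubring_rules(3,10)[OF M_ring] unfolding Qbar_iff[of x, symmetric] by (metis Int_iff Qbar_iff subsetD)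

lemma finite_Gal_sub: "\<rat> \<subseteq> K \<Longrightarrow> finite (Gal M K)"
  using finite_Gal Gal_antimono[of \<rat> K M] finite_subset by blast

lemma trace_mem:
  assumes K: "csubfield K" "K \<subseteq> M" and x: "x \<in> M"
  shows "(\<Sum>g\<in>Gal M K. g x) \<in> K"
proof (rule normal_fixed[OF normal K])
  show "(\<Sum>g\<in>Gal M K. g x) \<in> M" using x G_rules(4) by (intro csubring_sum M_ring) blast
  fix s assume s: "s \<in> Gal M K"
  have "s (\<Sum>g\<in>Gal M K. g x) = (\<Sum>g\<in>Gal M K. s (g x))"
    using x G_rules(4) by (intro chom_sum[OF G_rules(2)[OF s] M_ring]) blast
  thus "s (\<Sum>g\<in>Gal M K. g x) = (\<Sum>g\<in>Gal M K. g x)"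
    using sum_Gal_compose[OF M K(2) s x, of "\<lambda>x. x"] by simp
qed

lemma norm_mem:
  assumes K: "csubfield K" "K \<subseteq> M" and x: "x \<in> M"
  shows "(\<Prod>g\<in>Gal M K. g x) \<in> K"
proof (rule normal_fixed[OF normal K])
  show "(\<Prod>g\<in>Gal M K. g x) \<in> M" using x G_rules(4) by (intro csubring_prod M_ring) blast
  fix s assume s: "s \<in> Gal M K"
  have "s (\<Prod>g\<in>Gal M K. g x) = (\<Prod>g\<in>Gal M K. s (g x))"
    using x G_rules(4) by (intro chom_prod[OF G_rules(2)[OF s] M_ring]) blast
  also have "\<dots> = (\<Prod>g\<in>Gal M K. compose M s g x)" using x by (simp add: compose_eq)
  also have "\<dots> = (\<Prod>g\<in>Gal M K. g x)"
    by (rule prod.reindex_bij_betw[OF Gal_bij_compose[OF M K(2) s], of "\<lambda>g. g x"])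
  finally show "s (\<Prod>g\<in>Gal M K. g x) = (\<Prod>g\<in>Gal M K. g x)" .
qed

abbreviation "idM \<equiv> restrict (\<lambda>x. x) M"

lemma idM: "K \<subseteq> M \<Longrightarrow> idM \<in> Gal M K" by (rule Gal_id[OF M])

lemma trace_Ints:
  assumes "x \<in> \<O>" shows "(\<Sum>g\<in>Gal M \<rat>. g x) \<in> \<int>"
proof (rule Rats_Zbar)
  show "(\<Sum>g\<in>Gal M \<rat>. g x) \<in> \<rat>" using assms by (intro trace_mem csubfield_Rats Rats_M) auto
  show "(\<Sum>g\<in>Gal M \<rat>. g x) \<in> Zbar" using assms G_O by (intro csubring_sum csubring_Zbar) blast
qed

text \<open>The cofactor is the product of the other conjugates: the norm is a rational algebraic
  integer, and its sign is absorbed into the cofactor.\<close>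

lemma O_divides_nat:
  assumes a: "a \<in> \<O>" "a \<noteq> 0"
  obtains n :: nat and b where "n > 0" "b \<in> \<O>" "a * b = of_nat n"
proof -
  define b where "b = (\<Prod>g\<in>Gal M \<rat> - {idM}. g a)"
  have b: "b \<in> \<O>" unfolding b_def using G_O a(1) by (intro csubring_prod O_ring) blast
  have ab: "a * b = (\<Prod>g\<in>Gal M \<rat>. g a)"
    using prod.remove[OF finite_Gal idM[OF Rats_M], of "\<lambda>g. g a"] a by (simp add: b_def)
  have "a * b \<in> \<rat>" unfolding ab using a by (intro norm_mem csubfield_Rats Rats_M) auto
  moreover have "a * b \<in> Zbar" using a b by (auto intro: Zbar_rules)
  ultimately have "a * b \<in> \<int>" by (rule Rats_Zbar)
  then obtain m where m: "a * b = of_int m" by (auto elim: Ints_cases)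
  have "g a \<noteq> 0" if "g \<in> Gal M \<rat>" for g
    using inj_onD[OF G_rules(6)[OF that], of a 0] a chom_rules(4)[OF G_rules(2)[OF that] M_ring]
      csubring_basic(4)[OF M_ring] by auto
  hence "a * b \<noteq> 0" unfolding ab using finite_Gal by simp
  hence m0: "m \<noteq> 0" using m by auto
  have sb: "of_int (sgn m) * b \<in> \<O>" using O_rules(3)[OF O_rules(11) b] .
  have "a * (of_int (sgn m) * b) = of_int (sgn m) * (a * b)" by (simp add: mult_ac)
  also have "\<dots> = of_nat (nat \<bar>m\<bar>)" using m by (simp add: sgn_if)
  finally show ?thesis using m0 by (intro that[of "nat \<bar>m\<bar>", OF _ sb]) auto
qed

text \<open>The usual argument for primitive elements: with \<open>x\<close> moved by the new
  automorphism \<open>h\<close>, each automorphism of the enlarged set fixes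
  \<open>x + t * \<theta>\<close> for at most one natural number \<open>t\<close>, so some
  \<open>t\<close> is good for all.\<close>

lemma separating_element:
  assumes "finite T" "T \<subseteq> Gal M \<rat> - {idM}"
  shows "\<exists>\<theta>\<in>\<O>. \<forall>g\<in>T. g \<theta> \<noteq> \<theta>" using assms
proof (induction T rule: finite_induct)
  case empty
  thus ?case using O_rules(1) by blast
next
  case (insert h T)
  then obtain \<theta> where th: "\<theta> \<in> \<O>" "\<And>g. g \<in> T \<Longrightarrow> g \<theta> \<noteq> \<theta>" by auto
  have h: "h \<in> Gal M \<rat>" "h \<noteq> idM" using insert.prems by auto
  have "\<exists>y\<in>M. h y \<noteq> y"
  proof (rule ccontr)
    assume "\<not> (\<exists>y\<in>M. h y \<noteq> y)"
    hence "h = idM" by (intro Gal_eqI[OF M h(1) idM[OF Rats_M]]) auto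
    thus False using h by simp
  qed
  then obtain y where y: "y \<in> M" "h y \<noteq> y" by blast
  obtain n :: nat where n: "n > 0" "of_nat n * y \<in> \<O>" by (rule M_multiple_O[OF y(1)])
  define x where "x = of_nat n * y"
  have hx: "h x \<noteq> x"
    using y n chom_rules(3)[OF G_rules(2)[OF h(1)] M_ring, of "of_nat n" y] chom_of_nat[OF G_rules(2)[OF h(1)] M_ring]
      csubring_of_nat[OF M_ring] by (simp add: x_def)
  define f where "f t = x + of_nat t * \<theta>" for t :: nat
  have gf: "g (f t) - f t = (g x - x) + of_nat t * (g \<theta> - \<theta>)" if g: "g \<in> Gal M \<rat>" for g t
    using th(1) n(2) unfolding f_def x_def[symmetric]
    by (simp add: chom_rules[OF G_rules(2)[OF g] M_ring] chom_of_nat[OF G_rules(2)[OF g] M_ring]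
        csubring_rules[OF M_ring] algebra_simps)
  define bad where "bad = (\<Union>g\<in>insert h T. {t. g (f t) = f t})"
  have "finite {t. g (f t) = f t}" if g: "g \<in> insert h T" for g
  proof -
    have gG: "g \<in> Gal M \<rat>" using g insert.prems by auto
    have "t = t'" if tt: "g (f t) = f t" "g (f t') = f t'" for t t'
    proof -
      have e: "(g x - x) + of_nat t * (g \<theta> - \<theta>) = 0" "(g x - x) + of_nat t' * (g \<theta> - \<theta>) = 0"
        using gf[OF gG] tt by (metis right_minus_eq)+
      have "(of_nat t - of_nat t') * (g \<theta> - \<theta>) =
          ((g x - x) + of_nat t * (g \<theta> - \<theta>)) - ((g x - x) + of_nat t' * (g \<theta> - \<theta>))"
        by (simp add: left_diff_distrib)
      also have "\<dots> = 0" unfolding e by simp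
      finally have "(of_nat t - of_nat t') * (g \<theta> - \<theta>) = 0" .
      moreover have "g \<theta> - \<theta> \<noteq> 0"
      proof (cases "g = h")
        case True
        thus ?thesis using e(1) hx by auto
      next
        case False
        thus ?thesis using th(2) g by auto
      qed
      ultimately show ?thesis by simp
    qed
    hence "{t. g (f t) = f t} \<subseteq> {SOME t. g (f t) = f t}" by (auto intro: someI2)
    thus ?thesis by (rule finite_subset) simp
  qed
  hence "finite bad" unfolding bad_def using insert.hyps by blast
  then obtain t where t: "t \<notin> bad" using ex_new_if_finite infinite_UNIV_nat by blast
  have "f t \<in> \<O>" unfolding f_def x_def by (rule O_rules(6)[OF n(2) O_rules(3)[OF O_rules(10) th(1)]])
  moreover have "\<forall>g\<in>insert h T. g (f t) \<noteq> f t" using t by (auto simp: bad_def)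
  ultimately show ?case by blast
qed

text \<open>
  For a primitive element \<open>\<theta>\<close>, an integer \<open>x\<close> is determined modulo \<open>a\<close> by its traces against powers
  of \<open>\<theta>\<close>, modulo a suitable integer: they give \<open>x\<close> times the different of \<open>\<theta>\<close> by interpolation.
\<close>

lemma finite_quotient:
  assumes a: "a \<in> \<O>" "a \<noteq> 0"
  shows "\<exists>F. finite F \<and> F \<subseteq> \<O> \<and> (\<forall>x\<in>\<O>. \<exists>r\<in>F. \<exists>y\<in>\<O>. x - r = a * y)"
proof -
  obtain \<theta> where th: "\<theta> \<in> \<O>" "\<And>g. g \<in> Gal M \<rat> - {idM} \<Longrightarrow> g \<theta> \<noteq> \<theta>"
    using separating_element[of "Gal M \<rat> - {idM}"] finite_Gal by auto
  \<comment> \<open>\<open>e\<close> vanishes at every conjugate of \<open>\<theta>\<close> except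
    \<open>\<theta>\<close> itself, so summing \<open>g z * poly e (g \<theta>)\<close> over the
    group isolates \<open>z * \<delta>\<close>.\<close>
  define e where "e = (\<Prod>h\<in>Gal M \<rat> - {idM}. [:- h \<theta>, 1:])"
  define \<delta> where "\<delta> = poly e \<theta>"
  have e0: "poly e (g \<theta>) = 0" if "g \<in> Gal M \<rat> - {idM}" for g
    unfolding e_def poly_prod by (rule prod_zero) (use finite_Gal that in auto)
  have d0: "\<delta> \<noteq> 0" unfolding \<delta>_def e_def poly_prod using th(2) finite_Gal by (auto dest: sym)
  have eO: "coeff e k \<in> \<O>" for k unfolding e_def using G_O[OF _ th(1)] by (intro coeff_prod_linear_mem O_ring) blast
  have dO: "\<delta> \<in> \<O>" unfolding \<delta>_def by (rule csubfield_coeff_rules[OF O_ring eO th(1)])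
  have ad: "a * \<delta> \<in> \<O>" "a * \<delta> \<noteq> 0" using O_rules(3)[OF a(1) dO] a d0 by auto
  \<comment> \<open>Traces divisible by \<open>n = a * \<delta> * b\<close> make
    \<open>z * \<delta>\<close> divisible by it, and cancelling \<open>\<delta>\<close> leaves a
    multiple of \<open>a\<close>.\<close>
  obtain n :: nat and b where n: "n > 0" "b \<in> \<O>" "a * \<delta> * b = of_nat n" by (rule O_divides_nat[OF ad])
  define tr where "tr x k = (\<Sum>g\<in>Gal M \<rat>. g (x * \<theta> ^ k))" for x k
  define d where "d = degree e"
  define \<phi> where "\<phi> x = restrict (\<lambda>k. \<lfloor>Re (tr x k)\<rfloor> mod int n) {..d}" for x
  have trI: "tr x k \<in> \<int>" if "x \<in> \<O>" for x k unfolding tr_def using that th(1) by (intro trace_Ints O_rules)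
  have inj: "\<exists>y\<in>\<O>. x - r = a * y" if x: "x \<in> \<O>" and r: "r \<in> \<O>" and eq: "\<phi> x = \<phi> r" for x r
  proof -
    define z where "z = x - r"
    have z: "z \<in> \<O>" unfolding z_def by (rule O_rules(2)[OF x r])
    have trz: "tr z k = tr x k - tr r k" for k unfolding tr_def sum_subtractf[symmetric]
    proof (rule sum.cong[OF refl])
      fix g assume g: "g \<in> Gal M \<rat>"
      have "g (x * \<theta> ^ k - r * \<theta> ^ k) = g (x * \<theta> ^ k) - g (r * \<theta> ^ k)"
        using x r th(1) by (intro chom_rules(6)[OF G_rules(2)[OF g] M_ring] csubring_rules M_ring) auto
      thus "g (z * \<theta> ^ k) = g (x * \<theta> ^ k) - g (r * \<theta> ^ k)" by (simp add: z_def algebra_simps)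
    qed
    have "\<exists>m. tr z k = of_int (int n * m)" if k: "k \<le> d" for k
    proof -
      obtain u v where uv: "tr x k = of_int u" "tr r k = of_int v"
        using trI[OF x, of k] trI[OF r, of k] by (auto elim!: Ints_cases)
      have "u mod int n = v mod int n" using fun_cong[OF eq, of k] k by (simp add: \<phi>_def uv)
      hence "int n dvd u - v" by (simp add: mod_eq_dvd_iff)
      then obtain m where "u - v = int n * m" by (rule dvdE)
      moreover have "tr z k = of_int (u - v)" using trz[of k] uv by simp
      ultimately show ?thesis by metis
    qed
    then obtain m where m: "\<And>k. k \<le> d \<Longrightarrow> tr z k = of_int (int n * m k)" by metis
    have "z * \<delta> = (\<Sum>g\<in>Gal M \<rat>. g z * poly e (g \<theta>))"
    proof -
      have "(\<Sum>g\<in>Gal M \<rat>. g z * poly e (g \<theta>)) = idM z * poly e (idM \<theta>) + (\<Sum>g\<in>Gal M \<rat> - {idM}. g z * poly e (g \<theta>))"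
        by (rule sum.remove[OF finite_Gal idM[OF Rats_M]])
      also have "(\<Sum>g\<in>Gal M \<rat> - {idM}. g z * poly e (g \<theta>)) = 0" using e0 by simp
      finally show ?thesis using z th(1) by (simp add: \<delta>_def)
    qed
    also have "\<dots> = (\<Sum>g\<in>Gal M \<rat>. \<Sum>k\<le>d. coeff e k * g (z * \<theta> ^ k))"
    proof (rule sum.cong[OF refl])
      fix g assume g: "g \<in> Gal M \<rat>"
      have "g (z * \<theta> ^ k) = g z * g \<theta> ^ k" for k
        using z th(1) chom_rules(3)[OF G_rules(2)[OF g] M_ring, of z "\<theta> ^ k"] chom_power[OF G_rules(2)[OF g] M_ring, of \<theta> k]
          csubring_power[OF M_ring] by simp
      thus "g z * poly e (g \<theta>) = (\<Sum>k\<le>d. coeff e k * g (z * \<theta> ^ k))"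
        by (simp add: poly_altdef d_def sum_distrib_left mult_ac)
    qed
    also have "\<dots> = (\<Sum>k\<le>d. coeff e k * tr z k)" unfolding tr_def sum_distrib_left by (rule sum.swap)
    also have "\<dots> = of_nat n * (\<Sum>k\<le>d. coeff e k * of_int (m k))"
      unfolding sum_distrib_left by (rule sum.cong[OF refl]) (simp add: m)
    also have "\<dots> = \<delta> * (a * (b * (\<Sum>k\<le>d. coeff e k * of_int (m k))))"
      by (simp add: n(3)[symmetric] mult_ac)
    finally have "z = a * (b * (\<Sum>k\<le>d. coeff e k * of_int (m k)))" using d0 by simp
    moreover have "b * (\<Sum>k\<le>d. coeff e k * of_int (m k)) \<in> \<O>"
      by (intro O_rules(3) n(2) csubring_sum O_ring eO O_rules(11))
    ultimately show ?thesis unfolding z_def by blast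
  qed
  have "\<phi> ` \<O> \<subseteq> {..d} \<rightarrow>\<^sub>E {0..<int n}"
    unfolding \<phi>_def using n(1) by (intro image_subsetI restrict_PiE_iff[THEN iffD2] ballI) simp
  moreover have "finite ({..d} \<rightarrow>\<^sub>E {0..<int n})" by (intro finite_PiE) auto
  ultimately have fin: "finite (\<phi> ` \<O>)" by (rule finite_subset)
  obtain F where F: "F \<subseteq> \<O>" "finite F" "\<phi> ` \<O> = \<phi> ` F" using finite_subset_image[OF fin subset_refl] by metis
  have "\<exists>r\<in>F. \<exists>y\<in>\<O>. x - r = a * y" if x: "x \<in> \<O>" for x
  proof -
    obtain r where r: "r \<in> F" "\<phi> x = \<phi> r" using F(3) x by (metis imageE imageI)
    thus ?thesis using inj[OF x _ r(2)] F(1) by blast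
  qed
  thus ?thesis using F by blast
qed

text \<open>The form in which finiteness is used: for powers of one element, a repetition supplies
  inverses modulo a prime, nilpotence and integral equations.\<close>

lemma pigeonhole:
  assumes a: "a \<in> \<O>" "a \<noteq> 0" and s: "\<And>k::nat. s k \<in> \<O>"
  obtains k l y where "k < l" "y \<in> \<O>" "s k - s l = a * y"
proof -
  obtain F where F: "finite F" "F \<subseteq> \<O>" "\<forall>x\<in>\<O>. \<exists>r\<in>F. \<exists>y\<in>\<O>. x - r = a * y"
    using finite_quotient[OF a] by (elim exE conjE)
  have "\<exists>r. r \<in> F \<and> (\<exists>y\<in>\<O>. s k - r = a * y)" for k using bspec[OF F(3) s[of k]] by blast
  then obtain r where r: "\<And>k. r k \<in> F" "\<And>k. \<exists>y\<in>\<O>. s k - r k = a * y" by metis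
  have "\<not> inj r" using finite_subset[of "range r" F] F(1) r(1) range_inj_infinite[of r] by blast
  then obtain k l where kl: "k \<noteq> l" "r k = r l" by (auto simp: inj_def)
  note result = that
  have main: thesis if kl: "k < l" "r k = r l" for k l
  proof -
    obtain y y' where y: "y \<in> \<O>" "s k - r k = a * y" "y' \<in> \<O>" "s l - r l = a * y'" using r(2) by meson
    have "s k - s l = a * (y - y')" using y kl(2) by (simp add: algebra_simps)
    thus thesis using result[OF kl(1) O_rules(2)[OF y(1,3)]] by blast
  qed
  show thesis using main[of k l] main[of l k] kl by (metis linorder_neqE_nat)
qed

end

section \<open>Local arithmetic at a nonzero prime\<close>

locale number_field_prime = galois_number_field +
  fixes P :: "complex set"
  assumes prime: "prime_in \<O> P" and nonzero: "P \<noteq> {0}"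
begin

lemmas P_rules = prime_in_rules[OF prime O_ring]

lemma not_P_mult: "x \<in> \<O> - P \<Longrightarrow> y \<in> \<O> - P \<Longrightarrow> x * y \<in> \<O> - P"
  using P_rules(9)[of x y] O_rules(3)[of x y] by blast

lemma one_not_P: "1 \<in> \<O> - P" using P_rules(8) O_rules(1) by blast

lemma not_P_nonzero: "x \<in> \<O> - P \<Longrightarrow> x \<noteq> 0" using P_rules(2) by blast

lemma not_P_add: "x \<in> \<O> - P \<Longrightarrow> y \<in> P \<Longrightarrow> x + y \<in> \<O> - P"
  using P_rules(7)[of "x + y" y] O_rules(6)[of x y] P_rules(1)[of y] by auto

lemma nonzero_mem: obtains a where "a \<in> P" "a \<noteq> 0" using nonzero P_rules(2) by blast

text \<open>\<open>P\<close> contains a positive natural number, by \<open>O_divides_nat\<close>,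
  and hence one of its prime factors.\<close>

lemma residue_characteristic:
  obtains l :: nat where "prime l" "of_nat l \<in> P"
proof -
  obtain a where a: "a \<in> P" "a \<noteq> 0" by (rule nonzero_mem)
  obtain n :: nat and b where n: "n > 0" "b \<in> \<O>" "a * b = of_nat n"
    by (rule O_divides_nat[of a]) (use a P_rules(1) in auto)
  have nP: "of_nat n \<in> P" using P_rules(5)[OF n(2) a(1)] n(3) by simp
  have "\<exists>l. prime l \<and> (of_nat l :: complex) \<in> P" if "n > 0" "(of_nat n :: complex) \<in> P" for n :: nat
    using that
  proof (induction n rule: less_induct)
    case (less n)
    show ?case
    proof (cases "prime n")
      case False
      have "n \<noteq> 1" using less.prems P_rules(8) by auto
      then obtain q where q: "prime q" "q dvd n" using prime_factor_nat by blast
      then obtain k where k: "n = q * k" by (auto elim: dvdE)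
      have "(of_nat q :: complex) * of_nat k \<in> P" using less.prems k by simp
      hence "(of_nat q :: complex) \<in> P \<or> (of_nat k :: complex) \<in> P" using P_rules(9) O_rules(10) by blast
      moreover have "k < n" "k > 0" using k q(1) less.prems(1) prime_gt_1_nat[OF q(1)] by (auto intro!: Nat.gr0I)
      ultimately show ?thesis using q(1) less.IH[of k] by blast
    qed (use less in blast)
  qed
  thus ?thesis using n(1) nP that by blast
qed

text \<open>Two powers of \<open>x\<close> agree modulo \<open>P\<close>; cancelling the smaller one
  leaves \<open>1 - x * x ^ m\<close>.\<close>

lemma residue_inverse:
  assumes x: "x \<in> \<O> - P"
  obtains y where "y \<in> \<O>" "1 - x * y \<in> P"
proof -
  obtain a where a: "a \<in> P" "a \<noteq> 0" by (rule nonzero_mem)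
  have xO: "x \<in> \<O>" using x by blast
  obtain k l y where kl: "k < l" "y \<in> \<O>" "x ^ k - x ^ l = a * y"
    by (rule pigeonhole[of a "\<lambda>k. x ^ k"]) (use a P_rules(1) O_rules(7)[OF xO] in auto)
  define m where "m = l - k - 1"
  have l: "l = k + Suc m" using kl(1) by (simp add: m_def)
  have "x ^ k * (1 - x * x ^ m) = a * y" using kl(3) by (simp add: l power_add algebra_simps)
  hence "x ^ k * (1 - x * x ^ m) \<in> P" using P_rules(5)[OF kl(2) a(1)] by simp
  moreover have "x ^ k \<in> \<O>" "1 - x * x ^ m \<in> \<O>" using O_rules(7)[OF xO] O_rules(2)[OF O_rules(1) O_rules(3)[OF xO O_rules(7)[OF xO]]] .
  ultimately have "x ^ k \<in> P \<or> 1 - x * x ^ m \<in> P" by (rule P_rules(9))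
  moreover have "x ^ k \<notin> P" using prime_in_power[OF prime O_ring xO] x by blast
  ultimately show ?thesis using that[OF O_rules(7)[OF xO, of m]] by blast
qed

text \<open>
  \<open>P\<close> becomes principal after localization: a suitable \<open>x = c / a\<close> with \<open>x P \<subseteq> \<O>\<close> and \<open>x \<notin> \<O>\<close> exists
  because \<open>P\<close> consists of zero divisors modulo \<open>a\<close>, and \<open>x P \<subseteq> P\<close> would make \<open>x\<close> integral.
\<close>

definition uniformizer :: "complex \<Rightarrow> bool" where
  "uniformizer w \<longleftrightarrow> w \<in> P \<and> (\<exists>u\<in>\<O> - P. \<forall>x\<in>P. \<exists>y\<in>\<O>. u * x = w * y)"

text \<open>Every element of \<open>P\<close> becomes nilpotent in the localized quotient by
  \<open>a\<close>, since two of its powers agree there and \<open>1 - f * f ^ m\<close> is outside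
  \<open>P\<close>. Modulo \<open>a\<close> only finitely many elements matter, so one factor
  \<open>e\<close> outside \<open>P\<close> serves for all, and multiplying by suitable powers of
  the representatives yields a nonzero element killed by each.\<close>

lemma annihilator_mod:
  assumes a: "a \<in> P" "a \<noteq> 0"
  shows "\<exists>c\<in>\<O>. (\<forall>z\<in>\<O>. c \<noteq> a * z) \<and> (\<forall>y\<in>P. \<exists>z\<in>\<O>. c * y = a * z)"
proof -
  have aO: "a \<in> \<O>" using a P_rules(1) by blast
  obtain F where F: "finite F" "F \<subseteq> \<O>" "\<forall>x\<in>\<O>. \<exists>r\<in>F. \<exists>y\<in>\<O>. x - r = a * y"
    using finite_quotient[OF aO a(2)] by (elim exE conjE)
  define I where "I = {a * z | z. z \<in> \<O>}"
  have I_mult: "x * y \<in> I" if "x \<in> I" "y \<in> \<O>" for x y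
  proof -
    obtain z where z: "x = a * z" "z \<in> \<O>" using \<open>x \<in> I\<close> unfolding I_def by blast
    have "x * y = a * (z * y)" using z by simp
    thus ?thesis using O_rules(3)[OF z(2) \<open>y \<in> \<O>\<close>] unfolding I_def by blast
  qed
  have I_add: "x + y \<in> I" if "x \<in> I" "y \<in> I" for x y
  proof -
    obtain z z' where "x = a * z" "y = a * z'" "z \<in> \<O>" "z' \<in> \<O>" using \<open>x \<in> I\<close> \<open>y \<in> I\<close> unfolding I_def by blast
    hence "x + y = a * (z + z')" "z + z' \<in> \<O>" using O_rules(6) by (auto simp: algebra_simps)
    thus ?thesis unfolding I_def by blast
  qed
  have IP: "I \<subseteq> P" using a P_rules(5) unfolding I_def by blast
  have "\<exists>k e. e \<in> \<O> - P \<and> f ^ k * e \<in> I" if f: "f \<in> P" for f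
  proof -
    have fO: "f \<in> \<O>" using f P_rules(1) by blast
    obtain k l y where kl: "k < l" "y \<in> \<O>" "f ^ k - f ^ l = a * y"
      by (rule pigeonhole[of a "\<lambda>k. f ^ k"]) (use a aO O_rules(7)[OF fO] in auto)
    define m where "m = l - k - 1"
    have l: "l = k + Suc m" using kl(1) by (simp add: m_def)
    have "f ^ k * (1 - f * f ^ m) = a * y" using kl(3) by (simp add: l power_add algebra_simps)
    moreover have "1 + (- (f * f ^ m)) \<in> \<O> - P" by (intro not_P_add one_not_P P_rules(6) P_rules(5) O_rules(7) fO f)
    ultimately show ?thesis using kl(2) unfolding I_def by (intro exI[of _ k] exI[of _ "1 - f * f ^ m"]) auto
  qed
  then obtain k e0 where ke: "\<And>f. f \<in> P \<Longrightarrow> e0 f \<in> \<O> - P \<and> f ^ k f * e0 f \<in> I" by metis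
  define e where "e = (\<Prod>f\<in>F \<inter> P. e0 f)"
  have eO: "e \<in> \<O>" unfolding e_def using ke by (intro O_rules(9)) blast
  have eP: "e \<notin> P"
  proof
    assume "e \<in> P"
    then obtain f where "f \<in> F \<inter> P" "e0 f \<in> P"
      using prime_in_prod[OF prime O_ring, of "F \<inter> P" e0] F(1) ke unfolding e_def by blast
    thus False using ke by blast
  qed
  have efk: "e * f ^ k f \<in> I" if f: "f \<in> F \<inter> P" for f
  proof -
    have "e = e0 f * (\<Prod>f\<in>F \<inter> P - {f}. e0 f)" unfolding e_def using F(1) f by (intro prod.remove) auto
    hence "e * f ^ k f = (f ^ k f * e0 f) * (\<Prod>f\<in>F \<inter> P - {f}. e0 f)" by (simp add: mult_ac)
    moreover have "(\<Prod>f\<in>F \<inter> P - {f}. e0 f) \<in> \<O>" using ke by (intro O_rules(9)) blast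
    moreover have "f ^ k f * e0 f \<in> I" using ke f by blast
    ultimately show ?thesis using I_mult by metis
  qed
  have "\<exists>b\<in>\<O>. e * b \<notin> I \<and> (\<forall>f\<in>Y. e * b * f \<in> I)" if "finite Y" "Y \<subseteq> F \<inter> P" for Y
    using that
  proof (induction Y rule: finite_induct)
    case empty
    thus ?case using eP IP O_rules(1) by (intro bexI[of _ 1]) auto
  next
    case (insert f Y)
    then obtain b where b: "b \<in> \<O>" "e * b \<notin> I" "\<And>f. f \<in> Y \<Longrightarrow> e * b * f \<in> I" by auto
    have f: "f \<in> F \<inter> P" "f \<in> \<O>" using insert.prems P_rules(1) by auto
    have ex: "e * b * f ^ k f \<in> I" using I_mult[OF efk[OF f(1)] b(1)] by (simp add: mult_ac)
    \<comment> \<open>The exponent is positive because \<open>e * b\<close> is outside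
      \<open>I\<close>; its predecessor gives a multiple of \<open>e * b\<close> that is still
      outside \<open>I\<close> but is killed by \<open>f\<close>.\<close>
    define t where "t = (LEAST t. e * b * f ^ t \<in> I)"
    have t: "e * b * f ^ t \<in> I" unfolding t_def by (rule LeastI[of _ "k f"]) (rule ex)
    have "t \<noteq> 0" using t b(2) by (intro notI) simp
    then obtain t' where t': "t = Suc t'" by (cases t) auto
    have "e * b * f ^ t' \<notin> I" using not_less_Least[of t' "\<lambda>t. e * b * f ^ t \<in> I"] t' by (simp add: t_def)
    moreover have "e * (b * f ^ t') * f \<in> I" using t by (simp add: t' mult_ac)
    moreover have "e * (b * f ^ t') * f' \<in> I" if "f' \<in> Y" for f'
      using I_mult[OF b(3)[OF that] O_rules(7)[OF f(2), of t']] by (simp add: mult_ac)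
    ultimately show ?case using O_rules(3)[OF b(1) O_rules(7)[OF f(2), of t']]
      by (intro bexI[of _ "b * f ^ t'"]) (auto simp: mult.assoc)
  qed
  from this[of "F \<inter> P"] obtain b where b: "b \<in> \<O>" "e * b \<notin> I" "\<And>f. f \<in> F \<inter> P \<Longrightarrow> e * b * f \<in> I"
    using F(1) by auto
  have "e * b * y \<in> I" if y: "y \<in> P" for y
  proof -
    obtain r z where r: "r \<in> F" "z \<in> \<O>" "y - r = a * z" using bspec[OF F(3) P_rules(1)[OF y]] by blast
    have "r = y - a * z" using r(3) by (simp add: algebra_simps)
    hence "r \<in> P" using P_rules(7)[OF y P_rules(5)[OF r(2) a(1)]] by simp
    hence 1: "e * b * r \<in> I" using b(3) r(1) by blast
    have "a * z \<in> I" using r(2) unfolding I_def by blast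
    hence "a * z * (e * b) \<in> I" using I_mult O_rules(3)[OF eO b(1)] by blast
    hence "a * z * (e * b) + e * b * r \<in> I" using I_add 1 by blast
    moreover have "a * z * (e * b) + e * b * r = e * b * y" unfolding r(3)[symmetric] by (simp add: algebra_simps)
    ultimately show ?thesis by simp
  qed
  thus ?thesis using O_rules(3)[OF eO b(1)] b(2) unfolding I_def by (intro bexI[of _ "e * b"]) auto
qed

lemma uniformizer_exists: obtains w where "uniformizer w"
proof -
  obtain a where a: "a \<in> P" "a \<noteq> 0" by (rule nonzero_mem)
  have aO: "a \<in> \<O>" using a P_rules(1) by blast
  obtain c where c: "c \<in> \<O>" "\<And>z. z \<in> \<O> \<Longrightarrow> c \<noteq> a * z" "\<And>y. y \<in> P \<Longrightarrow> \<exists>z\<in>\<O>. c * y = a * z"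
    using annihilator_mod[OF a] by blast
  define x where "x = c / a"
  have xM: "x \<in> M" unfolding x_def using c(1) aO by (intro csubfield_divide[OF M]) auto
  have xO: "x \<notin> \<O>" using c(2)[of x] a(2) by (auto simp: x_def)
  have xP: "x * y \<in> \<O>" if y: "y \<in> P" for y
  proof -
    obtain z where z: "z \<in> \<O>" "c * y = a * z" using c(3)[OF y] by blast
    have "x * y = z" using z(2) a(2) by (simp add: x_def field_simps)
    thus ?thesis using z(1) by simp
  qed
  have "\<exists>w\<in>P. x * w \<notin> P"
  proof (rule ccontr)
    assume "\<not> (\<exists>w\<in>P. x * w \<notin> P)"
    hence st: "x * w \<in> P" if "w \<in> P" for w using that by blast
    have pw: "x ^ k * a \<in> P" for k
    proof (induction k)
      case (Suc k)
      thus ?case using st[OF Suc] by (simp add: mult.assoc)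
    qed (use a in simp)
    obtain k l y where kl: "k < l" "y \<in> \<O>" "x ^ k * a - x ^ l * a = a * y"
      by (rule pigeonhole[of a "\<lambda>k. x ^ k * a"]) (use a aO pw P_rules(1) in blast)+
    have "a * (x ^ k - x ^ l - y) = 0" using kl(3) by (simp add: algebra_simps)
    hence eq: "x ^ k - x ^ l - y = 0" using a(2) by simp
    \<comment> \<open>Dividing the repetition among the \<open>x ^ k * a\<close> by \<open>a\<close>
      gives the monic equation \<open>x ^ l - x ^ k + y = 0\<close>, so \<open>x\<close> would be
      integral.\<close>
    define q where "q = monom 1 l - monom 1 k + [:y:]"
    have lk: "l > 0" using kl(1) by simp
    have co: "coeff q n = (if n = l then 1 else 0) - (if n = k then 1 else 0) + (if n = 0 then y else 0)" for n
      by (simp add: q_def coeff_pCons split: nat.split)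
    have dq: "degree q = l"
    proof (rule antisym)
      show "degree q \<le> l" by (rule degree_le) (use kl(1) in \<open>auto simp: co\<close>)
      show "l \<le> degree q" by (rule le_degree) (use kl(1) in \<open>auto simp: co\<close>)
    qed
    have "x \<in> \<O>"
    proof (rule O_closed[of q])
      show "monic q" unfolding dq using kl(1) by (auto simp: co)
      show "coeff q n \<in> \<O>" for n unfolding co using O_rules(1,4) kl(2) by (intro O_rules(6) O_rules(2)) auto
      show "poly q x = 0" using eq by (simp add: q_def poly_monom algebra_simps)
    qed (rule xM)
    thus False using xO by blast
  qed
  then obtain w where w: "w \<in> P" "x * w \<notin> P" by blast
  have "x * w \<in> \<O> - P" using w xP by blast
  moreover have "\<exists>y\<in>\<O>. x * w * z = w * y" if "z \<in> P" for z
    using xP[OF that] by (intro bexI[of _ "x * z"]) (simp add: mult_ac)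
  ultimately have "uniformizer w" using w(1) unfolding uniformizer_def by blast
  thus ?thesis by (rule that)
qed

subsection \<open>The filtration by powers of a uniformizer\<close>

text \<open>For a uniformizer \<open>w\<close>, the integers of valuation at least \<open>n\<close>
  at \<open>P\<close>. The factor \<open>s\<close> outside \<open>P\<close> stands for the passage
  to the local ring.\<close>

definition Dv :: "complex \<Rightarrow> nat \<Rightarrow> complex set" where
  "Dv w n = {x \<in> \<O>. \<exists>s\<in>\<O> - P. \<exists>y\<in>\<O>. s * x = w ^ n * y}"

lemma DvI: "x \<in> \<O> \<Longrightarrow> s \<in> \<O> - P \<Longrightarrow> y \<in> \<O> \<Longrightarrow> s * x = w ^ n * y \<Longrightarrow> x \<in> Dv w n"
  unfolding Dv_def by blast

lemma DvE:
  assumes "x \<in> Dv w n" obtains s y where "s \<in> \<O> - P" "y \<in> \<O>" "s * x = w ^ n * y"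
  using assms unfolding Dv_def by blast

lemma Dv_O: "x \<in> Dv w n \<Longrightarrow> x \<in> \<O>" by (simp add: Dv_def)

lemma Dv_power: "w \<in> \<O> \<Longrightarrow> w ^ n \<in> Dv w n"
  using O_rules(7)[of w n] one_not_P O_rules(1) by (intro DvI[of _ 1 1]) auto

lemma Dv_add:
  assumes "x \<in> Dv w n" "y \<in> Dv w n" shows "x + y \<in> Dv w n"
proof -
  obtain s a where s: "s \<in> \<O> - P" "a \<in> \<O>" "s * x = w ^ n * a" by (rule DvE[OF assms(1)])
  obtain t b where t: "t \<in> \<O> - P" "b \<in> \<O>" "t * y = w ^ n * b" by (rule DvE[OF assms(2)])
  show ?thesis
  proof (rule DvI)
    show "x + y \<in> \<O>" using assms Dv_O O_rules(6) by blast
    show "s * t \<in> \<O> - P" by (rule not_P_mult[OF s(1) t(1)])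
    show "a * t + b * s \<in> \<O>" using s t by (intro O_rules(6) O_rules(3)) auto
    have "s * t * (x + y) = (s * x) * t + (t * y) * s" by (simp add: algebra_simps)
    thus "s * t * (x + y) = w ^ n * (a * t + b * s)" unfolding s(3) t(3) by (simp add: algebra_simps)
  qed
qed

lemma Dv_mult:
  assumes "x \<in> Dv w n" "y \<in> Dv w m" shows "x * y \<in> Dv w (n + m)"
proof -
  obtain s a where s: "s \<in> \<O> - P" "a \<in> \<O>" "s * x = w ^ n * a" by (rule DvE[OF assms(1)])
  obtain t b where t: "t \<in> \<O> - P" "b \<in> \<O>" "t * y = w ^ m * b" by (rule DvE[OF assms(2)])
  show ?thesis
  proof (rule DvI)
    show "x * y \<in> \<O>" using assms Dv_O O_rules(3) by blast
    show "s * t \<in> \<O> - P" by (rule not_P_mult[OF s(1) t(1)])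
    show "a * b \<in> \<O>" by (rule O_rules(3)[OF s(2) t(2)])
    have "s * t * (x * y) = (s * x) * (t * y)" by (simp add: algebra_simps)
    thus "s * t * (x * y) = w ^ (n + m) * (a * b)" unfolding s(3) t(3) by (simp add: power_add algebra_simps)
  qed
qed

lemma Dv_0: "Dv w 0 = \<O>" using one_not_P by (auto intro: DvI[of _ 1] dest: Dv_O)

lemma Dv_times: "x \<in> Dv w n \<Longrightarrow> y \<in> \<O> \<Longrightarrow> x * y \<in> Dv w n" "x \<in> Dv w n \<Longrightarrow> y \<in> \<O> \<Longrightarrow> y * x \<in> Dv w n"
  using Dv_mult[of x w n y 0] by (auto simp: Dv_0 mult.commute)

lemma Dv_minus: "x \<in> Dv w n \<Longrightarrow> - x \<in> Dv w n"
  using Dv_times(2)[of x w n "-1"] O_rules(5)[OF O_rules(1)] by simp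

lemma Dv_diff: "x \<in> Dv w n \<Longrightarrow> y \<in> Dv w n \<Longrightarrow> x - y \<in> Dv w n"
  using Dv_add[of x w n "- y"] Dv_minus by simp

lemma Dv_cancel:
  assumes "s * x \<in> Dv w n" "s \<in> \<O> - P" "x \<in> \<O>" shows "x \<in> Dv w n"
proof -
  obtain t a where t: "t \<in> \<O> - P" "a \<in> \<O>" "t * (s * x) = w ^ n * a" by (rule DvE[OF assms(1)])
  show ?thesis using t by (intro DvI[OF assms(3) not_P_mult[OF t(1) assms(2)] t(2)]) (simp add: mult.assoc)
qed

lemma Dv_1:
  assumes "uniformizer w" shows "Dv w 1 = P"
proof
  have w: "w \<in> P" using assms by (simp add: uniformizer_def)
  show "Dv w 1 \<subseteq> P"
  proof
    fix x assume x: "x \<in> Dv w 1"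
    obtain s y where s: "s \<in> \<O> - P" "y \<in> \<O>" "s * x = w ^ 1 * y" by (rule DvE[OF x])
    have "s * x \<in> P" using s(3) P_rules(5)[OF s(2) w] by simp
    thus "x \<in> P" using P_rules(9)[of s x] s Dv_O[OF x] by blast
  qed
  show "P \<subseteq> Dv w 1"
  proof
    fix x assume x: "x \<in> P"
    obtain u y where "u \<in> \<O> - P" "y \<in> \<O>" "u * x = w * y" using assms x unfolding uniformizer_def by blast
    thus "x \<in> Dv w 1" by (intro DvI[OF P_rules(1)[OF x], of u y]) auto
  qed
qed

lemma Dv_Suc_cancel:
  assumes w: "uniformizer w" "w \<noteq> 0" and "w ^ n * x \<in> Dv w (Suc n)" "x \<in> \<O>" shows "x \<in> P"
proof -
  obtain s y where s: "s \<in> \<O> - P" "y \<in> \<O>" "s * (w ^ n * x) = w ^ Suc n * y" by (rule DvE[OF assms(3)])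
  have "w ^ n * (s * x) = w ^ n * (w * y)" using s(3) by (simp add: mult_ac)
  hence "s * x = w * y" using w(2) by simp
  hence "s * x \<in> P" using P_rules(5)[OF s(2)] w(1) by (simp add: uniformizer_def)
  thus ?thesis using P_rules(9)[of s x] s(1) assms(4) by blast
qed

lemma uniformizer_nonzero: assumes "uniformizer w" shows "w \<noteq> 0"
proof
  assume "w = 0"
  obtain a where a: "a \<in> P" "a \<noteq> 0" by (rule nonzero_mem)
  obtain u y where "u \<in> \<O> - P" "u * a = w * y" using assms a unfolding uniformizer_def by blast
  hence "u * a = 0" "u \<noteq> 0" using \<open>w = 0\<close> not_P_nonzero by auto
  thus False using a by simp
qed

text \<open>If \<open>x\<close> were nonzero, two powers of \<open>w\<close> would agree modulo
  \<open>x\<close>; infinite valuation of \<open>x\<close> would give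
  \<open>w ^ k * (1 - w * w ^ m)\<close> valuation above \<open>k\<close>, although the second
  factor is a unit at \<open>P\<close>.\<close>

lemma Dv_Inter:
  assumes w: "uniformizer w" and x: "\<And>n. x \<in> Dv w n" shows "x = 0"
proof (rule ccontr)
  assume x0: "x \<noteq> 0"
  have wP: "w \<in> P" and wO: "w \<in> \<O>" and w0: "w \<noteq> 0" using w P_rules(1) uniformizer_nonzero[OF w] by (auto simp: uniformizer_def)
  have xO: "x \<in> \<O>" using Dv_O[OF x] .
  obtain k l y where kl: "k < l" "y \<in> \<O>" "w ^ k - w ^ l = x * y"
    by (rule pigeonhole[OF xO x0, of "\<lambda>k. w ^ k"]) (use O_rules(7)[OF wO] in auto)
  define m where "m = l - k - 1"
  have l: "l = k + Suc m" using kl(1) by (simp add: m_def)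
  have e: "1 - w * w ^ m \<in> \<O>" by (intro O_rules(2) O_rules(1) O_rules(3) wO O_rules(7))
  have "w ^ k * (1 - w * w ^ m) = x * y" using kl(3) by (simp add: l power_add algebra_simps)
  hence "w ^ k * (1 - w * w ^ m) \<in> Dv w (Suc k)" using Dv_times(1)[OF x kl(2)] by simp
  hence "1 - w * w ^ m \<in> P" by (rule Dv_Suc_cancel[OF w w0 _ e])
  hence "(1 - w * w ^ m) + w * w ^ m \<in> P" by (rule P_rules(3)[OF _ P_rules(5)[OF O_rules(7)[OF wO] wP]])
  thus False using P_rules(8) by simp
qed

lemma Dv_Suc_subset:
  assumes "w \<in> \<O>" shows "Dv w (Suc n) \<subseteq> Dv w n"
proof
  fix x assume x: "x \<in> Dv w (Suc n)"
  obtain s y where s: "s \<in> \<O> - P" "y \<in> \<O>" "s * x = w ^ Suc n * y" by (rule DvE[OF x])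
  show "x \<in> Dv w n" using s O_rules(3)[OF assms s(2)] by (intro DvI[OF Dv_O[OF x] s(1), of "w * y"]) (simp_all add: mult_ac)
qed

text \<open>The ideal product admits no denominators. If \<open>s * x = w ^ 2 * y\<close> and
  \<open>v\<close> inverts \<open>s\<close> modulo \<open>P\<close>, then
  \<open>x = w * (w * y * v) + x * (1 - s * v)\<close> is a sum of two products of elements of
  \<open>P\<close>.\<close>

lemma ideal_prod_square:
  assumes w: "uniformizer w"
  shows "ideal_prod (ring_of_integers M) P P = Dv w 2"
proof
  have ops: "x \<otimes>\<^bsub>ring_of_integers M\<^esub> y = x * y" "x \<oplus>\<^bsub>ring_of_integers M\<^esub> y = x + y" for x y
    by (simp_all add: ring_of_integers_def subring_of_complex_def ring_of_type_algebra_def)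
  show "ideal_prod (ring_of_integers M) P P \<subseteq> Dv w 2"
  proof
    fix x assume "x \<in> ideal_prod (ring_of_integers M) P P"
    thus "x \<in> Dv w 2"
    proof (induction rule: ideal_prod.induct)
      case (prod i j)
      hence "i * j \<in> Dv w (1 + 1)" using Dv_1[OF w] by (intro Dv_mult) auto
      thus ?case by (simp add: ops numeral_2_eq_2)
    next
      case (sum s1 s2)
      thus ?case by (simp add: ops Dv_add)
    qed
  qed
  show "Dv w 2 \<subseteq> ideal_prod (ring_of_integers M) P P"
  proof
    fix x assume x: "x \<in> Dv w 2"
    obtain s y where s: "s \<in> \<O> - P" "y \<in> \<O>" "s * x = w ^ 2 * y" by (rule DvE[OF x])
    obtain v where v: "v \<in> \<O>" "1 - s * v \<in> P" by (rule residue_inverse[OF s(1)])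
    have wP: "w \<in> P" using w by (simp add: uniformizer_def)
    have xP: "x \<in> P"
    proof -
      have "s * x \<in> P" unfolding s(3) using P_rules(5)[OF s(2) P_rules(5)[OF P_rules(1)[OF wP] wP]] by (simp add: power2_eq_square)
      thus ?thesis using P_rules(9)[of s x] s Dv_O[OF x] by blast
    qed
    have "x = w * (w * y * v) + x * (1 - s * v)"
      using arg_cong[OF s(3), of "\<lambda>z. z * v"] by (simp add: algebra_simps power2_eq_square)
    moreover have "w * (w * y * v) \<in> ideal_prod (ring_of_integers M) P P"
      using ideal_prod.prod[of w P "w * y * v" P "ring_of_integers M"] wP P_rules(5)[OF v(1) P_rules(5)[OF s(2) wP]]
      by (simp add: ops)
    moreover have "x * (1 - s * v) \<in> ideal_prod (ring_of_integers M) P P"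
      using ideal_prod.prod[of x P "1 - s * v" P "ring_of_integers M"] xP v(2) by (simp add: ops)
    ultimately show "x \<in> ideal_prod (ring_of_integers M) P P"
      using ideal_prod.sum[of "w * (w * y * v)" "ring_of_integers M" P P "x * (1 - s * v)"] by (simp add: ops)
  qed
qed

end

subsection \<open>Inertia and ramification\<close>

context number_field_prime
begin

lemma P_cong_power:
  assumes "a \<in> \<O>" "b \<in> \<O>" "a - b \<in> P" shows "a ^ n - b ^ n \<in> P"
proof -
  have "(\<Sum>i<n. b ^ (n - Suc i) * a ^ i) \<in> \<O>" using assms by (intro csubring_sum O_ring O_rules(3) O_rules(7))
  thus ?thesis using P_rules(5)[OF _ assms(3)] by (simp only: power_diff_sumr2)
qed

text \<open>The inner binomial coefficients are divisible by \<open>l\<close>, so the Frobenius map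
  is additive modulo \<open>P\<close>.\<close>

lemma diff_power_prime_mem:
  assumes l: "prime l" "of_nat l \<in> P" and ab: "a \<in> \<O>" "b \<in> \<O>"
  shows "(a - b) ^ l - (a ^ l - b ^ l) \<in> P"
proof -
  define c where "c = a - b"
  have c: "c \<in> \<O>" unfolding c_def by (rule O_rules(2)[OF ab])
  have l0: "l > 0" using prime_gt_0_nat[OF l(1)] .
  have "a ^ l = (c + b) ^ l" by (simp add: c_def)
  also have "\<dots> = (\<Sum>k\<le>l. of_nat (l choose k) * c ^ k * b ^ (l - k))" by (rule binomial_ring)
  also have "\<dots> = (\<Sum>k\<in>{0, l}. of_nat (l choose k) * c ^ k * b ^ (l - k)) + (\<Sum>k\<in>{..l} - {0, l}. of_nat (l choose k) * c ^ k * b ^ (l - k))"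
    by (rule sum.subset_diff[of "{0, l}" "{..l}", simplified add.commute]) auto
  also have "(\<Sum>k\<in>{0, l}. of_nat (l choose k) * c ^ k * b ^ (l - k)) = b ^ l + c ^ l" using l0 by simp
  finally have e: "c ^ l - (a ^ l - b ^ l) = - (\<Sum>k\<in>{..l} - {0, l}. of_nat (l choose k) * c ^ k * b ^ (l - k))" by simp
  have "of_nat (l choose k) * c ^ k * b ^ (l - k) \<in> P" if k: "k \<in> {..l} - {0, l}" for k
  proof -
    have "l dvd (l choose k)" using k by (intro dvd_choose_prime l(1)) auto
    then obtain m where m: "l choose k = l * m" by (rule dvdE)
    have "of_nat m * c ^ k * b ^ (l - k) \<in> \<O>" using c ab by (intro O_rules(3) O_rules(7) O_rules(10))
    hence "of_nat m * c ^ k * b ^ (l - k) * of_nat l \<in> P" by (rule P_rules(4)[OF _ l(2)])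
    thus ?thesis by (simp add: m mult_ac)
  qed
  hence "(\<Sum>k\<in>{..l} - {0, l}. of_nat (l choose k) * c ^ k * b ^ (l - k)) \<in> P"
    by (rule prime_in_sum[OF prime O_ring])
  thus ?thesis unfolding c_def[symmetric] e by (rule P_rules(6))
qed

text \<open>The iterated Frobenius images of \<open>x\<close> repeat modulo \<open>P\<close>.
  Additivity turns the repetition into a statement that a power of \<open>x - z\<close> lies in
  \<open>P\<close>, which pulls it back to \<open>x\<close> itself.\<close>

lemma residue_frobenius:
  assumes l: "prime l" "of_nat l \<in> P" and x: "x \<in> \<O>"
  obtains f where "f > 0" "x ^ (l ^ f) - x \<in> P"
proof -
  obtain a where a: "a \<in> P" "a \<noteq> 0" by (rule nonzero_mem)
  obtain k k' y where k: "k < k'" "y \<in> \<O>" "x ^ (l ^ k) - x ^ (l ^ k') = a * y"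
    by (rule pigeonhole[of a "\<lambda>k. x ^ (l ^ k)"]) (use a P_rules(1) O_rules(7)[OF x] in auto)
  define f where "f = k' - k"
  have k': "k' = f + k" and f: "f > 0" using k(1) by (auto simp: f_def)
  define z where "z = x ^ (l ^ f)"
  have z: "z \<in> \<O>" unfolding z_def by (rule O_rules(7)[OF x])
  have "(x - z) ^ (l ^ m) - (x ^ (l ^ m) - z ^ (l ^ m)) \<in> P" for m
  proof (induction m)
    case (Suc m)
    have O: "(x - z) ^ l ^ m \<in> \<O>" "x ^ l ^ m \<in> \<O>" "z ^ l ^ m \<in> \<O>" "x ^ l ^ m - z ^ l ^ m \<in> \<O>"
      using O_rules(7)[OF O_rules(2)[OF x z]] O_rules(7)[OF x] O_rules(7)[OF z]
        O_rules(2)[OF O_rules(7)[OF x] O_rules(7)[OF z]] by blast+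
    have "((x - z) ^ l ^ m) ^ l - (x ^ l ^ m - z ^ l ^ m) ^ l \<in> P" by (rule P_cong_power[OF O(1,4) Suc])
    moreover have "(x ^ l ^ m - z ^ l ^ m) ^ l - ((x ^ l ^ m) ^ l - (z ^ l ^ m) ^ l) \<in> P"
      by (rule diff_power_prime_mem[OF l O(2,3)])
    ultimately have "(((x - z) ^ l ^ m) ^ l - (x ^ l ^ m - z ^ l ^ m) ^ l) +
        ((x ^ l ^ m - z ^ l ^ m) ^ l - ((x ^ l ^ m) ^ l - (z ^ l ^ m) ^ l)) \<in> P" by (rule P_rules(3))
    moreover have "a - c + (c - d) = a - d" for a c d :: complex by simp
    ultimately have "((x - z) ^ l ^ m) ^ l - ((x ^ l ^ m) ^ l - (z ^ l ^ m) ^ l) \<in> P" by (simp only:)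
    thus ?case by (simp add: power_mult[symmetric] mult.commute)
  qed (use P_rules(2) in simp)
  from this[of k] have 1: "(x - z) ^ (l ^ k) - (x ^ (l ^ k) - z ^ (l ^ k)) \<in> P" .
  have "z ^ (l ^ k) = x ^ (l ^ k')" by (simp add: z_def k' power_add power_mult)
  hence "x ^ (l ^ k) - z ^ (l ^ k) \<in> P" using k(3) P_rules(5)[OF k(2) a(1)] by simp
  hence "(x - z) ^ (l ^ k) - (x ^ (l ^ k) - z ^ (l ^ k)) + (x ^ (l ^ k) - z ^ (l ^ k)) \<in> P" by (rule P_rules(3)[OF 1])
  hence "(x - z) ^ (l ^ k) \<in> P" by simp
  hence "x - z \<in> P" by (rule prime_in_power[OF prime O_ring O_rules(2)[OF x z]])
  hence "z - x \<in> P" using P_rules(6)[of "x - z"] by simp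
  thus ?thesis using that f unfolding z_def by blast
qed

lemma uniformizerI:
  assumes w: "uniformizer w" and y: "y \<in> P" "y \<notin> Dv w 2"
  shows "uniformizer y"
proof -
  obtain u where u: "u \<in> \<O> - P" "\<And>x. x \<in> P \<Longrightarrow> \<exists>z\<in>\<O>. u * x = w * z" using w unfolding uniformizer_def by blast
  obtain v where v: "v \<in> \<O>" "u * y = w * v" using u(2)[OF y(1)] by blast
  have wO: "w \<in> \<O>" using w P_rules(1) by (simp add: uniformizer_def)
  have "v \<notin> P"
  proof
    assume "v \<in> P"
    hence "v \<in> Dv w 1" using Dv_1[OF w] by simp
    hence "w ^ 1 * v \<in> Dv w (1 + 1)" by (intro Dv_mult Dv_power[OF wO, of 1])
    hence "u * y \<in> Dv w 2" using v(2) by (simp add: numeral_2_eq_2)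
    thus False using Dv_cancel[OF _ u(1) P_rules(1)[OF y(1)]] y(2) by blast
  qed
  hence vO: "v \<in> \<O> - P" using v by blast
  have "\<exists>z\<in>\<O>. v * x = y * z" if x: "x \<in> P" for x
  proof -
    obtain z where z: "z \<in> \<O>" "u * x = w * z" using u(2)[OF x] by blast
    have "u * (v * x) = v * (u * x)" by (simp add: mult_ac)
    also have "\<dots> = (w * v) * z" unfolding z(2) by (simp add: mult_ac)
    also have "\<dots> = u * (y * z)" unfolding v(2)[symmetric] by (simp add: mult_ac)
    finally have "v * x = y * z" using not_P_nonzero[OF u(1)] by simp
    thus ?thesis using z by blast
  qed
  thus ?thesis using y(1) vO unfolding uniformizer_def by blast
qed

lemma inertia_stable:
  assumes "\<And>x. x \<in> \<O> \<Longrightarrow> g x - x \<in> P" "x \<in> P" shows "g x \<in> P"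
  using P_rules(3)[OF assms(1)[OF P_rules(1)[OF assms(2)]] assms(2)] by simp

lemma trivial_on_O_imp_trivial:
  assumes g: "g \<in> Gal M \<rat>" and "\<And>x. x \<in> \<O> \<Longrightarrow> g x = x"
  shows "g = idM"
proof (rule Gal_eqI[OF M g idM[OF Rats_M]])
  fix x assume x: "x \<in> M"
  obtain n :: nat where n: "n > 0" "of_nat n * x \<in> \<O>" by (rule M_multiple_O[OF x])
  have "of_nat n * g x = g (of_nat n * x)"
    using chom_rules(3)[OF G_rules(2)[OF g] M_ring csubring_of_nat[OF M_ring] x] chom_of_nat[OF G_rules(2)[OF g] M_ring] by simp
  hence "of_nat n * g x = of_nat n * x" using assms(2)[OF n(2)] by simp
  thus "g x = idM x" using n(1) x by simp
qed

lemma fixes_all_levels_imp_id: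
  assumes w: "uniformizer w" and g: "g \<in> Gal M \<rat>" and "\<And>n x. x \<in> \<O> \<Longrightarrow> g x - x \<in> Dv w (Suc n)"
  shows "g = idM"
proof (rule trivial_on_O_imp_trivial[OF g])
  fix x assume x: "x \<in> \<O>"
  have "g x - x \<in> Dv w n" for n
    using assms(3)[OF x, of n] Dv_Suc_subset[of w n] w P_rules(1) by (auto simp: uniformizer_def)
  hence "g x - x = 0" by (rule Dv_Inter[OF w])
  thus "g x = x" by simp
qed

text \<open>
  Modulo every power of \<open>P\<close> each integer has a power series expansion in the uniformizer \<open>y\<close> fixed by
  \<open>g\<close>, with coefficients \<open>x ^ l ^ f\<close> that \<open>g\<close> fixes to one more level than \<open>x\<close>.
\<close>

lemma inertia_trivial:
  assumes w: "uniformizer w" and g: "g \<in> Gal M \<rat>" and inert: "\<And>x. x \<in> \<O> \<Longrightarrow> g x - x \<in> P"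
    and y: "y \<in> P" "y \<notin> Dv w 2" "g y = y"
  shows "g = idM"
proof (rule fixes_all_levels_imp_id[OF uniformizerI[OF w y(1,2)] g])
  note uy = uniformizerI[OF w y(1,2)]
  note ch = chom_rules[OF G_rules(2)[OF g] M_ring]
  have gO: "g x \<in> \<O>" if "x \<in> \<O>" for x by (rule G_O[OF g that])
  obtain l :: nat where l: "prime l" "of_nat l \<in> P" by (rule residue_characteristic)
  fix n x
  show "x \<in> \<O> \<Longrightarrow> g x - x \<in> Dv y (Suc n)"
  proof (induction n arbitrary: x)
    case 0
    thus ?case using inert Dv_1[OF uy] by simp
  next
    case (Suc n)
    obtain f where f: "f > 0" "x ^ (l ^ f) - x \<in> P" by (rule residue_frobenius[OF l Suc.prems])
    obtain f' where f': "f = Suc f'" using f(1) by (cases f) auto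
    define b where "b = x ^ (l ^ f')"
    have b: "b \<in> \<O>" unfolding b_def by (rule O_rules(7)[OF Suc.prems])
    define x' where "x' = b ^ l"
    have x': "x' \<in> \<O>" unfolding x'_def by (rule O_rules(7)[OF b])
    have x'_eq: "x' = x ^ (l ^ f)" by (simp add: x'_def b_def f' power_mult[symmetric] mult.commute)
    have gx': "g x' = g b ^ l" unfolding x'_def using b by (intro chom_power[OF G_rules(2)[OF g] M_ring]) auto
    \<comment> \<open>The cofactor of \<open>g b - b\<close> in \<open>g b ^ l - b ^ l\<close> is
      congruent to \<open>l * b ^ (l - 1)\<close>, hence lies in \<open>P\<close>: taking an
      \<open>l\<close>-th power gains one level.\<close>
    have "(\<Sum>i<l. b ^ (l - Suc i) * g b ^ i) \<in> P"
    proof -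
      have "b ^ (l - Suc i) * g b ^ i - b ^ (l - 1) \<in> P" if i: "i < l" for i
      proof -
        have "b ^ (l - 1) = b ^ (l - Suc i) * b ^ i" using i by (simp add: power_add[symmetric])
        moreover have "b ^ (l - Suc i) * (g b ^ i - b ^ i) \<in> P"
          by (rule P_rules(4)[OF O_rules(7)[OF b] P_cong_power[OF gO[OF b] b inert[OF b]]])
        ultimately show ?thesis by (simp add: algebra_simps)
      qed
      hence "(\<Sum>i<l. b ^ (l - Suc i) * g b ^ i - b ^ (l - 1)) \<in> P" by (intro prime_in_sum[OF prime O_ring]) simp
      moreover have "of_nat l * b ^ (l - 1) \<in> P" by (rule P_rules(5)[OF O_rules(7)[OF b] l(2)])
      ultimately have "(\<Sum>i<l. b ^ (l - Suc i) * g b ^ i - b ^ (l - 1)) + of_nat l * b ^ (l - 1) \<in> P" by (rule P_rules(3))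
      thus ?thesis by (simp add: sum_subtractf)
    qed
    hence "(g b - b) * (\<Sum>i<l. b ^ (l - Suc i) * g b ^ i) \<in> Dv y (Suc n + 1)"
      using Dv_1[OF uy] by (intro Dv_mult Suc.IH b) auto
    moreover have "g x' - x' = (g b - b) * (\<Sum>i<l. b ^ (l - Suc i) * g b ^ i)"
      unfolding gx' unfolding x'_def by (rule power_diff_sumr2)
    ultimately have 1: "g x' - x' \<in> Dv y (Suc (Suc n))" by simp
    \<comment> \<open>The remainder lies in \<open>P\<close>, so up to the factor \<open>s\<close>
      it is \<open>y * z\<close>. As \<open>g\<close> fixes \<open>y\<close>, the movement of
      \<open>z\<close> is raised by one level.\<close>
    define e where "e = x - x'"
    have eP: "e \<in> P" using P_rules(6)[OF f(2)] by (simp add: e_def x'_eq)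
    have eO: "e \<in> \<O>" by (rule P_rules(1)[OF eP])
    have "e \<in> Dv y 1" using eP Dv_1[OF uy] by simp
    then obtain s z where s: "s \<in> \<O> - P" "z \<in> \<O>" "s * e = y ^ 1 * z" by (rule DvE)
    have "g (s * e) = g s * g e" using s eO by (intro ch(3)) auto
    moreover have "g (y * z) = y * g z" using s y P_rules(1)[OF y(1)] ch(3)[of y z] by auto
    ultimately have gs: "g s * g e = y * g z" using s(3) by simp
    have "s * (g e - e) = y * (g z - z) - (g s - s) * g e" using gs s(3) by (simp add: algebra_simps)
    moreover have "y * (g z - z) \<in> Dv y (1 + Suc n)"
      using Dv_power[OF P_rules(1)[OF y(1)], of 1] Suc.IH[OF s(2)] by (intro Dv_mult) auto
    moreover have "(g s - s) * g e \<in> Dv y (Suc n + 1)"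
      using Suc.IH[of s] s inertia_stable[OF inert eP] Dv_1[OF uy] by (intro Dv_mult) auto
    ultimately have "s * (g e - e) \<in> Dv y (Suc (Suc n))" using Dv_diff by simp
    hence 2: "g e - e \<in> Dv y (Suc (Suc n))" by (rule Dv_cancel[OF _ s(1) O_rules(2)[OF gO[OF eO] eO]])
    have "g e = g x - g x'" unfolding e_def using Suc.prems x' by (intro ch(6)) auto
    hence "g x - x = (g e - e) + (g x' - x')" by (simp add: e_def)
    thus ?case using Dv_add[OF 2 1] by simp
  qed
qed

text \<open>Suppose \<open>g\<close> moves integers by elements \<open>d\<close> of level
  \<open>n + 1\<close>. One level deeper \<open>g\<close> fixes \<open>d\<close>, so the
  \<open>p\<close>-th iterate adds \<open>p * d\<close>; this iterate is the identity and
  \<open>p\<close> is a unit at \<open>P\<close>, hence \<open>d\<close> is one level deeper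
  too.\<close>

lemma tame_inertia_trivial:
  assumes w: "uniformizer w" and g: "g \<in> Gal M \<rat>" and inert: "\<And>x. x \<in> \<O> \<Longrightarrow> g x - x \<in> P"
    and gw: "g w - w \<in> Dv w 2" and p: "of_nat p \<notin> P" "\<And>x. x \<in> M \<Longrightarrow> (g ^^ p) x = x"
  shows "g = idM"
proof (rule fixes_all_levels_imp_id[OF w g])
  note ch = chom_rules[OF G_rules(2)[OF g] M_ring]
  have gO: "g x \<in> \<O>" if "x \<in> \<O>" for x by (rule G_O[OF g that])
  have wO: "w \<in> \<O>" using w P_rules(1) by (simp add: uniformizer_def)
  have gwm: "g (w ^ m) - w ^ m \<in> Dv w (Suc m)" for m
  proof (induction m)
    case 0
    have "g 1 = 1" using ch(1) .
    thus ?case using DvI[of 0 1 0] O_rules(4) one_not_P by simp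
  next
    case (Suc m)
    have "g (w * w ^ m) = g w * g (w ^ m)" using wO O_rules(7)[OF wO] by (intro ch(3)) auto
    hence "g (w ^ Suc m) - w ^ Suc m = g w * (g (w ^ m) - w ^ m) + (g w - w) * w ^ m" by (simp add: algebra_simps)
    moreover have "g w * (g (w ^ m) - w ^ m) \<in> Dv w (1 + Suc m)"
      using inertia_stable[OF inert] w Dv_1[OF w] Suc by (intro Dv_mult) (auto simp: uniformizer_def)
    moreover have "(g w - w) * w ^ m \<in> Dv w (2 + m)" by (intro Dv_mult gw Dv_power wO)
    ultimately show ?case by (simp add: Dv_add)
  qed
  \<comment> \<open>Triviality of \<open>g\<close> on \<open>w\<close> to first order propagates to
    all powers of \<open>w\<close>, so an element of level \<open>m\<close> is moved only by level
    \<open>m + 1\<close>.\<close>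
  have raise: "g x - x \<in> Dv w (Suc m)" if x: "x \<in> Dv w m" for x m
  proof -
    have xO: "x \<in> \<O>" by (rule Dv_O[OF x])
    obtain s y where s: "s \<in> \<O> - P" "y \<in> \<O>" "s * x = w ^ m * y" by (rule DvE[OF x])
    have "g s * g x = g (w ^ m) * g y"
    proof -
      have "g (s * x) = g s * g x" using s xO by (intro ch(3)) auto
      moreover have "g (w ^ m * y) = g (w ^ m) * g y" using s O_rules(7)[OF wO] by (intro ch(3)) auto
      ultimately show ?thesis using s(3) by simp
    qed
    hence "g s * (g x - x) = (g (w ^ m) - w ^ m) * g y + w ^ m * (g y - y) - (g s - s) * x"
      using s(3) by (simp add: algebra_simps)
    moreover have "(g (w ^ m) - w ^ m) * g y \<in> Dv w (Suc m)" by (rule Dv_times(1)[OF gwm gO[OF s(2)]])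
    moreover have "w ^ m * (g y - y) \<in> Dv w (m + 1)" using inert[OF s(2)] Dv_1[OF w] by (intro Dv_mult Dv_power wO) auto
    moreover have "(g s - s) * x \<in> Dv w (1 + m)" using inert[of s] s Dv_1[OF w] x by (intro Dv_mult) auto
    ultimately have "g s * (g x - x) \<in> Dv w (Suc m)" by (simp add: Dv_add Dv_diff)
    moreover have "s + (g s - s) \<in> \<O> - P" using s by (intro not_P_add inert) auto
    ultimately show ?thesis using Dv_cancel[of "g s" "g x - x"] O_rules(2)[OF gO[OF xO] xO] by simp
  qed
  fix n x
  show "x \<in> \<O> \<Longrightarrow> g x - x \<in> Dv w (Suc n)"
  proof (induction n arbitrary: x)
    case 0
    thus ?case using inert Dv_1[OF w] by simp
  next
    case (Suc n)
    define d where "d = g x - x"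
    have dD: "d \<in> Dv w (Suc n)" unfolding d_def by (rule Suc.IH[OF Suc.prems])
    have gx: "g x = x + d" by (simp add: d_def)
    \<comment> \<open>Linear approximation of the iterates; the errors have level
      \<open>n + 2\<close>, and \<open>raise\<close> keeps them there.\<close>
    have it: "(g ^^ k) x \<in> \<O> \<and> (g ^^ k) x - (x + of_nat k * d) \<in> Dv w (Suc (Suc n))" for k
    proof (induction k)
      case 0
      thus ?case using Suc.prems DvI[of 0 1 0] O_rules(4) one_not_P by simp
    next
      case (Suc k)
      define r where "r = (g ^^ k) x - (x + of_nat k * d)"
      have r: "r \<in> Dv w (Suc (Suc n))" "(g ^^ k) x \<in> \<O>" using Suc by (auto simp: r_def)
      have dO: "d \<in> \<O>" and rO: "r \<in> \<O>" using Dv_O dD r by blast+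
      have xM: "x \<in> M" "d \<in> M" "r \<in> M" "of_nat k * d \<in> M" "x + of_nat k * d \<in> M"
        using Suc.prems \<open>x \<in> \<O>\<close> dO rO O_rules(3)[OF O_rules(10) dO] O_rules(6)[OF \<open>x \<in> \<O>\<close> O_rules(3)[OF O_rules(10) dO]] by auto
      have eq: "(g ^^ k) x = (x + of_nat k * d) + r" by (simp add: r_def)
      have "g ((g ^^ k) x) = (g x + of_nat k * g d) + g r" unfolding eq using xM csubring_of_nat[OF M_ring]
        by (simp add: ch(2,3) chom_of_nat[OF G_rules(2)[OF g] M_ring])
      hence "(g ^^ Suc k) x - (x + of_nat (Suc k) * d) = of_nat k * (g d - d) + (r + (g r - r))"
        by (simp add: gx algebra_simps)
      moreover have 1: "of_nat k * (g d - d) \<in> Dv w (Suc (Suc n))" by (rule Dv_times(2)[OF raise[OF dD] O_rules(10)])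
      moreover have 2: "g r - r \<in> Dv w (Suc (Suc n))" using raise[OF r(1)] Dv_Suc_subset[OF wO] by blast
      ultimately have "(g ^^ Suc k) x - (x + of_nat (Suc k) * d) \<in> Dv w (Suc (Suc n))"
        using Dv_add[OF 1 Dv_add[OF r(1) 2]] by (simp only:)
      thus ?case using gO[OF r(2)] by simp
    qed
    have "(g ^^ p) x = x" using p(2) Suc.prems by auto
    hence "- (of_nat p * d) \<in> Dv w (Suc (Suc n))" using it[of p] by simp
    hence "of_nat p * d \<in> Dv w (Suc (Suc n))" using Dv_minus by fastforce
    moreover have "of_nat p \<in> \<O> - P" using p(1) O_rules(10) by blast
    ultimately show ?case using Dv_cancel Dv_O[OF dD] unfolding d_def by blast
  qed
qed

text \<open>Maximality of \<open>P\<close> in disguise: \<open>g x\<close> has an inverse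
  \<open>v\<close> modulo \<open>P\<close>, and \<open>1 - x * h v\<close>, with \<open>h\<close>
  inverse to \<open>g\<close>, is outside \<open>P\<close> but is sent into it.\<close>

lemma moved_prime:
  assumes g: "g \<in> Gal M \<rat>" and x: "x \<in> P" "g x \<notin> P"
  obtains y where "y \<in> \<O> - P" "g y \<in> P"
proof -
  note ch = chom_rules[OF G_rules(2)[OF g] M_ring]
  obtain h where h: "h \<in> Gal M \<rat>" "\<And>x. x \<in> M \<Longrightarrow> g (h x) = x" using Gal_inverse[OF M Rats_M g] by metis
  have xO: "x \<in> \<O>" by (rule P_rules(1)[OF x(1)])
  have "g x \<in> \<O> - P" using G_O[OF g xO] x by blast
  then obtain v where v: "v \<in> \<O>" "1 - g x * v \<in> P" by (rule residue_inverse)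
  have hv: "h v \<in> \<O>" by (rule G_O[OF h(1) v(1)])
  have xhv: "x * h v \<in> P" by (rule P_rules(5)[OF hv x(1)])
  have "1 + - (x * h v) \<in> \<O> - P" by (rule not_P_add[OF one_not_P P_rules(6)[OF xhv]])
  moreover have "g (1 - x * h v) = 1 - g x * v"
    using xO hv v(1) h(2)[of v] O_rules(3)[OF xO hv] ch(6)[of 1 "x * h v"] ch(3)[of x "h v"] ch(1)
      csubring_basic(1)[OF M_ring] by auto
  ultimately show ?thesis using that[of "1 - x * h v"] v(2) by simp
qed

text \<open>In place of the Chinese remainder theorem: the product of the elements of
  \<open>moved_prime\<close> over all automorphisms that do not preserve \<open>P\<close>.\<close>

lemma avoiding_element:
  obtains s where "s \<in> \<O> - P" "\<And>g x. g \<in> Gal M \<rat> \<Longrightarrow> x \<in> P \<Longrightarrow> g x \<notin> P \<Longrightarrow> g s \<in> P"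
proof -
  define B where "B = {g \<in> Gal M \<rat>. \<exists>x\<in>P. g x \<notin> P}"
  have finB: "finite B" unfolding B_def using finite_Gal by simp
  have "\<exists>y. y \<in> \<O> - P \<and> g y \<in> P" if "g \<in> B" for g
    using that moved_prime[of g] unfolding B_def by blast
  then obtain y where y: "\<And>g. g \<in> B \<Longrightarrow> y g \<in> \<O> - P \<and> g (y g) \<in> P" by metis
  define s where "s = (\<Prod>g\<in>B. y g)"
  have yO: "y g \<in> \<O>" if "g \<in> B" for g using y[OF that] by blast
  have sO: "s \<in> \<O>" unfolding s_def by (intro O_rules(9) yO)
  have "s \<notin> P"
  proof
    assume "s \<in> P"
    hence "\<exists>g\<in>B. y g \<in> P" unfolding s_def by (intro prime_in_prod[OF prime O_ring finB yO])
    thus False using y by blast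
  qed
  moreover have "g s \<in> P" if g: "g \<in> Gal M \<rat>" "x \<in> P" "g x \<notin> P" for g x
  proof -
    have gB: "g \<in> B" using g by (auto simp: B_def)
    have rO: "(\<Prod>g\<in>B - {g}. y g) \<in> \<O>" using yO by (intro O_rules(9)) blast
    have "s = y g * (\<Prod>g\<in>B - {g}. y g)" unfolding s_def by (rule prod.remove[OF finB gB])
    hence "g s = g (y g) * g (\<Prod>g\<in>B - {g}. y g)"
      using yO[OF gB] rO chom_rules(3)[OF G_rules(2)[OF g(1)] M_ring, of "y g" "\<Prod>g\<in>B - {g}. y g"] by auto
    thus ?thesis using P_rules(5)[OF G_O[OF g(1) rO]] y[OF gB] by simp
  qed
  ultimately show ?thesis using sO that by blast
qed

text \<open>Automorphisms congruent modulo \<open>P\<close> differ by an inertial one. With trivial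
  inertia this is the distinctness that \<open>independent_characters\<close> asks for.\<close>

lemma inertia_distinct:
  assumes L: "L \<subseteq> M" and triv: "\<And>g. g \<in> Gal M L \<Longrightarrow> (\<And>x. x \<in> \<O> \<Longrightarrow> g x - x \<in> P) \<Longrightarrow> g = idM"
    and gh: "g \<in> Gal M L" "h \<in> Gal M L" "g \<noteq> h"
  shows "\<exists>x\<in>\<O>. g x - h x \<notin> P"
proof (rule ccontr)
  assume *: "\<not> (\<exists>x\<in>\<O>. g x - h x \<notin> P)"
  obtain k where k: "k \<in> Gal M L" "\<And>x. x \<in> M \<Longrightarrow> h (k x) = x" "\<And>x. x \<in> M \<Longrightarrow> k (h x) = x" using Gal_inverse[OF M L gh(2)] by metis
  have "compose M g k = idM"
  proof (rule triv[OF Gal_compose[OF M L gh(1) k(1)]])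
    fix x assume x: "x \<in> \<O>"
    have "g (k x) - h (k x) \<in> P" using * G_O[OF k(1) x] by blast
    thus "compose M g k x - x \<in> P" using x k(2) by (simp add: compose_eq)
  qed
  hence "g (k (h x)) = h x" if "x \<in> M" for x using G_rules(4)[OF gh(2) that] compose_eq[of "h x" M g k] by simp
  hence "g = h" using k(3) by (intro Gal_eqI[OF M gh(1,2)]) simp
  thus False using gh by simp
qed

text \<open>
  If the inertia group is trivial, the automorphisms are independent characters modulo \<open>P\<close>, and hence
  some trace of a suitable multiple of the uniformizer is not divisible by its square.
\<close>

lemma unramified_of_inertia_trivial:
  assumes w: "uniformizer w" and L: "csubfield L" "L \<subseteq> M"
    and triv: "\<And>g. g \<in> Gal M L \<Longrightarrow> (\<And>x. x \<in> \<O> \<Longrightarrow> g x - x \<in> P) \<Longrightarrow> g = idM"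
  shows "\<exists>z\<in>P \<inter> L. z \<notin> Dv w 2"
proof (rule ccontr)
  assume neg: "\<not> (\<exists>z\<in>P \<inter> L. z \<notin> Dv w 2)"
  have HG: "Gal M L \<subseteq> Gal M \<rat>" by (rule Gal_antimono[OF Rats_subset_csubfield[OF L(1)]])
  have finH: "finite (Gal M L)" using finite_subset[OF HG finite_Gal] .
  have wP: "w \<in> P" and wO: "w \<in> \<O>" using w P_rules(1) by (auto simp: uniformizer_def)
  have w0: "w \<noteq> 0" by (rule uniformizer_nonzero[OF w])
  obtain u where u: "u \<in> \<O> - P" "\<And>x. x \<in> P \<Longrightarrow> \<exists>z\<in>\<O>. u * x = w * z" using w unfolding uniformizer_def by blast
  obtain s where s: "s \<in> \<O> - P" "\<And>g x. g \<in> Gal M \<rat> \<Longrightarrow> x \<in> P \<Longrightarrow> g x \<notin> P \<Longrightarrow> g s \<in> P"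
    by (rule avoiding_element) blast
  define z where "z = w * s"
  have zO: "z \<in> \<O>" unfolding z_def using wO s by (intro O_rules(3)) auto
  \<comment> \<open>Every conjugate of \<open>z\<close> lies in \<open>P\<close>: the factor
    \<open>w\<close> serves the automorphisms preserving \<open>P\<close>, the factor
    \<open>s\<close> the others.\<close>
  have gz: "g z \<in> P" if g: "g \<in> Gal M L" for g
  proof -
    have gG: "g \<in> Gal M \<rat>" using g HG by blast
    have e: "g z = g w * g s" unfolding z_def using wO s by (intro chom_rules(3)[OF G_rules(2)[OF g] M_ring]) auto
    have O: "g w \<in> \<O>" "g s \<in> \<O>" using G_O[OF g] wO s by auto
    show ?thesis
    proof (cases "g w \<in> P")
      case True
      thus ?thesis unfolding e by (rule P_rules(5)[OF O(2)])
    next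
      case False
      thus ?thesis unfolding e by (rule P_rules(4)[OF O(1) s(2)[OF gG wP]])
    qed
  qed
  hence "\<forall>g\<in>Gal M L. \<exists>c. c \<in> \<O> \<and> u * g z = w * c" using u(2) by blast
  then obtain c where c: "\<And>g. g \<in> Gal M L \<Longrightarrow> c g \<in> \<O>" "\<And>g. g \<in> Gal M L \<Longrightarrow> u * g z = w * c g" by metis
  have id: "idM \<in> Gal M L" by (rule idM[OF L(2)])
  have "c idM \<in> P"
  proof (rule independent_characters[OF prime O_ring, of \<O> "Gal M L" "\<lambda>g x. g x" c])
    show "1 \<in> \<O>" by (rule O_rules(1))
    show "\<And>x y. x \<in> \<O> \<Longrightarrow> y \<in> \<O> \<Longrightarrow> x * y \<in> \<O>" by (rule O_rules(3))
    show "g x \<in> \<O>" if "g \<in> Gal M L" "x \<in> \<O>" for g x by (rule G_O[OF that])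
    show "g 1 = 1" if "g \<in> Gal M L" for g using G_rules(2)[OF that] by (simp add: chom_def)
    show "g (x * y) = g x * g y" if "g \<in> Gal M L" "x \<in> \<O>" "y \<in> \<O>" for g x y
      using that by (intro chom_rules(3)[OF G_rules(2)[OF that(1)] M_ring]) auto
    show "\<exists>x\<in>\<O>. g x - h x \<notin> P" if "g \<in> Gal M L" "h \<in> Gal M L" "g \<noteq> h" for g h
      by (rule inertia_distinct[OF L(2) triv that])
    fix x assume x: "x \<in> \<O>"
    \<comment> \<open>The trace lies in \<open>P\<close> and in \<open>L\<close>, so by assumption
      it has valuation at least 2. Dividing by \<open>w\<close> leaves a relation modulo
      \<open>P\<close> with coefficients \<open>c g\<close>.\<close>
    define T where "T = (\<Sum>g\<in>Gal M L. g (z * x))"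
    have gzx: "g (z * x) = g z * g x" if "g \<in> Gal M L" for g
      using zO x by (intro chom_rules(3)[OF G_rules(2)[OF that] M_ring]) auto
    have "T \<in> L" unfolding T_def using zO x csubring_basic(3)[OF M_ring] by (intro trace_mem L) auto
    moreover have "T \<in> P" unfolding T_def
      by (rule prime_in_sum[OF prime O_ring]) (simp add: gzx P_rules(5)[OF G_O[OF _ x] gz])
    ultimately have "T \<in> Dv w 2" using neg by blast
    hence "u * T \<in> Dv w 2" using Dv_times(2) u(1) by blast
    moreover have "u * T = w * (\<Sum>g\<in>Gal M L. c g * g x)" unfolding T_def sum_distrib_left
    proof (rule sum.cong[OF refl])
      fix g assume g: "g \<in> Gal M L"
      have "u * g (z * x) = (u * g z) * g x" using gzx[OF g] by simp
      thus "u * g (z * x) = w * (c g * g x)" using c(2)[OF g] by simp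
    qed
    moreover have "(\<Sum>g\<in>Gal M L. c g * g x) \<in> \<O>" by (rule O_rules(8), rule O_rules(3)[OF c(1) G_O[OF _ x]])
    ultimately show "(\<Sum>g\<in>Gal M L. c g * g x) \<in> P"
      using Dv_Suc_cancel[OF w w0, of 1] by (simp add: numeral_2_eq_2)
  qed (use finH c(1) id in auto)
  hence "c idM \<in> Dv w 1" using Dv_1[OF w] by simp
  hence "w ^ 1 * c idM \<in> Dv w (1 + 1)" by (intro Dv_mult Dv_power wO)
  hence "u * z \<in> Dv w 2" using c(2)[OF id] zO by (simp add: numeral_2_eq_2)
  hence "z \<in> Dv w 2" by (rule Dv_cancel[OF _ u(1) zO])
  hence "s \<in> P" using Dv_Suc_cancel[OF w w0, of 1 s] s by (simp add: z_def numeral_2_eq_2)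
  thus False using s by blast
qed

text \<open>An element of \<open>L\<close> of valuation one is a uniformizer fixed by inertia, and
  conversely a trace produces such an element. All later uses of \<open>unramified_extension\<close>
  pass through this criterion.\<close>

lemma unramified_iff:
  assumes w: "uniformizer w" and L: "csubfield L" "L \<subseteq> M"
  shows "\<not> P \<inter> L \<subseteq> ideal_prod (ring_of_integers M) P P \<longleftrightarrow>
    (\<forall>g\<in>Gal M L. (\<forall>x\<in>\<O>. g x - x \<in> P) \<longrightarrow> g = idM)"
  unfolding ideal_prod_square[OF w]
proof
  assume "\<not> P \<inter> L \<subseteq> Dv w 2"
  then obtain y where y: "y \<in> P" "y \<in> L" "y \<notin> Dv w 2" by blast
  show "\<forall>g\<in>Gal M L. (\<forall>x\<in>\<O>. g x - x \<in> P) \<longrightarrow> g = idM"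
  proof (intro ballI impI)
    fix g assume g: "g \<in> Gal M L" "\<forall>x\<in>\<O>. g x - x \<in> P"
    have "g \<in> Gal M \<rat>" using g(1) Gal_antimono[OF Rats_subset_csubfield[OF L(1)]] by blast
    thus "g = idM" using inertia_trivial[where g = g and y = y, OF w] g(2) y G_rules(5)[OF g(1) y(2)] by blast
  qed
next
  assume "\<forall>g\<in>Gal M L. (\<forall>x\<in>\<O>. g x - x \<in> P) \<longrightarrow> g = idM"
  thus "\<not> P \<inter> L \<subseteq> Dv w 2" using unramified_of_inertia_trivial[OF w L] by blast
qed

end

section \<open>Residue fields and the primes above a rational prime\<close>

context number_field_prime
begin

text \<open>The quotient ring is a field by \<open>residue_inverse\<close> and finite by
  \<open>finite_quotient\<close>, so its multiplicative group is cyclic.\<close>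

lemma residue_generator:
  obtains y where "y \<in> \<O> - P" "\<And>x. x \<in> \<O> - P \<Longrightarrow> \<exists>m::nat. x - y ^ m \<in> P"
proof -
  define R where "R = ring_of_integers M"
  have ops: "carrier R = \<O>" "x \<otimes>\<^bsub>R\<^esub> y = x * y" "x \<oplus>\<^bsub>R\<^esub> y = x + y" "\<one>\<^bsub>R\<^esub> = 1" "\<zero>\<^bsub>R\<^esub> = 0" for x y
    by (simp_all add: R_def ring_of_integers_def subring_of_complex_def ring_of_type_algebra_def)
  have "primeideal P R" unfolding R_def using primeideal_iff[OF O_ring] prime by simp
  then interpret I: primeideal P R .
  define h where "h = (\<lambda>x. P +>\<^bsub>R\<^esub> x)"
  have minus: "\<ominus>\<^bsub>R\<^esub> x = - x" if "x \<in> \<O>" for x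
    using that O_rules(5)[OF that] by (intro I.minus_equality) (auto simp: ops)
  have eq_iff: "h x = h y \<longleftrightarrow> x - y \<in> P" if "x \<in> \<O>" "y \<in> \<O>" for x y
    unfolding h_def using I.quotient_eq_iff_same_a_r_cos[OF I.ideal_axioms, of x y] that minus[of y]
    by (simp add: ops a_minus_def)
  have hom: "h \<in> Ring.ring_hom R (R Quot P)" unfolding h_def by (rule I.rcos_ring_hom)
  have car: "carrier (R Quot P) = h ` \<O>" unfolding h_def by (auto simp: FactRing_def A_RCOSETS_def' ops)
  interpret Q: cring "R Quot P" by (rule I.quotient_is_cring[OF I.is_cring])
  have h1: "h 1 = \<one>\<^bsub>R Quot P\<^esub>" using ring_hom_one[OF hom] by (simp add: ops)
  have h0: "h 0 = \<zero>\<^bsub>R Quot P\<^esub>" using ring_hom_zero[OF hom I.ring_axioms Q.ring_axioms] by (simp add: ops)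
  have hm: "h (x * y) = h x \<otimes>\<^bsub>R Quot P\<^esub> h y" if "x \<in> \<O>" "y \<in> \<O>" for x y
    using ring_hom_mult[OF hom, of x y] that by (simp add: ops)
  have "field (R Quot P)"
  proof (rule Q.cring_fieldI2)
    show "\<zero>\<^bsub>R Quot P\<^esub> \<noteq> \<one>\<^bsub>R Quot P\<^esub>"
    proof
      assume "\<zero>\<^bsub>R Quot P\<^esub> = \<one>\<^bsub>R Quot P\<^esub>"
      hence "h 1 = h 0" using h0 h1 by simp
      hence "1 - 0 \<in> P" using eq_iff[OF O_rules(1,4)] by blast
      thus False using P_rules(8) by simp
    qed
    fix a assume a: "a \<in> carrier (R Quot P)" "a \<noteq> \<zero>\<^bsub>R Quot P\<^esub>"
    then obtain x where x: "x \<in> \<O>" "a = h x" using car by auto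
    have "x \<notin> P" using eq_iff[OF x(1) O_rules(4)] a(2) x(2) h0 by auto
    then obtain v where v: "v \<in> \<O>" "1 - x * v \<in> P" using residue_inverse[of x] x(1) by blast
    have "h (x * v) = h 1" using eq_iff[OF O_rules(1) O_rules(3)[OF x(1) v(1)]] v(2) by simp
    thus "\<exists>b\<in>carrier (R Quot P). a \<otimes>\<^bsub>R Quot P\<^esub> b = \<one>\<^bsub>R Quot P\<^esub>"
      using hm[OF x(1) v(1)] h1 x(2) v(1) car by (intro bexI[of _ "h v"]) auto
  qed
  then interpret Q: field "R Quot P" .
  obtain a where a: "a \<in> P" "a \<noteq> 0" by (rule nonzero_mem)
  obtain F where F: "finite F" "F \<subseteq> \<O>" "\<forall>x\<in>\<O>. \<exists>r\<in>F. \<exists>y\<in>\<O>. x - r = a * y"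
    using finite_quotient[OF P_rules(1)[OF a(1)] a(2)] by (elim exE conjE)
  have "h ` \<O> \<subseteq> h ` F"
  proof (rule image_subsetI)
    fix x assume x: "x \<in> \<O>"
    obtain r y where r: "r \<in> F" "y \<in> \<O>" "x - r = a * y" using bspec[OF F(3) x] by blast
    have "x - r \<in> P" unfolding r(3) by (rule P_rules(5)[OF r(2) a(1)])
    hence "h x = h r" using eq_iff[OF x] r(1) F(2) by blast
    thus "h x \<in> h ` F" using r(1) by simp
  qed
  hence "finite (carrier (R Quot P))" unfolding car using F(1) finite_subset by blast
  then obtain b where b: "b \<in> carrier (Multiplicative_Group.mult_of (R Quot P))"
    "carrier (Multiplicative_Group.mult_of (R Quot P)) = {b [^]\<^bsub>R Quot P\<^esub> i | i::nat. i \<in> UNIV}"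
    using Q.finite_field_mult_group_has_gen by blast
  obtain y where y: "y \<in> \<O>" "b = h y" using b(1) car by auto
  have pow: "h (y ^ m) = b [^]\<^bsub>R Quot P\<^esub> m" for m :: nat
  proof (induction m)
    case (Suc m)
    have "h (y ^ Suc m) = h (y ^ m) \<otimes>\<^bsub>R Quot P\<^esub> h y"
      using hm[OF O_rules(7)[OF y(1)] y(1)] by (simp add: mult.commute)
    thus ?case using Suc y(2) by simp
  qed (simp add: h1)
  have nz: "x \<in> P \<longleftrightarrow> h x = \<zero>\<^bsub>R Quot P\<^esub>" if "x \<in> \<O>" for x
    using eq_iff[OF that O_rules(4)] h0 by simp
  show ?thesis
  proof (rule that)
    show "y \<in> \<O> - P" using y nz[OF y(1)] b(1) by auto
    fix x assume x: "x \<in> \<O> - P"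
    hence "h x \<in> carrier (Multiplicative_Group.mult_of (R Quot P))" using nz car by auto
    then obtain m :: nat where "h x = b [^]\<^bsub>R Quot P\<^esub> m" using b(2) by auto
    hence "h x = h (y ^ m)" using pow by simp
    thus "\<exists>m. x - y ^ m \<in> P" using eq_iff[of x "y ^ m"] x O_rules(7)[OF y(1)] by blast
  qed
qed

text \<open>Multiplication by \<open>s * v\<close>, which is 1 modulo \<open>P\<close>, keeps the
  residue class. The factor \<open>s\<close> lets the generator detect whether an automorphism
  preserves \<open>P\<close>, as needed for lifting inertia.\<close>

lemma residue_generator_avoiding:
  obtains y where "y \<in> \<O> - P" "\<And>x. x \<in> \<O> - P \<Longrightarrow> \<exists>m::nat. x - y ^ m \<in> P"
    "\<And>g x. g \<in> Gal M \<rat> \<Longrightarrow> x \<in> P \<Longrightarrow> g x \<notin> P \<Longrightarrow> g y \<in> P"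
proof -
  obtain c where c: "c \<in> \<O> - P" "\<And>x. x \<in> \<O> - P \<Longrightarrow> \<exists>m::nat. x - c ^ m \<in> P"
    by (rule residue_generator) blast
  obtain s where s: "s \<in> \<O> - P" "\<And>g x. g \<in> Gal M \<rat> \<Longrightarrow> x \<in> P \<Longrightarrow> g x \<notin> P \<Longrightarrow> g s \<in> P"
    by (rule avoiding_element) blast
  obtain v where v: "v \<in> \<O>" "1 - s * v \<in> P" by (rule residue_inverse[OF s(1)])
  define y where "y = s * (v * c)"
  have vc: "v * c \<in> \<O>" using v c by (intro O_rules(3)) auto
  have yO: "y \<in> \<O>" unfolding y_def using s by (intro O_rules(3)[OF _ vc]) auto
  have "c * (1 - s * v) \<in> P" using c v by (intro P_rules(4)) auto
  hence cy: "c - y \<in> P" by (simp add: y_def algebra_simps)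
  show ?thesis
  proof (rule that)
    show "y \<in> \<O> - P" using P_rules(3)[OF cy, of y] c(1) yO by auto
    fix x assume "x \<in> \<O> - P"
    then obtain m where m: "x - c ^ m \<in> P" using c(2) by blast
    have "c ^ m - y ^ m \<in> P" using c(1) yO by (intro P_cong_power cy) auto
    hence "(x - c ^ m) + (c ^ m - y ^ m) \<in> P" by (rule P_rules(3)[OF m])
    thus "\<exists>m. x - y ^ m \<in> P" by auto
  next
    fix g x assume g: "g \<in> Gal M \<rat>" "x \<in> P" "g x \<notin> P"
    have "g y = g s * g (v * c)" unfolding y_def using s vc by (intro chom_rules(3)[OF G_rules(2)[OF g(1)] M_ring]) auto
    thus "g y \<in> P" using P_rules(5)[OF G_O[OF g(1) vc] s(2)[OF g]] by simp
  qed
qed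

text \<open>Otherwise there is an element of \<open>P'\<close> all of whose conjugates avoid
  \<open>P\<close>. Its norm is a rational integer in \<open>P'\<close> but outside
  \<open>P\<close>, hence prime to \<open>l\<close>, so that \<open>1\<close> would lie in
  \<open>P'\<close>.\<close>

lemma conjugate_prime_subset:
  assumes P': "prime_in \<O> P'" and l: "prime l" "of_nat l \<in> P" "of_nat l \<in> P'"
  shows "\<exists>g\<in>Gal M \<rat>. \<forall>x\<in>P. g x \<in> P'"
proof (rule ccontr)
  assume neg: "\<not> (\<exists>g\<in>Gal M \<rat>. \<forall>x\<in>P. g x \<in> P')"
  have l0: "(of_nat l :: complex) \<noteq> 0" using l(1) by auto
  interpret P': number_field_prime M P' by unfold_locales (use P' l(3) l0 in auto)
  obtain e where e: "\<And>g. g \<in> Gal M \<rat> \<Longrightarrow> e g \<in> P \<and> g (e g) \<notin> P'" using neg by metis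
  have eO: "g (e g) \<in> \<O>" "e g \<in> \<O>" if "g \<in> Gal M \<rat>" for g using e[OF that] P_rules(1) G_O[OF that] by blast+
  \<comment> \<open>No factor lies in \<open>P'\<close>, yet for each \<open>g\<close> the factor
    belonging to the inverse of \<open>g\<close> makes \<open>g y\<close> an element of
    \<open>P\<close>. Hence \<open>x = 1 - y * v\<close> has all conjugates congruent to 1 modulo
    \<open>P\<close>.\<close>
  define y where "y = (\<Prod>g\<in>Gal M \<rat>. g (e g))"
  have "y \<in> \<O>" unfolding y_def by (intro O_rules(9) eO)
  moreover have "y \<notin> P'"
  proof
    assume "y \<in> P'"
    hence "\<exists>g\<in>Gal M \<rat>. g (e g) \<in> P'" unfolding y_def by (intro prime_in_prod[OF P' O_ring finite_Gal eO(1)])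
    thus False using e by blast
  qed
  ultimately have yO: "y \<in> \<O> - P'" by blast
  obtain v where v: "v \<in> \<O>" "1 - y * v \<in> P'" by (rule P'.residue_inverse[OF yO])
  define x where "x = 1 - y * v"
  have yv: "y * v \<in> \<O>" using yO v by (intro O_rules(3)) auto
  have xO: "x \<in> \<O>" unfolding x_def by (rule O_rules(2)[OF O_rules(1) yv])
  have gx: "g x \<notin> P" if g: "g \<in> Gal M \<rat>" for g
  proof
    assume gxP: "g x \<in> P"
    note ch = chom_rules[OF G_rules(2)[OF g] M_ring]
    obtain h where h: "h \<in> Gal M \<rat>" "\<And>x. x \<in> M \<Longrightarrow> g (h x) = x" using Gal_inverse[OF M Rats_M g] by metis
    define r where "r = (\<Prod>k\<in>Gal M \<rat> - {h}. k (e k))"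
    have rO: "r \<in> \<O>" unfolding r_def using eO by (intro O_rules(9)) blast
    have y: "y = h (e h) * r" unfolding y_def r_def by (rule prod.remove[OF finite_Gal h(1)])
    have "g (y * v) = g (h (e h)) * g (r * v)"
      using ch(3)[of "h (e h)" "r * v"] eO[OF h(1)] O_rules(3)[OF rO v(1)] by (simp add: y mult.assoc)
    also have "g (h (e h)) = e h" using h(2) eO[OF h(1)] by blast
    finally have "g (y * v) = e h * g (r * v)" .
    hence "g (y * v) \<in> P" using P_rules(5)[OF G_O[OF g O_rules(3)[OF rO v(1)]]] e[OF h(1)] by simp
    hence "g x + g (y * v) \<in> P" by (rule P_rules(3)[OF gxP])
    moreover have "g x = g 1 - g (y * v)" unfolding x_def using csubring_basic(1)[OF M_ring] yv by (intro ch(6)) auto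
    hence "g x + g (y * v) = 1" using ch(1) by simp
    ultimately show False using P_rules(8) by simp
  qed
  define N where "N = (\<Prod>g\<in>Gal M \<rat>. g x)"
  have NP: "N \<notin> P"
  proof
    assume "N \<in> P"
    hence "\<exists>g\<in>Gal M \<rat>. g x \<in> P" unfolding N_def
      by (intro prime_in_prod[OF prime O_ring finite_Gal G_O[OF _ xO]])
    thus False using gx by blast
  qed
  have "N \<in> \<rat>" unfolding N_def using xO by (intro norm_mem csubfield_Rats Rats_M) auto
  moreover have NO: "N \<in> \<O>" unfolding N_def by (rule O_rules(9), rule G_O[OF _ xO])
  ultimately have "N \<in> \<int>" using Rats_Zbar by blast
  then obtain m where m: "N = of_int m" by (auto elim: Ints_cases)
  have "N = idM x * (\<Prod>g\<in>Gal M \<rat> - {idM}. g x)" unfolding N_def by (rule prod.remove[OF finite_Gal idM[OF Rats_M]])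
  moreover have "(\<Prod>g\<in>Gal M \<rat> - {idM}. g x) \<in> \<O>" using G_O xO by (intro O_rules(9)) blast
  ultimately have NP': "N \<in> P'" using P'.P_rules(5) v(2) xO by (simp add: x_def)
  show False
  proof (cases "int l dvd m")
    case True
    then obtain k where "m = int l * k" by (rule dvdE)
    hence "N = of_nat l * of_int k" by (simp add: m)
    thus False using NP P_rules(5)[OF O_rules(11) l(2)] by simp
  next
    case False
    have "prime (int l)" using l(1) by simp
    hence "coprime (int l) m" using False by (rule prime_imp_coprime)
    then obtain a b where "a * int l + b * m = 1" by (metis cong_def bezout_int coprime_imp_gcd_eq_1)
    hence "of_int a * of_nat l + of_int b * N = 1"
      unfolding m by (metis (mono_tags) of_int_1 of_int_add of_int_mult of_int_of_nat_eq)
    moreover have "of_int a * of_nat l + of_int b * N \<in> P'"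
      by (rule P'.P_rules(3)[OF P'.P_rules(4)[OF O_rules(11) l(3)] P'.P_rules(4)[OF O_rules(11) NP']])
    ultimately show False using P'.P_rules(8) by simp
  qed
qed

end

section \<open>Places of the field of algebraic numbers\<close>

text \<open>A maximal ideal containing \<open>l\<close>, by Zorn's lemma; it is proper because
  \<open>1 / l\<close> is rational and not an integer.\<close>

lemma exists_place:
  assumes l: "prime (l::nat)"
  obtains PP where "prime_in Zbar PP" "of_nat l \<in> PP"
proof -
  define A where "A = {I. I \<subseteq> Zbar \<and> of_nat l \<in> I \<and> 1 \<notin> I \<and> (\<forall>x\<in>I. \<forall>y\<in>I. x + y \<in> I) \<and> (\<forall>r\<in>Zbar. \<forall>x\<in>I. r * x \<in> I)}"
  define I0 where "I0 = {of_nat l * z | z. z \<in> Zbar}"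
  have "I0 \<in> A" unfolding A_def
  proof (intro CollectI conjI ballI)
    show "I0 \<subseteq> Zbar" unfolding I0_def using Zbar_rules(3)[OF Zbar_rules(10)] by blast
    show "of_nat l \<in> I0" unfolding I0_def using Zbar_rules(1) by force
    show "1 \<notin> I0"
    proof
      assume "1 \<in> I0"
      then obtain z where z: "1 = of_nat l * z" "z \<in> Zbar" unfolding I0_def by blast
      have l0: "(of_nat l :: complex) \<noteq> 0" using l by auto
      hence "z = 1 / of_nat l" using z(1) by (simp add: field_simps)
      hence "z \<in> \<rat>" by simp
      hence "z \<in> \<int>" using z(2) by (rule Rats_Zbar)
      then obtain k where "z = of_int k" by (auto elim: Ints_cases)
      hence "(of_int 1 :: complex) = of_int (int l * k)" using z(1) by simp
      hence "1 = int l * k" by (simp only: of_int_eq_iff)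
      hence "int l dvd 1" by (metis dvd_triv_left)
      thus False using l by simp
    qed
  next
    fix x y assume "x \<in> I0" "y \<in> I0"
    then obtain a b where "x = of_nat l * a" "y = of_nat l * b" "a \<in> Zbar" "b \<in> Zbar" unfolding I0_def by blast
    hence "x + y = of_nat l * (a + b)" "a + b \<in> Zbar" using Zbar_rules(6) by (auto simp: algebra_simps)
    thus "x + y \<in> I0" unfolding I0_def by blast
  next
    fix r x assume "r \<in> Zbar" "x \<in> I0"
    then obtain a where "x = of_nat l * a" "a \<in> Zbar" unfolding I0_def by blast
    hence "r * x = of_nat l * (r * a)" "r * a \<in> Zbar" using \<open>r \<in> Zbar\<close> Zbar_rules(3) by auto
    thus "r * x \<in> I0" unfolding I0_def by blast
  qed
  hence A0: "A \<noteq> {}" by blast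
  have "\<exists>m\<in>A. \<forall>I\<in>A. m \<subseteq> I \<longrightarrow> I = m"
  proof (rule subset_Zorn_nonempty[OF A0])
    fix C assume C: "C \<noteq> {}" "subset.chain A C"
    have CA: "C \<subseteq> A" using C(2) by (simp add: subset_chain_def)
    obtain c where c: "c \<in> C" using C(1) by blast
    show "\<Union>C \<in> A" unfolding A_def
    proof (intro CollectI conjI ballI)
      show "\<Union>C \<subseteq> Zbar" "1 \<notin> \<Union>C" using CA unfolding A_def by blast+
      show "of_nat l \<in> \<Union>C" using CA c unfolding A_def by blast
      fix x y assume "x \<in> \<Union>C" "y \<in> \<Union>C"
      then obtain I J where IJ: "I \<in> C" "x \<in> I" "J \<in> C" "y \<in> J" by blast
      hence "I \<subseteq> J \<or> J \<subseteq> I" using C(2) unfolding subset_chain_def by blast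
      then obtain K where "K \<in> C" "x \<in> K" "y \<in> K" using IJ by blast
      moreover from this have "K \<in> A" using CA by blast
      ultimately show "x + y \<in> \<Union>C" unfolding A_def by blast
    next
      fix r x assume "r \<in> Zbar" "x \<in> \<Union>C"
      then obtain I where I: "I \<in> C" "x \<in> I" by blast
      hence "I \<in> A" using CA by blast
      hence "r * x \<in> I" using \<open>r \<in> Zbar\<close> I(2) unfolding A_def by blast
      thus "r * x \<in> \<Union>C" using I(1) by blast
    qed
  qed
  then obtain m where mA: "m \<in> A" and mmax: "\<forall>I\<in>A. m \<subseteq> I \<longrightarrow> I = m" by blast
  have mZ: "m \<subseteq> Zbar" and lm: "of_nat l \<in> m" and m1: "1 \<notin> m"
    and add: "\<And>x y. x \<in> m \<Longrightarrow> y \<in> m \<Longrightarrow> x + y \<in> m" and mult: "\<And>r x. r \<in> Zbar \<Longrightarrow> x \<in> m \<Longrightarrow> r * x \<in> m"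
    using mA unfolding A_def by blast+
  have one: "\<exists>i\<in>m. \<exists>a\<in>Zbar. 1 = i + x * a" if x: "x \<in> Zbar" "x \<notin> m" for x
  proof (rule ccontr)
    assume neg: "\<not> (\<exists>i\<in>m. \<exists>a\<in>Zbar. 1 = i + x * a)"
    define J where "J = {i + x * a | i a. i \<in> m \<and> a \<in> Zbar}"
    have m0: "0 \<in> m" using mult[OF Zbar_rules(4) lm] by simp
    have mJ: "m \<subseteq> J" unfolding J_def using Zbar_rules(4) by force
    have xJ: "x \<in> J" unfolding J_def using m0 Zbar_rules(1) by force
    have "J \<in> A" unfolding A_def
    proof (intro CollectI conjI ballI)
      show "J \<subseteq> Zbar"
      proof
        fix z assume "z \<in> J"
        then obtain i a where "z = i + x * a" "i \<in> m" "a \<in> Zbar" unfolding J_def by blast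
        thus "z \<in> Zbar" using Zbar_rules(6)[OF _ Zbar_rules(3)[OF x(1)]] mZ by blast
      qed
      show "of_nat l \<in> J" using mJ lm by blast
      show "1 \<notin> J" using neg unfolding J_def by blast
      fix u v assume "u \<in> J" "v \<in> J"
      then obtain i a i' a' where uv: "u = i + x * a" "v = i' + x * a'" and i: "i \<in> m" "a \<in> Zbar" "i' \<in> m" "a' \<in> Zbar"
        unfolding J_def by blast
      have "u + v = (i + i') + x * (a + a')" by (simp add: uv algebra_simps)
      thus "u + v \<in> J" unfolding J_def using add[OF i(1,3)] Zbar_rules(6)[OF i(2,4)] by blast
    next
      fix r u assume r: "r \<in> Zbar" and "u \<in> J"
      then obtain i a where uv: "u = i + x * a" and i: "i \<in> m" "a \<in> Zbar" unfolding J_def by blast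
      have "r * u = r * i + x * (r * a)" by (simp add: uv algebra_simps)
      thus "r * u \<in> J" unfolding J_def using mult[OF r i(1)] Zbar_rules(3)[OF r i(2)] by blast
    qed
    hence "J = m" using mmax mJ by blast
    thus False using xJ x(2) by blast
  qed
  have "prime_in Zbar m" unfolding prime_in_def
  proof (intro conjI ballI impI)
    show "0 \<in> m" using mult[OF Zbar_rules(4) lm] by simp
    fix x y assume x: "x \<in> Zbar" and y: "y \<in> Zbar" and xy: "x * y \<in> m"
    show "x \<in> m \<or> y \<in> m"
    proof (rule ccontr)
      assume "\<not> (x \<in> m \<or> y \<in> m)"
      then obtain i a where ia: "i \<in> m" "a \<in> Zbar" "1 = i + x * a" using one[OF x] by blast
      have "y = y * i + a * (x * y)" using arg_cong[OF ia(3), of "\<lambda>z. y * z"] by (simp add: algebra_simps)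
      also have "\<dots> \<in> m" by (intro add mult y ia xy)
      finally show False using \<open>\<not> (x \<in> m \<or> y \<in> m)\<close> by blast
    qed
  qed (use mZ m1 add mult in auto)
  thus ?thesis using lm that by blast
qed

subsection \<open>Finite Galois extensions inside the field of algebraic numbers\<close>

lemma adjoin_rules:
  shows "csubfield (adjoin S)" "S \<subseteq> adjoin S" "csubfield K \<Longrightarrow> S \<subseteq> K \<Longrightarrow> adjoin S \<subseteq> K"
proof -
  define R where "R = (ring_of_type_algebra :: complex ring)"
  interpret R: field R unfolding R_def by (rule field_from_type_algebra)
  have ad: "adjoin S = generate_field R S" by (simp add: adjoin_def R_def)
  have car: "S \<subseteq> carrier R" by (simp add: R_def ring_of_type_algebra_def)
  show "csubfield (adjoin S)"
    unfolding ad using R.generate_field_is_subfield[OF car] subfield_iff_csubfield by (simp add: R_def)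
  show "S \<subseteq> adjoin S" unfolding ad by (auto intro: generate_field.incl)
  show "adjoin S \<subseteq> K" if "csubfield K" "S \<subseteq> K" unfolding ad using that subfield_iff_csubfield[of K]
    by (intro R.generate_field_min_subfield1[OF car]) (auto simp: R_def)
qed

lemma adjoin_hom_eq:
  assumes "chom (adjoin S) s" "chom (adjoin S) t" "\<And>x. x \<in> S \<Longrightarrow> s x = t x" "x \<in> adjoin S"
  shows "s x = t x"
proof -
  note A = adjoin_rules(1)[of S] and R = csubfield_csubring[OF adjoin_rules(1)[of S]]
  define K where "K = {x \<in> adjoin S. s x = t x}"
  have "csubring K" unfolding csubring_def K_def
    using csubring_basic(1-3)[OF R] assms(1,2) by (auto simp: chom_rules[OF _ R])
  hence "csubfield K" unfolding csubfield_def
    by (auto simp: K_def csubfield_inverse[OF A] chom_inverse[OF assms(1) A] chom_inverse[OF assms(2) A])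
  hence "adjoin S \<subseteq> K" by (rule adjoin_rules(3)) (use assms(3) adjoin_rules(2)[of S] in \<open>auto simp: K_def\<close>)
  thus ?thesis using assms(4) by (auto simp: K_def)
qed

lemma csubfield_preimage:
  assumes "chom F s" "csubfield F" "csubfield K" shows "csubfield {x \<in> F. s x \<in> K}"
proof -
  note R = csubfield_csubring[OF assms(2)] and R' = csubfield_csubring[OF assms(3)]
  have "csubring {x \<in> F. s x \<in> K}"
    unfolding csubring_def using csubring_basic(1-3)[OF R] csubring_basic(1-3)[OF R'] assms(1)
    by (auto simp: chom_rules[OF _ R])
  thus ?thesis unfolding csubfield_def
    using csubfield_inverse[OF assms(2)] csubfield_inverse[OF assms(3)] chom_inverse[OF assms(1,2)] by auto
qed

lemma normal_adjoin:
  assumes "S \<subseteq> Qbar" "\<And>s. s \<in> G_Q \<Longrightarrow> s ` S \<subseteq> S"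
  shows "normal_field (adjoin S)" unfolding normal_field_def
proof (intro conjI ballI adjoin_rules(1))
  show "adjoin S \<subseteq> Qbar" by (rule adjoin_rules(3)[OF Qbar_field assms(1)])
  fix s assume s: "s \<in> G_Q"
  have "adjoin S \<subseteq> {x \<in> Qbar. s x \<in> adjoin S}"
  proof (rule adjoin_rules(3)[OF csubfield_preimage[OF Gal_rules(2)[OF Qbar_field s] Qbar_field adjoin_rules(1)]])
    show "S \<subseteq> {x \<in> Qbar. s x \<in> adjoin S}" using assms(1) assms(2)[OF s] adjoin_rules(2)[of S] by blast
  qed
  thus "s ` adjoin S \<subseteq> adjoin S" by blast
qed

text \<open>An automorphism is determined by its restriction to \<open>M\<close> and its permutation
  of \<open>T\<close>, which leaves finitely many.\<close>

lemma galois_number_field_adjoin: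
  assumes M: "galois_number_field M" and T: "finite T" "T \<subseteq> Qbar" "\<And>s. s \<in> G_Q \<Longrightarrow> s ` T \<subseteq> T"
  shows "galois_number_field (adjoin (M \<union> T))"
proof
  interpret M: galois_number_field M by (rule M)
  let ?F = "adjoin (M \<union> T)"
  show N: "normal_field ?F"
  proof (rule normal_adjoin)
    show "M \<union> T \<subseteq> Qbar" using M.M_Qbar T(2) by blast
    fix s assume s: "s \<in> G_Q"
    have "s ` M \<subseteq> M" using M.normal s unfolding normal_field_def by blast
    thus "s ` (M \<union> T) \<subseteq> M \<union> T" using T(3)[OF s] by blast
  qed
  hence F: "csubfield ?F" "?F \<subseteq> Qbar" by (auto simp: normal_field_def)
  have sub: "M \<subseteq> ?F" "T \<subseteq> ?F" using adjoin_rules(2)[of "M \<union> T"] by auto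
  define \<rho> where "\<rho> g = (restrict g M, restrict g T)" for g :: "complex \<Rightarrow> complex"
  have lift: "\<exists>s\<in>G_Q. \<forall>x\<in>?F. s x = g x" if "g \<in> Gal ?F \<rat>" for g
    using Gal_lift[OF F Rats_subset_csubfield[OF F(1)] that] by metis
  have "\<rho> ` Gal ?F \<rat> \<subseteq> Gal M \<rat> \<times> (T \<rightarrow>\<^sub>E T)"
  proof (rule image_subsetI)
    fix g assume "g \<in> Gal ?F \<rat>"
    then obtain s where s: "s \<in> G_Q" "\<forall>x\<in>?F. s x = g x" using lift by blast
    have "restrict g M = restrict s M" using s(2) sub(1) by (auto simp: restrict_def fun_eq_iff)
    moreover have "restrict g T = restrict s T" using s(2) sub(2) by (auto simp: restrict_def fun_eq_iff)
    ultimately show "\<rho> g \<in> Gal M \<rat> \<times> (T \<rightarrow>\<^sub>E T)"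
      using normal_restrict[OF M.normal M.Rats_M s(1)] T(3)[OF s(1)] by (auto simp: \<rho>_def)
  qed
  moreover have "finite (Gal M \<rat> \<times> (T \<rightarrow>\<^sub>E T))" using M.finite_Gal T(1) by (intro finite_cartesian_product finite_PiE) auto
  ultimately have "finite (\<rho> ` Gal ?F \<rat>)" by (rule finite_subset)
  moreover have "inj_on \<rho> (Gal ?F \<rat>)"
  proof (rule inj_onI)
    fix g h assume gh: "g \<in> Gal ?F \<rat>" "h \<in> Gal ?F \<rat>" "\<rho> g = \<rho> h"
    have "g x = h x" if "x \<in> M \<union> T" for x
      using gh(3) that unfolding \<rho>_def by (metis Pair_inject UnE restrict_apply')
    thus "g = h"
      using adjoin_hom_eq[of "M \<union> T" g h] Gal_rules(2)[OF F(1)] gh by (intro Gal_eqI[OF F(1) gh(1,2)]) blast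
  qed
  ultimately show "finite (Gal ?F \<rat>)" by (rule finite_imageD)
qed

lemma galois_number_field_Rats: "galois_number_field \<rat>"
proof
  have Q: "\<rat> \<subseteq> Qbar" by (rule Rats_subset_csubfield[OF Qbar_field])
  show "normal_field \<rat>" unfolding normal_field_def
  proof (intro conjI ballI csubfield_Rats Q image_subsetI)
    fix s x assume s: "s \<in> G_Q" and x: "x \<in> (\<rat> :: complex set)"
    show "s x \<in> \<rat>" using Gal_rules(5)[OF Qbar_field s x] x by simp
  qed
  have "g = restrict (\<lambda>x. x) \<rat>" if "g \<in> Gal \<rat> \<rat>" for g :: "complex \<Rightarrow> complex"
    using Gal_rules(5)[OF csubfield_Rats that] by (intro Gal_eqI[OF csubfield_Rats that Gal_id[OF csubfield_Rats subset_refl]]) auto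
  hence "Gal \<rat> \<rat> \<subseteq> {restrict (\<lambda>x. x) \<rat>}" by blast
  thus "finite (Gal \<rat> \<rat>)" by (rule finite_subset) simp
qed

lemma finite_orbit:
  assumes "x \<in> Qbar" shows "finite ((\<lambda>s. s x) ` G_Q)"
  by (rule finite_subset[OF _ Qbar_conjugates_finite[OF assms]])
    (use Gal_rules(2)[OF Qbar_field] csubfield_csubring[OF Qbar_field] assms in blast)

lemma galois_number_field_extend:
  assumes M: "galois_number_field M" and S: "finite S" "S \<subseteq> Qbar"
  obtains F where "galois_number_field F" "M \<subseteq> F" "S \<subseteq> F"
proof -
  define T where "T = (\<Union>x\<in>S. (\<lambda>s. s x) ` G_Q)"
  have "finite T" unfolding T_def using S finite_orbit by blast
  moreover have "T \<subseteq> Qbar" using S(2) Gal_rules(4)[OF Qbar_field] unfolding T_def by blast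
  moreover have "s ` T \<subseteq> T" if s: "s \<in> G_Q" for s
  proof
    fix y assume "y \<in> s ` T"
    then obtain x t where x: "x \<in> S" "t \<in> G_Q" "y = s (t x)" unfolding T_def by blast
    have "compose Qbar s t \<in> G_Q" by (rule Gal_compose[OF Qbar_field Rats_subset_csubfield[OF Qbar_field] s x(2)])
    moreover have "y = compose Qbar s t x" using x S(2) by (simp add: compose_eq subset_iff)
    ultimately show "y \<in> T" unfolding T_def using x(1) by blast
  qed
  ultimately have "galois_number_field (adjoin (M \<union> T))" by (intro galois_number_field_adjoin M)
  moreover have "S \<subseteq> T"
  proof
    fix x assume x: "x \<in> S"
    have "restrict (\<lambda>x. x) Qbar \<in> G_Q" by (rule Gal_id[OF Qbar_field Rats_subset_csubfield[OF Qbar_field]])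
    moreover have "x = restrict (\<lambda>x. x) Qbar x" using x S(2) by auto
    ultimately show "x \<in> T" unfolding T_def using x by blast
  qed
  ultimately show ?thesis using that adjoin_rules(2)[of "M \<union> T"] by blast
qed

subsection \<open>Lifting inertia\<close>

lemma prime_in_restrict:
  assumes "prime_in Zbar PP" "csubfield K" shows "prime_in (K \<inter> Zbar) (PP \<inter> K)"
proof -
  note K = csubring_basic[OF csubfield_csubring[OF assms(2)]] and pr = prime_in_rules[OF assms(1) csubring_Zbar]
  show ?thesis unfolding prime_in_def
  proof (intro conjI ballI impI)
    show "PP \<inter> K \<subseteq> K \<inter> Zbar" using pr(1) by blast
    show "0 \<in> PP \<inter> K" "1 \<notin> PP \<inter> K" using pr(2,8) K(4) by blast+
    show "x + y \<in> PP \<inter> K" if "x \<in> PP \<inter> K" "y \<in> PP \<inter> K" for x y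
      using pr(3)[of x y] K(6)[of x y] that by blast
    show "x * y \<in> PP \<inter> K" if "x \<in> K \<inter> Zbar" "y \<in> PP \<inter> K" for x y
      using pr(4)[of x y] K(3)[of x y] that by blast
    show "x \<in> PP \<inter> K \<or> y \<in> PP \<inter> K" if "x \<in> K \<inter> Zbar" "y \<in> K \<inter> Zbar" "x * y \<in> PP \<inter> K" for x y
      using pr(9)[of x y] that by blast
  qed
qed

lemma G_Q_Zbar: "s \<in> G_Q \<Longrightarrow> x \<in> Zbar \<Longrightarrow> s x \<in> Zbar"
  using chom_Zbar[OF Gal_rules(2)[OF Qbar_field] csubfield_csubring[OF Qbar_field]] Zbar_subset_Qbar by blast

lemmas Q_ring = csubfield_csubring[OF Qbar_field]
lemmas GQ_rules = Gal_rules[OF Qbar_field]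
lemmas Rats_Qbar = Rats_subset_csubfield[OF Qbar_field]

lemma coeff_prod_linear_hom:
  assumes s: "chom K s" and K: "csubring K" and f: "\<And>h. h \<in> I \<Longrightarrow> f h \<in> K"
  shows "s (coeff (\<Prod>h\<in>I. [:- f h, 1:]) n) = coeff (\<Prod>h\<in>I. [:- s (f h), 1:]) n" using f
proof (induction I arbitrary: n rule: infinite_finite_induct)
  case (insert h I)
  define q where "q = (\<Prod>h\<in>I. [:- f h, 1:])"
  define q' where "q' = (\<Prod>h\<in>I. [:- s (f h), 1:])"
  have IH: "s (coeff q n) = coeff q' n" for n using insert unfolding q_def q'_def by blast
  have qK: "coeff q n \<in> K" for n unfolding q_def using insert.prems by (intro coeff_prod_linear_mem K) auto
  have fh: "f h \<in> K" using insert.prems by blast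
  have co: "coeff ([:- a, 1:] * r) n = (case n of 0 \<Rightarrow> 0 | Suc k \<Rightarrow> coeff r k) - a * coeff r n" for a and r :: "complex poly"
    by (simp add: coeff_pCons split: nat.split)
  have "s (coeff ([:- f h, 1:] * q) n) = coeff ([:- s (f h), 1:] * q') n"
    unfolding co using qK fh IH chom_rules[OF s K] csubring_basic[OF K] by (cases n) auto
  thus ?case unfolding q_def q'_def prod.insert[OF insert.hyps] .
next
  case (infinite A)
  thus ?case using chom_rules(1,4)[OF s K] by (simp add: coeff_1)
next
  case empty
  thus ?case using chom_rules(1,4)[OF s K] by (simp add: coeff_1)
qed

text \<open>
  Some conjugate of the generator \<open>y\<close> of the residue field over \<open>M\<close> is moved by \<open>s\<close> to something
  congruent to \<open>y\<close>, since \<open>s\<close> fixes the conjugate polynomial modulo \<open>PP\<close>.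
\<close>

lemma inertia_lift_step:
  assumes M: "galois_number_field M" and F: "galois_number_field F" and MF: "M \<subseteq> F"
    and PP: "prime_in Zbar PP" "of_nat l \<in> PP" "l \<noteq> 0"
    and s: "s \<in> G_Q" "\<And>x. x \<in> M \<inter> Zbar \<Longrightarrow> s x - x \<in> PP"
  shows "\<exists>t\<in>G_Q. (\<forall>x\<in>M. t x = s x) \<and> (\<forall>x\<in>F \<inter> Zbar. t x - x \<in> PP)"
proof -
  interpret M: galois_number_field M by (rule M)
  interpret F: number_field_prime F "PP \<inter> F"
  proof (rule number_field_prime.intro[OF F], unfold_locales)
    interpret F: galois_number_field F by (rule F)
    show "prime_in (F \<inter> Zbar) (PP \<inter> F)" by (rule prime_in_restrict[OF PP(1) F.M])
    have "(of_nat l :: complex) \<in> F" by (rule csubring_of_nat[OF F.M_ring])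
    hence "of_nat l \<in> PP \<inter> F" using PP(2) by blast
    moreover have "(of_nat l :: complex) \<noteq> 0" using PP(3) by simp
    ultimately show "PP \<inter> F \<noteq> {0}" by blast
  qed
  obtain y where y: "y \<in> F \<inter> Zbar - (PP \<inter> F)" "\<And>x. x \<in> F \<inter> Zbar - (PP \<inter> F) \<Longrightarrow> \<exists>m::nat. x - y ^ m \<in> PP \<inter> F"
    "\<And>g x. g \<in> Gal F \<rat> \<Longrightarrow> x \<in> PP \<inter> F \<Longrightarrow> g x \<notin> PP \<inter> F \<Longrightarrow> g y \<in> PP \<inter> F"
    by (rule F.residue_generator_avoiding) blast
  have yF: "y \<in> F \<inter> Zbar" using y(1) by blast
  define H where "H = Gal F M"
  have finH: "finite H" unfolding H_def by (rule F.finite_Gal_sub[OF M.Rats_M])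
  have hy: "h y \<in> F \<inter> Zbar" if "h \<in> H" for h using F.G_O[of h M y] that yF by (simp add: H_def)
  define f where "f = (\<Prod>h\<in>H. [:- h y, 1:])"
  have fO: "coeff f n \<in> M \<inter> Zbar" for n
  proof -
    have "coeff f n \<in> F \<inter> Zbar" unfolding f_def by (rule coeff_prod_linear_mem[OF F.O_ring hy])
    moreover have "coeff f n \<in> M"
    proof (rule normal_fixed[OF F.normal M.M MF])
      show "coeff f n \<in> F" using calculation by blast
      fix k assume k: "k \<in> Gal F M"
      have "k (coeff f n) = coeff (\<Prod>h\<in>H. [:- k (h y), 1:]) n"
        unfolding f_def using hy by (intro coeff_prod_linear_hom[OF F.G_rules(2)[OF k] F.M_ring]) auto
      also have "(\<Prod>h\<in>H. [:- k (h y), 1:]) = (\<Prod>h\<in>H. [:- (compose F k h) y, 1:])"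
        using yF by (simp add: compose_eq)
      also have "\<dots> = f"
        unfolding f_def H_def by (rule prod.reindex_bij_betw[OF Gal_bij_compose[OF F.M MF k], of "\<lambda>h. [:- h y, 1:]"])
      finally show "k (coeff f n) = coeff f n" .
    qed
    ultimately show ?thesis by blast
  qed
  define f' where "f' = (\<Prod>h\<in>H. [:- s (h y), 1:])"
  have hQ: "h y \<in> Qbar" if "h \<in> H" for h using hy[OF that] Zbar_subset_Qbar by blast
  have cf': "s (coeff f n) = coeff f' n" for n
    unfolding f_def f'_def by (rule coeff_prod_linear_hom[OF GQ_rules(2)[OF s(1)] Q_ring hQ])
  have "poly f y = 0" unfolding f_def poly_prod using F.idM[OF MF] finH yF
    by (intro prod_zero bexI[of _ "restrict (\<lambda>x. x) F"]) (auto simp: H_def)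
  have "poly f' y = poly f' y - poly f y" using \<open>poly f y = 0\<close> by simp
  also have "\<dots> = poly (f' - f) y" by simp
  also have "\<dots> \<in> PP" unfolding poly_altdef
  proof (rule prime_in_sum[OF PP(1) csubring_Zbar])
    fix n
    have "coeff (f' - f) n \<in> PP" using s(2)[OF fO[of n]] cf'[of n] by simp
    thus "coeff (f' - f) n * y ^ n \<in> PP" using yF by (intro prime_in_rules(5)[OF PP(1) csubring_Zbar] Zbar_rules(7)) auto
  qed
  finally have "(\<Prod>h\<in>H. y - s (h y)) \<in> PP" by (simp add: f'_def poly_prod)
  hence "\<exists>h\<in>H. y - s (h y) \<in> PP" using yF hy G_Q_Zbar[OF s(1)] Zbar_rules(2)
    by (intro prime_in_prod[OF PP(1) csubring_Zbar finH]) auto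
  then obtain h where h: "h \<in> H" "y - s (h y) \<in> PP" by blast
  obtain h' where h': "h' \<in> Gal Qbar M" "\<And>x. x \<in> F \<Longrightarrow> h' x = h x"
    using Gal_lift[OF F.M F.M_Qbar MF] h(1) unfolding H_def by metis
  have h'G: "h' \<in> G_Q" using Gal_Rats[OF Qbar_field h'(1)] .
  define t where "t = compose Qbar s h'"
  have tG: "t \<in> G_Q" unfolding t_def by (rule Gal_compose[OF Qbar_field Rats_Qbar s(1) h'G])
  have tx: "t x = s (h' x)" if "x \<in> Qbar" for x using that by (simp add: t_def compose_eq)
  define g where "g = restrict t F"
  have gG: "g \<in> Gal F \<rat>" unfolding g_def by (rule normal_restrict[OF F.normal F.Rats_M tG])
  have gt: "g x = t x" if "x \<in> F" for x using that by (simp add: g_def)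
  have tF: "t x \<in> F" if "x \<in> F" for x using F.G_rules(4)[OF gG that] gt[OF that] by simp
  have ty: "t y - y \<in> PP \<inter> F"
  proof -
    have "t y = s (h y)" using tx[of y] h'(2)[of y] yF F.M_Qbar by auto
    hence "- (y - s (h y)) = t y - y" by simp
    hence "t y - y \<in> PP" using prime_in_rules(6)[OF PP(1) csubring_Zbar h(2)] by simp
    thus ?thesis using csubring_basic(2)[OF F.M_ring tF] yF by blast
  qed
  \<comment> \<open>If \<open>t\<close> moved the prime, the choice of \<open>y\<close> would send
    \<open>y\<close> into it, whereas \<open>t y\<close> is congruent to \<open>y\<close>, which is
    outside.\<close>
  have stab: "t x \<in> PP \<inter> F" if x: "x \<in> PP \<inter> F" for x
  proof (rule ccontr)
    assume "t x \<notin> PP \<inter> F"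
    hence "g y \<in> PP \<inter> F" using y(3)[OF gG x] gt x by auto
    hence "t y \<in> PP \<inter> F" using gt yF by auto
    hence "t y - (t y - y) \<in> PP \<inter> F" by (rule F.P_rules(7)[OF _ ty])
    thus False using y(1) by simp
  qed
  have "t x - x \<in> PP" if x: "x \<in> F \<inter> Zbar" for x
  proof (cases "x \<in> PP \<inter> F")
    case True
    thus ?thesis using F.P_rules(7)[OF stab[OF True] True] by blast
  next
    case False
    then obtain m where m: "x - y ^ m \<in> PP \<inter> F" using y(2) x by blast
    have xQ: "x \<in> Qbar" "y \<in> Qbar" using x yF F.M_Qbar by auto
    have "t (x - y ^ m) = t x - t y ^ m"
      using xQ by (simp add: chom_rules(6)[OF GQ_rules(2)[OF tG] Q_ring] chom_power[OF GQ_rules(2)[OF tG] Q_ring] csubring_power[OF Q_ring])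
    hence 1: "t x - t y ^ m \<in> PP \<inter> F" using stab[OF m] by simp
    have "t y \<in> F \<inter> Zbar" using tF yF G_Q_Zbar[OF tG] by auto
    hence 2: "t y ^ m - y ^ m \<in> PP \<inter> F" by (rule F.P_cong_power[OF _ yF ty])
    have "t x - x = (t x - t y ^ m) + (t y ^ m - y ^ m) - (x - y ^ m)" by simp
    also have "\<dots> \<in> PP \<inter> F" by (rule F.P_rules(7)[OF F.P_rules(3)[OF 1 2] m])
    finally show ?thesis by blast
  qed
  moreover have "t x = s x" if "x \<in> M" for x using tx[of x] GQ_rules(5)[OF h'(1) that] that M.M_Qbar by auto
  ultimately show ?thesis using tG by blast
qed

text \<open>Countability allows automorphisms to be extended along a sequence of number fields that
  exhausts \<open>Qbar\<close>.\<close>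

lemma countable_Qbar: "countable Qbar"
proof -
  have "Qbar \<subseteq> (\<Union>l\<in>{l::int list. Poly l \<noteq> 0}. {x. poly (of_int_poly (Poly l)) x = 0})"
  proof
    fix x assume "x \<in> Qbar"
    then obtain p :: "int poly" where p: "p \<noteq> 0" "poly (of_int_poly p) x = 0" unfolding Qbar_iff_int_poly by blast
    thus "x \<in> (\<Union>l\<in>{l::int list. Poly l \<noteq> 0}. {x. poly (of_int_poly (Poly l)) x = 0})"
      by (intro UN_I[of "coeffs p"]) auto
  qed
  moreover have "countable (\<Union>l\<in>{l::int list. Poly l \<noteq> 0}. {x::complex. poly (of_int_poly (Poly l)) x = 0})"
    by (rule countable_UN[OF countableI_type countable_finite[OF poly_roots_finite]]) simp
  ultimately show ?thesis by (rule countable_subset)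
qed

text \<open>Successive steps of \<open>inertia_lift_step\<close> give compatible automorphisms,
  inertial on an increasing sequence of Galois number fields; they glue to an element of
  \<open>G_Q\<close>.\<close>

lemma inertia_lift:
  assumes M: "galois_number_field M"
    and PP: "prime_in Zbar PP" "of_nat l \<in> PP" "l \<noteq> 0"
    and s: "s \<in> G_Q" "\<And>x. x \<in> M \<inter> Zbar \<Longrightarrow> s x - x \<in> PP"
  obtains t where "t \<in> G_Q" "\<And>x. x \<in> M \<Longrightarrow> t x = s x" "\<And>x. x \<in> Zbar \<Longrightarrow> t x - x \<in> PP"
proof -
  \<comment> \<open>A state is a field together with an automorphism that is inertial on it. The
    relation \<open>Qr\<close> demands compatibility and that the next field contain the next
    algebraic number of the enumeration.\<close>
  define Pr where "Pr = (\<lambda>(n::nat) (F, u). galois_number_field F \<and> u \<in> G_Q \<and> (\<forall>x\<in>F \<inter> Zbar. u x - x \<in> PP) \<and> M \<subseteq> F \<and> (\<forall>x\<in>M. u x = s x))"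
  define Qr where "Qr = (\<lambda>(n::nat) (F, u :: complex \<Rightarrow> complex) (F', u' :: complex \<Rightarrow> complex). F \<subseteq> F' \<and> from_nat_into Qbar n \<in> F' \<and> (\<forall>x\<in>F. u' x = u x))"
  have Q0: "Qbar \<noteq> {}" using csubring_basic(1)[OF Q_ring] by blast
  have "\<exists>f. \<forall>n. Pr n (f n) \<and> Qr n (f n) (f (Suc n))"
  proof (rule dependent_nat_choice[of Pr Qr])
    show "\<exists>x. Pr 0 x" by (rule exI[of _ "(M, s)"]) (use M s in \<open>auto simp: Pr_def\<close>)
    fix Fu n assume "Pr n Fu"
    then obtain F u where Fu: "Fu = (F, u)" "galois_number_field F" "u \<in> G_Q" "\<And>x. x \<in> F \<inter> Zbar \<Longrightarrow> u x - x \<in> PP" "M \<subseteq> F" "\<And>x. x \<in> M \<Longrightarrow> u x = s x"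
      unfolding Pr_def by (cases Fu) auto
    obtain F' where F': "galois_number_field F'" "F \<subseteq> F'" "{from_nat_into Qbar n} \<subseteq> F'"
      by (rule galois_number_field_extend[OF Fu(2), of "{from_nat_into Qbar n}"]) (use from_nat_into[OF Q0] in auto)
    obtain u' where u': "u' \<in> G_Q" "\<forall>x\<in>F. u' x = u x" "\<forall>x\<in>F' \<inter> Zbar. u' x - x \<in> PP"
      using inertia_lift_step[OF Fu(2) F'(1,2) PP Fu(3,4)] by blast
    show "\<exists>y. Pr (Suc n) y \<and> Qr n Fu y"
      by (rule exI[of _ "(F', u')"]) (use Fu F' u' in \<open>auto simp: Pr_def Qr_def\<close>)
  qed
  then obtain f where f: "\<And>n. Pr n (f n)" "\<And>n. Qr n (f n) (f (Suc n))" by blast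
  define F u where "F n = fst (f n)" and "u n = snd (f n)" for n
  have P: "galois_number_field (F n)" "u n \<in> G_Q" "x \<in> F n \<inter> Zbar \<Longrightarrow> u n x - x \<in> PP" "M \<subseteq> F n" "x \<in> M \<Longrightarrow> u n x = s x" for n x
    using f(1)[of n] by (auto simp: Pr_def F_def u_def split: prod.splits)
  have Q: "F n \<subseteq> F (Suc n)" "from_nat_into Qbar n \<in> F (Suc n)" "x \<in> F n \<Longrightarrow> u (Suc n) x = u n x" for n x
    using f(2)[of n] by (auto simp: Qr_def F_def u_def split: prod.splits)
  have mono: "F n \<subseteq> F m \<and> (\<forall>x\<in>F n. u m x = u n x)" if "n \<le> m" for n m using that
  proof (induction m rule: dec_induct)
    case (step m)
    thus ?case using Q(1)[of m] Q(3)[of _ m] by auto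
  qed simp
  have ex: "\<exists>n. x \<in> F n" if "x \<in> Qbar" for x
    using Q(2)[of "to_nat_on Qbar x"] from_nat_into_to_nat_on[OF countable_Qbar that] by auto
  \<comment> \<open>The glued map takes its value at the first stage containing the argument; by
    \<open>mono\<close> every later stage gives the same value.\<close>
  define N where "N x = (LEAST n. x \<in> F n)" for x
  have N: "x \<in> F (N x)" if "x \<in> Qbar" for x unfolding N_def using LeastI_ex[OF ex[OF that]] .
  define t where "t x = u (N x) x" for x
  have t: "t x = u n x" if "x \<in> F n" for x n
  proof -
    have "N x \<le> n" unfolding N_def by (rule Least_le) (rule that)
    moreover have "x \<in> F (N x)" unfolding N_def by (rule LeastI[of _ n]) (rule that)
    ultimately show ?thesis using mono unfolding t_def by metis
  qed
  have "chom Qbar t" unfolding chom_def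
  proof (intro conjI ballI)
    show "t 1 = 1" using N[OF csubring_basic(1)[OF Q_ring]] t chom_rules(1)[OF GQ_rules(2)[OF P(2)] Q_ring] by metis
    fix x y assume xy: "x \<in> Qbar" "y \<in> Qbar"
    define n where "n = max (N x) (N y)"
    have xF: "x \<in> F n" "y \<in> F n" using N[OF xy(1)] N[OF xy(2)] mono[of "N x" n] mono[of "N y" n] unfolding n_def by auto
    interpret F: galois_number_field "F n" by (rule P(1))
    have "x + y \<in> F n" "x * y \<in> F n" using xF csubring_basic[OF F.M_ring] by auto
    thus "t (x + y) = t x + t y" "t (x * y) = t x * t y"
      using xF xy chom_rules(2,3)[OF GQ_rules(2)[OF P(2)[of n]] Q_ring] by (simp_all add: t)
  qed
  hence "restrict t Qbar \<in> G_Q" using chom_Rats[OF _ Qbar_field] Rats_Qbar by (intro chom_Qbar_Gal) auto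
  moreover have "t x = s x" if "x \<in> M" for x using t[of x 0] P(4)[of 0] P(5)[OF that] that by auto
  moreover have "t x - x \<in> PP" if "x \<in> Zbar" for x
    using P(3)[of x "N x"] N[of x] t[of x "N x"] that Zbar_subset_Qbar by auto
  moreover have "M \<subseteq> Qbar" using M by (auto simp: galois_number_field_def normal_field_def)
  ultimately show ?thesis using that[of "restrict t Qbar"] Zbar_subset_Qbar by (auto simp: subset_iff)
qed

lemma prime_in_image:
  assumes s: "s \<in> G_Q" and PP: "prime_in Zbar PP" shows "prime_in Zbar (s ` PP)"
proof -
  obtain t where t: "t \<in> G_Q" "\<And>x. x \<in> Qbar \<Longrightarrow> s (t x) = x" "\<And>x. x \<in> Qbar \<Longrightarrow> t (s x) = x"
    using Gal_inverse[OF Qbar_field Rats_Qbar s] by metis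
  note ZQ = subsetD[OF Zbar_subset_Qbar] and ch = chom_rules[OF GQ_rules(2)[OF s] Q_ring] and cht = chom_rules[OF GQ_rules(2)[OF t(1)] Q_ring]
  note pr = prime_in_rules[OF PP csubring_Zbar]
  have mem: "x \<in> s ` PP \<longleftrightarrow> t x \<in> PP" if "x \<in> Zbar" for x
  proof
    assume "x \<in> s ` PP"
    then obtain z where "z \<in> PP" "x = s z" by blast
    thus "t x \<in> PP" using t(3)[OF ZQ[OF pr(1)]] by simp
  next
    assume "t x \<in> PP"
    hence "s (t x) \<in> s ` PP" by blast
    thus "x \<in> s ` PP" using t(2)[OF ZQ[OF that]] by simp
  qed
  have sub: "s ` PP \<subseteq> Zbar" using pr(1) G_Q_Zbar[OF s] by blast
  show ?thesis unfolding prime_in_def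
  proof (intro conjI ballI impI sub)
    show "0 \<in> s ` PP" using mem[OF Zbar_rules(4)] cht(4) pr(2) by simp
    show "1 \<notin> s ` PP" using mem[OF Zbar_rules(1)] cht(1) pr(8) by simp
    show "x + y \<in> s ` PP" if "x \<in> s ` PP" "y \<in> s ` PP" for x y
    proof -
      have Z: "x \<in> Zbar" "y \<in> Zbar" using that sub by blast+
      have "t (x + y) = t x + t y" using Z ZQ by (intro cht(2)) auto
      thus ?thesis using mem[OF Zbar_rules(6)[OF Z]] mem[OF Z(1)] mem[OF Z(2)] that pr(3) by simp
    qed
    show "r * x \<in> s ` PP" if "r \<in> Zbar" "x \<in> s ` PP" for r x
    proof -
      have Z: "x \<in> Zbar" using that sub by blast
      have "t (r * x) = t r * t x" using Z that ZQ by (intro cht(3)) auto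
      thus ?thesis using mem[OF Zbar_rules(3)[OF that(1) Z]] mem[OF Z] that pr(4)[OF G_Q_Zbar[OF t(1) that(1)]] by simp
    qed
    show "x \<in> s ` PP \<or> y \<in> s ` PP" if "x \<in> Zbar" "y \<in> Zbar" "x * y \<in> s ` PP" for x y
    proof -
      have "t (x * y) = t x * t y" using that ZQ by (intro cht(3)) auto
      hence "t x * t y \<in> PP" using mem[OF Zbar_rules(3)[OF that(1,2)]] that(3) by simp
      hence "t x \<in> PP \<or> t y \<in> PP" by (rule pr(9)) (rule G_Q_Zbar[OF t(1)], fact)+
      thus ?thesis using mem that by blast
    qed
  qed
qed

text \<open>Any place over \<open>l\<close> can be moved so that the prime below it is contained in
  \<open>P\<close>; residue inverses make nonzero primes maximal, so the inclusion is an
  equality.\<close>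

lemma (in number_field_prime) place_above:
  assumes l: "prime l" "of_nat l \<in> P"
  obtains PP where "prime_in Zbar PP" "PP \<inter> M = P"
proof -
  obtain PP0 where PP0: "prime_in Zbar PP0" "of_nat l \<in> PP0" by (rule exists_place[OF l(1)])
  have P0: "prime_in \<O> (PP0 \<inter> M)" by (rule prime_in_restrict[OF PP0(1) M])
  have l0: "(of_nat l :: complex) \<noteq> 0" using l(1) by auto
  have lM: "of_nat l \<in> PP0 \<inter> M" using PP0(2) csubring_of_nat[OF M_ring] by blast
  interpret P0: number_field_prime M "PP0 \<inter> M"
  proof unfold_locales
    show "PP0 \<inter> M \<noteq> {0}" using lM l0 by blast
  qed (rule P0)
  obtain g where g: "g \<in> Gal M \<rat>" "\<And>x. x \<in> PP0 \<inter> M \<Longrightarrow> g x \<in> P"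
    using P0.conjugate_prime_subset[OF prime l(1) lM l(2)] by blast
  obtain s where s: "s \<in> G_Q" "\<And>x. x \<in> M \<Longrightarrow> s x = g x" using Gal_lift[OF M M_Qbar Rats_M g(1)] by metis
  obtain h where h: "h \<in> Gal M \<rat>" "\<And>x. x \<in> M \<Longrightarrow> g (h x) = x" "\<And>x. x \<in> M \<Longrightarrow> h (g x) = x" using Gal_inverse[OF M Rats_M g(1)] by metis
  have PP: "prime_in Zbar (s ` PP0)" by (rule prime_in_image[OF s(1) PP0(1)])
  have 1: "s ` PP0 \<inter> M \<subseteq> P"
  proof
    fix x assume x: "x \<in> s ` PP0 \<inter> M"
    then obtain z where z: "z \<in> PP0" "x = s z" by blast
    have hx: "h x \<in> M" "s (h x) = x" using x G_rules(4)[OF h(1)] s(2) h(2) by auto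
    have zQ: "z \<in> Qbar" using z(1) prime_in_rules(1)[OF PP0(1) csubring_Zbar] Zbar_subset_Qbar by blast
    have "z = h x" using inj_onD[OF GQ_rules(6)[OF s(1)], of z "h x"] hx z zQ M_Qbar by auto
    hence "g z \<in> P" using g(2) z hx by blast
    moreover have "g z = x" unfolding \<open>z = h x\<close> using h(2) x by blast
    ultimately show "x \<in> P" by metis
  qed
  have "P \<subseteq> s ` PP0 \<inter> M"
  proof
    fix x assume x: "x \<in> P"
    show "x \<in> s ` PP0 \<inter> M"
    proof (rule ccontr)
      assume "x \<notin> s ` PP0 \<inter> M"
      have xO: "x \<in> \<O>" by (rule P_rules(1)[OF x])
      have PM: "prime_in \<O> (s ` PP0 \<inter> M)" by (rule prime_in_restrict[OF PP M])
      have "s (of_nat l) = of_nat l" by (rule chom_of_nat[OF GQ_rules(2)[OF s(1)] Q_ring])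
      hence lm: "of_nat l \<in> s ` PP0 \<inter> M" using PP0(2) csubring_of_nat[OF M_ring] by (metis IntI imageI)
      interpret P1: number_field_prime M "s ` PP0 \<inter> M"
      proof unfold_locales
        show "s ` PP0 \<inter> M \<noteq> {0}" using lm l0 by blast
      qed (rule PM)
      obtain v where v: "v \<in> \<O>" "1 - x * v \<in> s ` PP0 \<inter> M"
        using P1.residue_inverse[of x] xO \<open>x \<notin> s ` PP0 \<inter> M\<close> by blast
      have "(1 - x * v) + x * v \<in> P" using 1 v(2) by (intro P_rules(3) P_rules(5)[OF v(1) x]) blast
      thus False using P_rules(8) by simp
    qed
  qed
  thus ?thesis using that[OF PP] 1 by blast
qed

subsection \<open>Open subgroups\<close>

abbreviation "idQ \<equiv> restrict (\<lambda>x. x) Qbar"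

lemma idQ: "K \<subseteq> Qbar \<Longrightarrow> idQ \<in> Gal Qbar K" by (rule Gal_id[OF Qbar_field])

definition gal_subgroup :: "(complex \<Rightarrow> complex) set \<Rightarrow> bool" where
  "gal_subgroup U \<longleftrightarrow> U \<subseteq> G_Q \<and> idQ \<in> U \<and> (\<forall>s\<in>U. \<forall>t\<in>U. compose Qbar s t \<in> U) \<and>
     (\<forall>s\<in>U. \<forall>t\<in>G_Q. (\<forall>x\<in>Qbar. s (t x) = x) \<longrightarrow> t \<in> U)"

lemma fixed_field_csubfield:
  assumes "U \<subseteq> G_Q" shows "csubfield {x \<in> Qbar. \<forall>s\<in>U. s x = x}"
proof -
  have ch: "chom Qbar s" if "s \<in> U" for s using GQ_rules(2) assms that by blast
  note Q = csubring_basic(1-3)[OF Q_ring] and r = chom_rules[OF ch Q_ring]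
  have "s (x - y) = x - y" "s (x * y) = x * y" "s (inverse x) = inverse x" "s 1 = 1"
    if "s \<in> U" "x \<in> Qbar" "y \<in> Qbar" "s x = x" "s y = y" for s x y
    using r(6)[of s x y] r(3)[of s x y] chom_inverse[OF ch Qbar_field, of s x] r(1)[of s] that by metis+
  thus ?thesis unfolding csubfield_def csubring_def using Q csubfield_inverse[OF Qbar_field] r(1) by (simp; blast)
qed

text \<open>The Galois correspondence for an open subgroup. Inside a Galois number field
  \<open>F\<close> containing \<open>S\<close> the image of \<open>U\<close> is complete, so
  \<open>t\<close> agrees on \<open>F\<close> with some \<open>s\<close> in \<open>U\<close>; then
  \<open>t\<close> differs from \<open>s\<close> by an automorphism fixing \<open>S\<close>, which
  also belongs to \<open>U\<close>.\<close>

lemma open_subgroup_closed: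
  assumes U: "gal_subgroup U" and S: "finite S" "S \<subseteq> Qbar" "\<And>s. s \<in> G_Q \<Longrightarrow> (\<And>x. x \<in> S \<Longrightarrow> s x = x) \<Longrightarrow> s \<in> U"
    and t: "t \<in> Gal Qbar {x \<in> Qbar. \<forall>s\<in>U. s x = x}"
  shows "t \<in> U"
proof -
  have UG: "U \<subseteq> G_Q" and Ucomp: "\<And>s t. s \<in> U \<Longrightarrow> t \<in> U \<Longrightarrow> compose Qbar s t \<in> U"
    and Uinv: "\<And>s t. s \<in> U \<Longrightarrow> t \<in> G_Q \<Longrightarrow> (\<And>x. x \<in> Qbar \<Longrightarrow> s (t x) = x) \<Longrightarrow> t \<in> U"
    and Uid: "idQ \<in> U" using U unfolding gal_subgroup_def by blast+
  have tG: "t \<in> G_Q" by (rule Gal_Rats[OF Qbar_field t])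
  obtain F where F: "galois_number_field F" "S \<subseteq> F"
    using galois_number_field_extend[OF galois_number_field_Rats S(1,2)] by metis
  interpret F: galois_number_field F by (rule F(1))
  define A where "A = (\<lambda>s. restrict s F) ` U"
  have AG: "A \<subseteq> Gal F \<rat>" unfolding A_def using normal_restrict[OF F.normal F.Rats_M] UG by blast
  have stab: "s x \<in> F" if "s \<in> G_Q" "x \<in> F" for s x using F.normal that unfolding normal_field_def by blast
  have comp: "compose F (restrict s F) (restrict u F) = restrict (compose Qbar s u) F" if "s \<in> U" "u \<in> U" for s u
    using that UG stab F.M_Qbar by (auto simp: compose_def fun_eq_iff subset_iff)
  have "restrict t F \<in> A"
  proof (rule Galois_subgroup_complete[OF F.M AG])
    show "finite A" by (rule finite_subset[OF AG F.finite_Gal])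
    have "restrict (\<lambda>x. x) F = restrict idQ F" using F.M_Qbar by (auto simp: fun_eq_iff)
    thus "restrict (\<lambda>x. x) F \<in> A" unfolding A_def using Uid by blast
    show "chom F t" by (rule chom_subset[OF GQ_rules(2)[OF tG] F.M_Qbar])
    show "t x = x" if "x \<in> F" "\<And>s. s \<in> A \<Longrightarrow> s x = x" for x
    proof (rule GQ_rules(5)[OF t])
      have "s x = x" if "s \<in> U" for s using \<open>\<And>s. s \<in> A \<Longrightarrow> s x = x\<close>[of "restrict s F"] \<open>x \<in> F\<close> that by (simp add: A_def)
      thus "x \<in> {x \<in> Qbar. \<forall>s\<in>U. s x = x}" using \<open>x \<in> F\<close> F.M_Qbar by blast
    qed
    fix s assume "s \<in> A"
    then obtain s' where s': "s' \<in> U" "s = restrict s' F" unfolding A_def by blast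
    show "bij_betw (compose F s) A A"
    proof -
      have "compose F s ` A \<subseteq> A"
      proof (rule image_subsetI)
        fix u assume "u \<in> A"
        then obtain u' where u': "u' \<in> U" "u = restrict u' F" unfolding A_def by blast
        show "compose F s u \<in> A" unfolding s' u' comp[OF s'(1) u'(1)] A_def using Ucomp[OF s'(1) u'(1)] by blast
      qed
      moreover have "inj_on (compose F s) A"
        using Gal_bij_compose[OF F.M F.Rats_M] AG \<open>s \<in> A\<close> by (meson bij_betw_def inj_on_subset subsetD)
      ultimately show ?thesis using endo_inj_surj[OF finite_subset[OF AG F.finite_Gal]] by (simp add: bij_betw_def)
    qed
  qed
  then obtain s where s: "s \<in> U" "restrict t F = restrict s F" unfolding A_def by blast
  have ts: "t x = s x" if "x \<in> F" for x using fun_cong[OF s(2), of x] that by simp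
  have sG: "s \<in> G_Q" using s(1) UG by blast
  obtain r where r: "r \<in> G_Q" "\<And>x. x \<in> Qbar \<Longrightarrow> s (r x) = x" "\<And>x. x \<in> Qbar \<Longrightarrow> r (s x) = x"
    using Gal_inverse[OF Qbar_field Rats_Qbar sG] by metis
  have "compose Qbar r t \<in> U"
  proof (rule S(3)[OF Gal_compose[OF Qbar_field Rats_Qbar r(1) tG]])
    fix x assume x: "x \<in> S"
    hence "t x = s x" "x \<in> Qbar" using ts F(2) S(2) by auto
    thus "compose Qbar r t x = x" using r(3) by (simp add: compose_eq)
  qed
  hence "compose Qbar s (compose Qbar r t) \<in> U" by (rule Ucomp[OF s(1)])
  moreover have "compose Qbar s (compose Qbar r t) = t" using r(2) GQ_rules(4)[OF tG] GQ_rules(1)[OF tG]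
    by (intro extensionalityI[of _ Qbar]) (auto simp: compose_eq compose_extensional)
  ultimately show ?thesis by simp
qed

lemma galois_number_field_subfield:
  assumes F: "galois_number_field F" and K: "normal_field K" "K \<subseteq> F"
  shows "galois_number_field K"
proof
  interpret F: galois_number_field F by (rule F)
  show "normal_field K" by (rule K)
  have Kf: "csubfield K" "K \<subseteq> Qbar" using K(1) by (auto simp: normal_field_def)
  have "Gal K \<rat> \<subseteq> (\<lambda>g. restrict g K) ` Gal F \<rat>"
  proof
    fix g assume g: "g \<in> Gal K \<rat>"
    obtain s where s: "s \<in> G_Q" "\<And>x. x \<in> K \<Longrightarrow> s x = g x" using Gal_lift[OF Kf Rats_subset_csubfield[OF Kf(1)] g] by metis
    have "restrict s F \<in> Gal F \<rat>" by (rule normal_restrict[OF F.normal F.Rats_M s(1)])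
    moreover have "g = restrict (restrict s F) K"
      using s(2) K(2) Gal_rules(1)[OF Kf(1) g] by (intro extensionalityI[of _ K]) auto
    ultimately show "g \<in> (\<lambda>g. restrict g K) ` Gal F \<rat>" by blast
  qed
  thus "finite (Gal K \<rat>)" using F.finite_Gal by (meson finite_imageI finite_subset)
qed

text \<open>An automorphism fixing a Galois number field that contains \<open>S\<close> lies in
  \<open>U\<close>, so the fixed field is contained in that number field. Invariance of
  \<open>U\<close> under conjugation makes it normal.\<close>

lemma normal_fixed_field:
  assumes U: "gal_subgroup U" and conj: "\<And>s t u. s \<in> G_Q \<Longrightarrow> t \<in> G_Q \<Longrightarrow> (\<And>x. x \<in> Qbar \<Longrightarrow> s (t x) = x) \<Longrightarrow>
      (\<And>x. x \<in> Qbar \<Longrightarrow> t (s x) = x) \<Longrightarrow> u \<in> U \<Longrightarrow> compose Qbar t (compose Qbar u s) \<in> U"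
    and S: "finite S" "S \<subseteq> Qbar" "\<And>s. s \<in> G_Q \<Longrightarrow> (\<And>x. x \<in> S \<Longrightarrow> s x = x) \<Longrightarrow> s \<in> U"
  shows "galois_number_field {x \<in> Qbar. \<forall>s\<in>U. s x = x}"
proof -
  define K where "K = {x \<in> Qbar. \<forall>s\<in>U. s x = x}"
  have UG: "U \<subseteq> G_Q" using U by (auto simp: gal_subgroup_def)
  obtain F where F: "galois_number_field F" "S \<subseteq> F"
    using galois_number_field_extend[OF galois_number_field_Rats S(1,2)] by metis
  interpret F: galois_number_field F by (rule F(1))
  have "K \<subseteq> F"
  proof
    fix x assume x: "x \<in> K"
    show "x \<in> F"
    proof (rule ccontr)
      assume "x \<notin> F"
      then obtain s where s: "s \<in> Gal Qbar F" "s x \<noteq> x"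
        using Gal_Qbar_moves[OF F.M F.M_Qbar, of x] x by (auto simp: K_def)
      have "s \<in> U" using S(3)[OF Gal_Rats[OF Qbar_field s(1)]] GQ_rules(5)[OF s(1)] F(2) by blast
      thus False using x s(2) by (simp add: K_def)
    qed
  qed
  moreover have "normal_field K" unfolding normal_field_def
  proof (intro conjI ballI image_subsetI)
    show "csubfield K" unfolding K_def by (rule fixed_field_csubfield[OF UG])
    show "K \<subseteq> Qbar" by (auto simp: K_def)
    fix s x assume s: "s \<in> G_Q" and x: "x \<in> K"
    have xQ: "x \<in> Qbar" using x by (simp add: K_def)
    obtain t where t: "t \<in> G_Q" "\<And>x. x \<in> Qbar \<Longrightarrow> s (t x) = x" "\<And>x. x \<in> Qbar \<Longrightarrow> t (s x) = x"
      using Gal_inverse[OF Qbar_field Rats_Qbar s] by metis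
    have "u (s x) = s x" if u: "u \<in> U" for u
    proof -
      have "compose Qbar t (compose Qbar u s) \<in> U" by (rule conj[OF s t u])
      hence "compose Qbar t (compose Qbar u s) x = x" using x by (auto simp: K_def)
      hence "t (u (s x)) = x" using xQ by (simp add: compose_eq)
      hence "s (t (u (s x))) = s x" by simp
      thus ?thesis using t(2) GQ_rules(4)[of u \<rat> "s x"] u UG GQ_rules(4)[OF s xQ] by auto
    qed
    thus "s x \<in> K" using GQ_rules(4)[OF s xQ] by (simp add: K_def)
  qed
  ultimately show ?thesis using galois_number_field_subfield[OF F(1)] unfolding K_def by blast
qed

subsection \<open>The Krull topology\<close>

text \<open>Agreement on a finite set forces agreement on the field it generates. This is what turns
  continuity of a cocycle into vanishing on the stabilizer of a finite set.\<close>

lemma krull_open_neighbourhood: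
  assumes W: "openin krull_topology W" and s: "s \<in> W"
  shows "\<exists>S. finite S \<and> S \<subseteq> Qbar \<and> (\<forall>t\<in>G_Q. (\<forall>x\<in>S. t x = s x) \<longrightarrow> t \<in> W)"
proof -
  have "generate_topology_on {{\<tau> \<in> G_Q. \<forall>x\<in>adjoin S. \<tau> x = \<sigma> x} | \<sigma> S. \<sigma> \<in> G_Q \<and> finite S \<and> S \<subseteq> Qbar} W"
    using W by (simp add: krull_topology_def openin_topology_generated_by_iff)
  thus ?thesis using s
  proof (induction rule: generate_topology_on.induct)
    case (Int a b)
    then obtain S T where "finite S" "S \<subseteq> Qbar" "\<forall>t\<in>G_Q. (\<forall>x\<in>S. t x = s x) \<longrightarrow> t \<in> a"
      "finite T" "T \<subseteq> Qbar" "\<forall>t\<in>G_Q. (\<forall>x\<in>T. t x = s x) \<longrightarrow> t \<in> b" by blast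
    thus ?case by (intro exI[of _ "S \<union> T"]) blast
  next
    case (UN K)
    then obtain k where k: "k \<in> K" "s \<in> k" by blast
    thus ?case using UN.IH[OF k] by blast
  next
    case (Basis W)
    then obtain \<sigma> S where S: "W = {\<tau> \<in> G_Q. \<forall>x\<in>adjoin S. \<tau> x = \<sigma> x}" "finite S" "S \<subseteq> Qbar" by blast
    have sG: "s \<in> G_Q" and s\<sigma>: "\<And>x. x \<in> adjoin S \<Longrightarrow> s x = \<sigma> x" using Basis.prems S(1) by auto
    have aQ: "adjoin S \<subseteq> Qbar" by (rule adjoin_rules(3)[OF Qbar_field S(3)])
    have "t \<in> W" if t: "t \<in> G_Q" "\<forall>x\<in>S. t x = s x" for t
    proof -
      have "t x = s x" if "x \<in> adjoin S" for x
        by (rule adjoin_hom_eq[OF chom_subset[OF GQ_rules(2)[OF t(1)] aQ] chom_subset[OF GQ_rules(2)[OF sG] aQ] _ that])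
          (use t(2) in blast)
      thus ?thesis using t(1) s\<sigma> by (simp add: S(1))
    qed
    thus ?case using S by blast
  qed simp
qed

lemma krull_continuousI:
  assumes S: "finite S" "S \<subseteq> Qbar" and c: "c \<in> G_Q \<rightarrow> A"
    "\<And>s t. s \<in> G_Q \<Longrightarrow> t \<in> G_Q \<Longrightarrow> (\<And>x. x \<in> S \<Longrightarrow> s x = t x) \<Longrightarrow> c s = c t"
  shows "continuous_map krull_topology (discrete_topology A) c"
proof -
  define B where "B s = {\<tau> \<in> G_Q. \<forall>x\<in>adjoin S. \<tau> x = s x}" for s
  have op: "openin krull_topology (B s)" if "s \<in> G_Q" for s unfolding krull_topology_def B_def using that S
    by (intro topology_generated_by_Basis) blast
  have top: "topspace krull_topology \<subseteq> G_Q" unfolding krull_topology_def topology_generated_by_topspace by blast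
  have mem: "s \<in> B s" if "s \<in> G_Q" for s using that by (simp add: B_def)
  have "s \<in> topspace krull_topology" if "s \<in> G_Q" for s using openin_subset[OF op[OF that]] mem[OF that] by blast
  hence tp: "topspace krull_topology = G_Q" using top by blast
  show ?thesis unfolding continuous_map_def tp
  proof (intro conjI allI impI)
    show "c \<in> G_Q \<rightarrow> topspace (discrete_topology A)" using c(1) by simp
    fix V assume "openin (discrete_topology A) V"
    have "{s \<in> G_Q. c s \<in> V} = \<Union> (B ` {s \<in> G_Q. c s \<in> V})"
    proof
      show "{s \<in> G_Q. c s \<in> V} \<subseteq> \<Union> (B ` {s \<in> G_Q. c s \<in> V})" using mem by blast
      show "\<Union> (B ` {s \<in> G_Q. c s \<in> V}) \<subseteq> {s \<in> G_Q. c s \<in> V}"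
      proof
        fix t assume "t \<in> \<Union> (B ` {s \<in> G_Q. c s \<in> V})"
        then obtain s where s: "s \<in> G_Q" "c s \<in> V" "t \<in> G_Q" "\<forall>x\<in>adjoin S. t x = s x" unfolding B_def by blast
        have "c t = c s" using s adjoin_rules(2)[of S] by (intro c(2)) auto
        thus "t \<in> {s \<in> G_Q. c s \<in> V}" using s by simp
      qed
    qed
    moreover have "openin krull_topology (\<Union> (B ` {s \<in> G_Q. c s \<in> V}))" using op by (intro openin_Union) blast
    ultimately show "openin krull_topology {s \<in> G_Q. c s \<in> V}" by simp
  qed
qed

section \<open>The Kummer field\<close>

lemma zeta_power: "n > 0 \<Longrightarrow> zeta n ^ n = 1" by (simp add: zeta_def Complex.DeMoivre)

lemma zeta_power_inj:
  assumes "n > 0" "a < n" "b < n" "zeta n ^ a = zeta n ^ b" shows "a = b"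
proof -
  have "bij_betw (\<lambda>k. cis (2 * pi * real k / real n)) {..<n} {z. z ^ n = 1}"
    by (rule Complex.bij_betw_roots_unity[OF assms(1)])
  moreover have "cis (2 * pi * real k / real n) = zeta n ^ k" for k by (simp add: zeta_def Complex.DeMoivre mult_ac)
  ultimately show ?thesis using assms by (auto simp: bij_betw_def inj_on_def)
qed

lemma root_of_unity_zeta:
  assumes "n > 0" "z ^ n = 1" obtains k where "k < n" "z = zeta n ^ k"
proof -
  have "bij_betw (\<lambda>k. cis (2 * pi * real k / real n)) {..<n} {z. z ^ n = 1}"
    by (rule Complex.bij_betw_roots_unity[OF assms(1)])
  moreover have "cis (2 * pi * real k / real n) = zeta n ^ k" for k by (simp add: zeta_def Complex.DeMoivre mult_ac)
  ultimately have "z \<in> (\<lambda>k. zeta n ^ k) ` {..<n}" using assms(2) by (auto simp: bij_betw_def)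
  thus ?thesis using that by blast
qed

text \<open>Both sides are monic of degree \<open>n\<close>, so their difference has lower degree
  but \<open>n\<close> roots.\<close>

lemma prod_zeta:
  assumes n: "n > 1" shows "(\<Prod>k\<in>{..<n}. [:- (zeta n ^ k), 1:]) = monom 1 n - 1"
proof -
  define A where "A = (\<Prod>k\<in>{..<n}. [:- (zeta n ^ k), 1:])"
  define B :: "complex poly" where "B = monom 1 n - 1"
  have degB: "degree B = n" "lead_coeff B = 1"
  proof -
    show d: "degree B = n"
    proof (rule antisym)
      show "degree B \<le> n" unfolding B_def by (intro degree_diff_le) (simp_all add: degree_monom_le)
      show "n \<le> degree B" by (rule le_degree) (use n in \<open>simp add: B_def coeff_1\<close>)
    qed
    show "lead_coeff B = 1" unfolding d using n by (simp add: B_def coeff_1)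
  qed
  have degA: "degree A = n" "lead_coeff A = 1"
  proof -
    show "degree A = n" unfolding A_def by (subst degree_prod_eq_sum_degree) auto
    show "lead_coeff A = 1" unfolding A_def lead_coeff_prod by simp
  qed
  have "A - B = 0"
  proof (rule ccontr)
    assume ne: "A - B \<noteq> 0"
    have "degree (A - B) \<noteq> n"
    proof
      assume "degree (A - B) = n"
      hence "lead_coeff (A - B) = 0" using degA degB by (metis coeff_diff diff_self)
      thus False using ne leading_coeff_0_iff by blast
    qed
    moreover have "degree (A - B) \<le> n" by (intro degree_diff_le) (simp_all add: degA degB)
    ultimately have lt: "degree (A - B) < n" by simp
    have "(\<lambda>k. zeta n ^ k) ` {..<n} \<subseteq> {x. poly (A - B) x = 0}"
    proof (rule image_subsetI)
      fix k assume k: "k \<in> {..<n}"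
      have "poly A (zeta n ^ k) = 0" unfolding A_def poly_prod by (rule prod_zero) (use k in auto)
      moreover have "(zeta n ^ k) ^ n = 1" using zeta_power[of n] n by (metis mult.commute power_mult power_one gr_implies_not0 not_gr_zero)
      ultimately show "zeta n ^ k \<in> {x. poly (A - B) x = 0}" by (simp add: B_def poly_monom)
    qed
    hence "card ((\<lambda>k. zeta n ^ k) ` {..<n}) \<le> card {x. poly (A - B) x = 0}"
      by (rule card_mono[OF poly_roots_finite[OF ne]])
    moreover have "card ((\<lambda>k. zeta n ^ k) ` {..<n}) = n"
      using zeta_power_inj n by (subst card_image) (auto simp: inj_on_def)
    ultimately show False using card_poly_roots_bound[OF ne] lt by simp
  qed
  thus ?thesis by (simp add: A_def B_def)
qed

text \<open>Cancel the factor \<open>X - 1\<close> in \<open>prod_zeta\<close> and evaluate at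
  1.\<close>

lemma zeta_norm:
  assumes n: "n > 1" shows "(\<Prod>k\<in>{1..<n}. 1 - zeta n ^ k) = of_nat n"
proof -
  define A where "A = (\<Prod>k\<in>{..<n}. [:- (zeta n ^ k), 1:])"
  define B :: "complex poly" where "B = monom 1 n - 1"
  have AB: "A = B" unfolding A_def B_def by (rule prod_zeta[OF n])
  define C where "C = (\<Prod>k\<in>{1..<n}. [:- (zeta n ^ k), 1:])"
  define D :: "complex poly" where "D = (\<Sum>k<n. [:0, 1:] ^ k)"
  have "A = [:- 1, 1:] * C" unfolding A_def C_def
  proof -
    have "{..<n} - {0} = {1..<n}" by auto
    thus "(\<Prod>k\<in>{..<n}. [:- (zeta n ^ k), 1:]) = [:- 1, 1:] * (\<Prod>k\<in>{1..<n}. [:- (zeta n ^ k), 1:])"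
      using n prod.remove[of "{..<n}" 0 "\<lambda>k. [:- (zeta n ^ k), 1:]"] by simp
  qed
  moreover have "B = [:- 1, 1:] * D"
  proof -
    have "[:0, 1:] ^ n - 1 = ([:0, 1:] - 1) * D" unfolding D_def by (rule power_diff_1_eq)
    moreover have "[:0, 1:] ^ n = (monom 1 n :: complex poly)" by (simp add: monom_altdef)
    ultimately show ?thesis unfolding B_def by (simp add: one_pCons)
  qed
  ultimately have "[:- 1, 1:] * C = [:- 1, 1:] * D" using AB by simp
  hence "C = D" by (metis mult_cancel_left pCons_eq_0_iff one_neq_zero)
  hence "poly C 1 = poly D 1" by simp
  thus ?thesis by (simp add: C_def D_def poly_prod poly_sum)
qed

lemma zeta_Zbar: "n > 0 \<Longrightarrow> zeta n \<in> Zbar"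
proof -
  assume n: "n > 0"
  have "algebraic_int (zeta n)"
    by (rule algebraic_int_root[of 1 "monom 1 n"]) (use n zeta_power in \<open>auto simp: poly_monom lead_coeff_monom degree_monom_eq\<close>)
  thus ?thesis by (simp add: Zbar_def)
qed

lemma kummer_root_power: "n > 0 \<Longrightarrow> kummer_root n m ^ n = of_nat m"
  unfolding kummer_root_def by (metis of_nat_0_le_iff of_real_of_nat_eq of_real_power real_root_pow_pos2)

lemma kummer_root_Zbar: "n > 0 \<Longrightarrow> kummer_root n m \<in> Zbar"
proof -
  assume n: "n > 0"
  have "algebraic_int (kummer_root n m)" by (rule algebraic_int_root[of "of_nat m" "monom 1 n"])
      (use n kummer_root_power[OF n] in \<open>auto simp: poly_monom lead_coeff_monom degree_monom_eq\<close>)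
  thus ?thesis by (simp add: Zbar_def)
qed

text \<open>The parameter \<open>ty\<close> binds the type variable \<open>'p\<close>, so that the
  coefficient field of the modules is fixed throughout the locale.\<close>

locale kummer =
  fixes p N :: nat and ty :: "'p::prime_card itself"
  assumes p_card: "p = CARD('p)" and odd_p: "odd p" and prime_N: "prime N" and N_cong: "[N = 1] (mod p)"
begin

abbreviation \<zeta> :: complex where "\<zeta> \<equiv> zeta p"
abbreviation \<nu> :: complex where "\<nu> \<equiv> kummer_root p N"
abbreviation L :: "complex set" where "L \<equiv> kummer_field p N"
abbreviation G_L :: "(complex \<Rightarrow> complex) set" where "G_L \<equiv> Gal Qbar L"
abbreviation chi :: "(complex \<Rightarrow> complex) \<Rightarrow> 'p mod_ring" where "chi \<equiv> cyc_char"
abbreviation kb :: "(complex \<Rightarrow> complex) \<Rightarrow> 'p mod_ring" where "kb \<equiv> kummer_cocycle N"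

text \<open>A homomorphism from the additive field with \<open>p\<close> elements to the roots of
  unity; by \<open>zp_of_nat\<close> any natural representative of the exponent may be used.\<close>

definition zp :: "'p mod_ring \<Rightarrow> complex" where "zp a = \<zeta> ^ nat (to_int_mod_ring a)"

lemma prime_p: "prime p" unfolding p_card by (rule prime_card)

lemma p_pos: "p > 1" "p > 0" using prime_gt_1_nat[OF prime_p] by auto

lemma N_ne_p: "N \<noteq> p" using N_cong p_pos by (auto simp: cong_def)

lemma N_pos: "N > 1" using prime_gt_1_nat[OF prime_N] .

lemma zp_of_nat: "zp (of_nat k) = \<zeta> ^ k"
proof -
  have "(of_nat k :: 'p mod_ring) = of_nat (k mod p)"
    using of_nat_mod_CHAR[of k, where 'a = "'p mod_ring"] by (simp add: p_card)
  also have "\<dots> = of_int_mod_ring (int (k mod p))" by (rule fun_cong[OF of_nat_of_int_mod_ring, unfolded o_def])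
  finally have "to_int_mod_ring (of_nat k :: 'p mod_ring) = int (k mod p)" using p_pos by (simp add: zmod_int p_card)
  hence "zp (of_nat k) = \<zeta> ^ (k mod p)" by (simp add: zp_def nat_mod_distrib)
  also have "\<dots> = \<zeta> ^ (k mod p) * (\<zeta> ^ p) ^ (k div p)" using zeta_power[OF p_pos(2)] by simp
  also have "\<dots> = \<zeta> ^ k" by (simp flip: power_mult power_add)
  finally show ?thesis .
qed

lemma of_nat_cases: obtains k where "k < p" "(a :: 'p mod_ring) = of_nat k"
  using surj_of_nat_mod_ring[of a] unfolding p_card by blast

lemma zp_add: "zp (a + b) = zp a * zp b"
proof -
  obtain k where k: "a = of_nat k" by (rule of_nat_cases) blast
  obtain l where l: "b = of_nat l" by (rule of_nat_cases) blast
  have "a + b = of_nat (k + l)" by (simp add: k l)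
  thus ?thesis by (simp only: zp_of_nat power_add k l)
qed

lemma zp_0: "zp 0 = 1" using zp_of_nat[of 0] by simp

lemma zp_1: "zp 1 = \<zeta>" using zp_of_nat[of 1] by simp

lemma zp_mult: "zp (a * of_nat k) = zp a ^ k" by (induction k) (simp_all add: zp_0 zp_add algebra_simps)

lemma zp_inj: assumes "zp a = zp b" shows "a = b"
proof -
  obtain k where k: "k < p" "a = of_nat k" by (rule of_nat_cases)
  obtain l where l: "l < p" "b = of_nat l" by (rule of_nat_cases)
  have "\<zeta> ^ k = \<zeta> ^ l" using assms by (simp add: k l zp_of_nat)
  thus ?thesis using zeta_power_inj[OF p_pos(2) k(1) l(1)] k l by simp
qed

lemma zp_minus: "zp (- a) * zp a = 1" using zp_add[of "- a" a] zp_0 by simp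

lemma root_of_unity_zp: assumes "z ^ p = 1" obtains a where "z = zp a"
  using root_of_unity_zeta[OF p_pos(2) assms] zp_of_nat by metis

lemma zp_Zbar: "zp a \<in> Zbar" unfolding zp_def by (intro Zbar_rules(7) zeta_Zbar p_pos)

lemma \<nu>_power: "\<nu> ^ p = of_nat N" by (rule kummer_root_power[OF p_pos(2)])

lemma \<nu>_nonzero: "\<nu> \<noteq> 0"
proof
  assume "\<nu> = 0"
  hence "(of_nat N :: complex) = 0" using \<nu>_power p_pos by (simp add: power_0_left)
  thus False using N_pos by simp
qed

lemma \<nu>_Zbar: "\<nu> \<in> Zbar" by (rule kummer_root_Zbar[OF p_pos(2)])

lemma \<zeta>_Zbar: "\<zeta> \<in> Zbar" by (rule zeta_Zbar[OF p_pos(2)])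

lemma zp_mem: "csubring K \<Longrightarrow> \<zeta> \<in> K \<Longrightarrow> zp a \<in> K"
  unfolding zp_def by (rule csubring_power)

text \<open>\<open>s\<close> permutes the \<open>p\<close>-th roots of unity, so the descriptions in
  \<open>cyc_char\<close> and \<open>kummer_cocycle\<close> have unique values. If
  \<open>chi s\<close> were 0, then \<open>s\<close> would kill each \<open>1 - \<zeta> ^ k\<close>
  and therefore their product \<open>p\<close>.\<close>

lemma char_action:
  assumes "chom K s" "csubring K" "\<zeta> \<in> K" "\<nu> \<in> K"
  shows "s \<zeta> = zp (chi s)" "s \<nu> = zp (kb s) * \<nu>" "s (zp a) = zp (chi s * a)" "chi s \<noteq> 0"
proof -
  have "s \<zeta> ^ p = s 1" using chom_power[OF assms(1-3), of p] zeta_power[OF p_pos(2)] by simp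
  hence "s \<zeta> ^ p = 1" using chom_rules(1)[OF assms(1,2)] by simp
  then obtain a where a: "s \<zeta> = zp a" by (rule root_of_unity_zp)
  have "chi s = a" unfolding cyc_char_def
    by (rule the_equality) (use a zp_inj in \<open>auto simp: zp_def p_card[symmetric]\<close>)
  thus 1: "s \<zeta> = zp (chi s)" using a by simp
  have "s \<nu> ^ p = s (of_nat N)" using chom_power[OF assms(1,2,4), of p] \<nu>_power by simp
  hence "s \<nu> ^ p = of_nat N" using chom_of_nat[OF assms(1,2)] by simp
  hence "(s \<nu> / \<nu>) ^ p = 1" using \<nu>_power N_pos by (simp add: power_divide)
  then obtain b where b: "s \<nu> / \<nu> = zp b" by (rule root_of_unity_zp)
  have "kb s = b" unfolding kummer_cocycle_def
    by (rule the_equality) (use b zp_inj in \<open>auto simp: zp_def p_card[symmetric]\<close>)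
  thus "s \<nu> = zp (kb s) * \<nu>" using b \<nu>_nonzero by (simp add: field_simps)
  show 3: "s (zp a) = zp (chi s * a)" for a
  proof -
    obtain k where k: "a = of_nat k" by (rule of_nat_cases) blast
    have "s (zp a) = s \<zeta> ^ k" unfolding k zp_of_nat by (rule chom_power[OF assms(1-3)])
    thus ?thesis by (simp add: 1 k zp_mult)
  qed
  show "chi s \<noteq> 0"
  proof
    assume "chi s = 0"
    hence e: "s \<zeta> = 1" using 1 zp_0 by simp
    have "\<zeta> = s \<zeta> * \<zeta> - 0" using e by simp
    obtain k where k: "p = Suc k" using p_pos by (cases p) auto
    show False
    proof -
      have "s (1 - \<zeta>) = 0" using e assms chom_rules[OF assms(1,2)] csubring_basic[OF assms(2)] by simp
      have all: "s (\<zeta> ^ j) = 1" for j using chom_power[OF assms(1-3), of j] e by simp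
      have "s (\<Prod>k\<in>{1..<p}. 1 - \<zeta> ^ k) = (\<Prod>k\<in>{1..<p}. s (1 - \<zeta> ^ k))"
        by (rule chom_prod[OF assms(1,2)]) (intro csubring_basic assms csubring_power)
      also have "\<dots> = (\<Prod>k\<in>{1..<p}. 0)"
        using all chom_rules[OF assms(1,2)] csubring_basic[OF assms(2)] csubring_power[OF assms(2,3)] by (intro prod.cong) auto
      also have "\<dots> = 0" using p_pos by simp
      finally have "s (of_nat p) = 0" using zeta_norm[OF p_pos(1)] by simp
      thus False using chom_of_nat[OF assms(1,2), of p] p_pos by simp
    qed
  qed
qed

lemma L_mem: "\<zeta> \<in> L" "\<nu> \<in> L" using adjoin_rules(2)[of "{\<zeta>, \<nu>}"] by (auto simp: kummer_field_def)

lemma L_field: "csubfield L" unfolding kummer_field_def by (rule adjoin_rules(1))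

lemma Rats_L: "\<rat> \<subseteq> L" by (rule Rats_subset_csubfield[OF L_field])

lemma L_Qbar: "L \<subseteq> Qbar" unfolding kummer_field_def
  by (rule adjoin_rules(3)[OF Qbar_field]) (use \<zeta>_Zbar \<nu>_Zbar Zbar_subset_Qbar in auto)

lemma Qbar_mem: "\<zeta> \<in> Qbar" "\<nu> \<in> Qbar" using L_mem L_Qbar by auto

lemmas GQ_action = char_action[OF GQ_rules(2) Q_ring Qbar_mem]

lemma char_cong:
  assumes "\<And>x. x \<in> L \<Longrightarrow> s x = t x" shows "chi s = chi t" "kb s = kb t"
  using assms[OF L_mem(1)] assms[OF L_mem(2)] by (auto simp: cyc_char_def kummer_cocycle_def p_card[symmetric])

text \<open>Multiplication of the matrices with rows \<open>(chi, kb)\<close> and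
  \<open>(0, 1)\<close>.\<close>

lemma char_compose:
  assumes s: "s \<in> Gal Qbar K" and t: "t \<in> Gal Qbar K'"
  shows "chi (compose Qbar s t) = chi s * chi t" "kb (compose Qbar s t) = kb s + chi s * kb t"
proof -
  have st: "compose Qbar s t \<in> G_Q"
    by (rule Gal_compose[OF Qbar_field Rats_Qbar Gal_Rats[OF Qbar_field s] Gal_Rats[OF Qbar_field t]])
  have "zp (chi (compose Qbar s t)) = zp (chi s * chi t)"
    using GQ_action(1)[OF st] GQ_action(1)[OF t] GQ_action(3)[OF s] Qbar_mem by (simp add: compose_eq)
  thus "chi (compose Qbar s t) = chi s * chi t" by (rule zp_inj)
  have zQ: "zp a \<in> Qbar" for a using zp_Zbar Zbar_subset_Qbar by blast
  have "zp (kb (compose Qbar s t)) * \<nu> = s (zp (kb t) * \<nu>)"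
    using GQ_action(2)[OF st] GQ_action(2)[OF t] Qbar_mem by (simp add: compose_eq)
  also have "\<dots> = zp (chi s * kb t) * (zp (kb s) * \<nu>)"
    using chom_rules(3)[OF GQ_rules(2)[OF s] Q_ring zQ Qbar_mem(2)] GQ_action(2,3)[OF s] by simp
  finally have "zp (kb (compose Qbar s t)) = zp (kb s + chi s * kb t)" using \<nu>_nonzero by (simp add: zp_add mult_ac)
  thus "kb (compose Qbar s t) = kb s + chi s * kb t" by (rule zp_inj)
qed

lemma Gal_L_iff: "s \<in> G_L \<longleftrightarrow> s \<in> G_Q \<and> chi s = 1 \<and> kb s = 0"
proof
  assume s: "s \<in> G_L"
  have "zp (chi s) = zp 1" "zp (kb s) * \<nu> = 1 * \<nu>"
    using GQ_action(1,2)[OF s] GQ_rules(5)[OF s] L_mem zp_1 by simp_all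
  thus "s \<in> G_Q \<and> chi s = 1 \<and> kb s = 0"
    using zp_inj[of "chi s" 1] zp_inj[of "kb s" 0] \<nu>_nonzero zp_0 Gal_Rats[OF Qbar_field s] by simp
next
  assume s: "s \<in> G_Q \<and> chi s = 1 \<and> kb s = 0"
  hence sG: "s \<in> G_Q" by blast
  have fx: "s \<zeta> = \<zeta>" "s \<nu> = \<nu>" using GQ_action(1,2)[OF sG] s zp_0 zp_1 by simp_all
  have "s x = x" if "x \<in> L" for x
  proof (rule adjoin_hom_eq[of "{\<zeta>, \<nu>}" s "\<lambda>x. x"])
    show "chom (adjoin {\<zeta>, \<nu>}) s" using chom_subset[OF GQ_rules(2)[OF sG] L_Qbar] by (simp add: kummer_field_def)
    show "chom (adjoin {\<zeta>, \<nu>}) (\<lambda>x. x)" by (simp add: chom_def)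
  qed (use fx that in \<open>auto simp: kummer_field_def\<close>)
  thus "s \<in> G_L" using sG by (simp add: Gal_iff[OF Qbar_field])
qed

lemma normal_L: "normal_field L" unfolding normal_field_def
proof (intro conjI ballI L_field L_Qbar)
  fix s assume s: "s \<in> G_Q"
  have R: "csubring L" by (rule csubfield_csubring[OF L_field])
  have "L \<subseteq> {x \<in> Qbar. s x \<in> L}" unfolding kummer_field_def
  proof (rule adjoin_rules(3))
    show "csubfield {x \<in> Qbar. s x \<in> adjoin {\<zeta>, \<nu>}}"
      by (rule csubfield_preimage[OF GQ_rules(2)[OF s] Qbar_field adjoin_rules(1)])
    show "{\<zeta>, \<nu>} \<subseteq> {x \<in> Qbar. s x \<in> adjoin {\<zeta>, \<nu>}}"
      using GQ_action(1,2)[OF s] zp_mem[OF R L_mem(1)] csubring_basic(3)[OF R _ L_mem(2)] Qbar_mem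
      by (simp add: kummer_field_def)
  qed
  thus "s ` L \<subseteq> L" by blast
qed

lemma galois_number_field_L: "galois_number_field L"
proof -
  obtain F where F: "galois_number_field F" "{\<zeta>, \<nu>} \<subseteq> F"
    using galois_number_field_extend[OF galois_number_field_Rats, of "{\<zeta>, \<nu>}"] Qbar_mem by auto
  have "L \<subseteq> F" unfolding kummer_field_def
    using F by (intro adjoin_rules(3)) (auto simp: galois_number_field_def normal_field_def)
  thus ?thesis by (rule galois_number_field_subfield[OF F(1) normal_L])
qed

subsection \<open>The cyclotomic character is surjective\<close>

text \<open>Equality up to units of \<open>Zbar\<close>; it replaces the valuation above
  \<open>p\<close> in the proof of \<open>chi_surj\<close>.\<close>

definition assoc :: "complex \<Rightarrow> complex \<Rightarrow> bool" where
  "assoc x y \<longleftrightarrow> (\<exists>u\<in>Zbar. x = u * y) \<and> (\<exists>v\<in>Zbar. y = v * x)"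

lemma assocI: "u \<in> Zbar \<Longrightarrow> x = u * y \<Longrightarrow> v \<in> Zbar \<Longrightarrow> y = v * x \<Longrightarrow> assoc x y"
  unfolding assoc_def by blast

lemma assocE:
  assumes "assoc x y" obtains u v where "u \<in> Zbar" "x = u * y" "v \<in> Zbar" "y = v * x"
  using assms unfolding assoc_def by blast

lemma assoc_mult:
  assumes "assoc x y" "assoc x' y'" shows "assoc (x * x') (y * y')"
proof -
  obtain u v where u: "u \<in> Zbar" "x = u * y" and v: "v \<in> Zbar" "y = v * x" using assms(1) by (rule assocE)
  obtain u' v' where u': "u' \<in> Zbar" "x' = u' * y'" and v': "v' \<in> Zbar" "y' = v' * x'" using assms(2) by (rule assocE)
  have "x * x' = u * u' * (y * y')" by (subst u(2), subst u'(2)) (simp only: mult_ac)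
  moreover have "y * y' = v * v' * (x * x')" by (subst v(2), subst v'(2)) (simp only: mult_ac)
  ultimately show ?thesis using Zbar_rules(3)[OF u(1) u'(1)] Zbar_rules(3)[OF v(1) v'(1)] by (intro assocI)
qed

lemma assoc_refl: "assoc x x" unfolding assoc_def using Zbar_rules(1) by force

lemma assoc_sym: "assoc x y \<Longrightarrow> assoc y x" unfolding assoc_def by blast

lemma assoc_trans: assumes "assoc x y" "assoc y z" shows "assoc x z"
proof -
  obtain u v where u: "u \<in> Zbar" "x = u * y" and v: "v \<in> Zbar" "y = v * x" using assms(1) by (rule assocE)
  obtain u' v' where u': "u' \<in> Zbar" "y = u' * z" and v': "v' \<in> Zbar" "z = v' * y" using assms(2) by (rule assocE)
  have "x = u * u' * z" by (subst u(2), subst u'(2)) (simp only: mult_ac)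
  moreover have "z = v' * v * x" by (subst v'(2), subst v(2)) (simp only: mult_ac)
  ultimately show ?thesis using Zbar_rules(3)[OF u(1) u'(1)] Zbar_rules(3)[OF v'(1) v(1)] by (intro assocI)
qed

lemma assoc_power: "assoc x y \<Longrightarrow> assoc (x ^ n) (y ^ n)" by (induction n) (auto intro: assoc_refl assoc_mult)

lemma assoc_prod: "finite I \<Longrightarrow> (\<And>k. k \<in> I \<Longrightarrow> assoc (f k) y) \<Longrightarrow> assoc (prod f I) (y ^ card I)"
  by (induction I rule: finite_induct) (auto intro: assoc_refl assoc_mult)

text \<open>Cyclotomic units: by a geometric series \<open>1 - zp b\<close> divides
  \<open>1 - zp (b * of_nat m)\<close>, and inverting \<open>a\<close> modulo \<open>p\<close> gives
  both divisibilities.\<close>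

lemma assoc_one_minus: assumes "a \<noteq> 0" shows "assoc (1 - zp a) (1 - \<zeta>)"
proof -
  obtain k where k: "a = of_nat k" by (rule of_nat_cases) blast
  have sub: "\<exists>u\<in>Zbar. 1 - zp (b * of_nat m) = u * (1 - zp b)" for b m
  proof -
    have "(\<Sum>i<m. zp b ^ i) \<in> Zbar" by (intro Zbar_rules(8) Zbar_rules(7) zp_Zbar)
    moreover have "1 - zp b ^ m = (\<Sum>i<m. zp b ^ i) * (1 - zp b)" by (metis one_diff_power_eq mult.commute)
    ultimately show ?thesis unfolding zp_mult by blast
  qed
  obtain m where m: "inverse a = of_nat m" by (rule of_nat_cases) blast
  have "a * of_nat m = 1" using assms m by (metis right_inverse)
  thus ?thesis unfolding assoc_def using sub[of 1 k] sub[of a m] k zp_1 by simp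
qed

lemma assoc_p: "assoc (of_nat p) ((1 - \<zeta>) ^ (p - 1))"
proof -
  have "assoc (\<Prod>k\<in>{1..<p}. 1 - \<zeta> ^ k) ((1 - \<zeta>) ^ card {1..<p})"
  proof (rule assoc_prod)
    fix k assume k: "k \<in> {1..<p}"
    have "(of_nat k :: 'p mod_ring) \<noteq> 0"
    proof
      assume "(of_nat k :: 'p mod_ring) = 0"
      hence "\<zeta> ^ k = \<zeta> ^ 0" using zp_of_nat[of k] zp_0 by simp
      thus False using zeta_power_inj[OF p_pos(2), of k 0] k by auto
    qed
    thus "assoc (1 - \<zeta> ^ k) (1 - \<zeta>)" using assoc_one_minus[of "of_nat k"] by (simp add: zp_of_nat)
  qed simp
  thus ?thesis using zeta_norm[OF p_pos(1)] by simp
qed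

lemma assoc_int: assumes "assoc (of_int m) (of_int n)" "m \<noteq> 0" shows "m dvd n"
proof -
  obtain v where v: "v \<in> Zbar" "of_int n = v * of_int m" using assms(1) unfolding assoc_def by blast
  have "v = of_int n / of_int m" using v(2) assms(2) by (simp add: field_simps)
  hence "v \<in> \<rat>" by simp
  hence "v \<in> \<int>" using v(1) by (rule Rats_Zbar)
  then obtain k where "v = of_int k" by (auto elim: Ints_cases)
  hence "(of_int n :: complex) = of_int (k * m)" using v(2) by simp
  hence "n = k * m" by (simp only: of_int_eq_iff)
  thus ?thesis by simp
qed

text \<open>Total ramification of \<open>p\<close>. For the image \<open>S\<close> of
  \<open>chi\<close> the product \<open>m\<close> is fixed by \<open>G_Q\<close>, hence an integer,
  and is associated to \<open>(1 - \<zeta>) ^ card S\<close>. As \<open>p\<close> is associated to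
  \<open>(1 - \<zeta>) ^ (p - 1)\<close>, the numbers \<open>m ^ (p - 1)\<close> and
  \<open>p ^ card S\<close> are associated; since \<open>p\<close> divides \<open>m\<close>, this
  forces \<open>card S \<ge> p - 1\<close>.\<close>

lemma chi_surj: assumes "(a :: 'p mod_ring) \<noteq> 0" obtains s where "s \<in> G_Q" "chi s = a"
proof -
  define S where "S = chi ` G_Q"
  have S0: "0 \<notin> S" unfolding S_def using GQ_action(4) by auto
  have finS: "finite S" by (rule finite_subset[OF subset_UNIV]) simp
  have S1: "1 \<in> S"
  proof -
    have "idQ \<in> G_L" by (rule idQ[OF L_Qbar])
    thus ?thesis unfolding S_def using Gal_L_iff by force
  qed
  have Smul: "(\<lambda>b. chi s * b) ` S = S" if s: "s \<in> G_Q" for s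
  proof -
    have "(\<lambda>b. chi s * b) ` S \<subseteq> S"
    proof
      fix y assume "y \<in> (\<lambda>b. chi s * b) ` S"
      then obtain t where t: "t \<in> G_Q" "y = chi s * chi t" unfolding S_def by blast
      have "y = chi (compose Qbar s t)" using char_compose(1)[OF s t(1)] t(2) by simp
      thus "y \<in> S" unfolding S_def using Gal_compose[OF Qbar_field Rats_Qbar s t(1)] by blast
    qed
    moreover have "inj_on (\<lambda>b. chi s * b) S" using GQ_action(4)[OF s] by (auto simp: inj_on_def)
    ultimately show ?thesis using endo_inj_surj[OF finS] by blast
  qed
  define m where "m = (\<Prod>a\<in>S. 1 - zp a)"
  have zQ: "zp a \<in> Qbar" for a using zp_Zbar Zbar_subset_Qbar by blast
  have mZ: "m \<in> Zbar" unfolding m_def by (intro Zbar_rules(9) Zbar_rules(2) Zbar_rules(1) zp_Zbar)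
  have "m \<in> \<rat>"
  proof (rule ccontr)
    assume "m \<notin> \<rat>"
    then obtain s where s: "s \<in> G_Q" "s m \<noteq> m"
      using Gal_Qbar_moves[OF csubfield_Rats Rats_Qbar, of m] mZ Zbar_subset_Qbar by blast
    have "s m = (\<Prod>a\<in>S. s (1 - zp a))"
      unfolding m_def by (rule chom_prod[OF GQ_rules(2)[OF s(1)] Q_ring]) (intro csubring_basic Q_ring zQ)
    also have "\<dots> = (\<Prod>a\<in>S. 1 - zp (chi s * a))"
      using chom_rules(1,6)[OF GQ_rules(2)[OF s(1)] Q_ring] csubring_basic(1)[OF Q_ring] zQ GQ_action(3)[OF s(1)] by simp
    also have "\<dots> = (\<Prod>a\<in>(\<lambda>b. chi s * b) ` S. 1 - zp a)"
      using GQ_action(4)[OF s(1)] by (subst prod.reindex) (auto simp: inj_on_def)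
    also have "\<dots> = m" unfolding Smul[OF s(1)] m_def ..
    finally show False using s(2) by simp
  qed
  hence "m \<in> \<int>" using mZ by (rule Rats_Zbar)
  then obtain k where k: "m = of_int k" by (auto elim: Ints_cases)
  have am: "assoc m ((1 - \<zeta>) ^ card S)" unfolding m_def by (rule assoc_prod[OF finS assoc_one_minus]) (use S0 in auto)
  have "assoc (m ^ (p - 1)) ((of_nat p) ^ card S)"
  proof (rule assoc_trans[OF assoc_power[OF am]])
    have "assoc (((1 - \<zeta>) ^ (p - 1)) ^ card S) (of_nat p ^ card S)" by (rule assoc_power[OF assoc_sym[OF assoc_p]])
    thus "assoc (((1 - \<zeta>) ^ card S) ^ (p - 1)) (of_nat p ^ card S)" by (simp add: mult.commute flip: power_mult)
  qed
  hence as: "assoc (of_int (k ^ (p - 1))) (of_int (int p ^ card S))" by (simp add: k)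
  have k0: "k \<noteq> 0"
  proof
    assume "k = 0"
    hence "\<exists>a\<in>S. 1 - zp a = 0" using k finS unfolding m_def by simp
    thus False using zp_inj[of _ 0] zp_0 S0 by auto
  qed
  have c: "card S > 0" using S1 finS by (auto simp: card_gt_0_iff)
  have "int p ^ card S dvd k ^ (p - 1)" using assoc_int[OF assoc_sym[OF as]] p_pos by simp
  hence "int p dvd k ^ (p - 1)" using c by (meson dvd_power dvd_trans)
  hence "int p dvd k" using prime_p by (metis prime_dvd_power prime_nat_int_transfer)
  hence "int p ^ (p - 1) dvd k ^ (p - 1)" by (rule dvd_power_same)
  moreover have "k ^ (p - 1) dvd int p ^ card S" using assoc_int[OF as] k0 by simp
  ultimately have "int p ^ (p - 1) dvd int p ^ card S" by (rule dvd_trans)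
  hence "p - 1 \<le> card S" using p_pos by (metis dvd_power_iff_le nat_int numeral_2_eq_2 Suc_leI One_nat_def int_dvd_int_iff of_nat_power)
  moreover have "card (UNIV - {0 :: 'p mod_ring}) = p - 1" by (subst card_Diff_subset) (auto simp: p_card)
  ultimately have "S = UNIV - {0}" using S0 by (intro card_seteq) auto
  thus ?thesis using assms that unfolding S_def by (metis DiffI UNIV_I imageE singletonD)
qed

end

subsection \<open>Ramification in the Kummer field\<close>

lemma distinct_primes_not_mem:
  assumes P: "prime_in R P" "csubring R" and l: "prime l" "prime q" "l \<noteq> q" "of_nat l \<in> P"
  shows "of_nat q \<notin> P"
proof
  assume q: "of_nat q \<in> P"
  have "coprime (int l) (int q)" using l by (simp add: primes_coprime)
  then obtain a b where "a * int l + b * int q = 1" by (metis bezout_int coprime_imp_gcd_eq_1)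
  hence "of_int a * of_nat l + of_int b * of_nat q = (1 :: complex)"
    by (metis (mono_tags) of_int_1 of_int_add of_int_mult of_int_of_nat_eq)
  moreover have "of_int a * of_nat l + of_int b * of_nat q \<in> P"
    by (intro prime_in_rules(3)[OF P] prime_in_rules(4)[OF P] csubring_of_int P l(4) q)
  ultimately show False using prime_in_rules(8)[OF P] by simp
qed

text \<open>\<open>q\<close> divides \<open>k\<close>, so \<open>q ^ 2\<close> divides
  \<open>k ^ m\<close>.\<close>

lemma Rats_power_dvd:
  assumes "prime q" "m \<ge> 2" "(of_int k :: complex) ^ m = of_nat q * of_int w"
  shows "int q dvd w"
proof -
  have "(of_int (k ^ m) :: complex) = of_int (int q * w)" using assms(3) by simp
  hence e: "k ^ m = int q * w" by (simp only: of_int_eq_iff)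
  hence "int q dvd k ^ m" by simp
  hence "int q dvd k" using assms(1) by (metis prime_dvd_power prime_nat_int_transfer)
  then obtain r where r: "k = int q * r" by (rule dvdE)
  obtain n where n: "m = Suc (Suc n)" using assms(2) by (metis Suc_le_D add_2_eq_Suc le_Suc_ex)
  have "int q * (int q * (int q ^ n * r ^ m)) = int q * w" using e by (simp add: r n power_mult_distrib mult_ac)
  hence "int q * (int q ^ n * r ^ m) = w" using prime_gt_0_nat[OF assms(1)] by simp
  thus ?thesis by (metis dvd_triv_left)
qed

context kummer
begin

text \<open>The difference of two distinct \<open>p\<close>-th roots of unity is a unit times a
  factor of the product in \<open>zeta_norm\<close>, so it divides \<open>p\<close>.\<close>

lemma zp_mod_inj:
  assumes P: "prime_in R P" "csubring R" and z: "\<zeta> \<in> R" and p: "of_nat p \<notin> P" and ab: "zp a - zp b \<in> P"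
  shows "a = b"
proof (rule ccontr)
  assume "a \<noteq> b"
  define c where "c = a - b"
  have zR: "zp x \<in> R" for x by (rule zp_mem[OF P(2) z])
  obtain k where k: "k < p" "c = of_nat k" by (rule of_nat_cases)
  have "k \<noteq> 0" using k(2) \<open>a \<noteq> b\<close> by (intro notI) (simp add: c_def)
  hence kI: "k \<in> {1..<p}" using k(1) by simp
  have "zp (- b) * (zp a - zp b) \<in> P" by (rule prime_in_rules(4)[OF P zR ab])
  moreover have "zp (- b) * (zp a - zp b) = - (1 - \<zeta> ^ k)"
    using zp_minus[of b] zp_add[of a "- b"] by (simp add: algebra_simps c_def[symmetric] k zp_of_nat)
  ultimately have 1: "1 - \<zeta> ^ k \<in> P" using prime_in_rules(6)[OF P, of "- (1 - \<zeta> ^ k)"] by simp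
  have "of_nat p = (1 - \<zeta> ^ k) * (\<Prod>k\<in>{1..<p} - {k}. 1 - \<zeta> ^ k)"
    using prod.remove[OF _ kI, of "\<lambda>k. 1 - \<zeta> ^ k"] zeta_norm[OF p_pos(1)] by simp
  moreover have "(\<Prod>k\<in>{1..<p} - {k}. 1 - \<zeta> ^ k) \<in> R"
    by (intro csubring_prod csubring_basic(2) csubring_basic(1) csubring_power P z)
  ultimately show False using prime_in_rules(5)[OF P _ 1] p by simp
qed

text \<open>Modulo \<open>P\<close> the \<open>p\<close>-th roots of unity stay distinct, and
  \<open>\<nu>\<close> is nonzero unless \<open>N\<close> is in \<open>P\<close>. The rings
  \<open>R\<close> and \<open>K\<close> are kept general so that this applies both to
  \<open>L\<close> and to \<open>Qbar\<close>.\<close>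

lemma inertia_char:
  assumes P: "prime_in R P" "csubring R" and z: "\<zeta> \<in> R" "\<nu> \<in> R" and s: "chom K s" "csubring K" "R \<subseteq> K"
    and inert: "\<And>x. x \<in> R \<Longrightarrow> s x - x \<in> P" and p: "of_nat p \<notin> P"
  shows "chi s = 1" "of_nat N \<notin> P \<Longrightarrow> kb s = 0"
proof -
  note act = char_action[OF s(1,2) subsetD[OF s(3) z(1)] subsetD[OF s(3) z(2)]]
  show "chi s = 1" using inert[OF z(1)] act(1) zp_1 by (intro zp_mod_inj[OF P z(1) p]) simp
  show "kb s = 0" if "of_nat N \<notin> P"
  proof -
    have "(zp (kb s) - zp 0) * \<nu> \<in> P" using inert[OF z(2)] act(2) by (simp add: zp_0 algebra_simps)
    moreover have "\<nu> \<notin> P"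
    proof
      assume "\<nu> \<in> P"
      hence "\<nu> * \<nu> ^ (p - 1) \<in> P" by (intro prime_in_rules(5)[OF P] csubring_power P z)
      thus False using \<nu>_power that p_pos by (simp add: power_eq_if[of _ p, symmetric] flip: power_Suc)
    qed
    ultimately have "zp (kb s) - zp 0 \<in> P"
      using prime_in_rules(9)[OF P, of "zp (kb s) - zp 0" \<nu>] csubring_basic(2)[OF P(2) zp_mem zp_mem] P z by blast
    thus ?thesis by (rule zp_mod_inj[OF P z(1) p])
  qed
qed

text \<open>
  Otherwise inertia in \<open>L\<close> would be trivial, so the automorphisms would be independent characters
  modulo \<open>P\<close>; but the Lagrange resolvents of \<open>\<nu>\<close> are all divisible by \<open>P\<close>.
\<close>

lemma inertia_moves_\<nu>:
  assumes P: "prime_in (L \<inter> Zbar) P" and N: "of_nat N \<in> P"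
  shows "\<exists>g\<in>Gal L \<rat>. (\<forall>x\<in>L \<inter> Zbar. g x - x \<in> P) \<and> g \<nu> \<noteq> \<nu>"
proof (rule ccontr)
  assume neg: "\<not> ?thesis"
  have N0: "(of_nat N :: complex) \<noteq> 0" using N_pos by simp
  interpret L: galois_number_field L by (rule galois_number_field_L)
  interpret L: number_field_prime L P
  proof unfold_locales
    show "P \<noteq> {0}" using N N0 by blast
  qed (rule P)
  have zO: "\<zeta> \<in> L \<inter> Zbar" "\<nu> \<in> L \<inter> Zbar" using L_mem \<zeta>_Zbar \<nu>_Zbar by auto
  have p: "of_nat p \<notin> P" by (rule distinct_primes_not_mem[OF P L.O_ring prime_N prime_p N_ne_p N])
  have act: "g \<nu> = zp (kb g) * \<nu>" "g \<zeta> = zp (chi g)" if "g \<in> Gal L \<rat>" for g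
    using char_action[OF L.G_rules(2)[OF that] L.M_ring L_mem] by auto
  have triv: "g = restrict (\<lambda>x. x) L" if g: "g \<in> Gal L \<rat>" "\<And>x. x \<in> L \<inter> Zbar \<Longrightarrow> g x - x \<in> P" for g
  proof (rule Gal_eqI[OF L.M g(1) L.idM[OF L.Rats_M]])
    have "chi g = 1" by (rule inertia_char(1)[OF P L.O_ring zO L.G_rules(2)[OF g(1)] L.M_ring _ g(2) p]) auto
    hence fx: "g \<zeta> = \<zeta>" "g \<nu> = \<nu>" using neg g act(2)[OF g(1)] zp_1 by auto
    fix x assume x: "x \<in> L"
    have "g x = x"
    proof (rule adjoin_hom_eq[of "{\<zeta>, \<nu>}" g "\<lambda>x. x"])
      show "chom (adjoin {\<zeta>, \<nu>}) g" using L.G_rules(2)[OF g(1)] by (simp add: kummer_field_def)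
      show "chom (adjoin {\<zeta>, \<nu>}) (\<lambda>x. x)" by (simp add: chom_def)
    qed (use fx x in \<open>auto simp: kummer_field_def\<close>)
    thus "g x = restrict (\<lambda>x. x) L x" using x by simp
  qed
  have "zp (kb (restrict (\<lambda>x. x) L)) \<in> P"
  proof (rule independent_characters[OF P L.O_ring, of "L \<inter> Zbar" "Gal L \<rat>" "\<lambda>g x. g x" "\<lambda>g. zp (kb g)"])
    show "1 \<in> L \<inter> Zbar" by (rule L.O_rules(1))
    show "\<And>x y. x \<in> L \<inter> Zbar \<Longrightarrow> y \<in> L \<inter> Zbar \<Longrightarrow> x * y \<in> L \<inter> Zbar" by (rule L.O_rules(3))
    show "finite (Gal L \<rat>)" by (rule L.finite_Gal)
    show "g x \<in> L \<inter> Zbar" if "g \<in> Gal L \<rat>" "x \<in> L \<inter> Zbar" for g x by (rule L.G_O[OF that])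
    show "g 1 = 1" if "g \<in> Gal L \<rat>" for g using L.G_rules(2)[OF that] by (simp add: chom_def)
    show "g (x * y) = g x * g y" if "g \<in> Gal L \<rat>" "x \<in> L \<inter> Zbar" "y \<in> L \<inter> Zbar" for g x y
      using that by (intro chom_rules(3)[OF L.G_rules(2)[OF that(1)] L.M_ring]) auto
    show "\<exists>x\<in>L \<inter> Zbar. g x - h x \<notin> P" if "g \<in> Gal L \<rat>" "h \<in> Gal L \<rat>" "g \<noteq> h" for g h
      by (rule L.inertia_distinct[OF L.Rats_M triv that])
    show "restrict (\<lambda>x. x) L \<in> Gal L \<rat>" by (rule L.idM[OF L.Rats_M])
    show "zp (kb g) \<in> L \<inter> Zbar" for g by (rule zp_mem[OF L.O_ring zO(1)])
    fix x assume x: "x \<in> L \<inter> Zbar"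
    \<comment> \<open>A Lagrange resolvent: \<open>\<nu> * u\<close> is the trace of
      \<open>\<nu> * x\<close>, an integer \<open>k\<close>. From \<open>k ^ p = N * u ^ p\<close>
      with \<open>p \<ge> 2\<close> the integer \<open>u ^ p\<close> is divisible by
      \<open>N\<close>, which puts \<open>u\<close> into \<open>P\<close>.\<close>
    define u where "u = (\<Sum>g\<in>Gal L \<rat>. zp (kb g) * g x)"
    have uO: "u \<in> L \<inter> Zbar" unfolding u_def
      by (rule L.O_rules(8), rule L.O_rules(3)[OF zp_mem[OF L.O_ring zO(1)] L.G_O[OF _ x]])
    have "(\<Sum>g\<in>Gal L \<rat>. g (\<nu> * x)) \<in> \<int>" by (rule L.trace_Ints[OF L.O_rules(3)[OF zO(2) x]])
    moreover have "(\<Sum>g\<in>Gal L \<rat>. g (\<nu> * x)) = \<nu> * u" unfolding u_def sum_distrib_left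
    proof (rule sum.cong[OF refl])
      fix g assume g: "g \<in> Gal L \<rat>"
      have "g (\<nu> * x) = g \<nu> * g x" using zO x by (intro chom_rules(3)[OF L.G_rules(2)[OF g] L.M_ring]) auto
      thus "g (\<nu> * x) = \<nu> * (zp (kb g) * g x)" using act(1)[OF g] by simp
    qed
    ultimately obtain k where k: "\<nu> * u = of_int k" by (auto elim: Ints_cases)
    have e: "of_int k ^ p = of_nat N * u ^ p" by (simp add: k[symmetric] power_mult_distrib \<nu>_power)
    have "u ^ p = of_int k ^ p / of_nat N" using e N0 by (simp add: field_simps)
    hence "u ^ p \<in> \<rat>" by simp
    moreover have upO: "u ^ p \<in> L \<inter> Zbar" by (rule L.O_rules(7)[OF uO])
    ultimately have "u ^ p \<in> \<int>" using Rats_Zbar by blast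
    then obtain w where w: "u ^ p = of_int w" by (auto elim: Ints_cases)
    have "int N dvd w" by (rule Rats_power_dvd[OF prime_N _ e[unfolded w]]) (use p_pos in simp)
    then obtain w' where "w = int N * w'" by (rule dvdE)
    hence "u ^ p = of_nat N * of_int w'" using w by simp
    hence "u ^ p \<in> P" using L.P_rules(5)[OF L.O_rules(11) N] by simp
    hence "u \<in> P" by (rule prime_in_power[OF P L.O_ring uO])
    thus "(\<Sum>g\<in>Gal L \<rat>. zp (kb g) * g x) \<in> P" unfolding u_def .
  qed
  hence "zp (- kb (restrict (\<lambda>x. x) L)) * zp (kb (restrict (\<lambda>x. x) L)) \<in> P"
    by (rule L.P_rules(4)[OF zp_mem[OF L.O_ring zO(1)]])
  thus False using zp_minus L.P_rules(8) by simp
qed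

subsection \<open>Powers of automorphisms\<close>

text \<open>Iterating \<open>compose Qbar\<close> from \<open>idQ\<close> keeps the powers
  extensional, hence inside \<open>G_Q\<close>.\<close>

definition gpow :: "(complex \<Rightarrow> complex) \<Rightarrow> nat \<Rightarrow> complex \<Rightarrow> complex" where
  "gpow t k = (compose Qbar t ^^ k) idQ"

lemma gpow_simps: "gpow t 0 = idQ" "gpow t (Suc k) = compose Qbar t (gpow t k)" by (simp_all add: gpow_def)

lemma gpow_G: "t \<in> G_Q \<Longrightarrow> gpow t k \<in> G_Q"
  by (induction k) (auto simp: gpow_simps idQ Rats_Qbar intro: Gal_compose[OF Qbar_field Rats_Qbar])

lemma char_idQ: "chi idQ = 1" "kb idQ = 0" using idQ[OF L_Qbar] Gal_L_iff by auto

lemma char_gpow: "t \<in> G_Q \<Longrightarrow> chi t = 1 \<Longrightarrow> chi (gpow t k) = 1 \<and> kb (gpow t k) = of_nat k * kb t"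
proof (induction k)
  case 0
  show ?case unfolding gpow_simps(1) char_idQ by simp
next
  case (Suc k)
  thus ?case using char_compose[OF Suc.prems(1) gpow_G[OF Suc.prems(1), of k]] by (simp add: gpow_simps algebra_simps)
qed

lemma gpow_inertia:
  assumes P: "prime_in Zbar PP" and t: "t \<in> G_Q" "\<And>x. x \<in> Zbar \<Longrightarrow> t x - x \<in> PP" and x: "x \<in> Zbar"
  shows "gpow t k x \<in> Zbar \<and> gpow t k x - x \<in> PP"
proof (induction k)
  case 0
  thus ?case using x Zbar_subset_Qbar prime_in_rules(2)[OF P csubring_Zbar] by (auto simp: gpow_simps)
next
  case (Suc k)
  have xQ: "x \<in> Qbar" using x Zbar_subset_Qbar by blast
  have e: "gpow t (Suc k) x = t (gpow t k x)" using xQ by (simp add: gpow_simps compose_eq)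
  have "(t (gpow t k x) - gpow t k x) + (gpow t k x - x) \<in> PP"
    using Suc t(2) by (intro prime_in_rules(3)[OF P csubring_Zbar]) auto
  thus ?case using Suc G_Q_Zbar[OF t(1)] by (simp add: e)
qed

text \<open>An inertial automorphism of \<open>L\<close> that moves \<open>\<nu>\<close> lifts to an
  inertial element of \<open>G_Q\<close>. Since \<open>N\<close> differs from \<open>p\<close> it
  fixes the roots of unity, and a power of it normalizes \<open>kb\<close> to 1.\<close>

lemma inertia_at_N:
  assumes PP: "prime_in Zbar PP" "of_nat N \<in> PP"
  obtains t where "t \<in> G_Q" "\<And>x. x \<in> Zbar \<Longrightarrow> t x - x \<in> PP" "chi t = 1" "kb t = 1"
proof -
  have P: "prime_in (L \<inter> Zbar) (PP \<inter> L)" by (rule prime_in_restrict[OF PP(1) L_field])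
  have "of_nat N \<in> PP \<inter> L" using PP(2) csubring_of_nat[OF csubfield_csubring[OF L_field]] by blast
  then obtain g where g: "g \<in> Gal L \<rat>" "\<forall>x\<in>L \<inter> Zbar. g x - x \<in> PP \<inter> L" "g \<nu> \<noteq> \<nu>"
    using inertia_moves_\<nu>[OF P] by blast
  obtain s where s: "s \<in> G_Q" "\<And>x. x \<in> L \<Longrightarrow> s x = g x"
    using Gal_lift[OF L_field L_Qbar Rats_L g(1)] by metis
  obtain t where t: "t \<in> G_Q" "\<And>x. x \<in> L \<Longrightarrow> t x = s x" "\<And>x. x \<in> Zbar \<Longrightarrow> t x - x \<in> PP"
    by (rule inertia_lift[OF galois_number_field_L PP _ s(1)]) (use g s N_pos in auto)
  have p: "of_nat p \<notin> PP" by (rule distinct_primes_not_mem[OF PP(1) csubring_Zbar prime_N prime_p N_ne_p PP(2)])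
  have c1: "chi t = 1"
    by (rule inertia_char(1)[OF PP(1) csubring_Zbar \<zeta>_Zbar \<nu>_Zbar GQ_rules(2)[OF t(1)] Q_ring Zbar_subset_Qbar t(3) p])
  have "kb t \<noteq> 0"
  proof
    assume "kb t = 0"
    hence "t \<nu> = \<nu>" using GQ_action(2)[OF t(1)] zp_0 by simp
    thus False using t(2)[OF L_mem(2)] s(2)[OF L_mem(2)] g(3) by simp
  qed
  obtain k where k: "inverse (kb t) = of_nat k" by (rule of_nat_cases) blast
  have "of_nat k * kb t = 1" using \<open>kb t \<noteq> 0\<close> by (simp flip: k)
  thus ?thesis using that[of "gpow t k"] gpow_G[OF t(1)] gpow_inertia[OF PP(1) t(1,3)] char_gpow[OF t(1) c1, of k] by simp
qed

text \<open>Powers of the inertial element at \<open>N\<close> adjust \<open>kb\<close> and leave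
  \<open>chi\<close> alone.\<close>

lemma char_surj:
  assumes "a \<noteq> 0" obtains s where "s \<in> G_Q" "chi s = a" "kb s = b"
proof -
  obtain PP where PP: "prime_in Zbar PP" "of_nat N \<in> PP" by (rule exists_place[OF prime_N])
  obtain t where t: "t \<in> G_Q" "chi t = 1" "kb t = 1" by (rule inertia_at_N[OF PP]) blast
  obtain s where s: "s \<in> G_Q" "chi s = a" by (rule chi_surj[OF assms])
  obtain k where k: "b - kb s = of_nat k" by (rule of_nat_cases) blast
  have g: "gpow t k \<in> G_Q" "chi (gpow t k) = 1" "kb (gpow t k) = b - kb s"
    using gpow_G[OF t(1)] char_gpow[OF t(1,2), of k] t(3) k by auto
  show ?thesis using that[of "compose Qbar (gpow t k) s"] char_compose[OF g(1) s(1)] g s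
      Gal_compose[OF Qbar_field Rats_Qbar g(1) s(1)] by simp
qed

end

section \<open>The modules as spaces of polynomials in one variable\<close>

lemma mod_ring_power_card:
  assumes "(a :: 'p::prime_card mod_ring) \<noteq> 0" shows "a ^ (CARD('p) - 1) = 1"
proof -
  define S where "S = UNIV - {0 :: 'p mod_ring}"
  have "(\<lambda>x. a * x) ` S = S" by (rule endo_inj_surj) (use assms in \<open>auto simp: S_def inj_on_def\<close>)
  moreover have inj: "inj_on (\<lambda>x. a * x) S" using assms by (auto simp: inj_on_def)
  ultimately have "prod (\<lambda>x. x) S = (\<Prod>x\<in>S. a * x)"
    by (metis (mono_tags, lifting) prod.cong prod.reindex_cong)
  also have "\<dots> = a ^ card S * prod (\<lambda>x. x) S" by (simp add: prod.distrib)
  finally have "prod (\<lambda>x. x) S * (a ^ card S - 1) = 0" by (simp add: algebra_simps)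
  moreover have "prod (\<lambda>x. x) S \<noteq> 0" by (auto simp: S_def)
  moreover have "card S = CARD('p) - 1" unfolding S_def by (subst card_Diff_subset) auto
  ultimately show ?thesis by simp
qed

text \<open>\<open>X ^ m - 1\<close> has at most \<open>m\<close> roots, fewer than there are
  nonzero elements.\<close>

lemma mod_ring_power_ne_one:
  assumes "0 < m" "m < CARD('p::prime_card) - 1"
  obtains a where "(a :: 'p::prime_card mod_ring) \<noteq> 0" "a ^ m \<noteq> 1"
proof -
  define q where "q = monom (1 :: 'p mod_ring) m - 1"
  have c: "coeff q m = 1" using assms(1) by (simp add: q_def coeff_1)
  have q0: "q \<noteq> 0" using c by auto
  have "degree q \<le> m" unfolding q_def by (intro degree_diff_le) (simp_all add: degree_monom_le)
  hence le: "card {x. poly q x = 0} \<le> m" using card_poly_roots_bound[OF q0] by simp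
  have "card (UNIV - {0 :: 'p mod_ring}) = CARD('p) - 1" by (subst card_Diff_subset) auto
  hence "\<not> UNIV - {0} \<subseteq> {x. poly q x = 0}"
    using card_mono[OF poly_roots_finite[OF q0], of "UNIV - {0}"] le assms(2) by auto
  then obtain a where "a \<noteq> 0" "poly q a \<noteq> 0" by blast
  thus ?thesis using that by (simp add: q_def poly_monom)
qed

lemma mod_ring_of_nat_ne_zero: "0 < n \<Longrightarrow> n < CARD('p::prime_card) \<Longrightarrow> (of_nat n :: 'p mod_ring) \<noteq> 0"
  using of_nat_0_mod_ring_dvd[of n, where 'a = 'p] nat_dvd_not_less by blast

text \<open>The difference operator. By \<open>dehom_act_shift\<close> it is \<open>T - 1\<close>
  for a Galois element \<open>T\<close> with \<open>chi = 1\<close> and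
  \<open>kb = 1\<close>.\<close>

definition shiftd :: "'a::comm_ring_1 poly \<Rightarrow> 'a poly" where
  "shiftd g = pcompose g [:1, 1:] - g"

lemma shiftd_add: "shiftd (g + h) = shiftd g + shiftd h" by (simp add: shiftd_def pcompose_add)

lemma coeff_pcompose_shift:
  fixes g :: "'a::comm_ring_1 poly"
  assumes "\<And>k. k > n \<Longrightarrow> coeff g k = 0"
  shows "coeff (pcompose g [:1, 1:]) k = (\<Sum>m\<le>n. coeff g m * of_nat (m choose k))"
proof -
  have dg: "degree g \<le> n" using assms by (intro degree_le) auto
  have "pcompose g [:1, 1:] = (\<Sum>m\<le>degree (map_poly (\<lambda>x. [:x:]) g). coeff (map_poly (\<lambda>x. [:x:]) g) m * [:1, 1:] ^ m)"
    unfolding pcompose_altdef by (rule poly_altdef)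
  also have "\<dots> = (\<Sum>m\<le>degree g. [:coeff g m:] * [:1, 1:] ^ m)"
    by (subst degree_map_poly) (auto simp: coeff_map_poly)
  also have "\<dots> = (\<Sum>m\<le>n. [:coeff g m:] * [:1, 1:] ^ m)"
    by (rule sum.mono_neutral_left) (use dg in \<open>auto simp: coeff_eq_0\<close>)
  finally have "pcompose g [:1, 1:] = (\<Sum>m\<le>n. smult (coeff g m) ([:1, 1:] ^ m))" by simp
  moreover have "coeff ([:1, 1:] ^ m) k = (of_nat (m choose k) :: 'a)" for m
    by (induction m arbitrary: k) (auto simp: coeff_pCons coeff_1 binomial_eq_0 split: nat.splits)
  ultimately show ?thesis by (simp add: coeff_sum)
qed

lemma coeff_shiftd:
  fixes g :: "'a::comm_ring_1 poly"
  assumes g: "\<And>k. k > n \<Longrightarrow> coeff g k = 0"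
  shows "k \<ge> n \<Longrightarrow> coeff (shiftd g) k = 0"
    "n = Suc l \<Longrightarrow> coeff (shiftd g) l = of_nat n * coeff g n"
proof -
  show "coeff (shiftd g) k = 0" if k: "k \<ge> n"
  proof -
    have "(\<Sum>m\<le>n. coeff g m * of_nat (m choose k)) = (\<Sum>m\<le>n. if m = k then coeff g k else 0)"
      using k by (intro sum.cong refl) (auto simp: binomial_eq_0)
    also have "\<dots> = coeff g k" using k g[of k] by auto
    finally show ?thesis by (simp add: shiftd_def coeff_pcompose_shift[OF g])
  qed
  show "coeff (shiftd g) l = of_nat n * coeff g n" if n: "n = Suc l"
  proof -
    have "(\<Sum>m\<le>n. coeff g m * of_nat (m choose l)) = (\<Sum>m<l. coeff g m * of_nat (m choose l)) + coeff g l + coeff g n * of_nat n"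
      by (simp add: n lessThan_Suc_atMost[symmetric])
    also have "(\<Sum>m<l. coeff g m * of_nat (m choose l)) = 0" by (intro sum.neutral) (simp add: binomial_eq_0)
    finally show ?thesis by (simp add: shiftd_def coeff_pcompose_shift[OF g] mult.commute)
  qed
qed

text \<open>Repeated differences of \<open>g\<close> have every degree from \<open>n\<close> down to
  0, since \<open>n < p\<close> keeps the factors produced by \<open>coeff_shiftd\<close>
  invertible; \<open>h\<close> is reduced against them.\<close>

lemma shiftd_span:
  fixes g :: "'p::prime_card mod_ring poly"
  assumes W: "\<And>x y. x \<in> W \<Longrightarrow> y \<in> W \<Longrightarrow> x - y \<in> W" "\<And>x. x \<in> W \<Longrightarrow> shiftd x \<in> W"
    and g: "g \<in> W" "\<And>k. k > n \<Longrightarrow> coeff g k = 0" "coeff g n \<noteq> 0" and n: "n < CARD('p)"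
    and h: "\<And>k. k > n \<Longrightarrow> coeff h k = 0"
  shows "h \<in> W" using g n h
proof (induction n arbitrary: g h)
  have W0: "0 \<in> W" if "x \<in> W" for x using W(1)[OF that that] by simp
  have add: "x + y \<in> W" if "x \<in> W" "y \<in> W" for x y using W(1)[OF that(1) W(1)[OF W0[OF that(1)] that(2)]] by simp
  \<comment> \<open>Every scalar is the class of a natural number, so closure under differences
    already makes \<open>W\<close> a subspace.\<close>
  have mult: "smult c x \<in> W" if "x \<in> W" for c :: "'p mod_ring" and x
  proof -
    obtain r where r: "c = of_nat r" using surj_of_nat_mod_ring[of c] by blast
    have "smult (of_nat r) x \<in> W" by (induction r) (use that W0[OF that] add in \<open>auto simp: smult_add_left\<close>)
    thus ?thesis by (simp add: r)
  qed
  {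
    case 0
    have "h = smult (coeff h 0 / coeff g 0) g"
    proof (rule poly_eqI)
      fix k show "coeff h k = coeff (smult (coeff h 0 / coeff g 0) g) k" using 0 by (cases "k = 0") auto
    qed
    thus ?case using mult[OF 0(1)] by metis
  next
    case (Suc n)
    have IH: "h' \<in> W" if "\<And>k. k > n \<Longrightarrow> coeff h' k = 0" for h'
    proof (rule Suc.IH[OF W(2)[OF Suc.prems(1)]])
      show "coeff (shiftd g) k = 0" if "k > n" for k using coeff_shiftd(1)[of "Suc n" g k] Suc.prems(2) that by auto
      have "coeff (shiftd g) n = of_nat (Suc n) * coeff g (Suc n)" by (rule coeff_shiftd(2)[OF Suc.prems(2)]) simp_all
      moreover have "(of_nat (Suc n) :: 'p mod_ring) \<noteq> 0" by (rule mod_ring_of_nat_ne_zero) (use Suc.prems(4) in auto)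
      ultimately show "coeff (shiftd g) n \<noteq> 0" using Suc.prems(3) by (simp del: of_nat_Suc)
    qed (use Suc.prems(4) that in auto)
    define c where "c = coeff h (Suc n) / coeff g (Suc n)"
    have "h - smult c g \<in> W"
    proof (rule IH)
      fix k assume "k > n"
      thus "coeff (h - smult c g) k = 0" using Suc.prems(2,3,5) by (cases "k = Suc n") (auto simp: c_def)
    qed
    hence "(h - smult c g) + smult c g \<in> W" using mult[OF Suc.prems(1)] add by blast
    thus ?case by simp
  }
qed

text \<open>Discrete integration: the leading term is divided by its new degree, which is nonzero
  modulo \<open>p\<close>, and what remains has smaller degree.\<close>

lemma shiftd_surj:
  fixes v :: "'p::prime_card mod_ring poly"
  assumes "n < CARD('p)" "\<And>k. k \<ge> n \<Longrightarrow> coeff v k = 0"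
  shows "\<exists>a. (\<forall>k>n. coeff a k = 0) \<and> shiftd a = v" using assms
proof (induction n arbitrary: v)
  case 0
  hence "v = 0" by (intro poly_eqI) simp
  thus ?case by (intro exI[of _ 0]) (simp add: shiftd_def)
next
  case (Suc n)
  have nz: "(of_nat (Suc n) :: 'p mod_ring) \<noteq> 0" by (rule mod_ring_of_nat_ne_zero) (use Suc.prems in auto)
  define a where "a = monom (coeff v n / of_nat (Suc n)) (Suc n)"
  have a0: "coeff a k = 0" if "k > Suc n" for k using that by (simp add: a_def)
  have "coeff (shiftd a) n = of_nat (Suc n) * coeff a (Suc n)" by (rule coeff_shiftd(2)[OF a0]) simp_all
  also have "\<dots> = coeff v n" using nz by (simp add: a_def del: of_nat_Suc)
  finally have top: "coeff (shiftd a) n = coeff v n" .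
  obtain b where b: "\<forall>k>n. coeff b k = 0" "shiftd b = v - shiftd a"
  proof (rule exE[OF Suc.IH[of "v - shiftd a"]])
    fix k assume "k \<ge> n"
    thus "coeff (v - shiftd a) k = 0" using top Suc.prems(2)[of k] coeff_shiftd(1)[OF a0, of k] by (cases "k = n") auto
  qed (use Suc.prems in auto)
  have "shiftd (a + b) = v" using b(2) by (simp add: shiftd_add)
  thus ?case using a0 b(1) by (intro exI[of _ "a + b"]) auto
qed

section \<open>Dehomogenization: forms of degree \<open>i\<close> as polynomials of degree at most
  \<open>i\<close>\<close>

definition dehom :: "'a::comm_semiring_1 poly poly \<Rightarrow> 'a poly" where
  "dehom f = map_poly (\<lambda>q. poly q 1) f"

definition homog :: "nat \<Rightarrow> 'a::comm_ring_1 poly \<Rightarrow> 'a poly poly" where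
  "homog i g = (\<Sum>k\<le>i. monom (monom (coeff g k) (i - k)) k)"

lemma comm_ring_hom_poly: "comm_ring_hom (\<lambda>q. poly q (a :: 'a::comm_ring_1))" by unfold_locales auto

lemma coeff_dehom: "coeff (dehom f) k = poly (coeff f k) 1" by (simp add: dehom_def coeff_map_poly)

lemma dehom_add: "dehom (f + g) = dehom f + dehom (g :: 'a::comm_ring_1 poly poly)"
  and dehom_diff: "dehom (f - g) = dehom f - dehom (g :: 'a poly poly)"
  and dehom_0: "dehom (0 :: 'a poly poly) = 0"
  and dehom_smult: "dehom (smult q f) = smult (poly q 1) (dehom (f :: 'a poly poly))"
  by (auto intro!: poly_eqI simp: coeff_dehom)

lemma Sym_coeff:
  assumes "f \<in> Sym i"
  shows "coeff f k = (if k \<le> i then monom (coeff (dehom f) k) (i - k) else 0)"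
proof -
  have z: "coeff (coeff f k) m = 0" if "k + m \<noteq> i" for m using assms that unfolding Sym_def by blast
  show ?thesis
  proof (cases "k \<le> i")
    case True
    define c where "c = coeff (coeff f k) (i - k)"
    have e: "coeff f k = monom c (i - k)"
    proof (rule poly_eqI)
      fix m show "coeff (coeff f k) m = coeff (monom c (i - k)) m"
        using z[of m] True by (cases "m = i - k") (auto simp: c_def)
    qed
    hence "coeff (dehom f) k = c" by (simp add: coeff_dehom poly_monom)
    thus ?thesis using e True by simp
  next
    case False
    hence "coeff f k = 0" using z by (intro poly_eqI) simp
    thus ?thesis using False by simp
  qed
qed

lemma dehom_inj: "f \<in> Sym i \<Longrightarrow> g \<in> Sym i \<Longrightarrow> dehom f = dehom g \<Longrightarrow> f = g"
  by (rule poly_eqI) (simp add: Sym_coeff)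

lemma dehom_bound: "f \<in> Sym i \<Longrightarrow> k > i \<Longrightarrow> coeff (dehom f) k = 0"
  using Sym_coeff[of f i k] by (simp add: coeff_dehom)

lemma homog_Sym: "homog i g \<in> (Sym i :: 'p::prime_card mod_ring poly poly set)"
  unfolding Sym_def homog_def by (auto simp: coeff_sum if_distrib[where f = "\<lambda>q. coeff q _"] split: if_splits)

lemma dehom_homog:
  assumes "\<And>k. k > i \<Longrightarrow> coeff g k = 0" shows "dehom (homog i g) = g"
proof (rule poly_eqI)
  fix k
  have "coeff (homog i g) k = (if k \<le> i then monom (coeff g k) (i - k) else 0)" by (simp add: homog_def coeff_sum)
  thus "coeff (dehom (homog i g)) k = coeff g k" using assms[of k] by (simp add: coeff_dehom poly_monom)
qed

lemma Sym_closed: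
  shows "0 \<in> Sym i" "f \<in> Sym i \<Longrightarrow> g \<in> Sym i \<Longrightarrow> f + g \<in> Sym i" "f \<in> Sym i \<Longrightarrow> g \<in> Sym i \<Longrightarrow> f - g \<in> Sym i"
    "f \<in> Sym i \<Longrightarrow> - f \<in> Sym i" "f \<in> Sym i \<Longrightarrow> smult [:a:] f \<in> Sym i"
proof -
  show "0 \<in> Sym i" by (simp add: Sym_def)
  show "f \<in> Sym i \<Longrightarrow> g \<in> Sym i \<Longrightarrow> f + g \<in> Sym i" unfolding Sym_def mem_Collect_eq coeff_add by (metis add_0)
  show "f \<in> Sym i \<Longrightarrow> g \<in> Sym i \<Longrightarrow> f - g \<in> Sym i" unfolding Sym_def mem_Collect_eq coeff_diff by (metis diff_0_right)
  show "f \<in> Sym i \<Longrightarrow> - f \<in> Sym i" unfolding Sym_def mem_Collect_eq coeff_minus by simp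
  show "f \<in> Sym i \<Longrightarrow> smult [:a:] f \<in> Sym i" unfolding Sym_def by simp
qed

lemma Sym_sum: "(\<And>k. k \<in> I \<Longrightarrow> f k \<in> Sym i) \<Longrightarrow> sum f I \<in> Sym i"
  by (induction I rule: infinite_finite_induct) (auto intro: Sym_closed)

lemma Sym_mult:
  assumes "f \<in> Sym a" "g \<in> Sym b" shows "f * g \<in> Sym (a + b)" unfolding Sym_def
proof (intro CollectI allI impI)
  fix k m assume nz: "coeff (coeff (f * g) k) m \<noteq> 0"
  have "coeff (coeff (f * g) k) m = (\<Sum>r\<le>k. \<Sum>s\<le>m. coeff (coeff f r) s * coeff (coeff g (k - r)) (m - s))"
    by (simp add: coeff_mult coeff_sum)
  then obtain r where r: "r \<le> k" "(\<Sum>s\<le>m. coeff (coeff f r) s * coeff (coeff g (k - r)) (m - s)) \<noteq> 0"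
    using nz by (metis (no_types, lifting) atMost_iff sum.neutral)
  then obtain s where s: "s \<le> m" "coeff (coeff f r) s * coeff (coeff g (k - r)) (m - s) \<noteq> 0"
    by (metis (no_types, lifting) atMost_iff sum.neutral)
  hence "r + s = a" "(k - r) + (m - s) = b" using assms unfolding Sym_def by auto
  thus "k + m = a + b" using r(1) s(1) by simp
qed

lemma Sym_power: "f \<in> Sym 1 \<Longrightarrow> f ^ n \<in> Sym n"
proof (induction n)
  case 0
  thus ?case by (simp add: Sym_def coeff_1)
next
  case (Suc n)
  thus ?case using Sym_mult[OF Suc.prems Suc.IH] by simp
qed

lemma Sym_act_Sym:
  assumes "f \<in> Sym i" shows "Sym_act N s f \<in> Sym i"
proof -
  define F where "F = map_poly (\<lambda>q. pcompose q [:0, cyc_char s:]) f"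
  have cF: "coeff F k = pcompose (coeff f k) [:0, cyc_char s:]" for k by (simp add: F_def coeff_map_poly)
  have "pcompose F [:[:0, kummer_cocycle N s:], 1:] =
      (\<Sum>m\<le>degree (map_poly (\<lambda>x. [:x:]) F). coeff (map_poly (\<lambda>x. [:x:]) F) m * [:[:0, kummer_cocycle N s:], 1:] ^ m)"
    unfolding pcompose_altdef by (rule poly_altdef)
  also have "\<dots> \<in> Sym i"
  proof (rule Sym_sum)
    fix m
    have l: "[:[:0, kummer_cocycle N s:], 1:] \<in> Sym 1"
      unfolding Sym_def by (auto simp: coeff_pCons split: nat.splits if_splits)
    show "coeff (map_poly (\<lambda>x. [:x:]) F) m * [:[:0, kummer_cocycle N s:], 1:] ^ m \<in> Sym i"
    proof (cases "m \<le> i")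
      case True
      define c where "c = coeff (dehom f) m"
      have "coeff f m = monom c (i - m)" using Sym_coeff[OF assms, of m] True by (simp add: c_def)
      hence "coeff F m = smult c ([:0, cyc_char s:] ^ (i - m))"
        by (simp add: cF monom_altdef pcompose_smult pcompose_hom.hom_power pcompose_pCons)
      also have "\<dots> = monom (c * cyc_char s ^ (i - m)) (i - m)"
      proof -
        have e: "[:0, cyc_char s:] = monom (cyc_char s) 1" by (simp add: monom_altdef)
        show ?thesis unfolding e by (simp add: monom_power smult_monom)
      qed
      finally have "[:coeff F m:] \<in> Sym (i - m)"
        unfolding Sym_def by (auto simp: coeff_pCons split: nat.splits if_splits)
      hence "[:coeff F m:] * [:[:0, kummer_cocycle N s:], 1:] ^ m \<in> Sym (i - m + m)"
        by (rule Sym_mult[OF _ Sym_power[OF l]])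
      thus ?thesis using True by (simp add: coeff_map_poly)
    next
      case False
      hence "coeff F m = 0" using Sym_coeff[OF assms, of m] by (simp add: cF)
      thus ?thesis by (simp add: coeff_map_poly Sym_closed)
    qed
  qed
  finally show ?thesis by (simp add: Sym_act_def F_def)
qed

lemma A_act_Sym: "f \<in> Sym i \<Longrightarrow> A_act N j s f \<in> Sym i"
  unfolding A_act_def by (intro Sym_closed(5) Sym_act_Sym)

lemma dehom_pcompose: "dehom (pcompose F G) = pcompose (dehom F) (dehom (G :: 'a::comm_ring_1 poly poly))"
proof -
  interpret comm_ring_hom "\<lambda>q. poly q (1 :: 'a)" by (rule comm_ring_hom_poly)
  interpret map_poly_comm_ring_hom "\<lambda>q. poly q (1 :: 'a)" ..
  show ?thesis unfolding dehom_def by (induction F arbitrary: G) (simp_all add: pcompose_pCons hom_distribs)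
qed

text \<open>On a form of degree \<open>i\<close>, scaling \<open>e1\<close> by \<open>chi\<close>
  amounts, after setting \<open>e1 = 1\<close>, to scaling the remaining variable by the inverse of
  \<open>chi\<close> and multiplying by \<open>chi ^ i\<close>. The action thus becomes an affine
  substitution.\<close>

lemma dehom_A_act:
  fixes f :: "'p::prime_card mod_ring poly poly"
  assumes f: "f \<in> Sym i" and x: "cyc_char s \<noteq> (0 :: 'p::prime_card mod_ring)"
  shows "dehom (A_act N j s f) = smult (cyc_char s powi j * cyc_char s ^ i)
     (pcompose (dehom f) [:kummer_cocycle N s / cyc_char s, 1 / cyc_char s:])"
proof -
  define x b where "x = (cyc_char s :: 'p mod_ring)" and "b = (kummer_cocycle N s :: 'p mod_ring)"
  have x0: "x \<noteq> 0" using x by (simp add: x_def)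
  have "dehom (map_poly (\<lambda>q. pcompose q [:0, x:]) f) = smult (x ^ i) (pcompose (dehom f) [:0, 1 / x:])"
  proof (rule poly_eqI)
    fix k
    have l: "pcompose (dehom f) [:0, 1 / x:] = (\<Sum>m\<le>degree (dehom f). monom (coeff (dehom f) m * (1 / x) ^ m) m)"
    proof -
      have "pcompose (dehom f) [:0, 1 / x:] = (\<Sum>m\<le>degree (map_poly (\<lambda>x. [:x:]) (dehom f)). coeff (map_poly (\<lambda>x. [:x:]) (dehom f)) m * [:0, 1 / x:] ^ m)"
        unfolding pcompose_altdef by (rule poly_altdef)
      also have "\<dots> = (\<Sum>m\<le>degree (dehom f). [:coeff (dehom f) m:] * [:0, 1 / x:] ^ m)"
        by (subst degree_map_poly) (auto simp: coeff_map_poly)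
      also have "\<dots> = (\<Sum>m\<le>degree (dehom f). monom (coeff (dehom f) m * (1 / x) ^ m) m)"
      proof (rule sum.cong[OF refl])
        fix m
        have e: "[:0, 1 / x:] = monom (1 / x) 1" by (simp add: monom_altdef)
        show "[:coeff (dehom f) m:] * [:0, 1 / x:] ^ m = monom (coeff (dehom f) m * (1 / x) ^ m) m"
          unfolding e by (simp add: monom_power smult_monom)
      qed
      finally show ?thesis .
    qed
    have r: "coeff (pcompose (dehom f) [:0, 1 / x:]) k = coeff (dehom f) k * (1 / x) ^ k"
      unfolding l coeff_sum by (simp add: coeff_eq_0)
    have "coeff (dehom (map_poly (\<lambda>q. pcompose q [:0, x:]) f)) k = poly (coeff f k) x"
      by (simp add: coeff_dehom coeff_map_poly poly_pcompose)
    also have "\<dots> = (if k \<le> i then coeff (dehom f) k * x ^ (i - k) else 0)"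
      using Sym_coeff[OF f, of k] by (simp add: poly_monom)
    also have "\<dots> = x ^ i * (coeff (dehom f) k * (1 / x) ^ k)"
      using dehom_bound[OF f, of k] x0 by (auto simp: power_diff power_one_over)
    finally show "coeff (dehom (map_poly (\<lambda>q. pcompose q [:0, x:]) f)) k = coeff (smult (x ^ i) (pcompose (dehom f) [:0, 1 / x:])) k"
      by (simp add: r)
  qed
  moreover have "dehom [:[:0, b:], 1:] = [:b, 1:]" by (rule poly_eqI) (simp add: coeff_dehom coeff_pCons split: nat.split)
  ultimately have "dehom (Sym_act N s f) = pcompose (smult (x ^ i) (pcompose (dehom f) [:0, 1 / x:])) [:b, 1:]"
    unfolding Sym_act_def dehom_pcompose x_def[symmetric] b_def[symmetric] by simp
  also have "\<dots> = smult (x ^ i) (pcompose (dehom f) (pcompose [:0, 1 / x:] [:b, 1:]))"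
    by (simp only: pcompose_smult pcompose_assoc)
  also have "pcompose [:0, 1 / x:] [:b, 1:] = [:b / x, 1 / x:]" by (simp add: pcompose_pCons)
  finally show ?thesis unfolding A_act_def dehom_smult x_def b_def by simp
qed

text \<open>Consequently the submodule generated by \<open>e1\<close> appears as the polynomials of
  degree below \<open>i\<close>.\<close>

lemma dehom_mult_e1: "dehom (mult_e1 f) = dehom (f :: 'p::prime_card mod_ring poly poly)"
proof (rule poly_eqI)
  fix k show "coeff (dehom (mult_e1 f)) k = coeff (dehom f) k" by (simp add: coeff_dehom mult_e1_def)
qed

lemma mult_e1_Sym: assumes "f \<in> Sym i" shows "mult_e1 f \<in> Sym (Suc i)"
proof -
  have "[:[:0, 1:]:] \<in> Sym 1" by (simp add: Sym_def coeff_pCons split: nat.split)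
  from Sym_mult[OF this assms] show ?thesis by (simp add: mult_e1_def)
qed

section \<open>Equivariant maps and cocycles trivial on the Kummer field\<close>

type_synonym 'p cochain = "(complex \<Rightarrow> complex) \<Rightarrow> 'p mod_ring poly poly"

context kummer
begin

abbreviation scale :: "'p mod_ring \<Rightarrow> 'p mod_ring poly poly \<Rightarrow> 'p mod_ring poly poly" where
  "scale a \<equiv> smult [:a:]"

abbreviation A :: "nat \<Rightarrow> 'p mod_ring poly poly set" where "A \<equiv> Sym"
abbreviation act :: "int \<Rightarrow> (complex \<Rightarrow> complex) \<Rightarrow> 'p mod_ring poly poly \<Rightarrow> 'p mod_ring poly poly" where "act \<equiv> A_act N"

text \<open>The coefficient of \<open>e2 ^ i\<close>. Its kernel on \<open>A i\<close> is the image
  of \<open>mult_e1\<close>, so it realizes the one-dimensional top quotient of the module.\<close>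

definition top_coeff :: "nat \<Rightarrow> 'p mod_ring poly poly \<Rightarrow> 'p mod_ring" where
  "top_coeff i f = coeff (dehom f) i"

lemmas GQ_compose = Gal_compose[OF Qbar_field Rats_Qbar]

lemma G_Q_inverse:
  assumes "s \<in> G_Q"
  obtains t where "t \<in> G_Q" "\<And>x. x \<in> Qbar \<Longrightarrow> s (t x) = x" "\<And>x. x \<in> Qbar \<Longrightarrow> t (s x) = x"
  by (rule Gal_inverse[OF Qbar_field Rats_Qbar assms]) blast

lemma chi_nonzero: "s \<in> G_Q \<Longrightarrow> chi s \<noteq> 0"
  by (rule char_action(4)[OF Gal_rules(2)[OF Qbar_field] _ Qbar_mem]) (use Qbar_field in \<open>auto simp: csubfield_def\<close>)

lemma dehom_act:
  assumes "f \<in> A i" "s \<in> G_Q"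
  shows "dehom (act j s f) = smult (chi s powi j * chi s ^ i) (pcompose (dehom f) [:kb s / chi s, 1 / chi s:])"
  by (rule dehom_A_act[OF assms(1) chi_nonzero[OF assms(2)]])

lemma act_mem: "f \<in> A i \<Longrightarrow> act j s f \<in> A i" by (rule A_act_Sym)

lemma act_linear:
  assumes f: "f \<in> A i" and g: "g \<in> A i" and s: "s \<in> G_Q"
  shows "act j s (f + g) = act j s f + act j s g" "act j s (f - g) = act j s f - act j s g"
    "act j s (scale a f) = scale a (act j s f)"
proof -
  note m = f g act_mem[OF f] act_mem[OF g] Sym_closed(2)[OF f g] Sym_closed(3)[OF f g] Sym_closed(5)[OF f]
  show "act j s (f + g) = act j s f + act j s g" by (rule dehom_inj[OF act_mem[OF m(5)] Sym_closed(2)[OF m(3,4)]])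
      (simp add: dehom_add dehom_act[where i = i, OF _ s] m pcompose_add smult_add_right)
  show "act j s (f - g) = act j s f - act j s g" by (rule dehom_inj[OF act_mem[OF m(6)] Sym_closed(3)[OF m(3,4)]])
      (simp add: dehom_diff dehom_act[where i = i, OF _ s] m pcompose_diff smult_diff_right)
  show "act j s (scale a f) = scale a (act j s f)" by (rule dehom_inj[OF act_mem[OF m(7)] Sym_closed(5)[OF m(3)]])
      (simp add: dehom_smult dehom_act[where i = i, OF _ s] m pcompose_smult mult.commute)
qed

lemma act_0: "act j s 0 = 0" by (simp add: A_act_def Sym_act_def)

lemma act_sum:
  assumes "s \<in> G_Q" "\<And>k. k \<in> K \<Longrightarrow> f k \<in> A i"
  shows "act j s (sum f K) = (\<Sum>k\<in>K. act j s (f k))" using assms(2)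
proof (induction K rule: infinite_finite_induct)
  case (insert k K)
  thus ?case using act_linear(1)[OF insert.prems _ assms(1), of k "sum f K"] Sym_sum[of K f i] by simp
qed (simp_all add: act_0)

lemma act_cong: "chi s = chi t \<Longrightarrow> kb s = kb t \<Longrightarrow> act j s f = act j t f"
  by (simp add: A_act_def Sym_act_def)

lemma act_compose:
  assumes f: "f \<in> A i" and s: "s \<in> G_Q" and t: "t \<in> G_Q"
  shows "act j (compose Qbar s t) f = act j s (act j t f)"
proof (rule dehom_inj[OF act_mem[OF f] act_mem[OF act_mem[OF f]]])
  have st: "compose Qbar s t \<in> G_Q" by (rule GQ_compose[OF s t])
  define x y where "x = chi s" and "y = chi t"
  have nz: "x \<noteq> 0" "y \<noteq> 0" using chi_nonzero s t by (auto simp: x_def y_def)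
  have q: "pcompose [:kb t / y, 1 / y:] [:kb s / x, 1 / x:] = [:(kb s + x * kb t) / (x * y), 1 / (x * y):]"
    using nz by (simp add: pcompose_pCons field_simps)
  show "dehom (act j (compose Qbar s t) f) = dehom (act j s (act j t f))"
    unfolding dehom_act[OF f st] dehom_act[OF act_mem[OF f] s] dehom_act[OF f t] char_compose[OF s t]
      x_def[symmetric] y_def[symmetric] pcompose_smult
    unfolding pcompose_assoc[symmetric] q by (simp add: power_int_mult_distrib power_mult_distrib mult_ac)
qed

lemma act_L: assumes "f \<in> A i" "s \<in> G_L" shows "act j s f = f"
proof -
  have s: "s \<in> G_Q" "chi s = 1" "kb s = 0" using assms(2) Gal_L_iff by auto
  show ?thesis by (rule dehom_inj[OF act_mem[OF assms(1)] assms(1)]) (simp add: dehom_act[OF assms(1) s(1)] s pcompose_idR)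
qed

lemma top_coeff_act:
  assumes f: "f \<in> A i" and s: "s \<in> G_Q"
  shows "top_coeff i (act j s f) = chi s powi j * top_coeff i f"
proof -
  define x where "x = chi s"
  have nz: "x \<noteq> 0" using chi_nonzero s by (auto simp: x_def)
  define q where "q = [:kb s / x, 1 / x:]"
  have dq: "degree q = 1" "lead_coeff q = 1 / x" using nz by (simp_all add: q_def)
  have d: "degree (dehom f) \<le> i" using dehom_bound[OF f] by (intro degree_le) auto
  have "coeff (pcompose (dehom f) q) i = coeff (dehom f) i * (1 / x) ^ i"
  proof (cases "degree (dehom f) = i")
    case True
    thus ?thesis using lead_coeff_comp[of q "dehom f"] dq by (simp add: degree_pcompose)
  next
    case False
    thus ?thesis using d dq by (simp add: degree_pcompose coeff_eq_0)
  qed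
  thus ?thesis unfolding top_coeff_def dehom_act[OF f s] x_def[symmetric] q_def[symmetric]
    using nz by (simp add: power_one_over)
qed

lemma top_coeff_linear:
  "top_coeff i (f + g) = top_coeff i f + top_coeff i g" "top_coeff i (f - g) = top_coeff i f - top_coeff i g"
  "top_coeff i 0 = 0" "top_coeff i (scale a f) = a * top_coeff i f"
  by (simp_all add: top_coeff_def dehom_add dehom_diff dehom_0 dehom_smult)

lemma dehom_act_shift:
  assumes "f \<in> A i" "t \<in> G_Q" "chi t = 1" "kb t = 1"
  shows "dehom (act j t f - f) = shiftd (dehom f)"
  using dehom_act[OF assms(1,2), of j] assms(3,4) by (simp add: dehom_diff shiftd_def)

text \<open>One unipotent element suffices: closure under \<open>t\<close> is closure under the
  difference operator, and \<open>shiftd_span\<close> applies.\<close>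

lemma act_span:
  assumes i: "i < p" and t: "t \<in> G_Q" "chi t = 1" "kb t = 1"
    and W: "W \<subseteq> A i" "\<And>f g. f \<in> W \<Longrightarrow> g \<in> W \<Longrightarrow> f - g \<in> W" "\<And>f. f \<in> W \<Longrightarrow> act j t f \<in> W"
    and f: "f \<in> W" "top_coeff i f \<noteq> 0"
  shows "W = A i"
proof
  show "A i \<subseteq> W"
  proof
    fix h assume h: "h \<in> A i"
    have "dehom h \<in> dehom ` W"
    proof (rule shiftd_span[of "dehom ` W" "dehom f" i])
      fix u v assume "u \<in> dehom ` W" "v \<in> dehom ` W"
      thus "u - v \<in> dehom ` W" using W(2) by (force simp: dehom_diff[symmetric])
    next
      fix u assume "u \<in> dehom ` W"
      then obtain g where g: "g \<in> W" "u = dehom g" by blast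
      thus "shiftd u \<in> dehom ` W"
        using dehom_act_shift[OF subsetD[OF W(1) g(1)] t, of j] W(2)[OF W(3)[OF g(1)] g(1)] by (metis imageI)
    qed (use f W(1) h dehom_bound i in \<open>auto simp: top_coeff_def p_card\<close>)
    then obtain g where "g \<in> W" "dehom h = dehom g" by blast
    thus "h \<in> W" using dehom_inj[OF h, of g] W(1) by auto
  qed
qed (rule W(1))

lemma act_surj:
  assumes i: "i < p" and t: "t \<in> G_Q" "chi t = 1" "kb t = 1" and v: "v \<in> A i" "top_coeff i v = 0"
  obtains a where "a \<in> A i" "act j t a - a = v"
proof -
  have "\<exists>a. (\<forall>k>i. coeff a k = 0) \<and> shiftd a = dehom v"
  proof (rule shiftd_surj)
    fix k assume "k \<ge> i"
    thus "coeff (dehom v) k = 0" using dehom_bound[OF v(1), of k] v(2) by (cases "k = i") (auto simp: top_coeff_def)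
  qed (use i p_card in simp)
  then obtain a where a: "\<forall>k>i. coeff a k = 0" "shiftd a = dehom v" by blast
  have m: "homog i a \<in> A i" by (rule homog_Sym)
  have "act j t (homog i a) - homog i a = v"
    by (rule dehom_inj[OF Sym_closed(3)[OF act_mem[OF m] m] v(1)]) (simp add: dehom_act_shift[OF m t] dehom_homog a)
  thus ?thesis using that[OF m] by blast
qed

text \<open>The vector \<open>e = e2 ^ i\<close> is an eigenvector of the diagonal elements, and for
  \<open>i < p - 1\<close> no lower monomial has the same weight, so its image is a multiple of
  \<open>e\<close>. As \<open>e\<close> generates the module under \<open>t\<close>, the map is that
  scalar everywhere.\<close>

lemma equivariant_scalar:
  assumes i: "i < p - 1"
    and \<alpha>: "\<And>f. f \<in> A i \<Longrightarrow> \<alpha> f \<in> A i" "\<And>f g. f \<in> A i \<Longrightarrow> g \<in> A i \<Longrightarrow> \<alpha> (f + g) = \<alpha> f + \<alpha> g"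
      "\<And>s f. s \<in> G_Q \<Longrightarrow> f \<in> A i \<Longrightarrow> \<alpha> (act j s f) = act j s (\<alpha> f)"
  obtains a where "\<And>f. f \<in> A i \<Longrightarrow> \<alpha> f = scale a f"
proof -
  have "\<alpha> 0 = \<alpha> 0 + \<alpha> 0" using \<alpha>(2)[OF Sym_closed(1) Sym_closed(1)] by (simp only: add_0_right)
  hence \<alpha>0: "\<alpha> 0 = 0" by (simp only: add_cancel_right_right)
  have \<alpha>d: "\<alpha> (f - g) = \<alpha> f - \<alpha> g" if "f \<in> A i" "g \<in> A i" for f g
    using \<alpha>(2)[OF Sym_closed(3)[OF that] that(2)] by simp
  have \<alpha>c: "\<alpha> (scale c f) = scale c (\<alpha> f)" if f: "f \<in> A i" for c f
  proof -
    obtain r where r: "c = of_nat r" using of_nat_cases by blast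
    have "\<alpha> (scale (of_nat r) f) = scale (of_nat r) (\<alpha> f)"
    proof (induction r)
      case (Suc r)
      have e: "scale (of_nat (Suc r)) h = h + scale (of_nat r) h" for h :: "'p mod_ring poly poly"
      proof -
        have "[:of_nat (Suc r):] = 1 + [:of_nat r :: 'p mod_ring:]" by (simp add: one_pCons)
        thus ?thesis by (simp only: smult_add_left smult_1_left)
      qed
      show ?case unfolding e using \<alpha>(2)[OF f Sym_closed(5)[OF f]] Suc by simp
    qed (simp add: \<alpha>0)
    thus ?thesis by (simp add: r)
  qed
  define e where "e = homog i (monom (1 :: 'p mod_ring) i)"
  have e: "e \<in> A i" unfolding e_def by (rule homog_Sym)
  have de: "dehom e = monom 1 i" unfolding e_def by (rule dehom_homog) simp
  define u where "u = dehom (\<alpha> e)"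
  have scale: "coeff (pcompose g [:0, c:]) k = coeff g k * c ^ k" for g :: "'p mod_ring poly" and c k
  proof (induction g arbitrary: k)
    case (pCons a g)
    thus ?case by (cases k) (simp_all add: pcompose_pCons coeff_pCons)
  qed simp
  \<comment> \<open>The weights of the monomials of degrees \<open>k\<close> and \<open>i\<close>
    differ by \<open>chi ^ (i - k)\<close>, a nontrivial character because
    \<open>0 < i - k < p - 1\<close>.\<close>
  have uk: "coeff u k = 0" if k: "k < i" for k
  proof -
    have "0 < i - k" "i - k < CARD('p) - 1" using k i p_card by auto
    then obtain x where x: "x \<noteq> (0 :: 'p mod_ring)" "x ^ (i - k) \<noteq> 1" by (rule mod_ring_power_ne_one)
    obtain s where s: "s \<in> G_Q" "chi s = x" "kb s = 0" using char_surj[OF x(1)] by blast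
    have "act j s e = scale (x powi j) e"
    proof (rule dehom_inj[OF act_mem[OF e] Sym_closed(5)[OF e]], rule poly_eqI)
      fix n show "coeff (dehom (act j s e)) n = coeff (dehom (scale (x powi j) e)) n"
        using x(1) by (simp add: dehom_act[OF e s(1)] s dehom_smult scale de power_one_over)
    qed
    hence "act j s (\<alpha> e) = scale (x powi j) (\<alpha> e)" using \<alpha>(3)[OF s(1) e] \<alpha>c[OF e] by simp
    hence "coeff (dehom (act j s (\<alpha> e))) k = x powi j * coeff u k" by (simp add: dehom_smult u_def)
    hence "x powi j * (x ^ i * (1 / x) ^ k * coeff u k) = x powi j * coeff u k"
      by (simp add: dehom_act[OF \<alpha>(1)[OF e] s(1)] s scale u_def mult_ac)
    hence "x ^ i * (1 / x) ^ k * coeff u k = coeff u k" using x(1) by simp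
    moreover have "x ^ i * (1 / x) ^ k = x ^ (i - k)" using x(1) k by (simp add: power_diff power_one_over)
    ultimately have "(x ^ (i - k) - 1) * coeff u k = 0" by (simp add: algebra_simps)
    thus ?thesis using x(2) by simp
  qed
  define a where "a = coeff u i"
  have \<alpha>e: "\<alpha> e = scale a e"
  proof (rule dehom_inj[OF \<alpha>(1)[OF e] Sym_closed(5)[OF e]], rule poly_eqI)
    fix n show "coeff (dehom (\<alpha> e)) n = coeff (dehom (scale a e)) n"
      using uk[of n] dehom_bound[OF \<alpha>(1)[OF e], of n]
      by (cases n i rule: linorder_cases) (auto simp: dehom_smult de a_def u_def)
  qed
  obtain t where t: "t \<in> G_Q" "chi t = 1" "kb t = 1" using char_surj[of 1 1] by auto
  have "{f \<in> A i. \<alpha> f = scale a f} = A i"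
  proof (rule act_span[OF _ t])
    fix f g assume "f \<in> {f \<in> A i. \<alpha> f = scale a f}" "g \<in> {f \<in> A i. \<alpha> f = scale a f}"
    thus "f - g \<in> {f \<in> A i. \<alpha> f = scale a f}" using \<alpha>d[of f g] Sym_closed(3) by (auto simp: smult_diff_right)
  next
    fix f assume "f \<in> {f \<in> A i. \<alpha> f = scale a f}"
    thus "act j t f \<in> {f \<in> A i. \<alpha> f = scale a f}"
      using \<alpha>(3)[OF t(1), of f] act_linear(3)[OF _ _ t(1), of f i f j a] act_mem by auto
  next
    show "e \<in> {f \<in> A i. \<alpha> f = scale a f}" using e \<alpha>e by simp
    show "top_coeff i e \<noteq> 0" by (simp add: top_coeff_def de)
  qed (use i in auto)
  thus ?thesis using that[of a] by blast
qed

text \<open>Cochains on \<^const>\<open>G_Q\<close> are only constrained there; continuity plays no role in this section.\<close>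

definition cocycle :: "nat \<Rightarrow> int \<Rightarrow> 'p cochain \<Rightarrow> bool" where
  "cocycle i j c \<longleftrightarrow> (\<forall>s\<in>G_Q. c s \<in> A i) \<and> (\<forall>s\<in>G_Q. \<forall>t\<in>G_Q. c (compose Qbar s t) = c s + act j s (c t))"

lemma cocycle_rules:
  assumes "cocycle i j c"
  shows "s \<in> G_Q \<Longrightarrow> c s \<in> A i" "s \<in> G_Q \<Longrightarrow> t \<in> G_Q \<Longrightarrow> c (compose Qbar s t) = c s + act j s (c t)"
  using assms unfolding cocycle_def by auto

lemma cocycle_coboundary: assumes a: "a \<in> A i" shows "cocycle i j (\<lambda>s. act j s a - a)" unfolding cocycle_def
proof (intro conjI ballI)
  fix s t assume s: "s \<in> G_Q" and t: "t \<in> G_Q"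
  show "act j s a - a \<in> A i" by (rule Sym_closed(3)[OF act_mem[OF a] a])
  show "act j (compose Qbar s t) a - a = act j s a - a + act j s (act j t a - a)"
    by (simp add: act_compose[OF a s t] act_linear(2)[OF act_mem[OF a] a s])
qed

lemma cocycle_diff:
  assumes c: "cocycle i j c" and d: "cocycle i j d" shows "cocycle i j (\<lambda>s. c s - d s)" unfolding cocycle_def
proof (intro conjI ballI)
  fix s t assume s: "s \<in> G_Q" and t: "t \<in> G_Q"
  note m = cocycle_rules(1)[OF c] cocycle_rules(1)[OF d]
  show "c s - d s \<in> A i" by (rule Sym_closed(3)[OF m(1)[OF s] m(2)[OF s]])
  show "c (compose Qbar s t) - d (compose Qbar s t) = c s - d s + act j s (c t - d t)"
    by (simp add: cocycle_rules(2)[OF c s t] cocycle_rules(2)[OF d s t] act_linear(2)[OF m(1)[OF t] m(2)[OF t] s])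
qed

lemma cocycle_smult:
  assumes c: "cocycle i j c" shows "cocycle i j (\<lambda>s. scale a (c s))" unfolding cocycle_def
proof (intro conjI ballI)
  fix s t assume s: "s \<in> G_Q" and t: "t \<in> G_Q"
  note m = cocycle_rules(1)[OF c]
  show "scale a (c s) \<in> A i" by (rule Sym_closed(5)[OF m[OF s]])
  show "scale a (c (compose Qbar s t)) = scale a (c s) + act j s (scale a (c t))"
    by (simp add: cocycle_rules(2)[OF c s t] act_linear(3)[OF m[OF t] m[OF t] s] smult_add_right)
qed

lemma cocycle_id: assumes c: "cocycle i j c" shows "c idQ = 0"
proof -
  have i: "idQ \<in> G_Q" by (rule idQ[OF Rats_Qbar])
  have "compose Qbar idQ idQ = idQ" by (auto simp: compose_def restrict_def)
  moreover have "act j idQ (c idQ) = c idQ" by (rule act_L[OF cocycle_rules(1)[OF c i]]) (rule idQ[OF L_Qbar])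
  ultimately have "c idQ = c idQ + c idQ" using cocycle_rules(2)[OF c i i] by (simp only:)
  thus ?thesis by (simp only: add_cancel_right_right)
qed

lemma Gal_L_factor:
  assumes s: "s \<in> G_Q" and t: "t \<in> G_Q" and e: "chi s = chi t" "kb s = kb t"
  obtains u where "u \<in> G_L" "s = compose Qbar t u"
proof -
  obtain t' where t': "t' \<in> G_Q" "\<And>x. x \<in> Qbar \<Longrightarrow> t (t' x) = x" "\<And>x. x \<in> Qbar \<Longrightarrow> t' (t x) = x"
    by (rule G_Q_inverse[OF t]) blast
  define u where "u = compose Qbar t' s"
  have u: "u \<in> G_Q" unfolding u_def by (rule GQ_compose[OF t'(1) s])
  have su: "s = compose Qbar t u"
  proof (rule Gal_eqI[OF Qbar_field s GQ_compose[OF t u]])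
    fix x assume x: "x \<in> Qbar"
    have "s x \<in> Qbar" by (rule Gal_rules(4)[OF Qbar_field s x])
    thus "s x = compose Qbar t u x" using x t'(2) by (simp add: u_def compose_def)
  qed
  have "chi t * chi u = chi t" "kb t + chi t * kb u = kb t" using char_compose[OF t u] e su by auto
  hence "u \<in> G_L" using Gal_L_iff u chi_nonzero[OF t] by auto
  thus ?thesis using that su by blast
qed

text \<open>The cocycle is inflated from the Galois group of \<open>L\<close>, whose elements are
  the pairs \<open>(chi, kb)\<close>.\<close>

lemma cocycle_factors:
  assumes c: "cocycle i j c" and L: "\<And>s. s \<in> G_L \<Longrightarrow> c s = 0"
    and s: "s \<in> G_Q" and t: "t \<in> G_Q" and e: "chi s = chi t" "kb s = kb t"
  shows "c s = c t"
proof -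
  obtain u where u: "u \<in> G_L" "s = compose Qbar t u" by (rule Gal_L_factor[OF s t e])
  thus ?thesis using cocycle_rules(2)[OF c t, of u] L[OF u(1)] Gal_L_iff by (simp add: act_0)
qed

text \<open>The residue of \<open>j - 1\<close> modulo \<open>p - 1\<close> is an exponent strictly
  between 0 and \<open>p - 1\<close>, so some element is not killed by it.\<close>

lemma powi_ne:
  assumes j: "\<not> [j = 1] (mod (int p - 1))"
  obtains a :: "'p mod_ring" where "a \<noteq> 0" "a powi j \<noteq> a"
proof -
  define m where "m = nat ((j - 1) mod (int p - 1))"
  have pp: "int p - 1 > 0" using p_pos by simp
  have m: "int m = (j - 1) mod (int p - 1)" using pp by (simp add: m_def)
  have "(j - 1) mod (int p - 1) \<noteq> 0" using j by (simp add: cong_iff_dvd_diff mod_eq_0_iff_dvd)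
  hence "0 < m" using m by (cases m) auto
  moreover have "m < CARD('p) - 1"
  proof -
    have "int m < int p - 1" using m pp by simp
    thus ?thesis using p_card by linarith
  qed
  ultimately obtain a where a: "(a :: 'p mod_ring) \<noteq> 0" "a ^ m \<noteq> 1" by (rule mod_ring_power_ne_one)
  define q where "q = (j - 1) div (int p - 1)"
  have jq: "j = (1 + int m) + (int p - 1) * q" using m by (simp add: q_def)
  have pq: "int p - 1 = int (CARD('p) - 1)" using p_card p_pos by simp
  have one: "a powi (int p - 1) = 1" unfolding pq power_int_of_nat by (rule mod_ring_power_card[OF a(1)])
  have "a powi j = a powi (1 + int m) * (a powi (int p - 1)) powi q"
    unfolding jq power_int_mult[symmetric] by (rule power_int_add) (use a(1) in simp)
  also have "\<dots> = a powi (1 + int m)" unfolding one by simp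
  also have "\<dots> = a * a ^ m" using a(1) by (simp add: power_int_add)
  finally have "a powi j = a * a ^ m" .
  hence "a powi j \<noteq> a" using a by simp
  thus ?thesis using that a(1) by blast
qed

lemma cocycle_gpow:
  assumes c: "cocycle i j c" and t: "t \<in> G_Q" "chi t = 1"
  shows "top_coeff i (c (gpow t k)) = of_nat k * top_coeff i (c t)" "c t = 0 \<Longrightarrow> c (gpow t k) = 0"
proof -
  note g = gpow_G[OF t(1)]
  show "top_coeff i (c (gpow t k)) = of_nat k * top_coeff i (c t)"
  proof (induction k)
    case 0
    show ?case unfolding gpow_simps(1) cocycle_id[OF c] top_coeff_linear(3) by simp
  next
    case (Suc k)
    show ?case unfolding gpow_simps(2) cocycle_rules(2)[OF c t(1) g] top_coeff_linear(1)
        top_coeff_act[OF cocycle_rules(1)[OF c g] t(1)] Suc by (simp add: t(2) algebra_simps)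
  qed
  show "c (gpow t k) = 0" if "c t = 0"
  proof (induction k)
    case 0
    show ?case unfolding gpow_simps(1) by (rule cocycle_id[OF c])
  next
    case (Suc k)
    thus ?case unfolding gpow_simps(2) cocycle_rules(2)[OF c t(1) g] by (simp add: that act_0)
  qed
qed

text \<open>The number of values of \<open>chi\<close> is invertible modulo \<open>p\<close>; this
  is the constant behind the averaging argument and the corestriction.\<close>

lemma card_nonzero: "(of_nat (card (UNIV - {0 :: 'p mod_ring})) :: 'p mod_ring poly poly) = - 1"
proof -
  have "card (UNIV - {0 :: 'p mod_ring}) = CARD('p) - 1" by (subst card_Diff_subset) auto
  hence "card (UNIV - {0 :: 'p mod_ring}) + 1 = CARD('p)" using zero_less_card_finite[where 'a='p] by simp
  hence "(of_nat (card (UNIV - {0 :: 'p mod_ring}) + 1) :: 'p mod_ring) = 0" by (simp add: of_nat_0_mod_ring_dvd)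
  hence "(of_nat (card (UNIV - {0 :: 'p mod_ring}) + 1) :: 'p mod_ring poly poly) = 0" by (simp only: of_nat_poly pCons_0_0)
  thus ?thesis by (simp only: of_nat_add of_nat_1 eq_neg_iff_add_eq_0)
qed

text \<open>
  \<open>H\<^sup>1(Gal(L/Q), A\<^sup>i\<^sup>,\<^sup>j) = 0\<close>: the relation between the generators of \<open>Gal(L/Q)\<close> kills the top coefficient
  on the subgroup of order \<open>p\<close>, because \<open>\<chi>\<^sup>j\<close> differs from \<open>\<chi>\<close>; what is left is a cocycle on a group of
  order \<open>p - 1\<close>, which is averaged away.
\<close>

lemma cocycle_trivial:
  assumes i: "i < p" and j: "\<not> [j = 1] (mod (int p - 1))"
    and c: "cocycle i j c" and L: "\<And>s. s \<in> G_L \<Longrightarrow> c s = 0"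
  shows "\<exists>a\<in>A i. \<forall>s\<in>G_Q. c s = act j s a - a"
proof -
  obtain t where t: "t \<in> G_Q" "chi t = 1" "kb t = 1" using char_surj[of 1 1] by auto
  obtain x :: "'p mod_ring" where x: "x \<noteq> 0" "x powi j \<noteq> x" by (rule powi_ne[OF j])
  obtain d where d: "d \<in> G_Q" "chi d = x" "kb d = 0" by (rule char_surj[OF x(1)])
  obtain r where r: "x = of_nat r" using of_nat_cases by blast
  note gp = gpow_G[OF t(1), of r] char_gpow[OF t(1,2), of r]
  \<comment> \<open>On \<open>L\<close> the diagonal element satisfies \<open>d t = t ^ r d\<close>.
    Top coefficients of the two expansions give
    \<open>(x powi j - x) * top_coeff i (c t) = 0\<close>.\<close>
  have "c (compose Qbar d t) = c (compose Qbar (gpow t r) d)"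
    by (rule cocycle_factors[OF c L GQ_compose[OF d(1) t(1)] GQ_compose[OF gp(1) d(1)]])
      (use gp(2) in \<open>auto simp: char_compose[OF d(1) t(1)] char_compose[OF gp(1) d(1)] d t r\<close>)
  hence "top_coeff i (c d + act j d (c t)) = top_coeff i (c (gpow t r) + act j (gpow t r) (c d))"
    using cocycle_rules(2)[OF c] d(1) t(1) gp(1) by simp
  hence "x powi j * top_coeff i (c t) = x * top_coeff i (c t)"
    using gp(2) unfolding top_coeff_linear(1) top_coeff_act[OF cocycle_rules(1)[OF c t(1)] d(1)]
      top_coeff_act[OF cocycle_rules(1)[OF c d(1)] gp(1)] cocycle_gpow(1)[OF c t(1,2)] by (simp add: d(2) r)
  hence "(x powi j - x) * top_coeff i (c t) = 0" by (simp add: algebra_simps)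
  hence "top_coeff i (c t) = 0" using x(2) by simp
  then obtain b where b: "b \<in> A i" "act j t b - b = c t" by (rule act_surj[OF i t cocycle_rules(1)[OF c t(1)]])
  define e where "e = (\<lambda>s. c s - (act j s b - b))"
  have e: "cocycle i j e" unfolding e_def by (rule cocycle_diff[OF c cocycle_coboundary[OF b(1)]])
  have eL: "e s = 0" if "s \<in> G_L" for s using L[OF that] act_L[OF b(1) that] by (simp add: e_def)
  have et: "e t = 0" by (simp add: e_def b(2))
  have echi: "e s = e s'" if s: "s \<in> G_Q" and s': "s' \<in> G_Q" and q: "chi s = chi s'" for s s'
  proof -
    \<comment> \<open>With this exponent \<open>s\<close> times \<open>t ^ k\<close> has the same
      \<open>chi\<close> and \<open>kb\<close> as \<open>s'\<close>, and \<open>e\<close> does not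
      see the power of \<open>t\<close>.\<close>
    obtain k where k: "(kb s' - kb s) / chi s = of_nat k" using of_nat_cases by blast
    note gk = gpow_G[OF t(1), of k] char_gpow[OF t(1,2), of k]
    have "e s' = e (compose Qbar s (gpow t k))"
    proof (rule cocycle_factors[OF e eL s' GQ_compose[OF s gk(1)]])
      show "chi s' = chi (compose Qbar s (gpow t k))" using gk(2) q by (simp add: char_compose[OF s gk(1)])
      show "kb s' = kb (compose Qbar s (gpow t k))"
        using gk(2) chi_nonzero[OF s] by (simp add: char_compose[OF s gk(1)] t(3) k[symmetric])
    qed
    also have "\<dots> = e s" using cocycle_rules(2)[OF e s gk(1)] cocycle_gpow(2)[OF e t(1,2) et, of k] by (simp add: act_0)
    finally show ?thesis by simp
  qed
  have "\<forall>a. \<exists>s. a \<noteq> 0 \<longrightarrow> s \<in> G_Q \<and> chi s = a" using chi_surj by metis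
  then obtain D where D: "\<And>a. a \<noteq> 0 \<Longrightarrow> D a \<in> G_Q \<and> chi (D a) = a" by metis
  define U where "U = UNIV - {0 :: 'p mod_ring}"
  \<comment> \<open>Shifting the summation by \<open>chi s\<close> gives
    \<open>S = card U * e s + act j s S\<close>, where \<open>card U = - 1\<close>.\<close>
  define S where "S = (\<Sum>a\<in>U. e (D a))"
  have S: "S \<in> A i" unfolding S_def by (rule Sym_sum) (use D cocycle_rules(1)[OF e] in \<open>auto simp: U_def\<close>)
  have card: "(of_nat (card U) :: 'p mod_ring poly poly) = - 1" unfolding U_def by (rule card_nonzero)
  have es: "e s = act j s S - S" if s: "s \<in> G_Q" for s
  proof -
    have "S = (\<Sum>a\<in>U. e (compose Qbar s (D a)))" unfolding S_def
    proof (rule sum.reindex_bij_witness[of _ "\<lambda>a. chi s * a" "\<lambda>a. a / chi s"])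
      fix a assume a: "a \<in> U"
      have nz: "a / chi s \<noteq> 0" "a \<noteq> 0" using a chi_nonzero[OF s] by (auto simp: U_def)
      show "e (compose Qbar s (D (a / chi s))) = e (D a)"
        by (rule echi) (use nz D s chi_nonzero[OF s] GQ_compose[OF s] in \<open>auto simp: char_compose[OF s, where K' = \<rat>]\<close>)
    qed (use chi_nonzero[OF s] in \<open>auto simp: U_def\<close>)
    also have "\<dots> = (\<Sum>a\<in>U. e s + act j s (e (D a)))"
      by (rule sum.cong[OF refl]) (use D cocycle_rules(2)[OF e s] in \<open>auto simp: U_def\<close>)
    also have "\<dots> = of_nat (card U) * e s + act j s S"
      unfolding S_def by (subst act_sum[OF s, of U _ i]) (use D cocycle_rules(1)[OF e] in \<open>auto simp: U_def sum.distrib\<close>)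
    finally show ?thesis by (simp add: card algebra_simps)
  qed
  show ?thesis
  proof (intro bexI[of _ "S + b"] ballI)
    show "S + b \<in> A i" by (rule Sym_closed(2)[OF S b(1)])
    fix s assume s: "s \<in> G_Q"
    show "c s = act j s (S + b) - (S + b)" using es[OF s] act_linear(1)[OF S b(1) s] by (simp add: e_def algebra_simps)
  qed
qed

text \<open>The top coefficients form a cocycle in degree 0 that is trivial on \<open>G_L\<close>,
  so \<open>cocycle_trivial\<close> bounds it by a constant, which is lifted to a multiple of
  \<open>e2 ^ i\<close>.\<close>

lemma cocycle_top_trivial:
  assumes j: "\<not> [j = 1] (mod (int p - 1))"
    and c: "cocycle i j c" and L: "\<And>s. s \<in> G_L \<Longrightarrow> top_coeff i (c s) = 0"
  shows "\<exists>a\<in>A i. \<forall>s\<in>G_Q. top_coeff i (c s - (act j s a - a)) = 0"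
proof -
  define d where "d = (\<lambda>s. homog 0 [:top_coeff i (c s):])"
  have dm: "d s \<in> A 0" for s unfolding d_def by (rule homog_Sym)
  have dd: "dehom (d s) = [:top_coeff i (c s):]" for s
    unfolding d_def by (rule dehom_homog) (simp add: coeff_pCons split: nat.split)
  have d1: "cocycle 0 j d" unfolding cocycle_def
  proof (intro conjI ballI dm)
    fix s t assume s: "s \<in> G_Q" and t: "t \<in> G_Q"
    show "d (compose Qbar s t) = d s + act j s (d t)"
    proof (rule dehom_inj[OF dm Sym_closed(2)[OF dm act_mem[OF dm]]])
      show "dehom (d (compose Qbar s t)) = dehom (d s + act j s (d t))"
        by (simp add: dehom_add dehom_act[OF dm s] dd cocycle_rules(2)[OF c s t] top_coeff_linear
          top_coeff_act[OF cocycle_rules(1)[OF c t] s])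
    qed
  qed
  have d2: "d s = 0" if "s \<in> G_L" for s by (rule dehom_inj[OF dm Sym_closed(1)]) (simp add: dd L[OF that] dehom_0)
  obtain b where b: "b \<in> A 0" "\<And>s. s \<in> G_Q \<Longrightarrow> d s = act j s b - b"
    using cocycle_trivial[OF p_pos(2) j d1 d2] by blast
  have tc: "top_coeff 0 (d s) = top_coeff i (c s)" for s by (simp add: top_coeff_def[of 0] dd)
  define a where "a = homog i (monom (top_coeff 0 b) i)"
  have a: "a \<in> A i" unfolding a_def by (rule homog_Sym)
  have ta: "top_coeff i a = top_coeff 0 b" unfolding a_def top_coeff_def[of i] by (subst dehom_homog) auto
  show ?thesis
  proof (intro bexI[OF _ a] ballI)
    fix s assume s: "s \<in> G_Q"
    have "top_coeff i (c s) = chi s powi j * top_coeff 0 b - top_coeff 0 b"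
      using tc[of s] b(2)[OF s] by (simp add: top_coeff_linear top_coeff_act[OF b(1) s])
    thus "top_coeff i (c s - (act j s a - a)) = 0" by (simp add: top_coeff_linear top_coeff_act[OF a s] ta)
  qed
qed

end

section \<open>Selmer classes and their lines\<close>

context kummer
begin

definition cocycles :: "nat \<Rightarrow> int \<Rightarrow> 'p cochain set" where
  "cocycles i j = Z1 (A i) (act j)"

definition cls :: "nat \<Rightarrow> int \<Rightarrow> 'p cochain \<Rightarrow> 'p cochain set" where
  "cls i j c = cohomologous (A i) (act j) `` {c}"

abbreviation coh :: "nat \<Rightarrow> int \<Rightarrow> 'p cochain rel" where
  "coh i j \<equiv> cohomologous (A i) (act j)"

lemma GQ_mult: "s \<in> G_Q \<Longrightarrow> t \<in> G_Q \<Longrightarrow> s \<otimes>\<^bsub>gal_group Qbar \<rat>\<^esub> t = compose Qbar s t"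
  by (rule gal_group_mult[OF Qbar_field])

lemma cocycle_agree:
  assumes c: "cocycle i j c" and S: "S \<subseteq> Qbar" "\<And>t. t \<in> G_Q \<Longrightarrow> (\<And>x. x \<in> S \<Longrightarrow> t x = x) \<Longrightarrow> c t = 0"
    and s: "s \<in> G_Q" and t: "t \<in> G_Q" and st: "\<And>x. x \<in> S \<Longrightarrow> s x = t x"
  shows "c s = c t"
proof -
  obtain t' where t': "t' \<in> G_Q" "\<And>x. x \<in> Qbar \<Longrightarrow> t (t' x) = x" "\<And>x. x \<in> Qbar \<Longrightarrow> t' (t x) = x"
    by (rule G_Q_inverse[OF t]) blast
  have u: "compose Qbar t' s \<in> G_Q" by (rule GQ_compose[OF t'(1) s])
  have "c (compose Qbar t' s) = 0" by (rule S(2)[OF u]) (use S(1) st t'(3) in \<open>auto simp: compose_def\<close>)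
  moreover have "s = compose Qbar t (compose Qbar t' s)"
  proof (rule Gal_eqI[OF Qbar_field s GQ_compose[OF t u]])
    fix x assume x: "x \<in> Qbar"
    thus "s x = compose Qbar t (compose Qbar t' s) x" using t'(2)[OF GQ_rules(4)[OF s x]] by (simp add: compose_def)
  qed
  ultimately show ?thesis using cocycle_rules(2)[OF c t u] by (simp add: act_0)
qed

text \<open>For a cocycle, local constancy near the identity spreads to all of \<open>G_Q\<close>,
  so continuity amounts to vanishing on the stabilizer of a finite set.\<close>

lemma cocycles_iff:
  "c \<in> cocycles i j \<longleftrightarrow> cocycle i j c \<and> (\<forall>s. s \<notin> G_Q \<longrightarrow> c s = 0) \<and>
     (\<exists>S. finite S \<and> S \<subseteq> Qbar \<and> (\<forall>t\<in>G_Q. (\<forall>x\<in>S. t x = x) \<longrightarrow> c t = 0))"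
proof
  assume "c \<in> cocycles i j"
  hence c: "c \<in> G_Q \<rightarrow> A i" "\<forall>s. s \<notin> G_Q \<longrightarrow> c s = 0" "continuous_map krull_topology (discrete_topology (A i)) c"
    "\<forall>s\<in>G_Q. \<forall>t\<in>G_Q. c (s \<otimes>\<^bsub>gal_group Qbar \<rat>\<^esub> t) = c s + act j s (c t)"
    unfolding cocycles_def Z1_def by auto
  have cc: "cocycle i j c" unfolding cocycle_def using c(1,4) by (auto simp: GQ_mult)
  have iq: "idQ \<in> G_Q" by (rule idQ[OF Rats_Qbar])
  have "openin krull_topology {s \<in> topspace krull_topology. c s \<in> {0}}"
    by (rule openin_continuous_map_preimage[OF c(3)]) (simp add: Sym_closed)
  moreover have "idQ \<in> topspace krull_topology"
  proof -
    have "openin krull_topology {t \<in> G_Q. \<forall>x\<in>adjoin {}. t x = idQ x}"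
      unfolding krull_topology_def by (rule topology_generated_by_Basis) (use iq in blast)
    from openin_subset[OF this] show ?thesis using iq by blast
  qed
  moreover from this have "idQ \<in> {s \<in> topspace krull_topology. c s \<in> {0}}"
    by (simp only: mem_Collect_eq singleton_iff cocycle_id[OF cc])
  ultimately have "\<exists>S. finite S \<and> S \<subseteq> Qbar \<and> (\<forall>t\<in>G_Q. (\<forall>x\<in>S. t x = idQ x) \<longrightarrow> t \<in> {s \<in> topspace krull_topology. c s \<in> {0}})"
    by (intro krull_open_neighbourhood)
  then obtain S where S: "finite S" "S \<subseteq> Qbar" "\<And>t. t \<in> G_Q \<Longrightarrow> (\<forall>x\<in>S. t x = idQ x) \<Longrightarrow> c t = 0" by auto
  have "c t = 0" if t: "t \<in> G_Q" "\<forall>x\<in>S. t x = x" for t by (rule S(3)[OF t(1)]) (use t(2) S(2) in auto)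
  thus "cocycle i j c \<and> (\<forall>s. s \<notin> G_Q \<longrightarrow> c s = 0) \<and>
     (\<exists>S. finite S \<and> S \<subseteq> Qbar \<and> (\<forall>t\<in>G_Q. (\<forall>x\<in>S. t x = x) \<longrightarrow> c t = 0))"
    using cc c(2) S(1,2) by blast
next
  assume r: "cocycle i j c \<and> (\<forall>s. s \<notin> G_Q \<longrightarrow> c s = 0) \<and>
     (\<exists>S. finite S \<and> S \<subseteq> Qbar \<and> (\<forall>t\<in>G_Q. (\<forall>x\<in>S. t x = x) \<longrightarrow> c t = 0))"
  then obtain S where S: "finite S" "S \<subseteq> Qbar" "\<And>t. t \<in> G_Q \<Longrightarrow> (\<And>x. x \<in> S \<Longrightarrow> t x = x) \<Longrightarrow> c t = 0" by auto
  have m: "c \<in> G_Q \<rightarrow> A i" using r cocycle_rules(1) by blast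
  have "continuous_map krull_topology (discrete_topology (A i)) c"
    by (rule krull_continuousI[OF S(1,2) m]) (use cocycle_agree[of i j c S] r S(2,3) in blast)
  thus "c \<in> cocycles i j" using r m unfolding cocycles_def Z1_def by (auto simp: GQ_mult cocycle_rules(2))
qed

lemma cocycles_cocycle: "c \<in> cocycles i j \<Longrightarrow> cocycle i j c" using cocycles_iff by blast

lemma cocycles_diff:
  assumes c: "c \<in> cocycles i j" and d: "d \<in> cocycles i j" shows "(\<lambda>s. c s - d s) \<in> cocycles i j"
proof -
  obtain S T where "finite S" "S \<subseteq> Qbar" "\<forall>t\<in>G_Q. (\<forall>x\<in>S. t x = x) \<longrightarrow> c t = 0"
    "finite T" "T \<subseteq> Qbar" "\<forall>t\<in>G_Q. (\<forall>x\<in>T. t x = x) \<longrightarrow> d t = 0" using c d unfolding cocycles_iff by blast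
  hence "finite (S \<union> T) \<and> S \<union> T \<subseteq> Qbar \<and> (\<forall>t\<in>G_Q. (\<forall>x\<in>S \<union> T. t x = x) \<longrightarrow> c t - d t = 0)" by auto
  thus ?thesis using c d cocycle_diff[of i j c d] unfolding cocycles_iff by auto
qed

lemma cocycles_smult:
  assumes c: "c \<in> cocycles i j" shows "(\<lambda>s. scale a (c s)) \<in> cocycles i j"
proof -
  obtain S where "finite S" "S \<subseteq> Qbar" "\<forall>t\<in>G_Q. (\<forall>x\<in>S. t x = x) \<longrightarrow> c t = 0" using c unfolding cocycles_iff by blast
  hence "finite S \<and> S \<subseteq> Qbar \<and> (\<forall>t\<in>G_Q. (\<forall>x\<in>S. t x = x) \<longrightarrow> scale a (c t) = 0)" by auto
  thus ?thesis using c cocycle_smult[of i j c a] unfolding cocycles_iff by auto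
qed

lemma GalL_fixes_roots:
  assumes "t \<in> G_Q" "t \<zeta> = \<zeta>" "t \<nu> = \<nu>" shows "t \<in> G_L"
proof -
  have "chi t = chi idQ" "kb t = kb idQ"
  proof -
    have "t x = idQ x" if "x \<in> L" for x
    proof -
      have "t x = idQ x"
      proof (rule adjoin_hom_eq[of "{\<zeta>, \<nu>}" t idQ x])
        show "chom (adjoin {\<zeta>, \<nu>}) t"
          using chom_subset[OF GQ_rules(2)[OF assms(1)] L_Qbar] by (simp add: kummer_field_def)
        show "chom (adjoin {\<zeta>, \<nu>}) idQ"
          using chom_subset[OF GQ_rules(2)[OF idQ[OF Rats_Qbar]] L_Qbar] by (simp add: kummer_field_def)
      qed (use that assms Qbar_mem in \<open>auto simp: kummer_field_def\<close>)
      thus ?thesis .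
    qed
    thus "chi t = chi idQ" "kb t = kb idQ" using char_cong[of t idQ] by auto
  qed
  thus ?thesis using Gal_L_iff assms(1) char_idQ by auto
qed

lemma cocycles_coboundary:
  assumes a: "a \<in> A i" shows "(\<lambda>s. if s \<in> G_Q then act j s a - a else 0) \<in> cocycles i j"
  unfolding cocycles_iff
proof (intro conjI exI[of _ "{\<zeta>, \<nu>}"])
  have "cocycle i j (\<lambda>s. act j s a - a)" by (rule cocycle_coboundary[OF a])
  thus "cocycle i j (\<lambda>s. if s \<in> G_Q then act j s a - a else 0)" unfolding cocycle_def using GQ_compose by simp
  show "\<forall>t\<in>G_Q. (\<forall>x\<in>{\<zeta>, \<nu>}. t x = x) \<longrightarrow> (if t \<in> G_Q then act j t a - a else 0) = 0"
    using GalL_fixes_roots act_L[OF a] by auto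
qed (use Qbar_mem in auto)

lemma cohomologous_iff:
  "(c, d) \<in> coh i j \<longleftrightarrow> c \<in> cocycles i j \<and> d \<in> cocycles i j \<and> (\<exists>a\<in>A i. \<forall>s\<in>G_Q. c s - d s = act j s a - a)"
  by (simp add: cohomologous_def cocycles_def)

lemma cohomologous_equiv: "equiv (cocycles i j) (coh i j)"
proof (rule equivI)
  show "coh i j \<subseteq> cocycles i j \<times> cocycles i j" by (auto simp: cohomologous_iff)
  show "refl_on (cocycles i j) (coh i j)"
    by (rule refl_onI) (auto simp: cohomologous_iff act_0 intro!: bexI[of _ 0] Sym_closed(1))
  show "sym (coh i j)"
  proof (rule symI)
    fix c d assume "(c, d) \<in> coh i j"
    then obtain a where a: "c \<in> cocycles i j" "d \<in> cocycles i j" "a \<in> A i" "\<forall>s\<in>G_Q. c s - d s = act j s a - a"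
      by (auto simp: cohomologous_iff)
    have "d s - c s = act j s (0 - a) - (0 - a)" if s: "s \<in> G_Q" for s
      using a(4) s act_linear(2)[OF Sym_closed(1) a(3) s, of j] by (simp add: act_0 algebra_simps)
    thus "(d, c) \<in> coh i j" unfolding cohomologous_iff using a(1,2) Sym_closed(3)[OF Sym_closed(1) a(3)] by blast
  qed
  show "trans (coh i j)"
  proof (rule transI)
    fix c d e assume "(c, d) \<in> coh i j" "(d, e) \<in> coh i j"
    then obtain a b where a: "c \<in> cocycles i j" "e \<in> cocycles i j" "a \<in> A i" "\<forall>s\<in>G_Q. c s - d s = act j s a - a"
      "b \<in> A i" "\<forall>s\<in>G_Q. d s - e s = act j s b - b" by (auto simp: cohomologous_iff)
    have "c s - e s = act j s (a + b) - (a + b)" if s: "s \<in> G_Q" for s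
    proof -
      have "c s - e s = (c s - d s) + (d s - e s)" by simp
      also have "\<dots> = act j s (a + b) - (a + b)" using a(4,6) s by (simp add: act_linear(1)[OF a(3,5) s])
      finally show ?thesis .
    qed
    thus "(c, e) \<in> coh i j" unfolding cohomologous_iff using a(1,2) Sym_closed(2)[OF a(3,5)] by blast
  qed
qed

lemma H1_iff: "\<xi> \<in> H1 (A i) (act j) \<longleftrightarrow> (\<exists>c\<in>cocycles i j. \<xi> = cls i j c)"
  unfolding H1_def cls_def cocycles_def[symmetric] quotient_def by auto

lemma cls_self: "c \<in> cocycles i j \<Longrightarrow> c \<in> cls i j c"
  unfolding cls_def by (rule equiv_class_self[OF cohomologous_equiv])

lemma cls_eq: "(c, d) \<in> coh i j \<Longrightarrow> cls i j c = cls i j d"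
  unfolding cls_def by (rule equiv_class_eq[OF cohomologous_equiv])

lemma cls_mem: "d \<in> cls i j c \<longleftrightarrow> (c, d) \<in> coh i j" by (simp add: cls_def)

lemma cohomologous_GalL:
  assumes "(c, d) \<in> coh i j" "s \<in> G_L" shows "c s = d s"
proof -
  obtain a where a: "a \<in> A i" "\<forall>s\<in>G_Q. c s - d s = act j s a - a" using assms(1) by (auto simp: cohomologous_iff)
  hence "c s - d s = 0" using act_L[OF a(1) assms(2)] assms(2) Gal_L_iff by auto
  thus ?thesis by simp
qed

text \<open>Inflation and restriction: a difference that vanishes on \<open>G_L\<close> is a
  coboundary by \<open>cocycle_trivial\<close>.\<close>

lemma cohomologousI_GalL:
  assumes i: "i < p" and j: "\<not> [j = 1] (mod (int p - 1))" and c: "c \<in> cocycles i j" and d: "d \<in> cocycles i j"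
    and e: "\<And>s. s \<in> G_L \<Longrightarrow> c s = d s"
  shows "(c, d) \<in> coh i j"
proof -
  have L: "c s - d s = 0" if "s \<in> G_L" for s using e[OF that] by simp
  obtain a where "a \<in> A i" "\<And>s. s \<in> G_Q \<Longrightarrow> c s - d s = act j s a - a"
    using cocycle_trivial[OF i j cocycles_cocycle[OF cocycles_diff[OF c d]] L] by blast
  thus ?thesis using c d unfolding cohomologous_iff by blast
qed

section \<open>Selmer conditions as vanishing on inertia in \<open>G_L\<close>\<close>

definition inertial :: "complex set \<Rightarrow> (complex \<Rightarrow> complex) \<Rightarrow> bool" where
  "inertial PP s \<longleftrightarrow> (\<forall>x\<in>Zbar. s x - x \<in> PP)"

definition unram :: "'p cochain \<Rightarrow> bool" where
  "unram c \<longleftrightarrow> (\<forall>l PP s. prime (l::nat) \<longrightarrow> l \<noteq> N \<longrightarrow> prime_in Zbar PP \<longrightarrow> of_nat l \<in> PP \<longrightarrow>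
     s \<in> G_L \<longrightarrow> inertial PP s \<longrightarrow> c s = 0)"

lemma places_over_iff: "PP \<in> places_over l \<longleftrightarrow> prime_in Zbar PP \<and> of_nat l \<in> PP"
proof -
  have "Qbar \<inter> Zbar = Zbar" using Zbar_subset_Qbar by blast
  thus ?thesis using primeideal_iff[of Qbar PP] csubring_Zbar by (simp add: places_over_def)
qed

text \<open>Shows that the stability of \<open>PP\<close> demanded by
  \<open>decomposition_group\<close> follows from the congruences alone.\<close>

lemma inertial_image:
  assumes PP: "prime_in Zbar PP" and s: "s \<in> G_Q" "inertial PP s" shows "s ` PP = PP"
proof
  note r = prime_in_rules[OF PP csubring_Zbar]
  have in1: "s x - x \<in> PP" if "x \<in> Zbar" for x using s(2) that unfolding inertial_def by blast
  show "s ` PP \<subseteq> PP"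
  proof
    fix y assume "y \<in> s ` PP"
    then obtain x where x: "x \<in> PP" "y = s x" by blast
    hence "(s x - x) + x \<in> PP" using r(3)[OF in1[OF r(1)]] by blast
    thus "y \<in> PP" by (simp add: x)
  qed
  show "PP \<subseteq> s ` PP"
  proof
    fix y assume y: "y \<in> PP"
    obtain t where t: "t \<in> G_Q" "\<And>x. x \<in> Qbar \<Longrightarrow> s (t x) = x"
      by (rule G_Q_inverse[OF s(1)]) blast
    have ty: "t y \<in> Zbar" "s (t y) = y" using G_Q_Zbar[OF t(1) r(1)[OF y]] t(2) r(1)[OF y] Zbar_subset_Qbar by auto
    hence "y - (y - t y) \<in> PP" using r(7)[OF y] in1[OF ty(1)] by metis
    thus "y \<in> s ` PP" using ty(2) by (metis diff_diff_eq2 add_diff_cancel_left' imageI)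
  qed
qed

lemma inertia_group_iff:
  assumes "prime_in Zbar PP" "\<rat> \<subseteq> K"
  shows "s \<in> inertia_group K PP \<longleftrightarrow> s \<in> Gal Qbar K \<and> inertial PP s"
  using inertial_image[OF assms(1)] Gal_antimono[OF assms(2), of Qbar]
  unfolding inertia_group_def decomposition_group_def inertial_def by blast

text \<open>The Kummer field is unramified outside \<open>p\<close> and \<open>N\<close>.\<close>

lemma inertial_GalL:
  assumes PP: "prime_in Zbar PP" and l: "prime l" "of_nat l \<in> PP" "l \<noteq> N" "l \<noteq> p"
    and s: "s \<in> G_Q" "inertial PP s"
  shows "s \<in> G_L"
proof -
  have pP: "of_nat p \<notin> PP" by (rule distinct_primes_not_mem[OF PP csubring_Zbar l(1) prime_p l(4,2)])
  have NP: "of_nat N \<notin> PP" by (rule distinct_primes_not_mem[OF PP csubring_Zbar l(1) prime_N l(3,2)])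
  have "s x - x \<in> PP" if "x \<in> Zbar" for x using s(2) that by (simp add: inertial_def)
  note ic = inertia_char[OF PP csubring_Zbar \<zeta>_Zbar \<nu>_Zbar GQ_rules(2)[OF s(1)] Q_ring Zbar_subset_Qbar this pP]
  show ?thesis using Gal_L_iff s(1) ic(1) ic(2)[OF _ NP] by auto
qed

text \<open>All the inertia groups involved lie in \<open>G_L\<close>: at \<open>p\<close> by
  definition, elsewhere by \<open>inertial_GalL\<close>. Since \<open>G_L\<close> acts trivially on
  the module, a class is trivial on such a group exactly when its cocycles vanish there.\<close>

lemma H1_Lambda_iff:
  assumes c: "c \<in> cocycles i j"
  shows "cls i j c \<in> H1_Lambda N i j \<longleftrightarrow> unram c"
proof -
  have triv: "trivial_on (A i) (act j) (cls i j c) I \<longleftrightarrow> (\<forall>s\<in>I. c s = 0)" if I: "I \<subseteq> G_L" for I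
  proof
    assume "trivial_on (A i) (act j) (cls i j c) I"
    then obtain a where "a \<in> A i" "\<forall>s\<in>I. c s = act j s a - a" using cls_self[OF c] unfolding trivial_on_def by blast
    thus "\<forall>s\<in>I. c s = 0" using act_L[of a i _ j] I by auto
  next
    assume z: "\<forall>s\<in>I. c s = 0"
    have "d s = 0" if "d \<in> cls i j c" "s \<in> I" for d s
      using cohomologous_GalL[of c d i j s] that z I by (auto simp: cls_mem)
    thus "trivial_on (A i) (act j) (cls i j c) I"
      unfolding trivial_on_def by (auto simp: act_0 intro!: bexI[of _ 0] Sym_closed(1))
  qed
  have RL: "\<rat> \<subseteq> L" by (rule Rats_L)
  have t1: "trivial_on (A i) (act j) (cls i j c) (inertia_group \<rat> P) \<longleftrightarrow> (\<forall>s\<in>G_L. inertial P s \<longrightarrow> c s = 0)"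
    if l: "prime l" "l \<noteq> N" "l \<noteq> p" "P \<in> places_over l" for l P
  proof -
    have P: "prime_in Zbar P" "of_nat l \<in> P" using l(4) places_over_iff by auto
    have e: "inertia_group \<rat> P = {s \<in> G_L. inertial P s}"
      using inertia_group_iff[OF P(1)] inertial_GalL[OF P(1) l(1) P(2) l(2,3)] Gal_antimono[OF RL, of Qbar] by blast
    show ?thesis unfolding e by (subst triv) auto
  qed
  have t2: "trivial_on (A i) (act j) (cls i j c) (inertia_group L P) \<longleftrightarrow> (\<forall>s\<in>G_L. inertial P s \<longrightarrow> c s = 0)"
    if l: "P \<in> places_over p" for P
  proof -
    have P: "prime_in Zbar P" "of_nat p \<in> P" using l places_over_iff by auto
    have e: "inertia_group L P = {s \<in> G_L. inertial P s}" using inertia_group_iff[OF P(1) RL] by blast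
    show ?thesis unfolding e by (subst triv) auto
  qed
  have "cls i j c \<in> H1 (A i) (act j)" using c H1_iff by blast
  hence "cls i j c \<in> H1_Lambda N i j \<longleftrightarrow>
     (\<forall>l. prime l \<and> l \<noteq> N \<and> l \<noteq> p \<longrightarrow> (\<forall>P\<in>places_over l. \<forall>s\<in>G_L. inertial P s \<longrightarrow> c s = 0)) \<and>
     (\<forall>P\<in>places_over p. \<forall>s\<in>G_L. inertial P s \<longrightarrow> c s = 0)"
    unfolding H1_Lambda_def p_card[symmetric] using t1 t2 by auto
  also have "\<dots> \<longleftrightarrow> unram c"
  proof (intro iffI conjI allI impI ballI)
    assume h: "(\<forall>l. prime l \<and> l \<noteq> N \<and> l \<noteq> p \<longrightarrow> (\<forall>P\<in>places_over l. \<forall>s\<in>G_L. inertial P s \<longrightarrow> c s = 0)) \<and>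
     (\<forall>P\<in>places_over p. \<forall>s\<in>G_L. inertial P s \<longrightarrow> c s = 0)"
    show "unram c" unfolding unram_def
    proof (intro allI impI)
      fix l PP s
      assume l: "prime (l::nat)" "l \<noteq> N" "prime_in Zbar PP" "of_nat l \<in> PP" "s \<in> G_L" "inertial PP s"
      hence "PP \<in> places_over l" by (simp add: places_over_iff)
      thus "c s = 0" using h l by (cases "l = p") auto
    qed
  qed (use prime_p N_ne_p in \<open>auto simp: unram_def places_over_iff\<close>)
  finally show ?thesis .
qed

lemma H1_LambdaE:
  fixes c :: "'p cochain"
  assumes "\<xi> \<in> H1_Lambda N i j" "c \<in> \<xi>" shows "c \<in> cocycles i j" "\<xi> = cls i j c" "unram c"
proof -
  have "\<xi> \<in> H1 (A i) (act j)" using assms(1) by (simp add: H1_Lambda_def)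
  then obtain d where d: "d \<in> cocycles i j" "\<xi> = cls i j d" using H1_iff by blast
  have dc: "(d, c) \<in> coh i j" using assms(2) d(2) cls_mem by blast
  thus c: "c \<in> cocycles i j" by (simp add: cohomologous_iff)
  show e: "\<xi> = cls i j c" using cls_eq[OF dc] d(2) by simp
  show "unram c" using H1_Lambda_iff[OF c] assms(1) e by simp
qed

lemma H1_Lambda_rep:
  fixes \<xi> :: "'p cochain set"
  assumes "\<xi> \<in> H1_Lambda N i j" obtains c where "c \<in> \<xi>"
proof -
  have "\<xi> \<in> H1 (A i) (act j)" using assms(1) by (simp add: H1_Lambda_def)
  thus ?thesis using H1_iff cls_self that by metis
qed

section \<open>Scaling of classes and surjective restrictions\<close>

definition scal :: "'p mod_ring \<Rightarrow> 'p cochain \<Rightarrow> (complex \<Rightarrow> complex) \<Rightarrow> 'p mod_ring poly poly" where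
  "scal a c = (\<lambda>s. scale a (c s))"

lemma scal_scal: "scal a (scal b c) = scal (a * b) c" by (simp add: scal_def mult.commute)

lemma scal_1: "scal 1 c = c" by (simp add: scal_def one_pCons[symmetric])

lemma scal_cocycles: "c \<in> cocycles i j \<Longrightarrow> scal a c \<in> cocycles i j" unfolding scal_def by (rule cocycles_smult)

lemma scal_cls:
  assumes c: "c \<in> cocycles i j" and a: "a \<noteq> 0"
  shows "scal a ` cls i j c = cls i j (scal a c)"
proof -
  have sub: "scal a ` cls i j c \<subseteq> cls i j (scal a c)" if c: "c \<in> cocycles i j" for a c
  proof
    fix e assume "e \<in> scal a ` cls i j c"
    then obtain d where d: "(c, d) \<in> coh i j" "e = scal a d" by (auto simp: cls_mem)
    then obtain b where b: "b \<in> A i" "\<forall>s\<in>G_Q. c s - d s = act j s b - b" "d \<in> cocycles i j" by (auto simp: cohomologous_iff)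
    have "scal a c s - e s = act j s (scale a b) - scale a b" if s: "s \<in> G_Q" for s
    proof -
      have "scal a c s - e s = scale a (act j s b - b)" using b(2) s by (simp add: d(2) scal_def smult_diff_right[symmetric])
      thus ?thesis using act_linear(3)[OF b(1) b(1) s, of j a] by (simp add: smult_diff_right)
    qed
    thus "e \<in> cls i j (scal a c)"
      unfolding cls_mem cohomologous_iff d(2) using scal_cocycles[OF c, of a] scal_cocycles[OF b(3), of a] Sym_closed(5)[OF b(1), of a] by blast
  qed
  show ?thesis
  proof (rule antisym[OF sub[OF c]], rule subsetI)
    fix e assume "e \<in> cls i j (scal a c)"
    hence "scal (1 / a) e \<in> cls i j (scal (1 / a) (scal a c))" using sub[OF scal_cocycles[OF c], of "1 / a" a] by blast
    hence "scal (1 / a) e \<in> cls i j c" using a by (simp add: scal_scal scal_1)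
    moreover have "e = scal a (scal (1 / a) e)" using a by (simp add: scal_scal scal_1)
    ultimately show "e \<in> scal a ` cls i j c" by blast
  qed
qed

lemma line_cls:
  assumes c: "c \<in> cocycles i j"
  shows "line (cls i j c) = {cls i j (scal a c) | a. a \<noteq> 0}"
proof -
  have "line (cls i j c) = {scal a ` cls i j c | a. a \<noteq> 0}" by (simp add: line_def scal_def[abs_def])
  also have "\<dots> = {cls i j (scal a c) | a. a \<noteq> 0}" by (rule Collect_cong) (metis scal_cls[OF c])
  finally show ?thesis .
qed

lemma line_self: assumes "c \<in> cocycles i j" shows "cls i j c \<in> line (cls i j c)"
  unfolding line_cls[OF assms] by (intro CollectI exI[of _ 1]) (simp add: scal_1)

lemma line_eqI:
  assumes c: "c \<in> cocycles i j" and a: "a \<noteq> 0"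
  shows "line (cls i j (scal a c)) = line (cls i j c)" unfolding line_cls[OF scal_cocycles[OF c]] line_cls[OF c] scal_scal
proof (intro equalityI subsetI)
  fix e assume "e \<in> {cls i j (scal (b * a) c) | b. b \<noteq> 0}"
  then obtain b where "b \<noteq> 0" "e = cls i j (scal (b * a) c)" by blast
  thus "e \<in> {cls i j (scal b c) | b. b \<noteq> 0}" using a by (intro CollectI exI[of _ "b * a"]) simp
next
  fix e assume "e \<in> {cls i j (scal b c) | b. b \<noteq> 0}"
  then obtain b where "b \<noteq> 0" "e = cls i j (scal b c)" by blast
  thus "e \<in> {cls i j (scal (b * a) c) | b. b \<noteq> 0}" using a by (intro CollectI exI[of _ "b / a"]) simp
qed

lemma cocycle_GalL:
  assumes c: "cocycle i j c" and s: "s \<in> G_L" and t: "t \<in> G_L"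
  shows "c (compose Qbar s t) = c s + c t"
proof -
  have "s \<in> G_Q" "t \<in> G_Q" using s t Gal_L_iff by auto
  thus ?thesis using cocycle_rules[OF c] act_L[of "c t" i s j] s by simp
qed

lemma cocycle_inverse:
  assumes c: "cocycle i j c" and s: "s \<in> G_Q" and t: "t \<in> G_Q" and st: "\<And>x. x \<in> Qbar \<Longrightarrow> s (t x) = x"
  shows "c s + act j s (c t) = 0"
proof -
  have "compose Qbar s t = idQ"
    by (rule Gal_eqI[OF Qbar_field GQ_compose[OF s t] idQ[OF Rats_Qbar]]) (simp add: compose_def st)
  thus ?thesis using cocycle_rules(2)[OF c s t] cocycle_id[OF c] by simp
qed

text \<open>Equivariance of the restriction to \<open>G_L\<close>: the terms \<open>c s\<close> and
  \<open>act j s (c t)\<close> cancel because \<open>t\<close> is inverse to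
  \<open>s\<close>.\<close>

lemma cocycle_conj:
  assumes c: "cocycle i j c" and s: "s \<in> G_Q" and t: "t \<in> G_Q" and st: "\<And>x. x \<in> Qbar \<Longrightarrow> s (t x) = x"
    and u: "u \<in> G_L"
  shows "compose Qbar s (compose Qbar u t) \<in> G_L" "c (compose Qbar s (compose Qbar u t)) = act j s (c u)"
proof -
  have uQ: "u \<in> G_Q" "chi u = 1" "kb u = 0" using u Gal_L_iff by auto
  have id: "compose Qbar s t = idQ"
    by (rule Gal_eqI[OF Qbar_field GQ_compose[OF s t] idQ[OF Rats_Qbar]]) (simp add: compose_def st)
  have ch: "chi s * chi t = 1" "kb s + chi s * kb t = 0" using char_compose[OF s t] id char_idQ by auto
  note ut = GQ_compose[OF uQ(1) t]
  show "compose Qbar s (compose Qbar u t) \<in> G_L"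
    unfolding Gal_L_iff using GQ_compose[OF s ut] ch by (simp add: char_compose[OF s ut] char_compose[OF uQ(1) t] uQ)
  note m = cocycle_rules(1)[OF c]
  have "c (compose Qbar s (compose Qbar u t)) = c s + act j s (c u + c t)"
    using cocycle_rules(2)[OF c s ut] cocycle_rules(2)[OF c uQ(1) t] act_L[OF m[OF t] u, of j] by simp
  also have "\<dots> = act j s (c u) + (c s + act j s (c t))" by (simp add: act_linear(1)[OF m[OF uQ(1)] m[OF t] s])
  finally show "c (compose Qbar s (compose Qbar u t)) = act j s (c u)" using cocycle_inverse[OF c s t st] by simp
qed

lemma idQ_GalL: "idQ \<in> G_L" by (rule idQ[OF L_Qbar])

text \<open>A submodule of \<open>A\<^sup>i\<^sup>,\<^sup>j\<close> not contained in the hyperplane \<open>A\<^sup>i\<^sup>-\<^sup>1\<^sup>,\<^sup>j\<^sup>+\<^sup>1\<close> is everything.\<close>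

lemma cocycle_image:
  assumes c: "cocycle i j c" and i: "i < p" and s: "s \<in> G_L" "top_coeff i (c s) \<noteq> 0"
  shows "c ` G_L = A i"
proof -
  obtain t where t: "t \<in> G_Q" "chi t = 1" "kb t = 1" using char_surj[of 1 1] by auto
  obtain t' where t': "t' \<in> G_Q" "\<And>x. x \<in> Qbar \<Longrightarrow> t (t' x) = x" "\<And>x. x \<in> Qbar \<Longrightarrow> t' (t x) = x"
    by (rule G_Q_inverse[OF t(1)]) blast
  show ?thesis
  proof (rule act_span[OF i t])
    show "c ` G_L \<subseteq> A i" using cocycle_rules(1)[OF c] Gal_L_iff by auto
    fix f assume "f \<in> c ` G_L"
    then obtain u where u: "u \<in> G_L" "f = c u" by blast
    show "act j t f \<in> c ` G_L" using cocycle_conj[OF c t(1) t'(1,2) u(1)] u(2) by (metis imageI)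
    fix g assume "g \<in> c ` G_L"
    then obtain v where v: "v \<in> G_L" "g = c v" by blast
    obtain v' where v': "v' \<in> G_L" "\<And>x. x \<in> Qbar \<Longrightarrow> v (v' x) = x"
      by (rule Gal_inverse[OF Qbar_field L_Qbar v(1)]) blast
    have vG: "v \<in> G_Q" "v' \<in> G_Q" using v(1) v'(1) Gal_L_iff by auto
    have "c v + c v' = 0" using cocycle_inverse[OF c vG v'(2)] act_L[OF cocycle_rules(1)[OF c vG(2)] v(1), of j] by simp
    hence "f - g = c (compose Qbar u v')"
      using cocycle_GalL[OF c u(1) v'(1)] u(2) v(2) by (simp add: eq_neg_iff_add_eq_0[symmetric])
    thus "f - g \<in> c ` G_L" using Gal_compose[OF Qbar_field L_Qbar u(1) v'(1)] by (metis imageI)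
  qed (use s in auto)
qed

lemma mult_e1_act:
  assumes f: "f \<in> A (i - 1)" and i: "i \<ge> 1" and s: "s \<in> G_Q"
  shows "mult_e1 (act (j + 1) s f) = act j s (mult_e1 f)" "mult_e1 f \<in> A i"
proof -
  have m: "mult_e1 f \<in> A i" if "f \<in> A (i - 1)" for f using mult_e1_Sym[OF that] i by simp
  show "mult_e1 f \<in> A i" by (rule m[OF f])
  show "mult_e1 (act (j + 1) s f) = act j s (mult_e1 f)"
  proof (rule dehom_inj[OF m[OF act_mem[OF f]] act_mem[OF m[OF f]]])
    have "chi s powi (j + 1) * chi s ^ (i - 1) = chi s powi j * chi s ^ i"
      using i chi_nonzero[OF s] by (cases i) (auto simp: power_int_add)
    thus "dehom (mult_e1 (act (j + 1) s f)) = dehom (act j s (mult_e1 f))"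
      by (simp add: dehom_mult_e1 dehom_act[OF f s] dehom_act[OF m[OF f] s])
  qed
qed

lemma mult_e1_cocycles:
  assumes d: "d \<in> cocycles (i - 1) (j + 1)" and i: "i \<ge> 1"
  shows "mult_e1 \<circ> d \<in> cocycles i j" "H1_map mult_e1 (A i) (act j) (cls (i - 1) (j + 1) d) = cls i j (mult_e1 \<circ> d)"
proof -
  have lin: "mult_e1 (f + g) = mult_e1 f + mult_e1 g" "mult_e1 (f - g) = mult_e1 f - mult_e1 g" "mult_e1 0 = 0"
    for f g :: "'p mod_ring poly poly" unfolding mult_e1_def by (simp_all only: distrib_left right_diff_distrib mult_zero_right)
  have comp: "mult_e1 \<circ> d \<in> cocycles i j" if d: "d \<in> cocycles (i - 1) (j + 1)" for d
  proof -
    note dc = cocycle_rules[OF cocycles_cocycle[OF d]]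
    have "cocycle i j (mult_e1 \<circ> d)" unfolding cocycle_def using dc mult_e1_act[OF dc(1) i] by (auto simp: lin)
    moreover obtain S where "finite S" "S \<subseteq> Qbar" "\<forall>t\<in>G_Q. (\<forall>x\<in>S. t x = x) \<longrightarrow> d t = 0" using d unfolding cocycles_iff by blast
    ultimately show ?thesis using d unfolding cocycles_iff by (auto simp: lin intro!: exI[of _ S])
  qed
  show "mult_e1 \<circ> d \<in> cocycles i j" by (rule comp[OF d])
  have "cls i j (mult_e1 \<circ> e) = cls i j (mult_e1 \<circ> d)" if e: "e \<in> cls (i - 1) (j + 1) d" for e
  proof -
    obtain a where a: "a \<in> A (i - 1)" "\<forall>s\<in>G_Q. d s - e s = act (j + 1) s a - a" "e \<in> cocycles (i - 1) (j + 1)"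
      using e by (auto simp: cls_mem cohomologous_iff)
    have "mult_e1 (d s) - mult_e1 (e s) = act j s (mult_e1 a) - mult_e1 a" if s: "s \<in> G_Q" for s
      using a(2) s mult_e1_act(1)[OF a(1) i s, of j] by (metis lin(2))
    hence "(mult_e1 \<circ> d, mult_e1 \<circ> e) \<in> coh i j"
      using comp[OF d] comp[OF a(3)] mult_e1_act(2)[OF a(1) i idQ[OF Rats_Qbar]] by (auto simp: cohomologous_iff)
    thus ?thesis using cls_eq by metis
  qed
  moreover have "H1_map mult_e1 (A i) (act j) (cls (i - 1) (j + 1) d) = (\<Union>e\<in>cls (i - 1) (j + 1) d. cls i j (mult_e1 \<circ> e))"
    by (auto simp: H1_map_def cls_def)
  ultimately show "H1_map mult_e1 (A i) (act j) (cls (i - 1) (j + 1) d) = cls i j (mult_e1 \<circ> d)"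
    using cls_self[OF d] by blast
qed

abbreviation Sel :: "nat \<Rightarrow> int \<Rightarrow> 'p cochain set set" where
  "Sel \<equiv> H1_Lambda N"

abbreviation Sel_sub :: "nat \<Rightarrow> int \<Rightarrow> 'p cochain set set" where
  "Sel_sub \<equiv> H1_Lambda_sub N"

text \<open>Cohomologous cocycles agree on \<open>G_L\<close>, so both conditions depend only on the
  class.\<close>

definition big_classes :: "nat \<Rightarrow> int \<Rightarrow> 'p cochain set set" where
  "big_classes i j = {cls i j c | c. c \<in> cocycles i j \<and> unram c \<and> c ` G_L = A i}"

lemma exists_top: obtains f where "f \<in> A i" "top_coeff i f = 1"
proof (rule that)
  show "homog i (monom (1 :: 'p mod_ring) i) \<in> A i" by (rule homog_Sym)
  show "top_coeff i (homog i (monom (1 :: 'p mod_ring) i)) = 1" unfolding top_coeff_def by (subst dehom_homog) auto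
qed

text \<open>A class from the smaller Selmer group has zero top coefficient on \<open>G_L\<close>.
  Conversely, if the top coefficient vanishes on \<open>G_L\<close>, then after subtracting a
  coboundary it vanishes on \<open>G_Q\<close>, and the cocycle is \<open>e1\<close> times a Selmer
  cocycle. In the remaining case \<open>cocycle_image\<close> gives surjectivity.\<close>

lemma line_big_classes:
  assumes i: "1 \<le> i" "i < p" and j: "\<not> [j = 1] (mod (int p - 1))"
  shows "P1 (Sel i j) - P1 (Sel_sub i j) = line ` big_classes i j"
proof (intro equalityI subsetI)
  fix W assume "W \<in> line ` big_classes i j"
  then obtain c where c: "c \<in> cocycles i j" "unram c" "c ` G_L = A i" "W = line (cls i j c)" by (auto simp: big_classes_def)
  obtain f where f: "f \<in> A i" "top_coeff i f = 1" by (rule exists_top)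
  then obtain s where s: "s \<in> G_L" "top_coeff i (c s) = 1" using c(3) by (metis imageE)
  have "(\<lambda>\<sigma>. 0) \<notin> cls i j c"
  proof
    assume "(\<lambda>\<sigma>. 0) \<in> cls i j c"
    hence "c s = 0" using cohomologous_GalL[of c "\<lambda>\<sigma>. 0" i j s] s(1) by (simp add: cls_mem)
    thus False using s(2) by (simp add: top_coeff_linear)
  qed
  hence W1: "W \<in> P1 (Sel i j)" unfolding P1_def using H1_Lambda_iff[OF c(1)] c(2,4) by blast
  moreover have "W \<notin> P1 (Sel_sub i j)"
  proof
    assume "W \<in> P1 (Sel_sub i j)"
    then obtain \<eta> where \<eta>: "\<eta> \<in> Sel (i - 1) (j + 1)" "W = line (H1_map mult_e1 (A i) (act j) \<eta>)"
      unfolding P1_def H1_Lambda_sub_def by blast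
    obtain d where d: "d \<in> \<eta>" by (rule H1_Lambda_rep[OF \<eta>(1)])
    note dd = H1_LambdaE[OF \<eta>(1) d]
    have "W = line (cls i j (mult_e1 \<circ> d))" using \<eta>(2) dd(2) mult_e1_cocycles(2)[OF dd(1) i(1)] by simp
    hence "cls i j c \<in> line (cls i j (mult_e1 \<circ> d))" using line_self[OF c(1)] c(4) by simp
    then obtain a where a: "cls i j c = cls i j (scal a (mult_e1 \<circ> d))"
      unfolding line_cls[OF mult_e1_cocycles(1)[OF dd(1) i(1)]] by blast
    hence "c \<in> cls i j (scal a (mult_e1 \<circ> d))" using cls_self[OF c(1)] by simp
    hence cs: "c s = scale a (mult_e1 (d s))" using cohomologous_GalL[OF _ s(1), of "scal a (mult_e1 \<circ> d)" c i j] unfolding cls_mem by (simp add: scal_def)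
    have "d s \<in> A (i - 1)" using cocycle_rules(1)[OF cocycles_cocycle[OF dd(1)]] s(1) Gal_L_iff by auto
    hence "top_coeff i (mult_e1 (d s)) = 0" unfolding top_coeff_def dehom_mult_e1 by (rule dehom_bound) (use i in simp)
    thus False using s(2) cs by (simp add: top_coeff_linear)
  qed
  ultimately show "W \<in> P1 (Sel i j) - P1 (Sel_sub i j)" by blast
next
  fix W assume W: "W \<in> P1 (Sel i j) - P1 (Sel_sub i j)"
  then obtain \<xi> where \<xi>: "\<xi> \<in> Sel i j" "(\<lambda>\<sigma>. 0) \<notin> \<xi>" "W = line \<xi>" by (auto simp: P1_def)
  obtain c where cx: "c \<in> \<xi>" by (rule H1_Lambda_rep[OF \<xi>(1)])
  note c = H1_LambdaE[OF \<xi>(1) cx]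
  note cc = cocycles_cocycle[OF c(1)]
  have "\<exists>s\<in>G_L. top_coeff i (c s) \<noteq> 0"
  proof (rule ccontr)
    assume "\<not> (\<exists>s\<in>G_L. top_coeff i (c s) \<noteq> 0)"
    hence z: "top_coeff i (c s) = 0" if "s \<in> G_L" for s using that by blast
    obtain a where a: "a \<in> A i" "\<And>s. s \<in> G_Q \<Longrightarrow> top_coeff i (c s - (act j s a - a)) = 0"
      using cocycle_top_trivial[OF j cc z] by blast
    define c' where "c' = (\<lambda>s. c s - (if s \<in> G_Q then act j s a - a else 0))"
    have c': "c' \<in> cocycles i j" unfolding c'_def by (rule cocycles_diff[OF c(1) cocycles_coboundary[OF a(1)]])
    note cc' = cocycles_cocycle[OF c']
    have rel: "(c, c') \<in> coh i j" using c(1) c' a(1) by (auto simp: cohomologous_iff c'_def)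
    have top: "top_coeff i (c' s) = 0" if "s \<in> G_Q" for s using a(2)[OF that] that by (simp add: c'_def)
    \<comment> \<open>Division by \<open>e1\<close>: the dehomogenized values of \<open>c'\<close>
      have degree below \<open>i\<close>, so they can be homogenized in degree
      \<open>i - 1\<close>.\<close>
    define d where "d = (\<lambda>s. homog (i - 1) (dehom (c' s)))"
    have dm: "d s \<in> A (i - 1)" for s unfolding d_def by (rule homog_Sym)
    have md: "mult_e1 (d s) = c' s" if s: "s \<in> G_Q" for s
    proof (rule dehom_inj)
      note m = cocycle_rules(1)[OF cc' s]
      show "c' s \<in> A i" by (rule m)
      show "mult_e1 (d s) \<in> A i" using mult_e1_Sym[OF dm[of s]] i(1) by simp
      show "dehom (mult_e1 (d s)) = dehom (c' s)" unfolding dehom_mult_e1 d_def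
      proof (rule dehom_homog)
        fix k assume "k > i - 1"
        thus "coeff (dehom (c' s)) k = 0"
          using dehom_bound[OF m, of k] top[OF s] by (cases "k = i") (auto simp: top_coeff_def)
      qed
    qed
    have inj: "f = g" if "f \<in> A (i - 1)" "g \<in> A (i - 1)" "mult_e1 f = mult_e1 g" for f g :: "'p mod_ring poly poly"
      by (rule dehom_inj[OF that(1,2)]) (metis dehom_mult_e1 that(3))
    have h0: "homog (i - 1) (dehom (0 :: 'p mod_ring poly poly)) = 0" by (simp add: homog_def dehom_0)
    have d0: "d s = 0" if "c' s = 0" for s using h0 by (simp add: d_def that)
    have dc: "cocycle (i - 1) (j + 1) d" unfolding cocycle_def
    proof (intro conjI ballI dm)
      fix s t assume s: "s \<in> G_Q" and t: "t \<in> G_Q"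
      show "d (compose Qbar s t) = d s + act (j + 1) s (d t)"
      proof (rule inj[OF dm Sym_closed(2)[OF dm act_mem[OF dm]]])
        have "mult_e1 (d s + act (j + 1) s (d t)) = mult_e1 (d s) + mult_e1 (act (j + 1) s (d t))"
          by (simp only: mult_e1_def distrib_left)
        also have "\<dots> = c' s + act j s (c' t)" by (simp add: md[OF s] mult_e1_act(1)[OF dm i(1) s] md[OF t])
        also have "\<dots> = mult_e1 (d (compose Qbar s t))" using cocycle_rules(2)[OF cc' s t] md[OF GQ_compose[OF s t]] by simp
        finally show "mult_e1 (d (compose Qbar s t)) = mult_e1 (d s + act (j + 1) s (d t))" by simp
      qed
    qed
    have d: "d \<in> cocycles (i - 1) (j + 1)"
    proof -
      have o: "\<forall>s. s \<notin> G_Q \<longrightarrow> d s = 0" using c' d0 unfolding cocycles_iff by blast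
      obtain S where "finite S" "S \<subseteq> Qbar" "\<forall>t\<in>G_Q. (\<forall>x\<in>S. t x = x) \<longrightarrow> c' t = 0" using c' unfolding cocycles_iff by blast
      hence "finite S \<and> S \<subseteq> Qbar \<and> (\<forall>t\<in>G_Q. (\<forall>x\<in>S. t x = x) \<longrightarrow> d t = 0)" using d0 by blast
      thus ?thesis using dc o unfolding cocycles_iff by blast
    qed
    have "unram d" using c(3) cohomologous_GalL[OF rel] d0 unfolding unram_def by metis
    hence dL: "cls (i - 1) (j + 1) d \<in> Sel (i - 1) (j + 1)" using H1_Lambda_iff[OF d] by simp
    have "mult_e1 \<circ> d = c'"
    proof
      fix s
      show "(mult_e1 \<circ> d) s = c' s"
      proof (cases "s \<in> G_Q")
        case False
        hence "c' s = 0" "d s = 0" using c' d unfolding cocycles_iff by auto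
        thus ?thesis by (simp add: mult_e1_def)
      qed (simp add: md)
    qed
    hence "H1_map mult_e1 (A i) (act j) (cls (i - 1) (j + 1) d) = \<xi>"
      using mult_e1_cocycles(2)[OF d i(1)] cls_eq[OF rel] c(2) by simp
    hence "\<xi> \<in> Sel_sub i j" unfolding H1_Lambda_sub_def using dL by blast
    hence "W \<in> P1 (Sel_sub i j)" unfolding P1_def using \<xi>(2,3) by blast
    thus False using W by blast
  qed
  hence "c ` G_L = A i" using cocycle_image[OF cc i(2)] by blast
  hence "\<xi> \<in> big_classes i j" using c unfolding big_classes_def by blast
  thus "W \<in> line ` big_classes i j" using \<xi>(3) by blast
qed

end

section \<open>The field cut out by a class\<close>

context kummer
begin

definition ker_GalL :: "'p cochain \<Rightarrow> (complex \<Rightarrow> complex) set" where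
  "ker_GalL c = {s \<in> G_L. c s = 0}"

definition class_field :: "'p cochain \<Rightarrow> complex set" where
  "class_field c = {x \<in> Qbar. \<forall>s\<in>ker_GalL c. s x = x}"

lemma GalL_G: "s \<in> G_L \<Longrightarrow> s \<in> G_Q" using Gal_L_iff by blast

lemma Gal_Qbar_iff:
  assumes "\<rat> \<subseteq> K" shows "s \<in> Gal Qbar K \<longleftrightarrow> s \<in> G_Q \<and> (\<forall>x\<in>K. s x = x)"
  using assms by (auto simp: Gal_iff[OF Qbar_field])

lemma ker_subgroup:
  assumes c: "cocycle i j c" shows "gal_subgroup (ker_GalL c)" unfolding gal_subgroup_def
proof (intro conjI ballI impI)
  show "ker_GalL c \<subseteq> G_Q" using GalL_G by (auto simp: ker_GalL_def)
  show "idQ \<in> ker_GalL c" unfolding ker_GalL_def using idQ_GalL cocycle_id[OF c] by blast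
  fix s assume s: "s \<in> ker_GalL c"
  hence s': "s \<in> G_L" "c s = 0" "s \<in> G_Q" using GalL_G by (auto simp: ker_GalL_def)
  show "compose Qbar s t \<in> ker_GalL c" if "t \<in> ker_GalL c" for t
    using that s' cocycle_GalL[OF c s'(1), of t] Gal_compose[OF Qbar_field L_Qbar s'(1), of t] by (auto simp: ker_GalL_def)
  fix t assume t: "t \<in> G_Q" "\<forall>x\<in>Qbar. s (t x) = x"
  have inv: "t x = x" if x: "x \<in> L" for x
  proof -
    have xQ: "x \<in> Qbar" using x L_Qbar by blast
    have "s (t x) = s x" using t(2) xQ Gal_rules(5)[OF Qbar_field s'(1) x] by simp
    thus ?thesis using Gal_rules(6)[OF Qbar_field s'(1)] GQ_rules(4)[OF t(1) xQ] xQ by (auto dest: inj_onD)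
  qed
  have tL: "t \<in> G_L" using t(1) inv Gal_Qbar_iff[OF Rats_L] by blast
  have "c s + act j s (c t) = 0" by (rule cocycle_inverse[OF c s'(3) t(1)]) (use t(2) in blast)
  hence "c t = 0" using s'(2) act_L[OF cocycle_rules(1)[OF c t(1)] s'(1), of j] by simp
  thus "t \<in> ker_GalL c" using tL by (simp add: ker_GalL_def)
qed

lemma ker_open:
  assumes c: "c \<in> cocycles i j"
  obtains S where "finite S" "S \<subseteq> Qbar" "\<And>s. s \<in> G_Q \<Longrightarrow> (\<And>x. x \<in> S \<Longrightarrow> s x = x) \<Longrightarrow> s \<in> ker_GalL c"
proof -
  obtain S where S: "finite S" "S \<subseteq> Qbar" "\<forall>t\<in>G_Q. (\<forall>x\<in>S. t x = x) \<longrightarrow> c t = 0" using c unfolding cocycles_iff by blast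
  show ?thesis
  proof (rule that[of "S \<union> {\<zeta>, \<nu>}"])
    fix s assume s: "s \<in> G_Q" "\<And>x. x \<in> S \<union> {\<zeta>, \<nu>} \<Longrightarrow> s x = x"
    thus "s \<in> ker_GalL c" using S(3) GalL_fixes_roots[of s] by (auto simp: ker_GalL_def)
  qed (use S Qbar_mem in auto)
qed

text \<open>The kernel of \<open>c\<close> on \<open>G_L\<close> is open by continuity and invariant
  under conjugation by equivariance, so it is recovered from its fixed field.\<close>

lemma class_field_rules:
  assumes c: "c \<in> cocycles i j"
  shows "galois_number_field (class_field c)" "Gal Qbar (class_field c) = ker_GalL c" "L \<subseteq> class_field c"
proof -
  note cc = cocycles_cocycle[OF c]
  obtain S where S: "finite S" "S \<subseteq> Qbar" "\<And>s. s \<in> G_Q \<Longrightarrow> (\<And>x. x \<in> S \<Longrightarrow> s x = x) \<Longrightarrow> s \<in> ker_GalL c"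
    by (rule ker_open[OF c]) blast
  show g: "galois_number_field (class_field c)" unfolding class_field_def
  proof (rule normal_fixed_field[OF ker_subgroup[OF cc] _ S])
    fix s t u assume h: "s \<in> G_Q" "t \<in> G_Q" "\<And>x. x \<in> Qbar \<Longrightarrow> s (t x) = x" "\<And>x. x \<in> Qbar \<Longrightarrow> t (s x) = x" "u \<in> ker_GalL c"
    hence u: "u \<in> G_L" "c u = 0" by (auto simp: ker_GalL_def)
    show "compose Qbar t (compose Qbar u s) \<in> ker_GalL c"
      using cocycle_conj[OF cc h(2,1,4) u(1)] u(2) by (simp add: ker_GalL_def act_0)
  qed
  show L: "L \<subseteq> class_field c" using L_Qbar Gal_rules(5)[OF Qbar_field] by (auto simp: class_field_def ker_GalL_def)
  show "Gal Qbar (class_field c) = ker_GalL c"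
  proof
    show "Gal Qbar (class_field c) \<subseteq> ker_GalL c"
    proof
      fix t assume "t \<in> Gal Qbar (class_field c)"
      hence t: "t \<in> Gal Qbar {x \<in> Qbar. \<forall>s\<in>ker_GalL c. s x = x}" by (simp add: class_field_def)
      show "t \<in> ker_GalL c" by (rule open_subgroup_closed[OF ker_subgroup[OF cc] S(1,2) _ t]) (rule S(3))
    qed
    show "ker_GalL c \<subseteq> Gal Qbar (class_field c)"
    proof
      fix s assume s: "s \<in> ker_GalL c"
      hence "s \<in> G_Q" using GalL_G by (auto simp: ker_GalL_def)
      moreover have "\<rat> \<subseteq> class_field c" using Rats_L L by blast
      ultimately show "s \<in> Gal Qbar (class_field c)" using s Gal_Qbar_iff[of "class_field c" s] by (auto simp: class_field_def)
    qed
  qed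
qed

lemma class_field_agree:
  assumes c: "c \<in> cocycles i j" and s: "s \<in> G_Q" and t: "t \<in> G_Q" and e: "\<And>x. x \<in> class_field c \<Longrightarrow> s x = t x"
  shows "c s = c t"
proof (rule cocycle_agree[OF cocycles_cocycle[OF c] _ _ s t e])
  show "class_field c \<subseteq> Qbar" by (auto simp: class_field_def)
  fix t assume "t \<in> G_Q" "\<And>x. x \<in> class_field c \<Longrightarrow> t x = x"
  hence "t \<in> Gal Qbar (class_field c)"
    using Gal_Qbar_iff[of "class_field c" t] class_field_rules(3)[OF c] Rats_L by blast
  thus "c t = 0" using class_field_rules(2)[OF c] by (simp add: ker_GalL_def)
qed

text \<open>Converse of \<open>class_field_agree\<close> on \<open>G_L\<close>: equal values put the
  quotient of \<open>s\<close> and \<open>t\<close> into the kernel.\<close>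

lemma class_field_agree_iff:
  assumes c: "c \<in> cocycles i j" and s: "s \<in> G_L" and t: "t \<in> G_L" and e: "c s = c t" and x: "x \<in> class_field c"
  shows "s x = t x"
proof -
  note cc = cocycles_cocycle[OF c]
  obtain t' where t': "t' \<in> G_L" "\<And>x. x \<in> Qbar \<Longrightarrow> t (t' x) = x" "\<And>x. x \<in> Qbar \<Longrightarrow> t' (t x) = x"
    by (rule Gal_inverse[OF Qbar_field L_Qbar t]) blast
  have "c t' + act j t' (c t) = 0" by (rule cocycle_inverse[OF cc GalL_G[OF t'(1)] GalL_G[OF t] t'(3)])
  hence "c t' + c t = 0" using act_L[OF cocycle_rules(1)[OF cc GalL_G[OF t]] t'(1), of j] by simp
  hence "c (compose Qbar t' s) = 0" using cocycle_GalL[OF cc t'(1) s] e by simp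
  hence "compose Qbar t' s \<in> ker_GalL c" using Gal_compose[OF Qbar_field L_Qbar t'(1) s] by (simp add: ker_GalL_def)
  hence "compose Qbar t' s x = x" using x by (simp add: class_field_def)
  moreover have xQ: "x \<in> Qbar" using x by (simp add: class_field_def)
  ultimately have "t' (s x) = x" by (simp add: compose_def)
  thus ?thesis using t'(2)[OF GQ_rules(4)[OF GalL_G[OF s] xQ]] by simp
qed

text \<open>The isomorphism evaluates \<open>c\<close> on lifts. It is well defined by
  \<open>class_field_agree\<close>, injective by \<open>class_field_agree_iff\<close> and
  equivariant by \<open>cocycle_conj\<close>.\<close>

lemma class_field_A_extension:
  assumes c: "c \<in> cocycles i j" and onto: "c ` G_L = A i"
  shows "A_extension TYPE('p) N i j (class_field c)"
proof -
  note cc = cocycles_cocycle[OF c]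
  define M where "M = class_field c"
  interpret M: galois_number_field M unfolding M_def by (rule class_field_rules(1)[OF c])
  have LM: "L \<subseteq> M" unfolding M_def by (rule class_field_rules(3)[OF c])
  have "\<forall>\<tau>. \<exists>s. \<tau> \<in> Gal M L \<longrightarrow> s \<in> G_L \<and> (\<forall>x\<in>M. s x = \<tau> x)"
    using Gal_lift[OF M.M M.M_Qbar LM] by metis
  then obtain lift where lift: "\<And>\<tau>. \<tau> \<in> Gal M L \<Longrightarrow> lift \<tau> \<in> G_L" "\<And>\<tau> x. \<tau> \<in> Gal M L \<Longrightarrow> x \<in> M \<Longrightarrow> lift \<tau> x = \<tau> x"
    by metis
  define \<phi> where "\<phi> = (\<lambda>\<tau>. c (lift \<tau>))"
  have \<phi>: "\<phi> \<tau> = c s" if "\<tau> \<in> Gal M L" "s \<in> G_Q" "\<And>x. x \<in> M \<Longrightarrow> s x = \<tau> x" for \<tau> s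
    unfolding \<phi>_def
    by (rule class_field_agree[OF c GalL_G[OF lift(1)[OF that(1)]] that(2)]) (use that lift(2) M_def in auto)
  have hom: "\<phi> (compose M \<tau> \<tau>') = \<phi> \<tau> + \<phi> \<tau>'" if t: "\<tau> \<in> Gal M L" "\<tau>' \<in> Gal M L" for \<tau> \<tau>'
  proof -
    have "\<phi> (compose M \<tau> \<tau>') = c (compose Qbar (lift \<tau>) (lift \<tau>'))"
    proof (rule \<phi>[OF Gal_compose[OF M.M LM t] GQ_compose[OF GalL_G[OF lift(1)[OF t(1)]] GalL_G[OF lift(1)[OF t(2)]]]])
      fix x assume x: "x \<in> M"
      thus "compose Qbar (lift \<tau>) (lift \<tau>') x = compose M \<tau> \<tau>' x"
        using lift(2) t M.G_rules(4)[OF t(2) x] M.M_Qbar by (auto simp: compose_def)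
    qed
    thus ?thesis using cocycle_GalL[OF cc lift(1)[OF t(1)] lift(1)[OF t(2)]] by (simp add: \<phi>_def)
  qed
  have bij: "bij_betw \<phi> (Gal M L) (A i)"
  proof (rule bij_betw_imageI)
    show "inj_on \<phi> (Gal M L)"
    proof (rule inj_onI)
      fix \<tau> \<tau>' assume t: "\<tau> \<in> Gal M L" "\<tau>' \<in> Gal M L" "\<phi> \<tau> = \<phi> \<tau>'"
      show "\<tau> = \<tau>'"
      proof (rule Gal_eqI[OF M.M t(1,2)])
        fix x assume x: "x \<in> M"
        have "lift \<tau> x = lift \<tau>' x"
          by (rule class_field_agree_iff[OF c lift(1)[OF t(1)] lift(1)[OF t(2)]]) (use t(3) x M_def in \<open>auto simp: \<phi>_def\<close>)
        thus "\<tau> x = \<tau>' x" using lift(2) t x by simp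
      qed
    qed
    show "\<phi> ` Gal M L = A i"
    proof
      show "\<phi> ` Gal M L \<subseteq> A i" using cocycle_rules(1)[OF cc GalL_G[OF lift(1)]] by (auto simp: \<phi>_def)
      show "A i \<subseteq> \<phi> ` Gal M L"
      proof
        fix f assume "f \<in> A i"
        then obtain s where s: "s \<in> G_L" "f = c s" using onto by blast
        have r: "restrict s M \<in> Gal M L" by (rule normal_restrict[OF M.normal LM s(1)])
        have "\<phi> (restrict s M) = c s" by (rule \<phi>[OF r GalL_G[OF s(1)]]) simp
        thus "f \<in> \<phi> ` Gal M L" using r s(2) by (metis imageI)
      qed
    qed
  qed
  have iso: "\<phi> \<in> iso (gal_group M L) (Sym_group i)" unfolding iso_def hom_def mem_Collect_eq
  proof (intro conjI ballI funcsetI)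
    show "\<phi> \<tau> \<in> carrier (Sym_group i)" if "\<tau> \<in> carrier (gal_group M L)" for \<tau>
      using that bij by (auto simp: gal_group_def Sym_group_def bij_betw_def)
    show "bij_betw \<phi> (carrier (gal_group M L)) (carrier (Sym_group i))"
      using bij by (simp add: gal_group_def Sym_group_def)
    fix \<tau> \<tau>' assume "\<tau> \<in> carrier (gal_group M L)" "\<tau>' \<in> carrier (gal_group M L)"
    hence t: "\<tau> \<in> Gal M L" "\<tau>' \<in> Gal M L" by (auto simp: gal_group_def)
    show "\<phi> (\<tau> \<otimes>\<^bsub>gal_group M L\<^esub> \<tau>') = \<phi> \<tau> \<otimes>\<^bsub>Sym_group i\<^esub> \<phi> \<tau>'"
      unfolding gal_group_mult[OF M.M t] hom[OF t] by (simp add: Sym_group_def)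
  qed
  have equi: "\<phi> (\<sigma> \<otimes>\<^bsub>gal_group M \<rat>\<^esub> \<tau> \<otimes>\<^bsub>gal_group M \<rat>\<^esub> inv\<^bsub>gal_group M \<rat>\<^esub> \<sigma>) = A_act N j (restrict \<sigma> L) (\<phi> \<tau>)"
    if \<sigma>: "\<sigma> \<in> Gal M \<rat>" and \<tau>: "\<tau> \<in> Gal M L" for \<sigma> \<tau>
  proof -
    obtain \<rho> where \<rho>: "\<rho> \<in> Gal M \<rat>" "\<And>x. x \<in> M \<Longrightarrow> \<sigma> (\<rho> x) = x" "\<And>x. x \<in> M \<Longrightarrow> \<rho> (\<sigma> x) = x"
      by (rule Gal_inverse[OF M.M M.Rats_M \<sigma>]) blast
    have inv: "inv\<^bsub>gal_group M \<rat>\<^esub> \<sigma> = \<rho>" by (rule gal_group_inv[OF M.M M.Rats_M \<sigma> \<rho>(1,3)])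
    have \<tau>Q: "\<tau> \<in> Gal M \<rat>" by (rule Gal_Rats[OF M.M \<tau>])
    have \<sigma>\<tau>: "compose M \<sigma> \<tau> \<in> Gal M \<rat>" by (rule Gal_compose[OF M.M M.Rats_M \<sigma> \<tau>Q])
    have prod: "\<sigma> \<otimes>\<^bsub>gal_group M \<rat>\<^esub> \<tau> \<otimes>\<^bsub>gal_group M \<rat>\<^esub> inv\<^bsub>gal_group M \<rat>\<^esub> \<sigma> = compose M (compose M \<sigma> \<tau>) \<rho>"
      unfolding inv gal_group_mult[OF M.M \<sigma> \<tau>Q] by (rule gal_group_mult[OF M.M \<sigma>\<tau> \<rho>(1)])
    obtain s where s: "s \<in> G_Q" "\<And>x. x \<in> M \<Longrightarrow> s x = \<sigma> x" by (rule Gal_lift[OF M.M M.M_Qbar M.Rats_M \<sigma>]) blast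
    obtain t where t: "t \<in> G_Q" "\<And>x. x \<in> Qbar \<Longrightarrow> s (t x) = x" "\<And>x. x \<in> Qbar \<Longrightarrow> t (s x) = x" by (rule G_Q_inverse[OF s(1)]) blast
    have tr: "t x = \<rho> x" if x: "x \<in> M" for x
    proof -
      have "s (\<rho> x) = x" using s(2)[OF M.G_rules(4)[OF \<rho>(1) x]] \<rho>(2)[OF x] by simp
      thus ?thesis using t(3)[of "\<rho> x"] M.G_rules(4)[OF \<rho>(1) x] M.M_Qbar by force
    qed
    define w where "w = compose Qbar s (compose Qbar (lift \<tau>) t)"
    note cj = cocycle_conj[OF cc s(1) t(1,2) lift(1)[OF \<tau>], folded w_def]
    have wM: "w x = compose M (compose M \<sigma> \<tau>) \<rho> x" if x: "x \<in> M" for x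
    proof -
      have r: "\<rho> x \<in> M" by (rule M.G_rules(4)[OF \<rho>(1) x])
      have r': "\<tau> (\<rho> x) \<in> M" by (rule M.G_rules(4)[OF \<tau> r])
      have xQ: "x \<in> Qbar" using x M.M_Qbar by blast
      have "w x = s (lift \<tau> (t x))" using GQ_rules(4)[OF t(1) xQ] xQ by (simp add: w_def compose_def)
      thus ?thesis using tr[OF x] lift(2)[OF \<tau> r] s(2)[OF r'] r x by (simp add: compose_def)
    qed
    have "compose M (compose M \<sigma> \<tau>) \<rho> = restrict w M" by (rule ext) (auto simp: wM compose_def)
    hence mem: "compose M (compose M \<sigma> \<tau>) \<rho> \<in> Gal M L" using normal_restrict[OF M.normal LM cj(1)] by simp
    have "\<phi> (compose M (compose M \<sigma> \<tau>) \<rho>) = c w" by (rule \<phi>[OF mem GalL_G[OF cj(1)] wM])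
    also have "\<dots> = act j s (\<phi> \<tau>)" using cj(2) by (simp add: \<phi>_def)
    also have "\<dots> = act j (restrict \<sigma> L) (\<phi> \<tau>)"
      using char_cong[of s "restrict \<sigma> L"] s(2) LM by (intro act_cong) auto
    finally show ?thesis unfolding prod .
  qed
  have g1: "galois_extension L M" by (rule normal_galois_extension[OF M.normal L_field LM])
  have g2: "galois_extension \<rat> M" by (rule normal_galois_extension[OF M.normal _ M.Rats_M]) (use csubfield_Rats in simp)
  show ?thesis unfolding A_extension_def Let_def M_def[symmetric] p_card[symmetric] using g1 g2 iso equi by blast
qed

text \<open>Neither a coboundary nor a nonzero factor changes the kernel on
  \<open>G_L\<close>.\<close>

lemma class_field_line:
  assumes c: "c \<in> cocycles i j" and d: "d \<in> cocycles i j" and e: "line (cls i j c) = line (cls i j d)"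
  shows "class_field c = class_field d"
proof -
  have "cls i j c \<in> line (cls i j d)" using line_self[OF c] e by simp
  then obtain a where a: "a \<noteq> 0" "cls i j c = cls i j (scal a d)" unfolding line_cls[OF d] by blast
  hence "c \<in> cls i j (scal a d)" using cls_self[OF c] by simp
  hence ca: "c s = scale a (d s)" if "s \<in> G_L" for s
    using cohomologous_GalL[OF _ that] unfolding cls_mem scal_def by metis
  have "ker_GalL c = ker_GalL d" using ca a(1) by (auto simp: ker_GalL_def)
  thus ?thesis by (simp add: class_field_def)
qed

text \<open>Equal kernels make \<open>c\<close> factor through \<open>d\<close> on
  \<open>G_L\<close>; the factor is an equivariant endomorphism of the module, hence a scalar, and
  agreement on \<open>G_L\<close> determines the class.\<close>

lemma line_class_field:
  assumes i: "i < p - 1" and j: "\<not> [j = 1] (mod (int p - 1))"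
    and c: "c \<in> cocycles i j" "c ` G_L = A i" and d: "d \<in> cocycles i j" "d ` G_L = A i"
    and e: "class_field c = class_field d"
  shows "line (cls i j c) = line (cls i j d)"
proof -
  note cc = cocycles_cocycle[OF c(1)] and dd = cocycles_cocycle[OF d(1)]
  have well: "c s = c t" if "s \<in> G_L" "t \<in> G_L" "d s = d t" for s t
    using class_field_agree[OF c(1) GalL_G[OF that(1)] GalL_G[OF that(2)]] class_field_agree_iff[OF d(1) that] e by simp
  \<comment> \<open>An arbitrary preimage under \<open>d\<close>; by \<open>well\<close> the value
    does not depend on the choice.\<close>
  define \<alpha> where "\<alpha> = (\<lambda>f. c (SOME s. s \<in> G_L \<and> d s = f))"
  have \<alpha>: "\<alpha> (d s) = c s" if s: "s \<in> G_L" for s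
  proof -
    have "(SOME t. t \<in> G_L \<and> d t = d s) \<in> G_L \<and> d (SOME t. t \<in> G_L \<and> d t = d s) = d s"
      by (rule someI[of _ s]) (use s in simp)
    thus ?thesis unfolding \<alpha>_def using well[OF _ s] by blast
  qed
  obtain a where a: "\<And>f. f \<in> A i \<Longrightarrow> \<alpha> f = scale a f"
  proof (rule equivariant_scalar[OF i, of \<alpha> j])
    fix f assume "f \<in> A i"
    then obtain u where u: "u \<in> G_L" "f = d u" using d(2) by blast
    show "\<alpha> f \<in> A i" using \<alpha>[OF u(1)] u(2) cocycle_rules(1)[OF cc GalL_G[OF u(1)]] by simp
    show "\<alpha> (f + g) = \<alpha> f + \<alpha> g" if "g \<in> A i" for g
    proof -
      obtain v where v: "v \<in> G_L" "g = d v" using \<open>g \<in> A i\<close> d(2) by blast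
      have "\<alpha> (d (compose Qbar u v)) = c (compose Qbar u v)" by (rule \<alpha>[OF Gal_compose[OF Qbar_field L_Qbar u(1) v(1)]])
      thus ?thesis unfolding cocycle_GalL[OF cc u(1) v(1)] cocycle_GalL[OF dd u(1) v(1)] u(2) v(2) \<alpha>[OF u(1)] \<alpha>[OF v(1)] .
    qed
    show "\<alpha> (act j s f) = act j s (\<alpha> f)" if s: "s \<in> G_Q" for s
    proof -
      obtain t where t: "t \<in> G_Q" "\<And>x. x \<in> Qbar \<Longrightarrow> s (t x) = x" by (rule G_Q_inverse[OF s]) blast
      show ?thesis
        using \<alpha>[OF cocycle_conj(1)[OF cc s t u(1)]] cocycle_conj(2)[OF cc s t u(1)] cocycle_conj(2)[OF dd s t u(1)] \<alpha>[OF u(1)] u(2) by simp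
    qed
  qed blast
  have ca: "c s = scal a d s" if s: "s \<in> G_L" for s
    using a[of "d s"] \<alpha>[OF s] imageI[OF s, of d] unfolding d(2) scal_def by simp
  have a0: "a \<noteq> 0"
  proof
    assume "a = 0"
    hence z: "c s = 0" if "s \<in> G_L" for s using ca[OF that] by (simp add: scal_def)
    obtain f where f: "f \<in> A i" "top_coeff i f = 1" by (rule exists_top)
    hence "f \<in> c ` G_L" using c(2) by simp
    hence "f = 0" using z by auto
    thus False using f(2) by (simp add: top_coeff_linear)
  qed
  have "i < p" using i by simp
  hence "(c, scal a d) \<in> coh i j" by (rule cohomologousI_GalL[OF _ j c(1) scal_cocycles[OF d(1)] ca])
  thus ?thesis using cls_eq line_eqI[OF d(1) a0] by metis
qed

end

section \<open>The field of a Selmer class is unramified\<close>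

lemma zeta_factorization:
  assumes n: "n > 1" shows "x ^ n - y ^ n = (\<Prod>k<n. x - zeta n ^ k * y)"
proof (cases "y = 0")
  case True
  thus ?thesis using n by simp
next
  case False
  have "(\<Prod>k<n. x / y - zeta n ^ k) = (x / y) ^ n - 1"
    using arg_cong[OF prod_zeta[OF n], of "\<lambda>q. poly q (x / y)"] by (simp add: poly_prod poly_monom)
  hence "y ^ n * (\<Prod>k<n. x / y - zeta n ^ k) = x ^ n - y ^ n" using False by (simp add: field_simps)
  moreover have "y ^ n * (\<Prod>k<n. x / y - zeta n ^ k) = (\<Prod>k<n. y * (x / y - zeta n ^ k))" by (simp add: prod.distrib)
  moreover have "y * (x / y - zeta n ^ k) = x - zeta n ^ k * y" for k using False by (simp add: field_simps)
  ultimately show ?thesis by simp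
qed

context number_field_prime
begin

lemma inertia_Dv2:
  assumes w: "uniformizer w" and g: "g \<in> Gal M \<rat>" and inert: "\<And>x. x \<in> \<O> \<Longrightarrow> g x - x \<in> P" and x: "x \<in> Dv w 2"
  shows "g x \<in> Dv w 2"
proof -
  note ch = chom_rules[OF G_rules(2)[OF g] M_ring]
  have gO: "g x \<in> \<O>" if "x \<in> \<O>" for x by (rule G_O[OF g that])
  have wO: "w \<in> \<O>" using w P_rules(1) by (simp add: uniformizer_def)
  have xO: "x \<in> \<O>" by (rule Dv_O[OF x])
  obtain s y where s: "s \<in> \<O> - P" "y \<in> \<O>" "s * x = w ^ 2 * y" by (rule DvE[OF x])
  have "g (s * x) = g s * g x" using s xO by (intro ch(3)) auto
  moreover have "g (w ^ 2 * y) = g w * g w * g y"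
    using ch(3)[of w w] ch(3)[of "w * w" y] s wO O_rules(3)[OF wO wO] by (simp add: power2_eq_square)
  ultimately have "g s * g x = g w * g w * g y" using s(3) by simp
  moreover have "g w * g w \<in> Dv w (1 + 1)"
    using inertia_stable[OF inert] w Dv_1[OF w] by (intro Dv_mult) (auto simp: uniformizer_def)
  ultimately have "g s * g x \<in> Dv w 2" using Dv_times(1)[of "g w * g w" w 2 "g y"] gO[OF s(2)] by (simp add: numeral_2_eq_2)
  moreover have "g s \<in> \<O> - P"
  proof -
    have "s + (g s - s) \<in> \<O> - P" by (rule not_P_add[OF s(1)]) (use inert s(1) in auto)
    thus ?thesis by simp
  qed
  ultimately show ?thesis using Dv_cancel gO[OF xO] by blast
qed

text \<open>To first order \<open>g w\<close> is \<open>(y / u) * w\<close>. Inertia fixes the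
  coefficients modulo \<open>P\<close>, so the \<open>n\<close>-th iterate multiplies by
  \<open>(y / u) ^ n\<close>, which must be 1 modulo \<open>P\<close>; factoring
  \<open>y ^ n - u ^ n\<close> makes \<open>y\<close> congruent to a root of unity times
  \<open>u\<close>.\<close>

lemma tame_character:
  assumes w: "uniformizer w" and g: "g \<in> Gal M \<rat>" and inert: "\<And>x. x \<in> \<O> \<Longrightarrow> g x - x \<in> P"
    and n: "n > 1" "zeta n \<in> M" "\<And>x. x \<in> M \<Longrightarrow> (g ^^ n) x = x"
  obtains k where "g w - zeta n ^ k * w \<in> Dv w 2"
proof -
  note ch = chom_rules[OF G_rules(2)[OF g] M_ring]
  have gO: "g x \<in> \<O>" if "x \<in> \<O>" for x by (rule G_O[OF g that])
  have wP: "w \<in> P" and wO: "w \<in> \<O>" using w P_rules(1) by (simp_all add: uniformizer_def)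
  have D1: "x \<in> Dv w 1" if "x \<in> P" for x using Dv_1[OF w] that by simp
  have D2: "x * y \<in> Dv w 2" if "x \<in> P" "y \<in> P" for x y using Dv_mult[OF D1 D1] that by (simp add: numeral_2_eq_2)
  obtain u where u: "u \<in> \<O> - P" "\<forall>x\<in>P. \<exists>y\<in>\<O>. u * x = w * y" using w unfolding uniformizer_def by blast
  have gP: "(g ^^ m) w \<in> P" for m by (induction m) (use inertia_stable[OF inert] wP in auto)
  obtain y where y: "y \<in> \<O>" "u * g w = w * y" using u(2) gP[of 1] by auto
  have uO: "u \<in> \<O>" using u(1) by blast
  \<comment> \<open>The first-order formula for the iterates, with denominators cleared.\<close>
  have iter: "u ^ m * (g ^^ m) w - y ^ m * w \<in> Dv w 2" for m
  proof (induction m)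
    case 0
    have "0 \<in> Dv w 2" using DvI[of 0 1 0] O_rules(4) one_not_P by simp
    thus ?case by simp
  next
    case (Suc m)
    let ?v = "(g ^^ m) w"
    have vO: "?v \<in> \<O>" using gP P_rules(1) by blast
    have gv: "g ?v \<in> P" using gP[of "Suc m"] by simp
    have e: "g (u ^ m * ?v - y ^ m * w) = g (u ^ m) * g ?v - g (y ^ m) * g w"
      using ch(3)[of "u ^ m" ?v] ch(3)[of "y ^ m" w] ch(6)[of "u ^ m * ?v" "y ^ m * w"] vO wO
        O_rules(7)[OF uO, of m] O_rules(7)[OF y(1), of m] O_rules(3)[of "u ^ m" ?v] O_rules(3)[of "y ^ m" w] by auto
    have d1: "g (u ^ m) * g ?v - g (y ^ m) * g w \<in> Dv w 2" unfolding e[symmetric] by (rule inertia_Dv2[OF w g inert Suc.IH])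
    have d2: "(g (u ^ m) - u ^ m) * g ?v \<in> Dv w 2" by (rule D2[OF inert[OF O_rules(7)[OF uO]] gv])
    have d3: "(g (y ^ m) - y ^ m) * g w \<in> Dv w 2" by (rule D2[OF inert[OF O_rules(7)[OF y(1)]]]) (use gP[of 1] in simp)
    have "(g (u ^ m) * g ?v - g (y ^ m) * g w) - (g (u ^ m) - u ^ m) * g ?v + (g (y ^ m) - y ^ m) * g w = u ^ m * g ?v - y ^ m * g w"
      by (simp add: algebra_simps)
    hence "u * (u ^ m * g ?v - y ^ m * g w) \<in> Dv w 2" using Dv_times(2)[OF Dv_add[OF Dv_diff[OF d1 d2] d3] uO] by simp
    moreover have "u * (u ^ m * g ?v - y ^ m * g w) = u ^ Suc m * (g ^^ Suc m) w - y ^ m * (u * g w)" by (simp add: algebra_simps)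
    moreover have "y ^ m * (u * g w) = y ^ Suc m * w" unfolding y(2) by simp
    ultimately show ?case by simp
  qed
  have "u ^ n * w - y ^ n * w \<in> Dv w 2" using iter[of n] n(3)[of w] wO by simp
  moreover have "y ^ n * w - u ^ n * w = - (u ^ n * w - y ^ n * w)" by simp
  ultimately have "y ^ n * w - u ^ n * w \<in> Dv w 2" using Dv_minus by metis
  hence "w ^ 1 * (y ^ n - u ^ n) \<in> Dv w (Suc 1)" by (simp add: algebra_simps numeral_2_eq_2)
  hence "y ^ n - u ^ n \<in> P"
    by (rule Dv_Suc_cancel[OF w uniformizer_nonzero[OF w]]) (use O_rules(2)[OF O_rules(7)[OF y(1)] O_rules(7)[OF uO]] in simp)
  hence pr: "(\<Prod>k<n. y - zeta n ^ k * u) \<in> P" unfolding zeta_factorization[OF n(1)] .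
  have zO: "zeta n ^ k \<in> \<O>" for k by (rule O_rules(7)) (use n zeta_Zbar in auto)
  have "\<exists>k\<in>{..<n}. y - zeta n ^ k * u \<in> P"
    by (rule prime_in_prod[OF prime O_ring _ _ pr]) (use O_rules(2)[OF y(1) O_rules(3)[OF zO uO]] in auto)
  then obtain k where k: "y - zeta n ^ k * u \<in> P" by blast
  have "u * (g w - zeta n ^ k * w) = w * (y - zeta n ^ k * u)" using y(2) by (simp add: algebra_simps)
  hence "u * (g w - zeta n ^ k * w) \<in> Dv w 2" using D2[OF wP k] by simp
  hence "g w - zeta n ^ k * w \<in> Dv w 2"
    by (rule Dv_cancel[OF _ u(1)]) (rule O_rules(2)[OF gO[OF wO] O_rules(3)[OF zO wO]])
  thus ?thesis by (rule that)
qed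

end

context kummer
begin

text \<open>
  On polynomials of degree \<open>i < p - 1\<close> a translation \<open>T\<close> satisfies \<open>1 + T + \<dots> + T\<^sup>p\<^sup>-\<^sup>1 = (T - 1)\<^sup>p\<^sup>-\<^sup>1 = 0\<close>.
\<close>

lemma cocycle_gpow_p:
  assumes c: "cocycle i j c" and i: "i < p - 1" and s: "s \<in> G_Q" "chi s = 1"
  shows "c (gpow s p) = 0"
proof (cases "kb s = 0")
  case True
  hence sL: "s \<in> G_L" using s Gal_L_iff by blast
  have "c (gpow s k) = of_nat k * c s" for k
  proof (induction k)
    case 0
    show ?case unfolding gpow_simps(1) cocycle_id[OF c] by simp
  next
    case (Suc k)
    have "act j s (c (gpow s k)) = c (gpow s k)" by (rule act_L[OF cocycle_rules(1)[OF c gpow_G[OF s(1)]] sL])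
    thus ?case using Suc cocycle_rules(2)[OF c s(1) gpow_G[OF s(1)], of k] by (simp add: gpow_simps(2) algebra_simps)
  qed
  moreover have "(of_nat p :: 'p mod_ring poly poly) = 0"
  proof -
    have "(of_nat p :: 'p mod_ring) = 0" by (simp add: of_nat_0_mod_ring_dvd p_card)
    thus ?thesis by (simp only: of_nat_poly pCons_0_0)
  qed
  ultimately show ?thesis by simp
next
  case False
  define b where "b = kb s"
  have b: "b \<noteq> 0" using False by (simp add: b_def)
  define v where "v = dehom (c s)"
  have cs: "c s \<in> A i" by (rule cocycle_rules(1)[OF c s(1)])
  \<comment> \<open>Rescaling the variable by \<open>b\<close> turns translation by \<open>b\<close>
    into translation by 1. The polynomial \<open>a'\<close> has degree at most \<open>i + 1\<close>,
    which must stay below \<open>p\<close>.\<close>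
  define v' where "v' = pcompose v [:0, b:]"
  have "degree v \<le> i" using dehom_bound[OF cs] by (intro degree_le) (auto simp: v_def)
  hence dv': "degree v' \<le> i" by (simp add: v'_def degree_pcompose b)
  have "\<exists>a. (\<forall>k>Suc i. coeff a k = 0) \<and> shiftd a = v'"
  proof (rule shiftd_surj)
    show "Suc i < CARD('p)" using i p_card by simp
    show "coeff v' k = 0" if "k \<ge> Suc i" for k using dv' that by (intro coeff_eq_0) simp
  qed
  then obtain a' where a': "shiftd a' = v'" by blast
  define a where "a = pcompose a' [:0, 1 / b:]"
  have sh: "pcompose a [:b, 1:] - a = v"
  proof -
    have "pcompose a [:b, 1:] = pcompose a' (pcompose [:0, 1 / b:] [:b, 1:])" unfolding a_def by (rule pcompose_assoc[symmetric])
    also have "pcompose [:0, 1 / b:] [:b, 1:] = pcompose [:1, 1:] [:0, 1 / b:]" using b by (simp add: pcompose_pCons)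
    also have "pcompose a' (pcompose [:1, 1:] [:0, 1 / b:]) = pcompose (pcompose a' [:1, 1:]) [:0, 1 / b:]" by (rule pcompose_assoc)
    finally have "pcompose a [:b, 1:] - a = pcompose (shiftd a') [:0, 1 / b:]" by (simp add: a_def shiftd_def pcompose_diff)
    also have "\<dots> = pcompose v (pcompose [:0, b:] [:0, 1 / b:])" unfolding a' v'_def by (rule pcompose_assoc[symmetric])
    also have "pcompose [:0, b:] [:0, 1 / b:] = [:0, 1:]" using b by (simp add: pcompose_pCons)
    finally show ?thesis by (simp add: pcompose_idR)
  qed
  \<comment> \<open>With \<open>v\<close> written as a difference of \<open>a\<close>, the cocycle
    on powers of \<open>s\<close> telescopes; at \<open>k = p\<close> the translation is by
    0.\<close>
  have "dehom (c (gpow s k)) = pcompose a [:of_nat k * b, 1:] - a" for k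
  proof (induction k)
    case 0
    show ?case unfolding gpow_simps(1) cocycle_id[OF c] by (simp add: dehom_0 pcompose_idR)
  next
    case (Suc k)
    have m: "c (gpow s k) \<in> A i" by (rule cocycle_rules(1)[OF c gpow_G[OF s(1)]])
    have "dehom (c (gpow s (Suc k))) = v + pcompose (pcompose a [:of_nat k * b, 1:] - a) [:b, 1:]"
      unfolding gpow_simps(2) cocycle_rules(2)[OF c s(1) gpow_G[OF s(1)]] dehom_add dehom_act[OF m s(1)] Suc v_def[symmetric]
      by (simp add: s(2) b_def[symmetric])
    also have "\<dots> = v - pcompose a [:b, 1:] + pcompose a (pcompose [:of_nat k * b, 1:] [:b, 1:])"
      unfolding pcompose_diff pcompose_assoc by (simp only: algebra_simps)
    also have "pcompose [:of_nat k * b, 1:] [:b, 1:] = [:of_nat (Suc k) * b, 1:]" by (simp add: pcompose_pCons algebra_simps)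
    finally show ?case using sh by (simp add: algebra_simps)
  qed
  from this[of p] have "dehom (c (gpow s p)) = 0" by (simp add: p_card of_nat_0_mod_ring_dvd pcompose_idR)
  thus ?thesis by (intro dehom_inj[OF cocycle_rules(1)[OF c gpow_G[OF s(1)]] Sym_closed(1)]) (simp add: dehom_0)
qed

lemma gpow_restrict:
  assumes M: "normal_field M" and s: "s \<in> G_Q" and x: "x \<in> M"
  shows "(restrict s M ^^ k) x = gpow s k x \<and> gpow s k x \<in> M"
proof (induction k)
  case 0
  thus ?case unfolding gpow_simps(1) using x M by (auto simp: normal_field_def)
next
  case (Suc k)
  have a: "gpow s k x \<in> M" and b: "(restrict s M ^^ k) x = gpow s k x" using Suc by blast+
  have "x \<in> Qbar" "s ` M \<subseteq> M" using x M s by (auto simp: normal_field_def)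
  hence "gpow s (Suc k) x = s (gpow s k x)" "s (gpow s k x) \<in> M" using a by (auto simp: gpow_simps(2) compose_def)
  moreover have "(restrict s M ^^ Suc k) x = s (gpow s k x)"
    unfolding funpow.simps comp_apply b using a by (rule restrict_apply')
  ultimately show ?case by (simp only:)
qed

lemma inertial_restrict:
  assumes M: "normal_field M" and s: "s \<in> G_Q" "inertial PP s" and x: "x \<in> M \<inter> Zbar"
  shows "restrict s M x - x \<in> PP \<inter> M"
proof -
  have "s x \<in> M" using M s(1) x by (auto simp: normal_field_def)
  hence "s x - x \<in> M" using x M csubring_rules(2)[OF csubfield_csubring] by (auto simp: normal_field_def)
  thus ?thesis using s(2) x by (auto simp: inertial_def)
qed

text \<open>On inertia inside the kernel of \<open>chi\<close>, a trivial tame character means a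
  trivial action on \<open>M\<close>. The inertial element \<open>t\<close> with
  \<open>kb t = 1\<close> therefore has a nontrivial character, and a suitable
  \<open>s * t ^ m\<close> has a trivial one; reading off \<open>kb\<close> shows that
  \<open>m\<close> is 0 modulo \<open>p\<close>, so the character of \<open>s\<close> was trivial
  already.\<close>

lemma class_field_tame:
  assumes c: "c \<in> cocycles i j" and i: "i < p - 1"
    and PP: "prime_in Zbar PP" "of_nat N \<in> PP" and s: "s \<in> G_L" "inertial PP s"
  shows "c s = 0"
proof -
  note cc = cocycles_cocycle[OF c]
  define M where "M = class_field c"
  interpret galois_number_field M unfolding M_def by (rule class_field_rules(1)[OF c])
  have LM: "L \<subseteq> M" unfolding M_def by (rule class_field_rules(3)[OF c])
  define P where "P = PP \<inter> M"
  have NP: "of_nat N \<in> P" using PP(2) csubring_of_nat[OF M_ring] by (auto simp: P_def)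
  interpret number_field_prime M P
  proof
    show "prime_in \<O> P" unfolding P_def by (rule prime_in_restrict[OF PP(1) M])
    show "P \<noteq> {0}" using NP N_pos by auto
  qed
  have pP: "of_nat p \<notin> P" by (rule distinct_primes_not_mem[OF prime O_ring prime_N prime_p N_ne_p NP])
  obtain w where w: "uniformizer w" by (rule uniformizer_exists)
  have wP: "w \<in> P" and wO: "w \<in> \<O>" using w P_rules(1) by (simp_all add: uniformizer_def)
  have zO: "zp a \<in> \<O>" for a using zp_Zbar zp_mem[OF M_ring] LM L_mem by blast
  have ker: "g \<in> G_L \<and> c g = 0" if "g \<in> G_Q" "restrict g M = idM" for g
  proof -
    have "g x = x" if "x \<in> M" for x using \<open>restrict g M = idM\<close> that by (metis restrict_apply')
    hence "g \<in> Gal Qbar M" using Gal_Qbar_iff[OF Rats_M] that(1) by blast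
    thus ?thesis using class_field_rules(2)[OF c] by (simp add: M_def ker_GalL_def)
  qed
  \<comment> \<open>The \<open>p\<close>-th power of \<open>g\<close> lies in \<open>G_L\<close>,
    since \<open>kb\<close> is multiplied by \<open>p = 0\<close>, and \<open>c\<close> kills it by
    \<open>cocycle_gpow_p\<close>.\<close>
  have per: "(restrict g M ^^ p) x = x" if g: "g \<in> G_Q" "chi g = 1" and x: "x \<in> M" for g x
  proof -
    have "kb (gpow g p) = of_nat p * kb g" "chi (gpow g p) = 1" using char_gpow[OF g] by auto
    moreover have "(of_nat p :: 'p mod_ring) = 0" by (simp add: of_nat_0_mod_ring_dvd p_card)
    ultimately have "gpow g p \<in> G_L" using Gal_L_iff gpow_G[OF g(1)] by simp
    hence "gpow g p \<in> ker_GalL c" using cocycle_gpow_p[OF cc i g] by (simp add: ker_GalL_def)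
    hence "gpow g p x = x" using x by (simp add: M_def class_field_def)
    thus ?thesis using gpow_restrict[OF normal g(1) x] by simp
  qed
  have res: "restrict g M \<in> Gal M \<rat>" if "g \<in> G_Q" for g by (rule normal_restrict[OF normal Rats_M that])
  have inert: "restrict g M x - x \<in> P" if "g \<in> G_Q" "inertial PP g" "x \<in> \<O>" for g x
    unfolding P_def by (rule inertial_restrict[OF normal that])
  have tc: "\<exists>a. g w - zp a * w \<in> Dv w 2" if g: "g \<in> G_Q" "inertial PP g" "chi g = 1" for g
  proof -
    obtain k where "restrict g M w - zeta p ^ k * w \<in> Dv w 2"
      by (rule tame_character[OF w res[OF g(1)] inert[OF g(1,2)] p_pos(1) subsetD[OF LM L_mem(1)] per[OF g(1,3)]])
    thus ?thesis using wO by (auto simp: zp_of_nat[symmetric])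
  qed
  have triv: "c g = 0 \<and> kb g = 0" if g: "g \<in> G_Q" "inertial PP g" "chi g = 1" "g w - w \<in> Dv w 2" for g
  proof -
    have "restrict g M = idM"
      by (rule tame_inertia_trivial[OF w res[OF g(1)] inert[OF g(1,2)] _ pP per[OF g(1,3)]]) (use g(4) wO in auto)
    thus ?thesis using ker[OF g(1)] Gal_L_iff by auto
  qed
  obtain t where t: "t \<in> G_Q" "\<And>x. x \<in> Zbar \<Longrightarrow> t x - x \<in> PP" "chi t = 1" "kb t = 1" by (rule inertia_at_N[OF PP]) blast
  have ti: "inertial PP t" using t(2) by (simp add: inertial_def)
  have sG: "s \<in> G_Q" "chi s = 1" "kb s = 0" using s(1) Gal_L_iff by auto
  obtain k where k: "s w - zp k * w \<in> Dv w 2" using tc[OF sG(1) s(2) sG(2)] by blast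
  obtain l where l: "t w - zp l * w \<in> Dv w 2" using tc[OF t(1) ti t(3)] by blast
  have "l \<noteq> 0"
  proof
    assume "l = 0"
    hence "t w - w \<in> Dv w 2" using l by (simp add: zp_0)
    thus False using triv[OF t(1) ti t(3)] t(4) by simp
  qed
  \<comment> \<open>The exponent for which the tame characters of \<open>s\<close> and of
    \<open>t ^ m\<close> cancel.\<close>
  obtain m where m: "- k / l = of_nat m" by (rule of_nat_cases)
  have comp: "g (h w) - zp (a + b) * w \<in> Dv w 2"
    if g: "g \<in> G_Q" "inertial PP g" "chi g = 1" "g w - zp a * w \<in> Dv w 2" and h: "h w - zp b * w \<in> Dv w 2" "h w \<in> M" for g h a b
  proof -
    have gr: "restrict g M x = g x" if "x \<in> M" for x using that by simp
    note ch = chom_rules[OF GQ_rules(2)[OF g(1)] Q_ring]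
    have Q: "w \<in> Qbar" "zp b \<in> Qbar" "h w \<in> Qbar" using wO zO[of b] h(2) M_Qbar by auto
    have mem: "h w - zp b * w \<in> M" using Dv_O[OF h(1)] by blast
    have "g (h w - zp b * w) \<in> Dv w 2" using inertia_Dv2[OF w res[OF g(1)] inert[OF g(1,2)] h(1)] mem by simp
    moreover have "g (h w - zp b * w) = g (h w) - zp b * g w"
    proof -
      have "g (zp b) = zp b" using char_action(3)[OF GQ_rules(2)[OF g(1)] Q_ring Qbar_mem, of b] g(3) by simp
      thus ?thesis using ch(6)[OF Q(3)] ch(3)[OF Q(2,1)] csubring_rules(3)[OF Q_ring Q(2,1)] by simp
    qed
    moreover have "zp b * (g w - zp a * w) \<in> Dv w 2" by (rule Dv_times(2)[OF g(4) zO])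
    ultimately have "(g (h w) - zp b * g w) + zp b * (g w - zp a * w) \<in> Dv w 2" using Dv_add by metis
    thus ?thesis by (simp add: zp_add algebra_simps)
  qed
  have pw: "gpow t r w - zp (of_nat r * l) * w \<in> Dv w 2" for r
  proof (induction r)
    case 0
    have "0 \<in> Dv w 2" using DvI[of 0 1 0] O_rules(4) one_not_P by simp
    thus ?case unfolding gpow_simps(1) using wO M_Qbar by (auto simp: zp_0)
  next
    case (Suc r)
    have "t (gpow t r w) - zp (l + of_nat r * l) * w \<in> Dv w 2"
      by (rule comp[where h = "gpow t r", OF t(1) ti t(3) l Suc]) (use gpow_restrict[OF normal t(1)] wO in blast)
    thus ?case unfolding gpow_simps(2) using wO M_Qbar by (auto simp: compose_def algebra_simps)
  qed
  define g where "g = compose Qbar s (gpow t m)"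
  have gt: "gpow t m \<in> G_Q" "chi (gpow t m) = 1" "kb (gpow t m) = of_nat m" using gpow_G[OF t(1)] char_gpow[OF t(1,3)] t(4) by auto
  have gG: "g \<in> G_Q" unfolding g_def by (rule GQ_compose[OF sG(1) gt(1)])
  have gc: "chi g = 1" "kb g = of_nat m" using char_compose[OF sG(1) gt(1)] gt sG by (auto simp: g_def)
  have gi: "inertial PP g" unfolding inertial_def
  proof
    fix x assume x: "x \<in> Zbar"
    have gx: "gpow t m x \<in> Zbar" "gpow t m x - x \<in> PP" using gpow_inertia[OF PP(1) t(1,2) x] by auto
    have "s (gpow t m x) - gpow t m x \<in> PP" using s(2) gx(1) by (simp add: inertial_def)
    hence "(s (gpow t m x) - gpow t m x) + (gpow t m x - x) \<in> PP" using prime_in_rules(3)[OF PP(1) csubring_Zbar _ gx(2)] by blast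
    thus "g x - x \<in> PP" using x Zbar_subset_Qbar by (auto simp: g_def compose_def)
  qed
  have "s (gpow t m w) - zp (k + of_nat m * l) * w \<in> Dv w 2"
    by (rule comp[where h = "gpow t m", OF sG(1) s(2) sG(2) k pw]) (use gpow_restrict[OF normal t(1)] wO in blast)
  moreover have "k + of_nat m * l = 0" using m \<open>l \<noteq> 0\<close> by (simp add: m[symmetric])
  ultimately have "g w - w \<in> Dv w 2" using wO M_Qbar by (auto simp: g_def compose_def zp_0)
  \<comment> \<open>Since \<open>kb g\<close> is the class of \<open>m\<close>, which is
    \<open>- k / l\<close>, this forces \<open>k = 0\<close>.\<close>
  hence "kb g = 0" using triv[OF gG gi gc(1)] by blast
  hence "k = 0" using gc(2) m \<open>l \<noteq> 0\<close> by simp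
  hence "s w - w \<in> Dv w 2" using k by (simp add: zp_0)
  thus ?thesis using triv[OF sG(1) s(2) sG(2)] by blast
qed

text \<open>An inertial element of \<open>Gal M L\<close> lifts to an inertial element of
  \<open>G_L\<close>. There \<open>c\<close> vanishes, at \<open>N\<close> by
  \<open>class_field_tame\<close> and elsewhere by \<open>unram\<close>, so the element is trivial
  on \<open>M\<close>.\<close>

lemma class_field_unramified:
  assumes c: "c \<in> cocycles i j" and un: "unram c" and i: "i < p - 1"
  shows "unramified_extension L (class_field c)"
proof -
  define M where "M = class_field c"
  interpret galois_number_field M unfolding M_def by (rule class_field_rules(1)[OF c])
  have LM: "L \<subseteq> M" unfolding M_def by (rule class_field_rules(3)[OF c])
  have "\<not> P \<inter> L \<subseteq> ideal_prod (ring_of_integers M) P P" if P: "primeideal P (ring_of_integers M)" "P \<noteq> {0}" for P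
  proof -
    interpret number_field_prime M P by unfold_locales (use P primeideal_iff[OF O_ring] in auto)
    obtain w where w: "uniformizer w" by (rule uniformizer_exists)
    obtain l :: nat where l: "prime l" "of_nat l \<in> P" by (rule residue_characteristic)
    obtain PP where PP: "prime_in Zbar PP" "PP \<inter> M = P" by (rule place_above[OF l])
    have lPP: "of_nat l \<in> PP" "l \<noteq> 0" using l PP(2) prime_gt_0_nat by auto
    show ?thesis unfolding unramified_iff[OF w L_field LM]
    proof (intro ballI impI)
      fix g assume g: "g \<in> Gal M L" "\<forall>x\<in>\<O>. g x - x \<in> P"
      obtain s where s: "s \<in> G_L" "\<And>x. x \<in> M \<Longrightarrow> s x = g x" by (rule Gal_lift[OF M M_Qbar LM g(1)]) blast
      have sP: "s x - x \<in> PP" if "x \<in> \<O>" for x using g(2) s(2) that PP(2) by auto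
      obtain t where t: "t \<in> G_Q" "\<And>x. x \<in> M \<Longrightarrow> t x = s x" "\<And>x. x \<in> Zbar \<Longrightarrow> t x - x \<in> PP"
        by (rule inertia_lift[OF galois_number_field_axioms PP(1) lPP GalL_G[OF s(1)] sP]) blast+
      have tL: "t \<in> G_L" using Gal_Qbar_iff[OF Rats_L] t(1,2) Gal_rules(5)[OF Qbar_field s(1)] LM by auto
      have ti: "inertial PP t" using t(3) by (simp add: inertial_def)
      have "c t = 0"
      proof (cases "l = N")
        case True
        thus ?thesis using class_field_tame[OF c i PP(1) _ tL ti] lPP by simp
      next
        case False
        thus ?thesis using un l(1) PP(1) lPP(1) tL ti unfolding unram_def by blast
      qed
      hence "t \<in> ker_GalL c" using tL by (simp add: ker_GalL_def)
      hence "t x = x" if "x \<in> M" for x using that unfolding M_def class_field_def by blast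
      hence fx: "g x = x" if "x \<in> M" for x using t(2)[OF that] s(2)[OF that] that by metis
      show "g = idM" by (rule Gal_eqI[OF M g(1) idM[OF LM]]) (simp add: fx)
    qed
  qed
  thus ?thesis unfolding unramified_extension_def M_def[symmetric] by blast
qed

end

section \<open>The class of an unramified extension\<close>

text \<open>The extension hypothesis only makes \<open>Gal M L\<close> finite. Fibres of restriction
  to \<open>L\<close> are empty or contained in cosets of it, which bounds
  \<open>Gal M \<rat>\<close>.\<close>

lemma finite_Gal_tower:
  assumes M: "csubfield M" "M \<subseteq> Qbar" and L: "normal_field L" "L \<subseteq> M" "finite (Gal L \<rat>)" and fin: "finite (Gal M L)"
  shows "finite (Gal M \<rat>)"
proof -
  have RM: "\<rat> \<subseteq> M" by (rule Rats_subset_csubfield[OF M(1)])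
  have Lf: "csubfield L" using L(1) by (simp add: normal_field_def)
  have RL: "\<rat> \<subseteq> L" by (rule Rats_subset_csubfield[OF Lf])
  define fib where "fib r = {g \<in> Gal M \<rat>. restrict g L = r}" for r
  have "Gal M \<rat> \<subseteq> (\<Union>r\<in>Gal L \<rat>. fib r)"
  proof
    fix g assume g: "g \<in> Gal M \<rat>"
    obtain s where s: "s \<in> G_Q" "\<And>x. x \<in> M \<Longrightarrow> s x = g x" by (rule Gal_lift[OF M RM g]) blast
    have "restrict s L = restrict g L" using s(2) L(2) by (intro restrict_ext) auto
    hence "restrict g L \<in> Gal L \<rat>" using normal_restrict[OF L(1) RL s(1)] by simp
    thus "g \<in> (\<Union>r\<in>Gal L \<rat>. fib r)" using g by (auto simp: fib_def)
  qed
  moreover have "finite (fib r)" for r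
  proof (cases "fib r = {}")
    case False
    then obtain g where g: "g \<in> Gal M \<rat>" "restrict g L = r" by (auto simp: fib_def)
    obtain g' where g': "g' \<in> Gal M \<rat>" "\<And>x. x \<in> M \<Longrightarrow> g (g' x) = x" "\<And>x. x \<in> M \<Longrightarrow> g' (g x) = x"
      by (rule Gal_inverse[OF M(1) RM g(1)]) blast
    have "fib r \<subseteq> compose M g ` Gal M L"
    proof
      fix h assume "h \<in> fib r"
      hence h: "h \<in> Gal M \<rat>" "restrict h L = r" by (auto simp: fib_def)
      have hg: "h x = g x" if "x \<in> L" for x using h(2) g(2) that by (metis restrict_apply')
      have m: "compose M g' h \<in> Gal M \<rat>" by (rule Gal_compose[OF M(1) RM g'(1) h(1)])
      have "compose M g' h x = x" if "x \<in> L" for x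
      proof -
        have "x \<in> M" using that L(2) by blast
        thus ?thesis using hg[OF that] g'(3) by (simp add: compose_def)
      qed
      hence "compose M g' h \<in> Gal M L" using m by (simp add: Gal_iff[OF M(1)])
      moreover have "h = compose M g (compose M g' h)"
      proof (rule Gal_eqI[OF M(1) h(1) Gal_compose[OF M(1) RM g(1) m]])
        fix x assume x: "x \<in> M"
        thus "h x = compose M g (compose M g' h) x" using g'(2)[OF Gal_rules(4)[OF M(1) h(1) x]] by (simp add: compose_def)
      qed
      ultimately show "h \<in> compose M g ` Gal M L" by blast
    qed
    thus ?thesis using fin finite_surj by blast
  qed simp
  ultimately show ?thesis using L(3) by (meson finite_UN finite_subset)
qed

lemma finite_Sym: "finite (Sym i :: 'p::prime_card mod_ring poly poly set)"
proof -
  have "finite {xs :: 'p mod_ring list. set xs \<subseteq> UNIV \<and> length xs = Suc i}" by (rule finite_lists_length_eq) simp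
  moreover have "dehom ` (Sym i :: 'p mod_ring poly poly set) \<subseteq> Poly ` {xs. set xs \<subseteq> UNIV \<and> length xs = Suc i}"
  proof
    fix q assume "q \<in> dehom ` (Sym i :: 'p mod_ring poly poly set)"
    hence q: "coeff q k = 0" if "k > i" for k using dehom_bound that by blast
    have "q = Poly (map (coeff q) [0..<Suc i])"
    proof (rule poly_eqI)
      fix k show "coeff q k = coeff (Poly (map (coeff q) [0..<Suc i])) k"
        using q[of k] by (auto simp: nth_default_def simp del: upt_Suc)
    qed
    thus "q \<in> Poly ` {xs. set xs \<subseteq> UNIV \<and> length xs = Suc i}" by (rule image_eqI) simp
  qed
  ultimately have "finite (dehom ` (Sym i :: 'p mod_ring poly poly set))" using finite_surj finite_subset by blast
  thus ?thesis by (rule finite_imageD) (auto intro: inj_onI dehom_inj)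
qed

context kummer
begin

abbreviation "GG \<equiv> gal_group Qbar \<rat>"

abbreviation gmult (infixl "\<cdot>" 70) where "s \<cdot> t \<equiv> s \<otimes>\<^bsub>GG\<^esub> t"

abbreviation "ginv s \<equiv> inv\<^bsub>GG\<^esub> s"

lemma carrier_GG: "carrier GG = G_Q" by (simp add: gal_group_def)

lemma group_GG: "Group.group GG" by (rule gal_group_group[OF Qbar_field Rats_Qbar])

lemma GG_apply:
  assumes "s \<in> G_Q" "t \<in> G_Q" "x \<in> Qbar" shows "(s \<cdot> t) x = s (t x)"
  using assms(3) GQ_rules(4)[OF assms(2,3)] by (simp add: GQ_mult[OF assms(1,2)] compose_def)

lemma GG_inv:
  assumes s: "s \<in> G_Q"
  shows "ginv s \<in> G_Q" "x \<in> Qbar \<Longrightarrow> s ((ginv s) x) = x" "x \<in> Qbar \<Longrightarrow> (ginv s) (s x) = x"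
    "chi (ginv s) * chi s = 1"
proof -
  obtain t where t: "t \<in> G_Q" "\<And>x. x \<in> Qbar \<Longrightarrow> s (t x) = x" "\<And>x. x \<in> Qbar \<Longrightarrow> t (s x) = x" by (rule G_Q_inverse[OF s]) blast
  have e: "ginv s = t" by (rule gal_group_inv[OF Qbar_field Rats_Qbar s t(1,3)])
  show "ginv s \<in> G_Q" "x \<in> Qbar \<Longrightarrow> s ((ginv s) x) = x" "x \<in> Qbar \<Longrightarrow> (ginv s) (s x) = x"
    using t unfolding e by auto
  have "compose Qbar t s = idQ"
    by (rule Gal_eqI[OF Qbar_field GQ_compose[OF t(1) s] idQ[OF Rats_Qbar]]) (simp add: compose_def t(3))
  thus "chi (ginv s) * chi s = 1" using char_compose(1)[OF t(1) s] char_idQ(1) unfolding e by simp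
qed

lemma char_GG:
  assumes "s \<in> G_Q" "t \<in> G_Q"
  shows "chi (s \<cdot> t) = chi s * chi t" "kb (s \<cdot> t) = kb s + chi s * kb t"
  unfolding GQ_mult[OF assms] by (rule char_compose[OF assms])+

lemma act_GG: "f \<in> A i \<Longrightarrow> s \<in> G_Q \<Longrightarrow> t \<in> G_Q \<Longrightarrow> act j (s \<cdot> t) f = act j s (act j t f)"
  by (simp add: GQ_mult act_compose)

text \<open>Corestriction from the kernel of \<open>\<chi>\<close>, whose index \<open>p - 1\<close> is \<open>-1\<close> modulo \<open>p\<close>.\<close>

lemma corestriction:
  assumes c0: "\<And>h. h \<in> G_Q \<Longrightarrow> chi h = 1 \<Longrightarrow> c0 h \<in> A i"
    "\<And>h h'. h \<in> G_Q \<Longrightarrow> chi h = 1 \<Longrightarrow> h' \<in> G_Q \<Longrightarrow> chi h' = 1 \<Longrightarrow> c0 (h \<cdot> h') = c0 h + act j h (c0 h')"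
    and equi: "\<And>u s. u \<in> G_L \<Longrightarrow> s \<in> G_Q \<Longrightarrow> act j s (c0 (ginv s \<cdot> u \<cdot> s)) = c0 u"
  obtains c where "cocycle i j c" "\<And>u. u \<in> G_L \<Longrightarrow> c u = c0 u"
proof -
  interpret Gr: Group.group GG by (rule group_GG)
  have mG: "s \<cdot> t \<in> G_Q" if "s \<in> G_Q" "t \<in> G_Q" for s t using Gr.m_closed[of s t] that by (simp add: carrier_GG)
  have canc: "s \<cdot> (ginv s \<cdot> t) = t" if "s \<in> carrier GG" "t \<in> carrier GG" for s t
    using that by (simp add: Gr.m_assoc[symmetric])
  have "\<forall>a. \<exists>s. a \<noteq> 0 \<longrightarrow> s \<in> G_Q \<and> chi s = a" using chi_surj by metis
  then obtain D where D: "\<And>a. a \<noteq> 0 \<Longrightarrow> D a \<in> G_Q" "\<And>a. a \<noteq> 0 \<Longrightarrow> chi (D a) = a" by metis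
  define U where "U = UNIV - {0 :: 'p mod_ring}"
  \<comment> \<open>For coset representatives \<open>D\<close> this is the kernel element with
    \<open>g D(a) = D(chi g * a) hh(g, a)\<close>.\<close>
  define hh where "hh g a = ginv (D (chi g * a)) \<cdot> g \<cdot> D a" for g a
  have hhG: "hh g a \<in> G_Q" and hh1: "chi (hh g a) = 1" if "g \<in> G_Q" "a \<noteq> 0" for g a
  proof -
    have nz: "chi g * a \<noteq> 0" using that chi_nonzero by simp
    note i = GG_inv[OF D(1)[OF nz]]
    show "hh g a \<in> G_Q" unfolding hh_def by (intro mG i(1) D that)
    have "chi (hh g a) = chi (ginv (D (chi g * a))) * (chi g * a)"
      unfolding hh_def using char_GG(1)[OF mG[OF i(1) that(1)] D(1)[OF that(2)]] char_GG(1)[OF i(1) that(1)] D(2)[OF that(2)] by simp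
    thus "chi (hh g a) = 1" using i(4) D(2)[OF nz] by simp
  qed
  \<comment> \<open>The sign compensates the index: there are \<open>p - 1\<close> summands, and
    \<open>p - 1\<close> is \<open>- 1\<close> in the coefficients.\<close>
  define c where "c g = - (\<Sum>a\<in>U. act j (D (chi g * a)) (c0 (hh g a)))" for g
  have cm: "act j (D (chi g * a)) (c0 (hh g a)) \<in> A i" if "g \<in> G_Q" "a \<in> U" for g a
    using that by (intro act_mem c0(1) hhG hh1) (auto simp: U_def)
  have "cocycle i j c" unfolding cocycle_def
  proof (intro conjI ballI)
    fix g assume g: "g \<in> G_Q"
    show "c g \<in> A i" unfolding c_def by (intro Sym_closed(4) Sym_sum cm[OF g])
    fix g' assume g': "g' \<in> G_Q"
    have tm: "act j (D (chi (g \<cdot> g') * a)) (c0 (hh (g \<cdot> g') a)) =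
        act j (D (chi g * (chi g' * a))) (c0 (hh g (chi g' * a))) + act j g (act j (D (chi g' * a)) (c0 (hh g' a)))"
      if a: "a \<in> U" for a
    proof -
      define b where "b = chi g' * a"
      have nz: "a \<noteq> 0" "b \<noteq> 0" "chi g * b \<noteq> 0" using a chi_nonzero[OF g] chi_nonzero[OF g'] by (auto simp: U_def b_def)
      define d2 where "d2 = D (chi g * b)"
      note mem = D(1)[OF nz(1)] D(1)[OF nz(2)] D(1)[OF nz(3), folded d2_def]
      note cr = g g' mem GG_inv(1)[OF mem(2)] GG_inv(1)[OF mem(3)]
      have crc: "g \<in> carrier GG" "g' \<in> carrier GG" "D a \<in> carrier GG" "D b \<in> carrier GG" "d2 \<in> carrier GG"
        using cr by (simp_all add: carrier_GG)
      have hg: "hh g b = ginv d2 \<cdot> g \<cdot> D b" by (simp add: hh_def d2_def)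
      have hg': "hh g' a = ginv (D b) \<cdot> g' \<cdot> D a" by (simp add: hh_def b_def)
      have e: "chi (g \<cdot> g') * a = chi g * b" by (simp add: char_GG[OF g g'] b_def)
      have "hh (g \<cdot> g') a = ginv d2 \<cdot> (g \<cdot> g') \<cdot> D a" unfolding hh_def e d2_def ..
      also have "\<dots> = hh g b \<cdot> hh g' a" unfolding hg hg' using crc by (simp add: Gr.m_assoc canc)
      finally have h: "hh (g \<cdot> g') a = hh g b \<cdot> hh g' a" .
      have d: "d2 \<cdot> hh g b = g \<cdot> D b" unfolding hg using crc by (simp add: Gr.m_assoc[symmetric])
      note H = hhG[OF g nz(2)] hh1[OF g nz(2)] hhG[OF g' nz(1)] hh1[OF g' nz(1)]
      have m: "c0 (hh g b) \<in> A i" "c0 (hh g' a) \<in> A i" using c0(1) H by auto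
      have "act j d2 (c0 (hh (g \<cdot> g') a)) = act j d2 (c0 (hh g b)) + act j d2 (act j (hh g b) (c0 (hh g' a)))"
        unfolding h c0(2)[OF H] by (rule act_linear(1)[OF m(1) act_mem[OF m(2)] mem(3)])
      also have "act j d2 (act j (hh g b) (c0 (hh g' a))) = act j g (act j (D b) (c0 (hh g' a)))"
        unfolding act_GG[OF m(2) mem(3) H(1), symmetric] d by (rule act_GG[OF m(2) g mem(2)])
      finally show ?thesis unfolding e by (simp add: d2_def b_def)
    qed
    have "(\<Sum>a\<in>U. act j (D (chi (g \<cdot> g') * a)) (c0 (hh (g \<cdot> g') a))) =
        (\<Sum>a\<in>U. act j (D (chi g * (chi g' * a))) (c0 (hh g (chi g' * a)))) + (\<Sum>a\<in>U. act j g (act j (D (chi g' * a)) (c0 (hh g' a))))"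
      unfolding sum.distrib[symmetric] by (rule sum.cong[OF refl tm])
    also have "(\<Sum>a\<in>U. act j (D (chi g * (chi g' * a))) (c0 (hh g (chi g' * a)))) = (\<Sum>a\<in>U. act j (D (chi g * a)) (c0 (hh g a)))"
      by (rule sum.reindex_bij_witness[of _ "\<lambda>a. a / chi g'" "\<lambda>a. chi g' * a"]) (use chi_nonzero[OF g'] in \<open>auto simp: U_def\<close>)
    also have "(\<Sum>a\<in>U. act j g (act j (D (chi g' * a)) (c0 (hh g' a)))) = act j g (\<Sum>a\<in>U. act j (D (chi g' * a)) (c0 (hh g' a)))"
      by (rule act_sum[OF g cm[OF g'], symmetric])
    finally have s: "c (g \<cdot> g') = c g - act j g (\<Sum>a\<in>U. act j (D (chi g' * a)) (c0 (hh g' a)))" by (simp add: c_def)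
    have "act j g (c g') = act j g (0 - (\<Sum>a\<in>U. act j (D (chi g' * a)) (c0 (hh g' a))))" by (simp add: c_def)
    also have "\<dots> = act j g 0 - act j g (\<Sum>a\<in>U. act j (D (chi g' * a)) (c0 (hh g' a)))"
      by (rule act_linear(2)[OF Sym_closed(1) Sym_sum[OF cm[OF g']] g])
    finally have t: "act j g (c g') = - act j g (\<Sum>a\<in>U. act j (D (chi g' * a)) (c0 (hh g' a)))" by (simp add: act_0)
    show "c (compose Qbar g g') = c g + act j g (c g')" using s t by (simp add: GQ_mult[OF g g'])
  qed
  moreover have "c u = c0 u" if u: "u \<in> G_L" for u
  proof -
    have cu: "chi u = 1" using u Gal_L_iff by blast
    \<comment> \<open>For \<open>u\<close> in \<open>G_L\<close> the element \<open>hh u a\<close>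
      is a conjugate of \<open>u\<close>, so \<open>equi\<close> makes all summands equal to
      \<open>c0 u\<close>.\<close>
    have "(\<Sum>a\<in>U. act j (D (chi u * a)) (c0 (hh u a))) = (\<Sum>a\<in>U. c0 u)"
      by (rule sum.cong[OF refl]) (use equi[OF u D(1)] in \<open>auto simp: hh_def cu U_def\<close>)
    also have "\<dots> = of_nat (card U) * c0 u" by (simp only: sum_constant)
    also have "\<dots> = - c0 u" unfolding U_def card_nonzero by simp
    finally show ?thesis by (simp add: c_def)
  qed
  ultimately show ?thesis by (rule that)
qed

lemma unramified_inertia:
  assumes M: "galois_number_field M" and LM: "L \<subseteq> M" and un: "unramified_extension L M"
    and PP: "prime_in Zbar PP" "of_nat l \<in> PP" "l \<noteq> 0" and s: "s \<in> G_L" "inertial PP s" and x: "x \<in> M"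
  shows "s x = x"
proof -
  interpret galois_number_field M by (rule M)
  define P where "P = PP \<inter> M"
  have lP: "of_nat l \<in> P" using PP(2) csubring_of_nat[OF M_ring] by (auto simp: P_def)
  interpret number_field_prime M P
  proof
    show "prime_in \<O> P" unfolding P_def by (rule prime_in_restrict[OF PP(1) M])
    show "P \<noteq> {0}" using lP PP(3) by auto
  qed
  obtain w where w: "uniformizer w" by (rule uniformizer_exists)
  have "primeideal P (ring_of_integers M)" using primeideal_iff[OF O_ring] prime by simp
  hence "\<not> P \<inter> L \<subseteq> ideal_prod (ring_of_integers M) P P" using un nonzero unfolding unramified_extension_def by blast
  hence "\<forall>g\<in>Gal M L. (\<forall>x\<in>\<O>. g x - x \<in> P) \<longrightarrow> g = idM" using unramified_iff[OF w L_field LM] by simp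
  moreover have "restrict s M \<in> Gal M L" by (rule normal_restrict[OF normal LM s(1)])
  moreover have "\<forall>x\<in>\<O>. restrict s M x - x \<in> P"
    unfolding P_def using inertial_restrict[OF normal GalL_G[OF s(1)] s(2)] by blast
  ultimately have "restrict s M = idM" by blast
  thus ?thesis using x by (metis restrict_apply')
qed

lemma gpow_add: "t \<in> G_Q \<Longrightarrow> x \<in> Qbar \<Longrightarrow> gpow t (a + b) x = gpow t a (gpow t b x)"
proof (induction a)
  case 0
  thus ?case unfolding add_0 gpow_simps(1) using GQ_rules(4)[OF gpow_G] by simp
next
  case (Suc a)
  thus ?case using GQ_rules(4)[OF gpow_G[OF Suc.prems(1)]] by (simp add: gpow_simps(2) compose_def)
qed

text \<open>The isomorphism \<open>\<phi>\<close>, pulled back to \<open>G_L\<close> as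
  \<open>\<psi>\<close>, is first extended to the kernel of \<open>chi\<close> by declaring it zero
  on the powers of \<open>t\<close>. \<open>c0\<close> is this cocycle, and its compatibility with
  conjugation feeds \<open>corestriction\<close>.\<close>

lemma class_of_extension:
  assumes ext: "A_extension TYPE('p) N i j M" and un: "unramified_extension L M"
  obtains c where "c \<in> cocycles i j" "unram c" "c ` G_L = A i" "class_field c = M"
proof -
  note e = ext[unfolded A_extension_def Let_def p_card[symmetric]]
  have gLM: "galois_extension L M" by (rule conjunct1[OF e])
  have gQM: "galois_extension \<rat> M" by (rule conjunct1[OF conjunct2[OF e]])
  obtain \<phi> where iso: "\<phi> \<in> iso (gal_group M L) (Sym_group i :: 'p mod_ring poly poly monoid)"
    and eq: "\<forall>\<sigma>\<in>Gal M \<rat>. \<forall>\<tau>\<in>Gal M L.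
      \<phi> (\<sigma> \<otimes>\<^bsub>gal_group M \<rat>\<^esub> \<tau> \<otimes>\<^bsub>gal_group M \<rat>\<^esub> inv\<^bsub>gal_group M \<rat>\<^esub> \<sigma>) = A_act N j (restrict \<sigma> L) (\<phi> \<tau>)"
    using conjunct2[OF conjunct2[OF e]] by (rule bexE)
  note equi = eq[rule_format]
  have LM: "L \<subseteq> M" and Mf: "csubfield M" "M \<subseteq> Qbar" using gLM by (auto simp: galois_extension_def subfield_iff_csubfield)
  have bij: "bij_betw \<phi> (Gal M L) (A i)" using iso by (simp add: iso_def gal_group_def Sym_group_def)
  have hom: "\<phi> (compose M \<tau> \<tau>') = \<phi> \<tau> + \<phi> \<tau>'" if "\<tau> \<in> Gal M L" "\<tau>' \<in> Gal M L" for \<tau> \<tau>'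
  proof -
    have "\<phi> (\<tau> \<otimes>\<^bsub>gal_group M L\<^esub> \<tau>') = \<phi> \<tau> \<otimes>\<^bsub>Sym_group i\<^esub> \<phi> \<tau>'"
      using iso that by (auto simp: iso_def hom_def gal_group_def)
    thus ?thesis unfolding gal_group_mult[OF Mf(1) that] by (simp add: Sym_group_def)
  qed
  have "finite (Gal M L)" using bij bij_betw_finite finite_Sym by blast
  hence fin: "finite (Gal M \<rat>)"
    using finite_Gal_tower[OF Mf normal_L LM galois_number_field.finite_Gal[OF galois_number_field_L]] by blast
  interpret galois_number_field M by unfold_locales (rule galois_extension_normal[OF gQM fin], rule fin)
  note gnf = galois_number_field_axioms
  interpret Gr: Group.group GG by (rule group_GG)
  have mG: "s \<cdot> t \<in> G_Q" if "s \<in> G_Q" "t \<in> G_Q" for s t using Gr.m_closed[of s t] that by (simp add: carrier_GG)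
  have canc: "s \<cdot> (ginv s \<cdot> t) = t" if "s \<in> carrier GG" "t \<in> carrier GG" for s t
    using that by (simp add: Gr.m_assoc[symmetric])
  have MQ: "x \<in> Qbar" if "x \<in> M" for x using that M_Qbar by blast
  have sM: "s x \<in> M" if "s \<in> G_Q" "x \<in> M" for s x using that normal by (auto simp: normal_field_def)
  define \<psi> where "\<psi> s = \<phi> (restrict s M)" for s
  have res: "restrict s M \<in> Gal M L" if "s \<in> G_L" for s by (rule normal_restrict[OF normal LM that])
  have resQ: "restrict s M \<in> Gal M \<rat>" if "s \<in> G_Q" for s by (rule normal_restrict[OF normal Rats_M that])
  have \<psi>A: "\<psi> s \<in> A i" if "s \<in> G_L" for s using res[OF that] bij by (auto simp: \<psi>_def bij_betw_def)
  have \<psi>cong: "\<psi> s = \<psi> t" if "\<And>x. x \<in> M \<Longrightarrow> s x = t x" for s t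
    unfolding \<psi>_def by (rule arg_cong[of _ _ \<phi>], rule restrict_ext) (rule that)
  have \<psi>hom: "\<psi> (s \<cdot> t) = \<psi> s + \<psi> t" if s: "s \<in> G_L" and t: "t \<in> G_L" for s t
  proof -
    have "restrict (s \<cdot> t) M = compose M (restrict s M) (restrict t M)"
      unfolding compose_def by (rule restrict_ext) (use GG_apply[OF GalL_G[OF s] GalL_G[OF t]] MQ sM[OF GalL_G[OF t]] in auto)
    thus ?thesis using hom[OF res[OF s] res[OF t]] by (simp add: \<psi>_def)
  qed
  have \<psi>conj: "\<psi> (s \<cdot> u \<cdot> ginv s) = act j s (\<psi> u)" if s: "s \<in> G_Q" and u: "u \<in> G_L" for s u
  proof -
    define \<rho> where "\<rho> = restrict (ginv s) M"
    have \<rho>: "\<rho> \<in> Gal M \<rat>" unfolding \<rho>_def by (rule resQ[OF GG_inv(1)[OF s]])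
    have uG: "u \<in> G_Q" by (rule GalL_G[OF u])
    have "inv\<^bsub>gal_group M \<rat>\<^esub> (restrict s M) = \<rho>"
      by (rule gal_group_inv[OF M Rats_M resQ[OF s] \<rho>]) (use GG_inv(3)[OF s] MQ sM[OF s] in \<open>auto simp: \<rho>_def\<close>)
    hence "restrict s M \<otimes>\<^bsub>gal_group M \<rat>\<^esub> restrict u M \<otimes>\<^bsub>gal_group M \<rat>\<^esub> inv\<^bsub>gal_group M \<rat>\<^esub> (restrict s M)
        = compose M (compose M (restrict s M) (restrict u M)) \<rho>"
      using gal_group_mult[OF M resQ[OF s] resQ[OF uG]] gal_group_mult[OF M Gal_compose[OF M Rats_M resQ[OF s] resQ[OF uG]] \<rho>] by simp
    also have "\<dots> = restrict (s \<cdot> u \<cdot> ginv s) M" unfolding compose_def \<rho>_def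
    proof (rule restrict_ext)
      fix x assume x: "x \<in> M"
      have y: "(ginv s) x \<in> M" by (rule sM[OF GG_inv(1)[OF s] x])
      show "restrict (\<lambda>x. restrict s M (restrict u M x)) M (restrict (ginv s) M x) = (s \<cdot> u \<cdot> ginv s) x"
        using x y sM[OF uG y] GG_apply[OF mG[OF s uG] GG_inv(1)[OF s] MQ[OF x]] GG_apply[OF s uG MQ[OF y]] by simp
    qed
    finally have "\<psi> (s \<cdot> u \<cdot> ginv s) = act j (restrict (restrict s M) L) (\<psi> u)"
      using equi[OF resQ[OF s] res[OF u]] by (simp add: \<psi>_def)
    also have "\<dots> = act j s (\<psi> u)"
    proof -
      have "restrict (restrict s M) L x = s x" if "x \<in> L" for x using LM that by auto
      thus ?thesis by (intro act_cong char_cong)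
    qed
    finally show ?thesis .
  qed
  have \<psi>0: "\<psi> s = 0 \<longleftrightarrow> (\<forall>x\<in>M. s x = x)" if s: "s \<in> G_L" for s
  proof -
    have "\<phi> (compose M idM idM) = \<phi> idM + \<phi> idM" by (rule hom[OF idM[OF LM] idM[OF LM]])
    moreover have "compose M idM idM = idM" by (auto simp: compose_def intro!: restrict_ext)
    ultimately have z: "\<phi> idM = 0" by (simp only: add_cancel_right_right)
    have "\<psi> s = 0 \<longleftrightarrow> restrict s M = idM"
      using bij z res[OF s] idM[OF LM] unfolding \<psi>_def bij_betw_def by (metis inj_onD)
    also have "\<dots> \<longleftrightarrow> (\<forall>x\<in>M. s x = x)" by (metis restrict_apply' restrict_ext)
    finally show ?thesis .
  qed
  obtain PP where PP: "prime_in Zbar PP" "of_nat N \<in> PP" by (rule exists_place[OF prime_N])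
  obtain t where t: "t \<in> G_Q" "\<And>x. x \<in> Zbar \<Longrightarrow> t x - x \<in> PP" "chi t = 1" "kb t = 1" by (rule inertia_at_N[OF PP]) blast
  note gt = gpow_G[OF t(1)] and ct = char_gpow[OF t(1,3)]
  have p0: "(of_nat p :: 'p mod_ring) = 0" by (simp add: of_nat_0_mod_ring_dvd p_card)
  \<comment> \<open>\<open>t ^ p\<close> is inertial and lies in \<open>G_L\<close>, so it acts
    trivially on \<open>M\<close>. Exponents of \<open>t\<close> thus matter only modulo
    \<open>p\<close> there.\<close>
  have tp: "gpow t p x = x" if x: "x \<in> M" for x
  proof (rule unramified_inertia[OF gnf LM un PP _ _ _ x])
    show "gpow t p \<in> G_L" using gt ct[of p] p0 Gal_L_iff by auto
    show "inertial PP (gpow t p)" unfolding inertial_def using gpow_inertia[OF PP(1) t(1,2)] by blast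
  qed (use N_pos in simp)
  have tpq: "gpow t (p * q) x = x" if x: "x \<in> M" for q x
  proof (induction q)
    case 0
    thus ?case using MQ[OF x] by (simp add: gpow_simps(1))
  next
    case (Suc q)
    have "gpow t (p * Suc q) x = gpow t p (gpow t (p * q) x)" using gpow_add[OF t(1) MQ[OF x], of p "p * q"] by simp
    thus ?case using Suc tp[OF x] by simp
  qed
  have tcong: "gpow t a x = gpow t b x" if ab: "(of_nat a :: 'p mod_ring) = of_nat b" and x: "x \<in> M" for a b x
  proof -
    have red: "gpow t a x = gpow t (a mod p) x" for a
    proof -
      have "gpow t (a mod p + p * (a div p)) x = gpow t (a mod p) (gpow t (p * (a div p)) x)" by (rule gpow_add[OF t(1) MQ[OF x]])
      thus ?thesis using tpq[OF x] by simp
    qed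
    have "a mod p = b mod p" using ab by (simp add: of_nat_eq_iff_cong_CHAR cong_def p_card)
    thus ?thesis using red by metis
  qed
  \<comment> \<open>The exponent that moves \<open>h\<close> into \<open>G_L\<close>; by
    \<open>tcong\<close> any other representative gives the same action on \<open>M\<close>.\<close>
  define m where "m h = (SOME r. (of_nat r :: 'p mod_ring) = - kb h)" for h
  have m: "of_nat (m h) = - kb h" for h unfolding m_def by (rule someI_ex) (metis of_nat_cases)
  define c0 where "c0 h = \<psi> (h \<cdot> gpow t (m h))" for h
  have hL: "h \<cdot> gpow t r \<in> G_L" if "h \<in> G_Q" "chi h = 1" "of_nat r = - kb h" for h r
    using that mG[OF that(1) gt] char_GG[OF that(1) gt] ct t(4) by (auto simp: Gal_L_iff)
  have c0r: "c0 h = \<psi> (h \<cdot> gpow t r)" if "h \<in> G_Q" "of_nat r = - kb h" for h r unfolding c0_def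
  proof (rule \<psi>cong)
    fix x assume x: "x \<in> M"
    have "gpow t (m h) x = gpow t r x" by (rule tcong[OF _ x]) (simp add: m that(2))
    thus "(h \<cdot> gpow t (m h)) x = (h \<cdot> gpow t r) x" by (simp add: GG_apply[OF that(1) gt MQ[OF x]])
  qed
  have c0L: "c0 u = \<psi> u" if u: "u \<in> G_L" for u
  proof -
    have "c0 u = \<psi> (u \<cdot> gpow t 0)" by (rule c0r) (use u Gal_L_iff in auto)
    also have "\<dots> = \<psi> u"
    proof (rule \<psi>cong)
      fix x assume "x \<in> M"
      thus "(u \<cdot> gpow t 0) x = u x" using GG_apply[OF GalL_G[OF u] gt[of 0] MQ] MQ by (simp add: gpow_simps(1))
    qed
    finally show ?thesis .
  qed
  obtain c1 where c1: "cocycle i j c1" "\<And>u. u \<in> G_L \<Longrightarrow> c1 u = c0 u"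
  proof (rule corestriction[of c0 i j])
    show "c0 h \<in> A i" if "h \<in> G_Q" "chi h = 1" for h unfolding c0_def by (rule \<psi>A[OF hL[OF that m]])
    show "c0 (h \<cdot> h') = c0 h + act j h (c0 h')" if h: "h \<in> G_Q" "chi h = 1" and h': "h' \<in> G_Q" "chi h' = 1" for h h'
    proof -
      define u where "u = h' \<cdot> gpow t (m h')"
      define v where "v = h \<cdot> gpow t (m h)"
      have u: "u \<in> G_L" unfolding u_def by (rule hL[OF h' m])
      have v: "v \<in> G_L" unfolding v_def by (rule hL[OF h m])
      note hi = GG_inv(1)[OF h(1)]
      \<comment> \<open>\<open>cocycle_conj\<close> is applied to the zero cocycle only for its
        first conclusion, the normality of \<open>G_L\<close>.\<close>
      have q: "h \<cdot> u \<cdot> ginv h \<in> G_L"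
        using cocycle_conj(1)[OF cocycle_coboundary[OF Sym_closed(1)] h(1) hi GG_inv(2)[OF h(1)] u]
          Gr.m_assoc[of h u "ginv h"] h(1) hi GalL_G[OF u] GQ_mult[OF h(1) mG[OF GalL_G[OF u] hi]] GQ_mult[OF GalL_G[OF u] hi]
        by (simp add: carrier_GG)
      \<comment> \<open>The order of the exponents fits
        \<open>h h' t ^ (m h') t ^ (m h) = (h u h^-1) v\<close>, a product of two elements of
        \<open>G_L\<close>.\<close>
      have "c0 (h \<cdot> h') = \<psi> ((h \<cdot> h') \<cdot> gpow t (m h' + m h))"
        by (rule c0r[OF mG[OF h(1) h'(1)]]) (simp add: m char_GG[OF h(1) h'(1)] h(2))
      also have "\<dots> = \<psi> ((h \<cdot> u \<cdot> ginv h) \<cdot> v)"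
      proof (rule \<psi>cong)
        fix x assume "x \<in> M"
        hence x: "x \<in> Qbar" by (rule MQ)
        have y: "gpow t (m h) x \<in> Qbar" by (rule GQ_rules(4)[OF gt x])
        have vx: "v x = h (gpow t (m h) x)" unfolding v_def by (rule GG_apply[OF h(1) gt x])
        have "((h \<cdot> u \<cdot> ginv h) \<cdot> v) x = (h \<cdot> u \<cdot> ginv h) (v x)"
          by (rule GG_apply[OF GalL_G[OF q] GalL_G[OF v] x])
        also have "\<dots> = (h \<cdot> u) ((ginv h) (v x))"
          by (rule GG_apply[OF mG[OF h(1) GalL_G[OF u]] hi GQ_rules(4)[OF GalL_G[OF v] x]])
        also have "(ginv h) (v x) = gpow t (m h) x" unfolding vx by (rule GG_inv(3)[OF h(1) y])
        also have "(h \<cdot> u) (gpow t (m h) x) = h (u (gpow t (m h) x))" by (rule GG_apply[OF h(1) GalL_G[OF u] y])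
        also have "u (gpow t (m h) x) = h' (gpow t (m h') (gpow t (m h) x))" unfolding u_def by (rule GG_apply[OF h'(1) gt y])
        also have "\<dots> = h' (gpow t (m h' + m h) x)" by (simp add: gpow_add[OF t(1) x])
        also have "h \<dots> = (h \<cdot> h') (gpow t (m h' + m h) x)" by (rule GG_apply[OF h(1) h'(1) GQ_rules(4)[OF gt x], symmetric])
        also have "\<dots> = ((h \<cdot> h') \<cdot> gpow t (m h' + m h)) x" by (rule GG_apply[OF mG[OF h(1) h'(1)] gt x, symmetric])
        finally show "((h \<cdot> h') \<cdot> gpow t (m h' + m h)) x = ((h \<cdot> u \<cdot> ginv h) \<cdot> v) x" ..
      qed
      also have "\<dots> = act j h (\<psi> u) + \<psi> v" unfolding \<psi>hom[OF q v] \<psi>conj[OF h(1) u] ..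
      finally show ?thesis by (simp add: c0_def u_def v_def add.commute)
    qed
    show "act j s (c0 (ginv s \<cdot> u \<cdot> s)) = c0 u" if u: "u \<in> G_L" and s: "s \<in> G_Q" for u s
    proof -
      note si = GG_inv(1)[OF s] and uG = GalL_G[OF u]
      define v where "v = ginv s \<cdot> u \<cdot> s"
      have v: "v \<in> G_L" using cocycle_conj(1)[OF cocycle_coboundary[OF Sym_closed(1)] si s GG_inv(3)[OF s] u]
          Gr.m_assoc[of "ginv s" u s] s si uG GQ_mult[OF si mG[OF uG s]] GQ_mult[OF uG s] by (simp add: carrier_GG v_def)
      have "s \<cdot> v \<cdot> ginv s = u" unfolding v_def using s uG by (simp add: carrier_GG[symmetric] Gr.m_assoc canc)
      thus ?thesis using \<psi>conj[OF s v] c0L[OF v] c0L[OF u] by (simp add: v_def)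
    qed
  qed blast
  define c where "c s = (if s \<in> G_Q then c1 s else 0)" for s
  have c\<psi>: "c u = \<psi> u" if "u \<in> G_L" for u using c1(2)[OF that] c0L[OF that] GalL_G[OF that] by (simp add: c_def)
  have zero: "c s = 0" if "s \<in> G_L" "\<And>x. x \<in> M \<Longrightarrow> s x = x" for s using c\<psi>[OF that(1)] \<psi>0[OF that(1)] that(2) by simp
  \<comment> \<open>An automorphism fixing this one element is trivial on \<open>M\<close>, so
    \<open>{\<theta>}\<close> witnesses the continuity of \<open>c\<close>.\<close>
  obtain \<theta> where \<theta>: "\<theta> \<in> \<O>" "\<forall>g\<in>Gal M \<rat> - {idM}. g \<theta> \<noteq> \<theta>"
    using separating_element[of "Gal M \<rat> - {idM}"] fin by blast
  have c: "c \<in> cocycles i j" unfolding cocycles_iff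
  proof (intro conjI exI[of _ "{\<theta>}"] ballI impI)
    show "cocycle i j c" using c1(1) GQ_compose unfolding cocycle_def c_def by simp
    fix s assume s: "s \<in> G_Q" "\<forall>x\<in>{\<theta>}. s x = x"
    hence "restrict s M \<theta> = \<theta>" using \<theta>(1) by simp
    hence "restrict s M = idM" using \<theta>(2) resQ[OF s(1)] by blast
    hence fx: "s x = x" if "x \<in> M" for x using that by (metis restrict_apply')
    hence "s \<in> G_L" using Gal_Qbar_iff[OF Rats_L] s(1) LM by blast
    thus "c s = 0" using zero fx by blast
  qed (use \<theta>(1) M_Qbar in \<open>auto simp: c_def\<close>)
  moreover have "unram c" unfolding unram_def
  proof (intro allI impI)
    fix l QQ s assume h: "prime (l::nat)" "l \<noteq> N" "prime_in Zbar QQ" "of_nat l \<in> QQ" "s \<in> G_L" "inertial QQ s"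
    have "l \<noteq> 0" using h(1) by auto
    thus "c s = 0" using zero[OF h(5)] unramified_inertia[OF gnf LM un h(3,4) _ h(5,6)] by blast
  qed
  moreover have "c ` G_L = A i"
  proof
    show "c ` G_L \<subseteq> A i" using c\<psi> \<psi>A by auto
    show "A i \<subseteq> c ` G_L"
    proof
      fix f assume "f \<in> A i"
      hence "f \<in> \<phi> ` Gal M L" using bij by (simp add: bij_betw_def)
      then obtain g where g: "g \<in> Gal M L" "f = \<phi> g" by blast
      obtain s where s: "s \<in> G_L" "\<And>x. x \<in> M \<Longrightarrow> s x = g x" by (rule Gal_lift[OF M M_Qbar LM g(1)]) blast
      have "restrict s M = g" by (rule Gal_eqI[OF M res[OF s(1)] g(1)]) (simp add: s(2))
      hence "f = c s" using c\<psi>[OF s(1)] g(2) by (simp add: \<psi>_def)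
      thus "f \<in> c ` G_L" using s(1) by blast
    qed
  qed
  moreover have "class_field c = M"
  proof
    show "M \<subseteq> class_field c" unfolding class_field_def ker_GalL_def using M_Qbar c\<psi> \<psi>0 by auto
    show "class_field c \<subseteq> M"
    proof
      fix x assume x: "x \<in> class_field c"
      show "x \<in> M"
      proof (rule ccontr)
        assume "x \<notin> M"
        moreover have "x \<in> Qbar" using x by (simp add: class_field_def)
        ultimately obtain s where s: "s \<in> Gal Qbar M" "s x \<noteq> x" using Gal_Qbar_moves[OF M M_Qbar] by metis
        have sx: "s y = y" if "y \<in> M" for y by (rule Gal_rules(5)[OF Qbar_field s(1) that])
        have "s \<in> G_L" using Gal_antimono[OF LM] s(1) by blast
        hence "s \<in> ker_GalL c" using zero sx by (simp add: ker_GalL_def)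
        thus False using x s(2) by (simp add: class_field_def)
      qed
    qed
  qed
  ultimately show ?thesis by (rule that)
qed

end

section \<open>Matching the fields cut out by surjective classes with their lines\<close>

theorem theorem4p10:
  fixes p N i :: nat and j :: int
  assumes "p = CARD('p::prime_card)" and "prime p" and "odd p"
    and "prime N" and "[N = 1] (mod p)"
    and "1 \<le> i" and "i < p - 1"
    and "\<not> [j = 1] (mod (int p - 1))"
  shows "\<exists>f. bij_betw f (unramified_A_extensions TYPE('p) N i j)
    (P1 (H1_Lambda N i j :: 'p cochain set set) -
     P1 (H1_Lambda_sub N i j))"
proof -
  interpret kummer p N "TYPE('p)" by unfold_locales (use assms in auto)
  have i: "i < p" using assms(7) by simp
  define B where "B = {c \<in> cocycles i j. unram c \<and> c ` G_L = A i}"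
  define l where "l c = line (cls i j c)" for c
  have target: "P1 (H1_Lambda N i j) - P1 (H1_Lambda_sub N i j) = l ` B"
    unfolding line_big_classes[OF assms(6) i assms(8)] by (auto simp: big_classes_def B_def l_def)
  have source: "unramified_A_extensions TYPE('p) N i j = class_field ` B"
  proof (intro equalityI subsetI)
    fix M assume "M \<in> unramified_A_extensions TYPE('p) N i j"
    hence "A_extension TYPE('p) N i j M" "unramified_extension L M"
      by (auto simp: unramified_A_extensions_def p_card[symmetric])
    then obtain c where "c \<in> cocycles i j" "unram c" "c ` G_L = A i" "class_field c = M" by (rule class_of_extension)
    thus "M \<in> class_field ` B" unfolding B_def by blast
  next
    fix M assume "M \<in> class_field ` B"
    then obtain c where c: "c \<in> cocycles i j" "unram c" "c ` G_L = A i" "M = class_field c" by (auto simp: B_def)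
    show "M \<in> unramified_A_extensions TYPE('p) N i j"
      using class_field_A_extension[OF c(1,3)] class_field_unramified[OF c(1,2) assms(7)]
      by (simp add: unramified_A_extensions_def p_card[symmetric] c(4))
  qed
  have eq: "class_field c = class_field d \<longleftrightarrow> l c = l d" if "c \<in> B" "d \<in> B" for c d
  proof -
    have "c \<in> cocycles i j" "c ` G_L = A i" "d \<in> cocycles i j" "d ` G_L = A i" using that by (auto simp: B_def)
    thus ?thesis unfolding l_def using class_field_line[of c i j d] line_class_field[OF assms(7,8), of c d] by blast
  qed
  \<comment> \<open>Any cocycle cutting out \<open>M\<close> may be chosen, because by
    \<open>eq\<close> all of them span the same line.\<close>
  define f where "f M = l (SOME c. c \<in> B \<and> class_field c = M)" for M
  have f: "f (class_field c) = l c" if "c \<in> B" for c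
  proof -
    have "(SOME d. d \<in> B \<and> class_field d = class_field c) \<in> B \<and> class_field (SOME d. d \<in> B \<and> class_field d = class_field c) = class_field c"
      by (rule someI[of _ c]) (simp add: that)
    thus ?thesis unfolding f_def using eq[OF _ that] by blast
  qed
  have "bij_betw f (class_field ` B) (l ` B)"
  proof (rule bij_betw_imageI)
    show "inj_on f (class_field ` B)"
    proof (rule inj_onI)
      fix M M' assume h: "M \<in> class_field ` B" "M' \<in> class_field ` B" "f M = f M'"
      then obtain c d where cd: "c \<in> B" "M = class_field c" "d \<in> B" "M' = class_field d" by blast
      hence "l c = l d" using h(3) f by simp
      thus "M = M'" using eq[OF cd(1,3)] cd(2,4) by simp
    qed
    show "f ` class_field ` B = l ` B" unfolding image_image using f by (rule image_cong[OF refl])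
  qed
  thus ?thesis unfolding source target by blast
qed

end
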